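(* For every positive integer $m$ let $\mathfrak{P}_m$ be a prime ideal of $\mathcal{O}_{K_m}$, where $K_m=\mathbb{Q}[\zeta_m]$, lying over a prime number that does not divide $m$, and let $q_m=|\mathcal{O}_{K_m}/\mathfrak{P}_m|$. Let $\mathcal{L}_{\mathcal{C},m}$ be the associated family of symplectic lattices in $(K_m\otimes_{\mathbb{Q}}\mathbb{R})^2\cong\mathbb{R}^{2\phi(m)}$ defined in the context. Assume that $\phi(m)^2 m=o\big(q_m^{1/\phi(m)}\big)$ as $m\to\infty$. Then for every $0<\varepsilon<1$ and all $m$ big enough, the family of symplectic lattices $\mathcal{L}_{\mathcal{C},m}$ contains a lattice $\Lambda\subset\mathbb{R}^{2\phi(m)}$ satisfying $$\Delta(\Lambda)>\frac{(1-\varepsilon)m}{2^{2\phi(m)}}.$$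
   Context: $\phi$ is Euler's totient function, $\zeta_m$ a primitive $m$-th root of unity, $K=\mathbb{Q}[\zeta_m]$ with ring of integers $\mathcal{O}_K$ and discriminant $d_K$, and $K_{\mathbb{R}}=K\otimes_{\mathbb{Q}}\mathbb{R}$ is a Euclidean space of dimension $\phi(m)$ for the scalar product $\langle x,y\rangle=\mathrm{tr}(x\overline{y})$ induced by the trace form of $K/\mathbb{Q}$ and complex conjugation. $E=K_{\mathbb{R}}^2$ carries the scalar product $\langle x,y\rangle=\langle x_1,y_1\rangle+\langle x_2,y_2\rangle$ and is identified isometrically with $\mathbb{R}^{2\phi(m)}$. The dual of a lattice $\Lambda$ in a Euclidean space $E$ is $\Lambda^\#=\{x\in E: \langle x,y\rangle\in\mathbb{Z}\ \forall y\in\Lambda\}$. $\Lambda$ is symplectic if there is an isometry $\sigma$ of $E$ with $\sigma(\Lambda)=\Lambda^\#$ and $\sigma^2=-\mathrm{Id}$. Let $\mathfrak{P}$ be a prime ideal of $\mathcal{O}_K$ over a prime number not dividing $m$, $F=\mathcal{O}_K/\mathfrak{P}$, $q=|F|$. Put $\alpha=(q|d_K|)^{1/(2\phi(m))}$ and $\Lambda_0=\alpha^{-1}\mathcal{O}_K\times\alpha\,\mathfrak{P}^{-1}\mathcal{O}_K^\#\subset E$, where $\mathcal{O}_K^\#$ is the dual of $\mathcal{O}_K$ in $K_{\mathbb{R}}$. Let $\pi:\Lambda_0\to\Lambda_0/\mathfrak{P}\Lambda_0$ be the canonical surjection onto this $2$-dimensional $F$-vector space. $\mathcal{C}$ is the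 set of its $q+1$ one-dimensional $F$-subspaces; for $C\in\mathcal{C}$, $\Lambda_C=\pi^{-1}(C)$; and $\mathcal{L}_{\mathcal{C}}=\{\Lambda_C:C\in\mathcal{C}\}$. $\mathcal{L}_{\mathcal{C},m}$ denotes this family for the given $m$ and $\mathfrak{P}=\mathfrak{P}_m$. For a lattice $\Lambda$ in an $n$-dimensional Euclidean space, $\mathrm{Vol}(\Lambda)$ is the volume of a fundamental region, $\mu_\Lambda=\min\{\|x\|:x\in\Lambda\setminus\{0\}\}$, $B(r)$ is the closed ball of radius $r$ centered at $0$, and $\Delta(\Lambda)=\frac{\mathrm{Vol}(B(\mu_\Lambda))}{2^n\mathrm{Vol}(\Lambda)}$. *)

theory Defs
  imports
    "HOL-Analysis.Analysis"
    "HOL-Library.Function_Algebras"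
    "HOL-Library.Landau_Symbols"
    "HOL-Algebra.QuotRing"
    "HOL-Number_Theory.Totient"
    "Jordan_Normal_Form.Determinant"
begin

text \<open>Pointwise real scaling of functions, completing the pointwise ring operations of
  \<^theory>\<open>HOL-Library.Function_Algebras\<close>.\<close>

instantiation "fun" :: (type, real_vector) real_vector
begin

definition scaleR_fun :: "real \<Rightarrow> ('a \<Rightarrow> 'b) \<Rightarrow> 'a \<Rightarrow> 'b"
  where "scaleR_fun c f = (\<lambda>x. c *\<^sub>R f x)"

instance
  by standard (simp_all add: scaleR_fun_def fun_eq_iff scaleR_add_right scaleR_add_left)

end

section \<open>Lattices in Euclidean spaces\<close>

text \<open>A Euclidean space is a finite-dimensional real subspace \<open>V\<close> of an ambient real vector space,
  together with a function \<open>ip\<close> that is a scalar product on \<open>V\<close>.\<close>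

definition zspan :: "'a::real_vector set \<Rightarrow> 'a set"
  where "zspan S = {\<Sum>x\<in>T. of_int (c x) *\<^sub>R x | (T::'a set) (c::'a \<Rightarrow> int). finite T \<and> T \<subseteq> S}"

definition lattice_in :: "'a::real_vector set \<Rightarrow> 'a set \<Rightarrow> bool"
  where "lattice_in V L \<longleftrightarrow>
    (\<exists>B. finite B \<and> B \<subseteq> V \<and> independent B \<and> span B = V \<and> L = zspan B)"

definition dual_lattice :: "'a::real_vector set \<Rightarrow> ('a \<Rightarrow> 'a \<Rightarrow> real) \<Rightarrow> 'a set \<Rightarrow> 'a set"
  where "dual_lattice V ip L = {x \<in> V. \<forall>y\<in>L. ip x y \<in> \<int>}"

definition linear_isometry_of ::
  "'a::real_vector set \<Rightarrow> ('a \<Rightarrow> 'a \<Rightarrow> real) \<Rightarrow> ('a \<Rightarrow> 'a) \<Rightarrow> bool"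
  where "linear_isometry_of V ip s \<longleftrightarrow>
    bij_betw s V V \<and>
    (\<forall>x\<in>V. \<forall>y\<in>V. s (x + y) = s x + s y) \<and>
    (\<forall>c. \<forall>x\<in>V. s (c *\<^sub>R x) = c *\<^sub>R s x) \<and>
    (\<forall>x\<in>V. \<forall>y\<in>V. ip (s x) (s y) = ip x y)"

definition symplectic_lattice ::
  "'a::real_vector set \<Rightarrow> ('a \<Rightarrow> 'a \<Rightarrow> real) \<Rightarrow> 'a set \<Rightarrow> bool"
  where "symplectic_lattice V ip L \<longleftrightarrow>
    lattice_in V L \<and>
    (\<exists>s. linear_isometry_of V ip s \<and> s ` L = dual_lattice V ip L \<and> (\<forall>x\<in>V. s (s x) = - x))"

definition orthonormal_basis ::
  "'a::real_vector set \<Rightarrow> ('a \<Rightarrow> 'a \<Rightarrow> real) \<Rightarrow> (nat \<Rightarrow> 'a) \<Rightarrow> bool"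
  where "orthonormal_basis V ip b \<longleftrightarrow>
    (\<forall>i<dim V. \<forall>j<dim V. ip (b i) (b j) = (if i = j then 1 else 0)) \<and>
    span (b ` {..<dim V}) = V"

text \<open>Volumes in \<open>V\<close> are Lebesgue measures in coordinates with respect to an orthonormal basis, that
  is, after an isometric identification of \<open>V\<close> with \<open>\<real>\<^sup>n\<close>, \<open>n = dim V\<close>. Lebesgue measure is invariant
  under orthogonal maps, so the choice of the basis is immaterial.\<close>

abbreviation lborel_n :: "nat \<Rightarrow> (nat \<Rightarrow> real) measure"
  where "lborel_n n \<equiv> Pi\<^sub>M {..<n} (\<lambda>_. lborel)"

definition coord_set ::
  "'a::real_vector set \<Rightarrow> ('a \<Rightarrow> 'a \<Rightarrow> real) \<Rightarrow> 'a set \<Rightarrow> (nat \<Rightarrow> real) set"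
  where "coord_set V ip S =
    (let b = (SOME b. orthonormal_basis V ip b)
     in {c \<in> space (lborel_n (dim V)). (\<Sum>i<dim V. c i *\<^sub>R b i) \<in> S})"

definition eucl_volume :: "'a::real_vector set \<Rightarrow> ('a \<Rightarrow> 'a \<Rightarrow> real) \<Rightarrow> 'a set \<Rightarrow> real"
  where "eucl_volume V ip S = measure (lborel_n (dim V)) (coord_set V ip S)"

definition fundamental_region ::
  "'a::real_vector set \<Rightarrow> ('a \<Rightarrow> 'a \<Rightarrow> real) \<Rightarrow> 'a set \<Rightarrow> 'a set \<Rightarrow> bool"
  where "fundamental_region V ip L F \<longleftrightarrow>
    F \<subseteq> V \<and> coord_set V ip F \<in> sets (lborel_n (dim V)) \<and>
    (\<forall>x\<in>V. \<exists>!y. y \<in> F \<and> x - y \<in> L)"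

text \<open>All measurable fundamental regions of a lattice have the same volume.\<close>

definition lattice_volume :: "'a::real_vector set \<Rightarrow> ('a \<Rightarrow> 'a \<Rightarrow> real) \<Rightarrow> 'a set \<Rightarrow> real"
  where "lattice_volume V ip L = eucl_volume V ip (SOME F. fundamental_region V ip L F)"

definition eucl_norm :: "('a \<Rightarrow> 'a \<Rightarrow> real) \<Rightarrow> 'a \<Rightarrow> real"
  where "eucl_norm ip x = sqrt (ip x x)"

text \<open>The infimum is attained when \<open>L\<close> is a nonzero lattice.\<close>

definition min_length :: "('a::real_vector \<Rightarrow> 'a \<Rightarrow> real) \<Rightarrow> 'a set \<Rightarrow> real"
  where "min_length ip L = Inf (eucl_norm ip ` (L - {0}))"

definition eucl_ball :: "'a::real_vector set \<Rightarrow> ('a \<Rightarrow> 'a \<Rightarrow> real) \<Rightarrow> real \<Rightarrow> 'a set"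
  where "eucl_ball V ip r = {x \<in> V. eucl_norm ip x \<le> r}"

definition packing_density :: "'a::real_vector set \<Rightarrow> ('a \<Rightarrow> 'a \<Rightarrow> real) \<Rightarrow> 'a set \<Rightarrow> real"
  where "packing_density V ip L =
    eucl_volume V ip (eucl_ball V ip (min_length ip L)) / (2 ^ dim V * lattice_volume V ip L)"

section \<open>Cyclotomic fields\<close>

definition zeta :: "nat \<Rightarrow> complex"
  where "zeta m = cis (2 * pi / real m)"

definition cyclo_field :: "nat \<Rightarrow> complex set"
  where "cyclo_field m = range (\<lambda>p::rat poly. poly (map_poly of_rat p) (zeta m))"

definition int_ring :: "nat \<Rightarrow> complex ring"
  where "int_ring m =
    \<lparr>carrier = {x \<in> cyclo_field m. algebraic_int x},
     monoid.mult = (*), one = 1, zero = 0, add = (+)\<rparr>"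

abbreviation integers_of :: "nat \<Rightarrow> complex set"
  where "integers_of m \<equiv> carrier (int_ring m)"

definition lies_over :: "complex set \<Rightarrow> nat \<Rightarrow> bool"
  where "lies_over P p \<longleftrightarrow> {k::int. of_int k \<in> P} = {k. int p dvd k}"

definition residue_card :: "nat \<Rightarrow> complex set \<Rightarrow> nat"
  where "residue_card m P = card (carrier (int_ring m Quot P))"

definition embeddings :: "nat \<Rightarrow> (complex \<Rightarrow> complex) set"
  where "embeddings m =
    {s \<in> extensional (cyclo_field m). s 1 = 1 \<and>
      (\<forall>x\<in>cyclo_field m. \<forall>y\<in>cyclo_field m. s (x + y) = s x + s y \<and> s (x * y) = s x * s y)}"

definition field_trace :: "nat \<Rightarrow> complex \<Rightarrow> complex"
  where "field_trace m x = (\<Sum>s\<in>embeddings m. s x)"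

definition integral_basis :: "nat \<Rightarrow> (nat \<Rightarrow> complex) \<Rightarrow> bool"
  where "integral_basis m w \<longleftrightarrow>
    w ` {..<totient m} \<subseteq> integers_of m \<and>
    (\<forall>x\<in>integers_of m. \<exists>!c. c \<in> {..<totient m} \<rightarrow>\<^sub>E (UNIV :: int set) \<and>
      x = (\<Sum>i<totient m. of_int (c i) * w i))"

definition discriminant :: "nat \<Rightarrow> complex"
  where "discriminant m =
    (let w = (SOME w. integral_basis m w)
     in Determinant.det (Matrix.mat (totient m) (totient m)
          (\<lambda>(i, j). field_trace m (w i * w j))))"

section \<open>The Euclidean space $E$\<close>

text \<open>The real algebra \<open>K\<^sub>\<real>\<close>, the tensor product of \<open>K\<close> with \<open>\<real>\<close> over \<open>\<rat>\<close>, is realized as Minkowski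
  space: \<open>K\<close> is embedded into the product of copies of \<open>\<complex>\<close> indexed by the field embeddings of \<open>K\<close>, with
  pointwise operations, and \<open>K\<^sub>\<real>\<close> is the real span of the image, which is the image of the injective
  map \<open>x \<otimes> c \<mapsto> (c s(x))\<^sub>s\<close>.\<close>

type_synonym mink = "(complex \<Rightarrow> complex) \<Rightarrow> complex"

definition emb :: "nat \<Rightarrow> complex \<Rightarrow> mink"
  where "emb m x = (\<lambda>s. if s \<in> embeddings m then s x else 0)"

definition K_real :: "nat \<Rightarrow> mink set"
  where "K_real m = span (emb m ` cyclo_field m)"

definition mink_trace :: "nat \<Rightarrow> mink \<Rightarrow> complex"
  where "mink_trace m x = (\<Sum>s\<in>embeddings m. x s)"

definition mink_cnj :: "mink \<Rightarrow> mink"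
  where "mink_cnj x = (\<lambda>s. cnj (x s))"

lemma zeta_in_cyclo_field: "zeta m \<in> cyclo_field m"
  unfolding cyclo_field_def by (rule range_eqI[of _ _ "[:0, 1:]"]) (simp add: map_poly_pCons)

lemma of_rat_in_cyclo_field: "of_rat q \<in> cyclo_field m"
  unfolding cyclo_field_def by (rule range_eqI[of _ _ "[:q:]"]) (simp add: map_poly_pCons)

text \<open>Pointwise conjugation and pointwise trace do extend conjugation and trace of \<open>K\<close>.\<close>

lemma mink_trace_emb: "mink_trace m (emb m x) = field_trace m x"
  by (simp add: mink_trace_def emb_def field_trace_def)

lemma embedding_poly:
  assumes "s \<in> embeddings m"
  shows "s (poly (map_poly of_rat p) (zeta m)) = poly (map_poly of_rat p) (s (zeta m))"
proof -
  let ?K = "cyclo_field m"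
  have add: "s (x + y) = s x + s y" and mult: "s (x * y) = s x * s y"
    if "x \<in> ?K" "y \<in> ?K" for x y
    using assms that by (auto simp: embeddings_def)
  have one: "s 1 = 1"
    using assms by (simp add: embeddings_def)
  have K_rat: "of_rat q \<in> ?K" for q
    by (rule of_rat_in_cyclo_field)
  have zero: "s 0 = 0"
    using add[OF K_rat[of 0] K_rat[of 0]] by simp
  have nat: "s (of_nat n) = of_nat n" for n
  proof (induction n)
    case (Suc n)
    then show ?case using add[OF K_rat[of 1] K_rat[of "of_nat n"]] one by simp
  qed (simp add: zero)
  have int: "s (of_int k) = of_int k" for k
  proof (cases k)
    case (nonneg n)
    then show ?thesis using nat by simp
  next
    case (neg n)
    have "of_rat (of_int k) + of_rat (of_nat (Suc n)) = (0 :: complex)"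
      unfolding of_rat_add[symmetric] by (simp add: neg)
    then have "s (of_int k) + s (of_nat (Suc n)) = 0"
      using add[OF K_rat[of "of_int k"] K_rat[of "of_nat (Suc n)"]] zero
      by (simp only: of_rat_of_int_eq of_rat_of_nat_eq)
    then have "s (of_int k) + of_nat (Suc n) = 0"
      unfolding nat .
    then show ?thesis using neg by (simp add: add_eq_0_iff2)
  qed
  have rat: "s (of_rat q) = of_rat q" for q
  proof -
    obtain a b where q: "q = of_int a / of_int b" "b \<noteq> 0"
      by (cases q) (auto simp: Fract_of_int_quotient)
    have "s (of_rat q) * of_int b = s (of_rat q * of_int b)"
      using mult[OF K_rat[of q] K_rat[of "of_int b"]] int by simp
    also have "of_rat q * of_int b = (of_int a :: complex)"
      using q by (simp add: of_rat_divide)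
    finally have "s (of_rat q) * of_int b = of_int a"
      by (simp add: int)
    then show ?thesis
      using \<open>of_rat q * of_int b = of_int a\<close> q(2)
      by (metis mult_cancel_right of_int_eq_0_iff)
  qed
  show ?thesis
  proof (induction p)
    case 0
    then show ?case by (simp add: zero)
  next
    case (pCons a p)
    let ?f = "poly (map_poly of_rat p) :: complex \<Rightarrow> complex"
    have f: "?f (zeta m) \<in> ?K"
      unfolding cyclo_field_def by blast
    have "zeta m * ?f (zeta m) = poly (map_poly of_rat (pCons 0 p)) (zeta m)"
      by (simp add: map_poly_pCons)
    then have zf: "zeta m * ?f (zeta m) \<in> ?K"
      unfolding cyclo_field_def by blast
    show ?case
      using pCons add[OF K_rat[of a] zf] mult[OF zeta_in_cyclo_field f]
      by (simp add: map_poly_pCons rat)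
  qed
qed

lemma mink_cnj_emb:
  assumes "x \<in> cyclo_field m" "m \<ge> 1"
  shows "cnj x \<in> cyclo_field m" "mink_cnj (emb m x) = emb m (cnj x)"
proof -
  have z1: "zeta m ^ m = 1"
    using assms(2) by (simp add: zeta_def Complex.DeMoivre)
  have zc: "zeta m * cnj (zeta m) = 1"
    by (simp add: zeta_def complex_norm_square[symmetric])
  have cz: "cnj (zeta m) = zeta m ^ (m - 1)"
  proof -
    have "zeta m * zeta m ^ (m - 1) = zeta m * cnj (zeta m)"
      using z1 zc assms(2) by (simp flip: power_Suc)
    moreover have "zeta m \<noteq> 0"
      by (simp add: zeta_def)
    ultimately show ?thesis by simp
  qed
  obtain p :: "rat poly" where x: "x = poly (map_poly of_rat p) (zeta m)"
    using assms(1) by (auto simp: cyclo_field_def)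
  have cp: "cnj (poly (map_poly of_rat p) z) = poly (map_poly of_rat p) (cnj z)" for z
  proof (induction p)
    case (pCons a p)
    have "cnj (of_rat a) = of_rat a"
      by (cases a) (simp add: Fract_of_int_quotient of_rat_divide)
    then show ?case using pCons by (simp add: map_poly_pCons)
  qed simp
  have pow: "poly (map_poly of_rat p) (z ^ k) =
      poly (map_poly of_rat (pcompose p (monom 1 k))) z" for z :: complex and k
  proof (induction p)
    case (pCons a p)
    have "map_poly of_rat (q + r) = (map_poly of_rat q + map_poly of_rat r :: complex poly)"
      for q r by (rule poly_eqI) (simp add: coeff_map_poly of_rat_add)
    moreover have "poly (map_poly of_rat (monom 1 k * q)) z = z ^ k * poly (map_poly of_rat q) z" for q
    proof -
      have "map_poly of_rat (monom 1 k * q) = (monom 1 k * map_poly of_rat q :: complex poly)"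
        by (rule poly_eqI) (simp add: coeff_map_poly coeff_monom_mult)
      then show ?thesis by (simp add: poly_monom)
    qed
    ultimately show ?case using pCons by (simp add: map_poly_pCons pcompose_pCons)
  qed simp
  let ?q = "pcompose p (monom 1 (m - 1))"
  have cx: "cnj x = poly (map_poly of_rat ?q) (zeta m)"
    by (simp add: x cp cz pow)
  then show "cnj x \<in> cyclo_field m"
    unfolding cyclo_field_def by blast
  have "cnj (s x) = s (cnj x)" if s: "s \<in> embeddings m" for s
  proof -
    have smult: "s (y * z) = s y * s z" if "y \<in> cyclo_field m" "z \<in> cyclo_field m" for y z
      using s that by (auto simp: embeddings_def)
    have one: "s 1 = 1"
      using s by (simp add: embeddings_def)
    have "s (zeta m ^ k) = s (zeta m) ^ k" for k
      using embedding_poly[OF s, of "monom 1 k"] by (simp add: map_poly_monom poly_monom)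
    from this[of m] have w: "s (zeta m) ^ m = 1"
      by (simp add: z1 one)
    then have "cmod (s (zeta m)) = 1"
      using assms(2) power_eq_imp_eq_base[of "cmod (s (zeta m))" m 1]
      by (simp flip: norm_power)
    then have "s (zeta m) * cnj (s (zeta m)) = 1"
      by (simp add: complex_norm_square[symmetric])
    moreover have "s (zeta m) * s (zeta m) ^ (m - 1) = 1"
      using w assms(2) by (simp flip: power_Suc)
    ultimately have "cnj (s (zeta m)) = s (zeta m) ^ (m - 1)"
      by (metis mult_cancel_left mult_zero_left zero_neq_one)
    then show ?thesis
      using embedding_poly[OF s, of p] embedding_poly[OF s, of ?q]
      by (simp add: cx x[symmetric] cp pow)
  qed
  then show "mink_cnj (emb m x) = emb m (cnj x)"
    by (auto simp: mink_cnj_def emb_def)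
qed

text \<open>The values of \<open>mink_trace\<close> occurring here are real, so \<open>Re\<close> only changes the type.\<close>

definition ip_K :: "nat \<Rightarrow> mink \<Rightarrow> mink \<Rightarrow> real"
  where "ip_K m x y = Re (mink_trace m (x * mink_cnj y))"

definition E_space :: "nat \<Rightarrow> (mink \<times> mink) set"
  where "E_space m = K_real m \<times> K_real m"

definition ip_E :: "nat \<Rightarrow> mink \<times> mink \<Rightarrow> mink \<times> mink \<Rightarrow> real"
  where "ip_E m x y = ip_K m (fst x) (fst y) + ip_K m (snd x) (snd y)"

section \<open>The family of lattices\<close>

definition smult_E :: "nat \<Rightarrow> complex \<Rightarrow> mink \<times> mink \<Rightarrow> mink \<times> mink"
  where "smult_E m a x = (emb m a * fst x, emb m a * snd x)"

definition ideal_inverse :: "nat \<Rightarrow> complex set \<Rightarrow> complex set"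
  where "ideal_inverse m P = {x \<in> cyclo_field m. \<forall>y\<in>P. x * y \<in> integers_of m}"

definition int_dual :: "nat \<Rightarrow> mink set"
  where "int_dual m = dual_lattice (K_real m) (ip_K m) (emb m ` integers_of m)"

definition alpha :: "nat \<Rightarrow> complex set \<Rightarrow> real"
  where "alpha m P =
    (real (residue_card m P) * cmod (discriminant m)) powr (1 / (2 * real (totient m)))"

definition Lambda0 :: "nat \<Rightarrow> complex set \<Rightarrow> (mink \<times> mink) set"
  where "Lambda0 m P =
    (\<lambda>x. inverse (alpha m P) *\<^sub>R x) ` (emb m ` integers_of m) \<times>
    (\<lambda>x. alpha m P *\<^sub>R x) ` zspan {emb m a * y | a y. a \<in> ideal_inverse m P \<and> y \<in> int_dual m}"

definition P_Lambda0 :: "nat \<Rightarrow> complex set \<Rightarrow> (mink \<times> mink) set"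
  where "P_Lambda0 m P = zspan {smult_E m a x | a x. a \<in> P \<and> x \<in> Lambda0 m P}"

definition residue_proj :: "nat \<Rightarrow> complex set \<Rightarrow> mink \<times> mink \<Rightarrow> (mink \<times> mink) set"
  where "residue_proj m P x = (\<lambda>z. x + z) ` P_Lambda0 m P"

text \<open>The scalar \<open>a + P\<close> of the residue field acts on cosets by sending the class of \<open>x\<close> to the class of
  \<open>a x\<close>; a one-dimensional subspace consists of the multiples of a nonzero class.\<close>

definition residue_lines :: "nat \<Rightarrow> complex set \<Rightarrow> (mink \<times> mink) set set set"
  where "residue_lines m P =
    {{residue_proj m P (smult_E m a x) | a. a \<in> integers_of m} | x.
      x \<in> Lambda0 m P \<and> residue_proj m P x \<noteq> residue_proj m P 0}"

definition Lambda_C :: "nat \<Rightarrow> complex set \<Rightarrow> (mink \<times> mink) set set \<Rightarrow> (mink \<times> mink) set"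
  where "Lambda_C m P C = {x \<in> Lambda0 m P. residue_proj m P x \<in> C}"

definition lattice_family :: "nat \<Rightarrow> complex set \<Rightarrow> (mink \<times> mink) set set"
  where "lattice_family m P = Lambda_C m P ` residue_lines m P"

end

theory Submission
  imports
    Defs
    "HOL-Real_Asymp.Real_Asymp"
    "HOL-Computational_Algebra.Fundamental_Theorem_Algebra"
begin

text \<open>Let \<open>n = \<phi>(m)\<close>. The form \<open>(w, x) \<mapsto> tr(w\<^sub>1 x\<^sub>2 - w\<^sub>2 x\<^sub>1)\<close> is alternating, so modulo the
  inverse different it vanishes on a line of \<open>\<Lambda>\<^sub>0/P\<Lambda>\<^sub>0\<close>; hence \<open>(x, y) \<mapsto> (-cnj y, cnj x)\<close> maps each
  \<open>\<Lambda>\<^sub>C\<close> onto its dual, \<open>\<Lambda>\<^sub>C\<close> has volume 1 and \<open>\<Lambda>\<^sub>0\<close> has volume \<open>1/q\<close>. A vector of \<open>\<Lambda>\<^sub>0\<close> outside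
  \<open>P\<Lambda>\<^sub>0\<close> lies in a single \<open>\<Lambda>\<^sub>C\<close>, together with its \<open>m\<close> multiples by roots of unity of the same
  length. A ball of volume slightly below \<open>m\<close> contains fewer than \<open>q m\<close> nonzero points of \<open>\<Lambda>\<^sub>0\<close>, and
  none of \<open>P\<Lambda>\<^sub>0\<close>, whose minimum is large by the inequality of arithmetic and geometric means for
  norms; so it contains no nonzero point of some \<open>\<Lambda>\<^sub>C\<close>. The error in counting points is controlled
  by the covering radius of \<open>\<Lambda>\<^sub>0\<close>, for which Minkowski's theorem provides a short vector \<open>x\<close> and
  thereby the basis \<open>x \<zeta>\<^sup>i\<close> of a sublattice. Since the volume of a lattice is determined by the
  numbers of its points in large balls, it is invariant under isometries, and Gram--Schmidt
  orthogonalization expresses it by the Gram determinant.\<close>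

section \<open>Bases and lattices as finite sequences\<close>

text \<open>Put n = \<phi>(m), \<kappa> = q^(1/n), and let R be the radius of the ball of volume m
  in dimension 2n; then n/12 <= R^2 <= m n. Passing from volumes to numbers of points costs the
  covering radius \<tau> of \<open>\<Lambda>0\<close>, hence a factor (1 - \<tau>/R)^(2n) >= 1 -
  2n\<tau>/R. The normalization \<open>\<alpha>\<close> gives \<tau>^2 <= 2n^2/\<kappa> and makes
  nonzero vectors of \<open>P\<Lambda>\<close> have squared length at least \<kappa>. So the loss is
  small once n^3/\<kappa> is, and R^2 < \<kappa> holds once m n < \<kappa>; both follow from n^2 m =
  o(\<kappa>).

  In place of unique factorization of ideals, one fact carries the arithmetic at P: as p does not
  divide m, x^Q = x modulo p for some Q >= 2 and all x in the ring of integers. It yields inverses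
  modulo P and an explicit idempotent showing that P is invertible. Norms and indices enter as
  ratios of volumes of lattices, so that every comparison of norms is an inclusion of
  lattices.\<close>

definition basis_seq :: "nat \<Rightarrow> (nat \<Rightarrow> 'a::real_vector) \<Rightarrow> 'a set \<Rightarrow> bool"
  where "basis_seq n f V \<longleftrightarrow>
    inj_on f {..<n} \<and> independent (f ` {..<n}) \<and> span (f ` {..<n}) = V"

definition zlat :: "nat \<Rightarrow> (nat \<Rightarrow> 'a::real_vector) \<Rightarrow> 'a set"
  where "zlat n f = range (\<lambda>c::nat \<Rightarrow> int. \<Sum>i<n. of_int (c i) *\<^sub>R f i)"

lemma span_seq: "span (f ` {..<n::nat}) = range (\<lambda>c. \<Sum>i<n. c i *\<^sub>R (f i::'a::real_vector))"
proof
  show "span (f ` {..<n}) \<subseteq> range (\<lambda>c. \<Sum>i<n. c i *\<^sub>R f i)"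
  proof (rule span_minimal)
    show "f ` {..<n} \<subseteq> range (\<lambda>c. \<Sum>i<n. c i *\<^sub>R f i)"
    proof safe
      fix i assume "i < n"
      then have "f i = (\<Sum>k<n. (if k = i then 1 else 0) *\<^sub>R f k)"
        by (simp add: if_distrib[of "\<lambda>x. x *\<^sub>R _"] cong: if_cong)
      then show "f i \<in> range (\<lambda>c. \<Sum>i<n. c i *\<^sub>R f i)"
        by (intro image_eqI[where x = "\<lambda>k. if k = i then 1 else 0"]) auto
    qed
    show "subspace (range (\<lambda>c. \<Sum>i<n. c i *\<^sub>R f i))"
      unfolding subspace_def
    proof (intro conjI ballI allI)
      show "0 \<in> range (\<lambda>c. \<Sum>i<n. c i *\<^sub>R f i)"
        by (rule image_eqI[where x = "\<lambda>_. 0"]) auto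
    next
      fix x y assume "x \<in> range (\<lambda>c. \<Sum>i<n. c i *\<^sub>R f i)" "y \<in> range (\<lambda>c. \<Sum>i<n. c i *\<^sub>R f i)"
      then obtain c d where "x = (\<Sum>i<n. c i *\<^sub>R f i)" "y = (\<Sum>i<n. d i *\<^sub>R f i)" by blast
      then show "x + y \<in> range (\<lambda>c. \<Sum>i<n. c i *\<^sub>R f i)"
        by (intro image_eqI[where x = "\<lambda>i. c i + d i"]) (auto simp: scaleR_add_left sum.distrib)
    next
      fix a x assume "x \<in> range (\<lambda>c. \<Sum>i<n. c i *\<^sub>R f i)"
      then obtain c where "x = (\<Sum>i<n. c i *\<^sub>R f i)" by blast
      then show "a *\<^sub>R x \<in> range (\<lambda>c. \<Sum>i<n. c i *\<^sub>R f i)"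
        by (intro image_eqI[where x = "\<lambda>i. a * c i"]) (auto simp: scaleR_sum_right)
    qed
  qed
  show "range (\<lambda>c. \<Sum>i<n. c i *\<^sub>R f i) \<subseteq> span (f ` {..<n})"
    by (auto intro!: span_sum span_scale intro: span_base)
qed

lemma basis_seq_zero:
  assumes "basis_seq n f V" "(\<Sum>i<n. c i *\<^sub>R f i) = 0" "i < n"
  shows "c i = 0"
proof -
  have inj: "inj_on f {..<n}" and ind: "independent (f ` {..<n})"
    using assms(1) by (auto simp: basis_seq_def)
  have "(\<Sum>v\<in>f ` {..<n}. (c (the_inv_into {..<n} f v)) *\<^sub>R v) = (\<Sum>i<n. c i *\<^sub>R f i)"
    using inj by (subst sum.reindex) (auto simp: the_inv_into_f_f)
  then have "\<forall>v\<in>f ` {..<n}. c (the_inv_into {..<n} f v) = 0"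
    using ind assms(2) real_vector.dependent_finite[of "f ` {..<n}"] by auto
  then show ?thesis using inj assms(3) by (auto simp: the_inv_into_f_f)
qed

lemma basis_seq_unique:
  assumes "basis_seq n f V" "(\<Sum>i<n. c i *\<^sub>R f i) = (\<Sum>i<n. d i *\<^sub>R f i)" "i < n"
  shows "c i = d i"
  using basis_seq_zero[OF assms(1), of "\<lambda>i. c i - d i" i] assms
  by (simp add: scaleR_diff_left sum_subtractf)

lemma seq_independentI:
  assumes "\<And>c i. (\<Sum>i<n. c i *\<^sub>R f i) = 0 \<Longrightarrow> i < n \<Longrightarrow> c i = 0"
  shows "inj_on f {..<n::nat}" "independent (f ` {..<n})"
proof -
  show inj: "inj_on f {..<n}"
  proof (rule inj_onI, rule ccontr)
    fix i j assume ij: "i \<in> {..<n}" "j \<in> {..<n}" "f i = f j" "i \<noteq> j"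
    let ?c = "\<lambda>k. (if k = i then 1 else 0) - (if k = j then 1 else (0::real))"
    have "(\<Sum>k<n. ?c k *\<^sub>R f k) = f i - f j"
      using ij by (simp add: scaleR_diff_left sum_subtractf if_distrib[of "\<lambda>x. x *\<^sub>R _"] cong: if_cong)
    then show False using assms[of ?c i] ij by simp
  qed
  show "independent (f ` {..<n})"
  proof
    assume "dependent (f ` {..<n})"
    then obtain u v where u: "v \<in> f ` {..<n}" "u v \<noteq> 0" "(\<Sum>v\<in>f ` {..<n}. u v *\<^sub>R v) = 0"
      using real_vector.dependent_finite[of "f ` {..<n}"] by auto
    then show False using assms[of "\<lambda>i. u (f i)"] inj by (auto simp: sum.reindex)
  qed
qed

lemma basis_seq_subspace: "basis_seq n f V \<Longrightarrow> subspace V"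
  by (auto simp: basis_seq_def)

lemma basis_seq_dim: "basis_seq n f V \<Longrightarrow> dim V = n"
  unfolding basis_seq_def
  by (metis card_image card_lessThan dim_eq_card_independent dim_span)

lemma basis_seq_in: "basis_seq n f V \<Longrightarrow> i < n \<Longrightarrow> f i \<in> V"
  by (auto simp: basis_seq_def intro: span_base)

lemma basis_seq_expand:
  assumes "basis_seq n f V" "x \<in> V"
  obtains c where "x = (\<Sum>i<n. c i *\<^sub>R f i)"
  using assms span_seq[of f n] by (auto simp: basis_seq_def)

text \<open>A maximal independent subset of the family already spans V, so it has n elements; hence
  the family has no repetition and is itself independent.\<close>

lemma basis_seqI_spanning:
  assumes V: "basis_seq n f V" and g: "\<And>i. i < n \<Longrightarrow> g i \<in> V" and sp: "\<And>i. i < n \<Longrightarrow> f i \<in> span (g ` {..<n})"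
  shows "basis_seq n g V"
proof -
  have sg: "span (g ` {..<n}) = V"
  proof
    show "span (g ` {..<n}) \<subseteq> V"
      using g basis_seq_subspace[OF V] by (intro span_minimal) auto
    have "span (f ` {..<n}) \<subseteq> span (g ` {..<n})"
      using sp by (intro span_minimal) auto
    then show "V \<subseteq> span (g ` {..<n})" using V by (simp add: basis_seq_def)
  qed
  obtain B where B: "B \<subseteq> g ` {..<n}" "independent B" "g ` {..<n} \<subseteq> span B"
    using real_vector.maximal_independent_subset[of "g ` {..<n}"] by auto
  have "span B = V"
  proof
    show "span B \<subseteq> V" using B(1) sg span_mono by blast
    show "V \<subseteq> span B" using span_minimal[OF B(3)] sg by simp
  qed
  then have "card B = n"
    using dim_eq_card_independent[OF B(2)] basis_seq_dim[OF V] by (metis dim_span)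
  then have "card (g ` {..<n}) \<ge> n"
    using B(1) card_mono[of "g ` {..<n}" B] by simp
  then have cg: "card (g ` {..<n}) = n"
    using card_image_le[of "{..<n}" g] by simp
  then have "inj_on g {..<n}" by (simp add: eq_card_imp_inj_on)
  moreover have "B = g ` {..<n}"
    using cg \<open>card B = n\<close> B(1) by (simp add: card_subset_eq)
  ultimately show ?thesis using B(2) sg by (simp add: basis_seq_def)
qed

text \<open>A vector of V outside the span would give n + 1 independent vectors in the span of the n
  vectors \<open>f i\<close>.\<close>

lemma basis_seqI_independent:
  assumes V: "basis_seq n f V" and g: "\<And>i. i < n \<Longrightarrow> g i \<in> V"
    and ind: "\<And>c i. (\<Sum>i<n. c i *\<^sub>R g i) = 0 \<Longrightarrow> i < n \<Longrightarrow> c i = 0"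
  shows "basis_seq n g V"
proof -
  have i: "inj_on g {..<n}" "independent (g ` {..<n})"
    by (rule seq_independentI; fact ind)+
  have cg: "card (g ` {..<n}) = n" using i(1) by (simp add: card_image)
  have sub: "span (g ` {..<n}) \<subseteq> V"
    using g basis_seq_subspace[OF V] by (intro span_minimal) auto
  have "V \<subseteq> span (g ` {..<n})"
  proof
    fix x assume x: "x \<in> V"
    show "x \<in> span (g ` {..<n})"
    proof (rule ccontr)
      assume nx: "x \<notin> span (g ` {..<n})"
      then have "independent (insert x (g ` {..<n}))"
        using i(2) by (simp add: real_vector.independent_insertI)
      moreover have "insert x (g ` {..<n}) \<subseteq> span (f ` {..<n})"
        using x g V unfolding basis_seq_def by blast
      ultimately have "card (insert x (g ` {..<n})) \<le> card (f ` {..<n})"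
        using real_vector.independent_span_bound[of "f ` {..<n}"] by blast
      moreover have x': "x \<notin> g ` {..<n}" using nx by (metis span_base)
      moreover have "card (f ` {..<n}) \<le> n" using card_image_le[of "{..<n}" f] by simp
      moreover have "card (insert x (g ` {..<n})) = Suc n"
        using x' cg by (subst card_insert_disjoint) auto
      ultimately show False by linarith
    qed
  qed
  then have "span (g ` {..<n}) = V" using sub by (rule subset_antisym[rotated])
  then show ?thesis using i by (simp add: basis_seq_def)
qed

lemma basis_seq_neq0: "basis_seq n f V \<Longrightarrow> i < n \<Longrightarrow> f i \<noteq> 0"
  by (metis basis_seq_def dependent_zero image_eqI lessThan_iff)

section \<open>Integer combinations of a finite sequence\<close>

lemma zlat_0 [simp]: "0 \<in> zlat n f"
  unfolding zlat_def by (rule image_eqI[where x = "\<lambda>_. 0"]) auto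

lemma zlat_add: "x \<in> zlat n f \<Longrightarrow> y \<in> zlat n f \<Longrightarrow> x + y \<in> zlat n f"
proof -
  assume "x \<in> zlat n f" "y \<in> zlat n f"
  then obtain c d :: "nat \<Rightarrow> int" where "x = (\<Sum>i<n. of_int (c i) *\<^sub>R f i)" "y = (\<Sum>i<n. of_int (d i) *\<^sub>R f i)"
    by (auto simp: zlat_def)
  then show ?thesis unfolding zlat_def
    by (intro image_eqI[where x = "\<lambda>i. c i + d i"]) (auto simp: scaleR_add_left sum.distrib)
qed

lemma zlat_int_scale: "x \<in> zlat n f \<Longrightarrow> of_int k *\<^sub>R x \<in> zlat n f"
proof -
  assume "x \<in> zlat n f"
  then obtain c :: "nat \<Rightarrow> int" where "x = (\<Sum>i<n. of_int (c i) *\<^sub>R f i)"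
    by (auto simp: zlat_def)
  then show ?thesis unfolding zlat_def
    by (intro image_eqI[where x = "\<lambda>i. k * c i"]) (auto simp: scaleR_sum_right)
qed

lemma zlat_uminus: "x \<in> zlat n f \<Longrightarrow> - x \<in> zlat n f"
  using zlat_int_scale[of x n f "-1"] by simp

lemma zlat_diff: "x \<in> zlat n f \<Longrightarrow> y \<in> zlat n f \<Longrightarrow> x - y \<in> zlat n f"
  using zlat_add[of x n f "- y"] zlat_uminus[of y n f] by simp

lemma zlat_base: "i < n \<Longrightarrow> f i \<in> zlat n f"
  unfolding zlat_def
  by (rule image_eqI[where x = "\<lambda>k. if k = i then 1 else 0"])
    (auto simp: if_distrib[of "\<lambda>x. of_int x *\<^sub>R _"] cong: if_cong)

lemma subgroup_int_scale:
  fixes L :: "'a::real_vector set"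
  assumes "0 \<in> L" "\<And>x y. x \<in> L \<Longrightarrow> y \<in> L \<Longrightarrow> x - y \<in> L" "x \<in> L"
  shows "of_int k *\<^sub>R x \<in> L"
proof -
  have um: "y \<in> L \<Longrightarrow> - y \<in> L" for y using assms(2)[OF assms(1), of y] by simp
  have ad: "y \<in> L \<Longrightarrow> z \<in> L \<Longrightarrow> y + z \<in> L" for y z using assms(2)[of y "- z"] um by simp
  have nat: "of_nat n *\<^sub>R x \<in> L" for n
    by (induction n) (auto simp: assms scaleR_add_left intro: ad)
  show ?thesis
  proof (cases k)
    case (nonneg n) then show ?thesis using nat[of n] by simp
  next
    case (neg n)
    have "of_int k *\<^sub>R x = - (of_nat (Suc n) *\<^sub>R x)"
      unfolding neg by (simp add: scaleR_diff_left scaleR_add_left)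
    then show ?thesis using um[OF nat[of "Suc n"]] by (simp del: of_nat_Suc)
  qed
qed

lemma subgroup_sum:
  fixes L :: "'a::real_vector set"
  assumes "0 \<in> L" "\<And>x y. x \<in> L \<Longrightarrow> y \<in> L \<Longrightarrow> x - y \<in> L" "\<And>i. i \<in> I \<Longrightarrow> g i \<in> L"
  shows "sum g I \<in> L"
proof -
  have ad: "y \<in> L \<Longrightarrow> z \<in> L \<Longrightarrow> y + z \<in> L" for y z
    using assms(2)[of y "0 - z"] assms(2)[of 0 z] assms(1) by simp
  show ?thesis using assms(3) by (induction I rule: infinite_finite_induct) (auto simp: assms(1) ad)
qed

lemma zlat_subset:
  assumes "0 \<in> L" "\<And>x y. x \<in> L \<Longrightarrow> y \<in> L \<Longrightarrow> x - y \<in> L" "\<And>i. i < n \<Longrightarrow> f i \<in> L"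
  shows "zlat n f \<subseteq> L"
  unfolding zlat_def using assms
  by (auto intro!: subgroup_sum subgroup_int_scale)

lemma zspan_subset:
  assumes "0 \<in> L" "\<And>x y. x \<in> L \<Longrightarrow> y \<in> L \<Longrightarrow> x - y \<in> L" "S \<subseteq> L"
  shows "zspan S \<subseteq> L"
  unfolding zspan_def using assms
  by (auto intro!: subgroup_sum subgroup_int_scale)

lemma zspan_base: "x \<in> S \<Longrightarrow> x \<in> zspan S"
  unfolding zspan_def
  by (rule CollectI, rule exI[of _ "{x}"], rule exI[of _ "\<lambda>_. 1"]) auto

lemma zspan_0: "0 \<in> zspan S"
  unfolding zspan_def by (rule CollectI, rule exI[of _ "{}"]) auto

lemma zspan_diff:
  assumes "x \<in> zspan S" "y \<in> zspan S"
  shows "x - y \<in> zspan S"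
proof -
  obtain T c where x: "x = (\<Sum>v\<in>T. of_int (c v) *\<^sub>R v)" "finite T" "T \<subseteq> S"
    using assms(1) by (auto simp: zspan_def)
  obtain U d where y: "y = (\<Sum>v\<in>U. of_int (d v) *\<^sub>R v)" "finite U" "U \<subseteq> S"
    using assms(2) by (auto simp: zspan_def)
  let ?e = "\<lambda>v. (if v \<in> T then c v else 0) - (if v \<in> U then d v else 0)"
  have "x = (\<Sum>v\<in>T \<union> U. of_int (if v \<in> T then c v else 0) *\<^sub>R v)"
    unfolding x(1) using x(2) y(2) by (intro sum.mono_neutral_cong_left) auto
  moreover have "y = (\<Sum>v\<in>T \<union> U. of_int (if v \<in> U then d v else 0) *\<^sub>R v)"
    unfolding y(1) using x(2) y(2) by (intro sum.mono_neutral_cong_left) auto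
  ultimately have "x - y = (\<Sum>v\<in>T \<union> U. of_int (?e v) *\<^sub>R v)"
    by (simp only: sum_subtractf[symmetric] scaleR_diff_left[symmetric] of_int_diff[symmetric])
  then show ?thesis
    unfolding zspan_def using x(2,3) y(2,3)
    by (intro CollectI exI[of _ "T \<union> U"] exI[of _ ?e]) auto
qed

lemma zspan_image_zlat:
  assumes "inj_on f {..<n}"
  shows "zspan (f ` {..<n}) = zlat n f"
proof
  show "zspan (f ` {..<n}) \<subseteq> zlat n f"
    by (rule zspan_subset) (auto intro: zlat_diff zlat_base)
  show "zlat n f \<subseteq> zspan (f ` {..<n})"
    by (rule zlat_subset) (auto intro: zspan_diff zspan_base zspan_0)
qed

lemma lattice_in_zlat:
  assumes "basis_seq n f V"
  shows "lattice_in V (zlat n f)"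
  unfolding lattice_in_def
  using assms zspan_image_zlat[of f n]
  by (intro exI[of _ "f ` {..<n}"]) (auto simp: basis_seq_def intro: span_base)

lemma basis_seq_scale:
  assumes "basis_seq n f V" "c \<noteq> 0"
  shows "basis_seq n (\<lambda>i. c *\<^sub>R f i) V"
proof (rule basis_seqI_independent[OF assms(1)])
  show "\<And>i. i < n \<Longrightarrow> c *\<^sub>R f i \<in> V"
    using basis_seq_subspace[OF assms(1)] basis_seq_in[OF assms(1)] subspace_scale by blast
  fix d i assume "(\<Sum>i<n. d i *\<^sub>R c *\<^sub>R f i) = 0" "i < n"
  then show "d i = 0" using basis_seq_zero[OF assms(1), of "\<lambda>i. d i * c" i] assms(2) by simp
qed

lemma zlat_scale: "zlat n (\<lambda>i. c *\<^sub>R f i) = (\<lambda>x. c *\<^sub>R x) ` zlat n f"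
  unfolding zlat_def image_image by (simp add: scaleR_sum_right mult.commute)

section \<open>Bases and lattices of a direct product\<close>

definition seq_prod :: "nat \<Rightarrow> (nat \<Rightarrow> 'a::real_vector) \<Rightarrow> (nat \<Rightarrow> 'b::real_vector) \<Rightarrow> nat \<Rightarrow> 'a \<times> 'b"
  where "seq_prod n f g i = (if i < n then (f i, 0) else (0, g (i - n)))"

lemma sum_seq_prod:
  "(\<Sum>i<n + k. c i *\<^sub>R seq_prod n f g i) = (\<Sum>i<n. c i *\<^sub>R f i, \<Sum>i<k. c (n + i) *\<^sub>R g i)"
proof -
  have "(\<Sum>i<n + k. c i *\<^sub>R seq_prod n f g i) =
      (\<Sum>i<n. c i *\<^sub>R seq_prod n f g i) + (\<Sum>i=n..<n + k. c i *\<^sub>R seq_prod n f g i)"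
    using sum.atLeastLessThan_concat[of 0 n "n + k" "\<lambda>i. c i *\<^sub>R seq_prod n f g i"]
    by (simp add: atLeast0LessThan)
  also have "(\<Sum>i=n..<n + k. c i *\<^sub>R seq_prod n f g i) = (\<Sum>i<k. c (n + i) *\<^sub>R seq_prod n f g (n + i))"
    using sum.shift_bounds_nat_ivl[of "\<lambda>i. c i *\<^sub>R seq_prod n f g i" 0 n k]
    by (simp add: atLeast0LessThan add.commute)
  also have "\<dots> = (0, \<Sum>i<k. c (n + i) *\<^sub>R g i)"
    by (simp add: seq_prod_def prod_eq_iff fst_sum snd_sum)
  also have "(\<Sum>i<n. c i *\<^sub>R seq_prod n f g i) = (\<Sum>i<n. c i *\<^sub>R f i, 0)"
    by (simp add: seq_prod_def prod_eq_iff fst_sum snd_sum)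
  finally show ?thesis by simp
qed

lemma basis_seq_prod:
  assumes f: "basis_seq n f V" and g: "basis_seq k g W"
  shows "basis_seq (n + k) (seq_prod n f g) (V \<times> W)"
proof -
  have ind: "c i = 0" if "(\<Sum>i<n + k. c i *\<^sub>R seq_prod n f g i) = 0" "i < n + k" for c i
  proof (cases "i < n")
    case True
    then show ?thesis using that basis_seq_zero[OF f] by (auto simp: sum_seq_prod zero_prod_def)
  next
    case False
    then show ?thesis using that basis_seq_zero[OF g, of "\<lambda>i. c (n + i)" "i - n"]
      by (auto simp: sum_seq_prod zero_prod_def)
  qed
  have "span (seq_prod n f g ` {..<n + k}) = V \<times> W"
  proof (intro equalityI subsetI)
    fix x assume "x \<in> span (seq_prod n f g ` {..<n + k})"
    then obtain c where "x = (\<Sum>i<n. c i *\<^sub>R f i, \<Sum>i<k. c (n + i) *\<^sub>R g i)"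
      unfolding span_seq sum_seq_prod by auto
    moreover have "(\<Sum>i<n. c i *\<^sub>R f i) \<in> V" "(\<Sum>i<k. c (n + i) *\<^sub>R g i) \<in> W"
      using basis_seq_in[OF f] basis_seq_in[OF g] basis_seq_subspace[OF f] basis_seq_subspace[OF g]
      by (auto intro!: subspace_sum subspace_scale)
    ultimately show "x \<in> V \<times> W" by simp
  next
    fix x assume "x \<in> V \<times> W"
    then have x: "fst x \<in> V" "snd x \<in> W" by auto
    obtain c where c: "fst x = (\<Sum>i<n. c i *\<^sub>R f i)" using basis_seq_expand[OF f x(1)] .
    obtain d where d: "snd x = (\<Sum>i<k. d i *\<^sub>R g i)" using basis_seq_expand[OF g x(2)] .
    have "x = (\<Sum>i<n + k. (if i < n then c i else d (i - n)) *\<^sub>R seq_prod n f g i)"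
      unfolding sum_seq_prod prod_eq_iff using c d by simp
    then show "x \<in> span (seq_prod n f g ` {..<n + k})"
      unfolding span_seq by (intro image_eqI[where x = "\<lambda>i. if i < n then c i else d (i - n)"]) auto
  qed
  moreover have "inj_on (seq_prod n f g) {..<n + k}" "independent (seq_prod n f g ` {..<n + k})"
    by (rule seq_independentI; fact ind)+
  ultimately show ?thesis by (simp add: basis_seq_def)
qed

lemma zlat_prod: "zlat (n + k) (seq_prod n f g) = zlat n f \<times> zlat k g"
proof (intro equalityI subsetI)
  fix x assume "x \<in> zlat (n + k) (seq_prod n f g)"
  then obtain c :: "nat \<Rightarrow> int"
    where "x = (\<Sum>i<n. of_int (c i) *\<^sub>R f i, \<Sum>i<k. of_int (c (n + i)) *\<^sub>R g i)"
    unfolding zlat_def sum_seq_prod by auto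
  then show "x \<in> zlat n f \<times> zlat k g" unfolding zlat_def by auto
next
  fix x assume "x \<in> zlat n f \<times> zlat k g"
  then obtain c d :: "nat \<Rightarrow> int"
    where x: "fst x = (\<Sum>i<n. of_int (c i) *\<^sub>R f i)" "snd x = (\<Sum>i<k. of_int (d i) *\<^sub>R g i)"
    unfolding zlat_def by auto
  have "x = (\<Sum>i<n + k. of_int (if i < n then c i else d (i - n)) *\<^sub>R seq_prod n f g i)"
    unfolding sum_seq_prod prod_eq_iff using x by simp
  then show "x \<in> zlat (n + k) (seq_prod n f g)" unfolding zlat_def
    by (intro image_eqI[where x = "\<lambda>i. if i < n then c i else d (i - n)"]) auto
qed

text \<open>Bilinearity is asked on the whole type but positivity only on V. This fits
  \<open>ip_K\<close>, a sum over finitely many embeddings: it is bilinear on all functions but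
  vanishes on those supported elsewhere.\<close>

locale euclid =
  fixes V :: "'a::real_vector set" and ip :: "'a \<Rightarrow> 'a \<Rightarrow> real" and n :: nat
  assumes ip_sym: "ip x y = ip y x"
    and ip_add: "ip (x + y) z = ip x z + ip y z"
    and ip_scale: "ip (c *\<^sub>R x) z = c * ip x z"
    and ip_pos: "x \<in> V \<Longrightarrow> x \<noteq> 0 \<Longrightarrow> ip x x > 0"
    and basis_ex: "\<exists>f. basis_seq n f V"
begin

lemma ip_add_right: "ip z (x + y) = ip z x + ip z y"
  using ip_add[of x y z] by (simp add: ip_sym[of z])

lemma ip_scale_right: "ip z (c *\<^sub>R x) = c * ip z x"
  using ip_scale[of c x z] by (simp add: ip_sym[of z])

lemma ip_0 [simp]: "ip 0 x = 0" "ip x 0 = 0"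
  using ip_scale[of 0 0 x] ip_scale_right[of x 0 0] by auto

lemma ip_minus: "ip (- x) y = - ip x y" "ip x (- y) = - ip x y"
  using ip_scale[of "-1" x y] ip_scale_right[of x "-1" y] by auto

lemma ip_diff: "ip (x - y) z = ip x z - ip y z" "ip z (x - y) = ip z x - ip z y"
  using ip_add[of x "- y" z] ip_add_right[of z x "- y"] by (auto simp: ip_minus)

lemma ip_sum: "ip (sum h A) z = (\<Sum>i\<in>A. ip (h i) z)"
  by (induction A rule: infinite_finite_induct) (auto simp: ip_add)

lemma ip_sum_right: "ip z (sum h A) = (\<Sum>i\<in>A. ip z (h i))"
  by (induction A rule: infinite_finite_induct) (auto simp: ip_add_right)

lemma ip_nonneg: "x \<in> V \<Longrightarrow> ip x x \<ge> 0"
  using ip_pos[of x] by (cases "x = 0") auto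

lemma ip_eq_0: "x \<in> V \<Longrightarrow> ip x x = 0 \<longleftrightarrow> x = 0"
  using ip_pos[of x] by (cases "x = 0") auto

lemma subV: "subspace V"
  using basis_ex basis_seq_subspace by blast

lemma dimV: "dim V = n"
  using basis_ex basis_seq_dim by blast

lemma V_closed [simp, intro]:
  "0 \<in> V" "x \<in> V \<Longrightarrow> y \<in> V \<Longrightarrow> x + y \<in> V" "x \<in> V \<Longrightarrow> y \<in> V \<Longrightarrow> x - y \<in> V"
  "x \<in> V \<Longrightarrow> - x \<in> V" "x \<in> V \<Longrightarrow> c *\<^sub>R x \<in> V"
  using subV by (auto intro: subspace_0 subspace_add subspace_diff subspace_neg subspace_scale)

lemma V_sum [intro]: "(\<And>i. i \<in> A \<Longrightarrow> h i \<in> V) \<Longrightarrow> sum h A \<in> V"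
  by (rule subspace_sum[OF subV])

lemma zlat_in_V: "basis_seq n f V \<Longrightarrow> x \<in> zlat n f \<Longrightarrow> x \<in> V"
  using zlat_subset[of V n f] basis_seq_in[of n f V] by blast

subsection \<open>Gram--Schmidt orthogonalization\<close>

text \<open>Without normalization, so that the change of basis is unitriangular and one box serves
  as fundamental region for both \<open>zlat n f\<close> and \<open>zlat n (gs f)\<close>.\<close>

function gs :: "(nat \<Rightarrow> 'a) \<Rightarrow> nat \<Rightarrow> 'a" where
  "gs f i = f i - (\<Sum>j<i. (ip (f i) (gs f j) / ip (gs f j) (gs f j)) *\<^sub>R gs f j)"
  by auto
termination by (relation "Wellfounded.measure snd") auto

declare gs.simps [simp del]

lemma gs_in_V: "(\<And>j. j \<le> i \<Longrightarrow> f j \<in> V) \<Longrightarrow> gs f i \<in> V"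
  by (induction i rule: less_induct) (subst gs.simps, auto)

lemma gs_orth:
  assumes "\<And>j. j \<le> i \<Longrightarrow> f j \<in> V" "j < i"
  shows "ip (gs f i) (gs f j) = 0"
  using assms
proof (induction i arbitrary: j rule: less_induct)
  case (less i)
  have o: "ip (gs f k) (gs f j) = (if k = j then ip (gs f j) (gs f j) else 0)" if "k < i" for k
    using less.IH[of k j] less.IH[of j k] less.prems that ip_sym[of "gs f k" "gs f j"]
    by (cases k j rule: linorder_cases) auto
  have gV: "gs f j \<in> V" using less.prems by (intro gs_in_V) auto
  let ?c = "\<lambda>k. ip (f i) (gs f k) / ip (gs f k) (gs f k)"
  have "ip (gs f i) (gs f j) = ip (f i) (gs f j) - (\<Sum>k<i. ?c k * ip (gs f k) (gs f j))"
    unfolding gs.simps[of f i] ip_diff(1) ip_sum ip_scale by (rule refl)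
  also have "(\<Sum>k<i. ?c k * ip (gs f k) (gs f j)) =
      (\<Sum>k<i. if k = j then ?c j * ip (gs f j) (gs f j) else 0)"
    by (intro sum.cong refl) (simp only: lessThan_iff o mult_zero_right split: if_split, simp)
  also have "\<dots> = ?c j * ip (gs f j) (gs f j)" using less.prems by simp
  \<comment> \<open>If \<open>gs f j\<close> is 0, the quotient is 0 by convention, and so is
    \<open>ip (f i) (gs f j)\<close>.\<close>
  also have "\<dots> = ip (f i) (gs f j)" using ip_eq_0[OF gV] by auto
  finally show ?case by simp
qed

text \<open>The unitriangular matrix of \<open>f\<close> in terms of \<open>gs f\<close>.\<close>

definition gsc :: "(nat \<Rightarrow> 'a) \<Rightarrow> nat \<Rightarrow> nat \<Rightarrow> real"
  where "gsc f i j = (if j = i then 1 else if j < i then ip (f i) (gs f j) / ip (gs f j) (gs f j) else 0)"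

lemma gs_expand:
  assumes "i < n"
  shows "f i = (\<Sum>j<n. gsc f i j *\<^sub>R gs f j)"
proof -
  have "(\<Sum>j<n. gsc f i j *\<^sub>R gs f j) = (\<Sum>j\<in>insert i {..<i}. gsc f i j *\<^sub>R gs f j)"
    using assms by (intro sum.mono_neutral_right) (auto simp: gsc_def)
  also have "\<dots> = gs f i + (\<Sum>j<i. (ip (f i) (gs f j) / ip (gs f j) (gs f j)) *\<^sub>R gs f j)"
    by (simp add: gsc_def)
  also have "\<dots> = f i" using gs.simps[of f i] by simp
  finally show ?thesis by simp
qed

lemma basis_seq_gs:
  assumes "basis_seq n f V"
  shows "basis_seq n (gs f) V"
proof (rule basis_seqI_spanning[OF assms])
  show "\<And>i. i < n \<Longrightarrow> gs f i \<in> V"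
    using basis_seq_in[OF assms] by (intro gs_in_V) auto
  fix i assume "i < n"
  then show "f i \<in> span (gs f ` {..<n})"
    using gs_expand[of i f] by (auto simp: span_seq)
qed

lemma gs_orth':
  assumes "basis_seq n f V" "i < n" "j < n" "i \<noteq> j"
  shows "ip (gs f i) (gs f j) = 0"
  using gs_orth[of i f j] gs_orth[of j f i] basis_seq_in[OF assms(1)] assms ip_sym[of "gs f i" "gs f j"]
  by (cases i j rule: linorder_cases) auto

lemma gs_pos:
  assumes "basis_seq n f V" "i < n"
  shows "ip (gs f i) (gs f i) > 0"
  using basis_seq_neq0[OF basis_seq_gs] basis_seq_in[OF basis_seq_gs] assms by (intro ip_pos) auto

text \<open>Only \<open>gs f k\<close> with k <= j occur in \<open>f j\<close>, and these are
  orthogonal to \<open>gs f i\<close> unless k = i. This is the triangularity that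
  \<open>box_region\<close> asks for.\<close>

lemma ip_gs_upper:
  assumes "basis_seq n f V" "i < n" "j \<le> i"
  shows "ip (f j) (gs f i) = (if j = i then ip (gs f i) (gs f i) else 0)"
proof -
  have "ip (f j) (gs f i) = (\<Sum>k<n. gsc f j k * ip (gs f k) (gs f i))"
    using gs_expand[of j f] assms ip_sum[of "\<lambda>k. gsc f j k *\<^sub>R gs f k" "{..<n}" "gs f i"]
    by (simp add: ip_scale)
  also have "\<dots> = (\<Sum>k<n. if k = i then gsc f j i * ip (gs f i) (gs f i) else 0)"
    using assms gs_orth' by (intro sum.cong) auto
  also have "\<dots> = gsc f j i * ip (gs f i) (gs f i)" using assms by simp
  finally show ?thesis using assms by (auto simp: gsc_def)
qed

text \<open>\<open>f i - gs f i\<close> is orthogonal to \<open>gs f i\<close>, so by Pythagoras its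
  squared length is the difference of the two sides.\<close>

lemma gs_norm_le:
  assumes "basis_seq n f V" "i < n"
  shows "ip (gs f i) (gs f i) \<le> ip (f i) (f i)"
proof -
  have "f i - gs f i \<in> V"
    using basis_seq_in[OF basis_seq_gs[OF assms(1)] assms(2)] basis_seq_in[OF assms] by blast
  then have "0 \<le> ip (f i - gs f i) (f i - gs f i)" by (rule ip_nonneg)
  also have "\<dots> = ip (f i) (f i) - ip (gs f i) (gs f i)"
    using ip_gs_upper[OF assms order_refl] ip_sym[of "f i" "gs f i"] by (simp add: ip_diff)
  finally show ?thesis by simp
qed

subsection \<open>Orthonormal bases and dual bases\<close>

lemma orthonormal_basis_exists: "\<exists>b. orthonormal_basis V ip b"
proof -
  obtain f where f: "basis_seq n f V" using basis_ex by blast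
  let ?a = "\<lambda>i. 1 / sqrt (ip (gs f i) (gs f i))"
  let ?b = "\<lambda>i. ?a i *\<^sub>R gs f i"
  have o: "ip (?b i) (?b j) = (if i = j then 1 else 0)" if "i < n" "j < n" for i j
    using gs_orth'[OF f, of i j] gs_pos[OF f, of i] that
    by (auto simp: ip_scale ip_scale_right real_sqrt_mult_self field_simps)
  have "basis_seq n ?b V"
  proof (rule basis_seqI_spanning[OF basis_seq_gs[OF f]])
    fix i assume i: "i < n"
    show "?b i \<in> V" using basis_seq_in[OF basis_seq_gs[OF f] i] by auto
    have "sqrt (ip (gs f i) (gs f i)) *\<^sub>R ?b i \<in> span (?b ` {..<n})"
      using i by (intro span_scale span_base) auto
    moreover have "sqrt (ip (gs f i) (gs f i)) *\<^sub>R ?b i = gs f i" using gs_pos[OF f i] by simp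
    ultimately show "gs f i \<in> span (?b ` {..<n})" by metis
  qed
  then have "span (?b ` {..<dim V}) = V" unfolding basis_seq_def dimV by (elim conjE)
  then show ?thesis
    unfolding orthonormal_basis_def using o by (intro exI[of _ ?b] conjI allI impI) (unfold dimV)
qed

text \<open>The same choice as in \<open>coord_set\<close>, so that volumes unfold to measures of
  \<open>coords\<close> in these coordinates.\<close>

definition obs :: "nat \<Rightarrow> 'a" where "obs = (SOME b. orthonormal_basis V ip b)"

lemma orthonormal_obs: "orthonormal_basis V ip obs"
  unfolding obs_def using orthonormal_basis_exists by (rule someI_ex)

lemma ip_obs: "i < n \<Longrightarrow> j < n \<Longrightarrow> ip (obs i) (obs j) = (if i = j then 1 else 0)"
  using orthonormal_obs by (auto simp: orthonormal_basis_def dimV)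

lemma obs_in_V: "i < n \<Longrightarrow> obs i \<in> V"
  using orthonormal_obs unfolding orthonormal_basis_def dimV by (metis image_eqI lessThan_iff span_base)

lemma ip_sum_obs: "j < n \<Longrightarrow> ip (\<Sum>i<n. c i *\<^sub>R obs i) (obs j) = c j"
proof -
  assume "j < n"
  then have "ip (\<Sum>i<n. c i *\<^sub>R obs i) (obs j) = (\<Sum>i<n. if i = j then c j else 0)"
    unfolding ip_sum ip_scale by (intro sum.cong) (auto simp: ip_obs)
  then show ?thesis using \<open>j < n\<close> by simp
qed

lemma basis_seq_obs: "basis_seq n obs V"
proof -
  obtain f where f: "basis_seq n f V" using basis_ex by blast
  show ?thesis
  proof (rule basis_seqI_independent[OF f])
    fix c i assume "(\<Sum>i<n. c i *\<^sub>R obs i) = 0" "i < n"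
    then show "c i = 0" using ip_sum_obs[of i c] by simp
  qed (rule obs_in_V)
qed

lemma obs_expand: "x \<in> V \<Longrightarrow> x = (\<Sum>i<n. ip x (obs i) *\<^sub>R obs i)"
proof -
  assume "x \<in> V"
  then obtain c where c: "x = (\<Sum>i<n. c i *\<^sub>R obs i)" using basis_seq_expand[OF basis_seq_obs] by blast
  then show ?thesis using ip_sum_obs[of _ c] by simp
qed

text \<open>If \<open>a\<close> is the matrix of \<open>obs\<close> in terms of \<open>f\<close>,
  its transpose expresses the dual basis in terms of \<open>obs\<close>. Biorthogonality is read off
  by expanding \<open>f j\<close> through \<open>obs\<close> back into \<open>f\<close> and
  comparing coefficients.\<close>

lemma dual_basis_exists:
  assumes f: "basis_seq n f V"
  obtains f' where "basis_seq n f' V" "\<And>i j. i < n \<Longrightarrow> j < n \<Longrightarrow> ip (f i) (f' j) = (if i = j then 1 else 0)"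
proof -
  have "\<forall>k\<in>{..<n}. \<exists>c. obs k = (\<Sum>i<n. c i *\<^sub>R f i)"
    using basis_seq_expand[OF f] obs_in_V by (metis lessThan_iff)
  then obtain a where a: "\<And>k. k < n \<Longrightarrow> obs k = (\<Sum>i<n. a k i *\<^sub>R f i)"
    by (metis lessThan_iff)
  define f' where "f' i = (\<Sum>k<n. a k i *\<^sub>R obs k)" for i
  have d: "ip (f j) (f' i) = (if j = i then 1 else 0)" if ij: "i < n" "j < n" for i j
  proof -
    have "(\<Sum>i<n. (if i = j then 1 else 0) *\<^sub>R f i) = f j"
      using ij by (simp add: if_distrib[of "\<lambda>x. x *\<^sub>R _"] cong: if_cong)
    also have "\<dots> = (\<Sum>k<n. ip (f j) (obs k) *\<^sub>R obs k)"
      using obs_expand basis_seq_in[OF f] ij by blast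
    also have "\<dots> = (\<Sum>k<n. \<Sum>i<n. (ip (f j) (obs k) * a k i) *\<^sub>R f i)"
      using a by (intro sum.cong) (auto simp: scaleR_sum_right)
    also have "\<dots> = (\<Sum>i<n. (\<Sum>k<n. ip (f j) (obs k) * a k i) *\<^sub>R f i)"
      by (subst sum.swap) (simp add: scaleR_sum_left)
    finally have "(if i = j then 1 else 0) = (\<Sum>k<n. ip (f j) (obs k) * a k i)"
      by (rule basis_seq_unique[OF f]) (rule ij)
    then show ?thesis by (auto simp: f'_def ip_sum_right ip_scale_right mult.commute)
  qed
  have "basis_seq n f' V"
  proof (rule basis_seqI_independent[OF f])
    show "\<And>i. i < n \<Longrightarrow> f' i \<in> V" using obs_in_V by (auto simp: f'_def)
    fix c i assume c: "(\<Sum>i<n. c i *\<^sub>R f' i) = 0" "i < n"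
    have "0 = ip (f i) (\<Sum>i<n. c i *\<^sub>R f' i)" using c by simp
    also have "\<dots> = (\<Sum>j<n. if j = i then c i else 0)"
      unfolding ip_sum_right ip_scale_right using c d by (intro sum.cong) auto
    finally show "c i = 0" using c by simp
  qed
  then show thesis using that d by simp
qed

definition dual_pair :: "(nat \<Rightarrow> 'a) \<Rightarrow> (nat \<Rightarrow> 'a) \<Rightarrow> bool"
  where "dual_pair f f' \<longleftrightarrow> basis_seq n f V \<and> basis_seq n f' V \<and>
    (\<forall>i<n. \<forall>j<n. ip (f i) (f' j) = (if i = j then 1 else 0))"

lemma dual_pair_exists:
  assumes "basis_seq n f V" obtains f' where "dual_pair f f'"
  using dual_basis_exists[OF assms] assms unfolding dual_pair_def by metis

lemma dual_pair_sym: "dual_pair f f' \<Longrightarrow> dual_pair f' f"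
  unfolding dual_pair_def by (metis ip_sym)

lemma dual_pair_coeff:
  assumes "dual_pair f f'" "j < n"
  shows "ip (\<Sum>i<n. c i *\<^sub>R f i) (f' j) = c j"
proof -
  have "ip (\<Sum>i<n. c i *\<^sub>R f i) (f' j) = (\<Sum>i<n. if i = j then c j else 0)"
    unfolding ip_sum ip_scale using assms by (intro sum.cong) (auto simp: dual_pair_def)
  then show ?thesis using assms by simp
qed

lemma dual_pair_expand:
  assumes "dual_pair f f'" "x \<in> V"
  shows "x = (\<Sum>i<n. ip x (f' i) *\<^sub>R f i)"
proof -
  obtain c where c: "x = (\<Sum>i<n. c i *\<^sub>R f i)"
    using assms basis_seq_expand[of n f V] by (auto simp: dual_pair_def)
  then show ?thesis using dual_pair_coeff[OF assms(1), of _ c] by simp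
qed

lemma zlat_dual_iff:
  assumes "dual_pair f f'"
  shows "x \<in> zlat n f \<longleftrightarrow> x \<in> V \<and> (\<forall>i<n. ip x (f' i) \<in> \<int>)"
proof
  assume x: "x \<in> zlat n f"
  then obtain c :: "nat \<Rightarrow> int" where "x = (\<Sum>i<n. of_int (c i) *\<^sub>R f i)" by (auto simp: zlat_def)
  then show "x \<in> V \<and> (\<forall>i<n. ip x (f' i) \<in> \<int>)"
    using dual_pair_coeff[OF assms, of _ "\<lambda>i. of_int (c i)"] zlat_in_V[OF _ x] assms
    by (auto simp: dual_pair_def)
next
  assume x: "x \<in> V \<and> (\<forall>i<n. ip x (f' i) \<in> \<int>)"
  then have "x = (\<Sum>i<n. of_int \<lfloor>ip x (f' i)\<rfloor> *\<^sub>R f i)"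
    using dual_pair_expand[OF assms] by auto
  then show "x \<in> zlat n f" by (auto simp: zlat_def)
qed

lemma dual_lattice_zlat:
  assumes "dual_pair f f'"
  shows "dual_lattice V ip (zlat n f) = zlat n f'"
proof -
  have "(\<forall>y\<in>zlat n f. ip x y \<in> \<int>) \<longleftrightarrow> (\<forall>i<n. ip x (f i) \<in> \<int>)" for x
  proof
    assume "\<forall>i<n. ip x (f i) \<in> \<int>"
    then show "\<forall>y\<in>zlat n f. ip x y \<in> \<int>"
      by (auto simp: zlat_def ip_sum_right ip_scale_right intro!: Ints_sum)
  qed (auto intro: zlat_base)
  then show ?thesis
    unfolding dual_lattice_def set_eq_iff using zlat_dual_iff[OF dual_pair_sym[OF assms]] by auto
qed

lemma cauchy_schwarz:
  assumes "x \<in> V" "y \<in> V"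
  shows "(ip x y)\<^sup>2 \<le> ip x x * ip y y"
proof (cases "y = 0")
  case False
  then have yp: "ip y y > 0" using assms ip_pos by auto
  have "0 \<le> ip (x - (ip x y / ip y y) *\<^sub>R y) (x - (ip x y / ip y y) *\<^sub>R y)"
    using assms by (intro ip_nonneg) auto
  also have "\<dots> = ip x x - (ip x y)\<^sup>2 / ip y y"
    using yp ip_sym[of x y] by (simp add: ip_diff ip_scale ip_scale_right power2_eq_square)
  finally show ?thesis using yp by (simp add: field_simps)
qed simp

text \<open>The coordinates of a lattice point are its inner products with the dual basis, which
  Cauchy-Schwarz bounds on a ball.\<close>

lemma zlat_finite_ball:
  assumes f: "basis_seq n f V"
  shows "finite {x \<in> zlat n f. ip x x \<le> R}"
proof -
  obtain f' where d: "dual_pair f f'" using dual_pair_exists[OF f] .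
  define K where "K i = \<lceil>sqrt (R * ip (f' i) (f' i))\<rceil>" for i
  have "{x \<in> zlat n f. ip x x \<le> R} \<subseteq>
      (\<lambda>c. \<Sum>i<n. of_int (c i) *\<^sub>R f i) ` (PiE {..<n} (\<lambda>i. {- K i..K i}))"
  proof
    fix x assume "x \<in> {x \<in> zlat n f. ip x x \<le> R}"
    then have x: "x \<in> zlat n f" "ip x x \<le> R" "x \<in> V" using zlat_in_V[OF f] by auto
    let ?c = "\<lambda>i\<in>{..<n}. \<lfloor>ip x (f' i)\<rfloor>"
    have 1: "ip x (f' i) = of_int \<lfloor>ip x (f' i)\<rfloor>" if "i < n" for i
      using x(1) that zlat_dual_iff[OF d] by auto
    have "x = (\<Sum>i<n. ip x (f' i) *\<^sub>R f i)" by (rule dual_pair_expand[OF d x(3)])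
    also have "\<dots> = (\<Sum>i<n. of_int (?c i) *\<^sub>R f i)" using 1 by (intro sum.cong) auto
    finally have 2: "x = (\<Sum>i<n. of_int (?c i) *\<^sub>R f i)" .
    have "\<bar>\<lfloor>ip x (f' i)\<rfloor>\<bar> \<le> K i" if i: "i < n" for i
    proof -
      have fV: "f' i \<in> V" using d i basis_seq_in by (auto simp: dual_pair_def)
      have "(ip x (f' i))\<^sup>2 \<le> R * ip (f' i) (f' i)"
        using cauchy_schwarz[OF x(3) fV] mult_right_mono[OF x(2) ip_nonneg[OF fV]] by linarith
      then have "\<bar>ip x (f' i)\<bar> \<le> sqrt (R * ip (f' i) (f' i))"
        by (metis real_sqrt_abs real_sqrt_le_mono)
      then have "of_int \<bar>\<lfloor>ip x (f' i)\<rfloor>\<bar> \<le> sqrt (R * ip (f' i) (f' i))" using 1[OF i] by simp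
      then show ?thesis unfolding K_def by linarith
    qed
    then have "?c \<in> PiE {..<n} (\<lambda>i. {- K i..K i})" by (force simp: abs_le_iff)
    then show "x \<in> (\<lambda>c. \<Sum>i<n. of_int (c i) *\<^sub>R f i) ` (PiE {..<n} (\<lambda>i. {- K i..K i}))"
      using 2 by blast
  qed
  then show ?thesis by (rule finite_subset) (auto intro!: finite_imageI finite_PiE)
qed

subsection \<open>Rounding and sublattices\<close>

text \<open>If \<open>t\<close> is rounded up with probability equal to its fractional part, the squared length grows
  by at most a quarter of \<open>|v|\<^sup>2\<close> on average, so one of the two roundings achieves this.\<close>

lemma rounding_aux:
  fixes v :: "nat \<Rightarrow> 'a" and t :: "nat \<Rightarrow> real"
  assumes "\<And>i. i < k \<Longrightarrow> v i \<in> V" "e \<in> V"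
  shows "\<exists>c::nat \<Rightarrow> int. ip (e + (\<Sum>i<k. (t i - c i) *\<^sub>R v i)) (e + (\<Sum>i<k. (t i - c i) *\<^sub>R v i))
    \<le> ip e e + (\<Sum>i<k. ip (v i) (v i)) / 4"
  using assms
proof (induction k arbitrary: e)
  case (Suc k)
  let ?p = "frac (t k)"
  let ?v = "v k"
  have p: "0 \<le> ?p" "?p < 1" by (auto simp: frac_lt_1)
  have vV: "?v \<in> V" using Suc.prems by auto
  have q: "ip (e + s *\<^sub>R ?v) (e + s *\<^sub>R ?v) = ip e e + 2 * s * ip e ?v + s\<^sup>2 * ip ?v ?v" for s
    using ip_sym[of ?v e] by (simp add: ip_add ip_add_right ip_scale ip_scale_right power2_eq_square algebra_simps)
  have avg: "(1 - ?p) * ip (e + ?p *\<^sub>R ?v) (e + ?p *\<^sub>R ?v)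
      + ?p * ip (e + (?p - 1) *\<^sub>R ?v) (e + (?p - 1) *\<^sub>R ?v) = ip e e + (?p * (1 - ?p)) * ip ?v ?v"
    unfolding q by (simp add: algebra_simps power2_eq_square)
  have "?p * (1 - ?p) \<le> 1 / 4"
    using zero_le_power2[of "?p - 1 / 2"] by (simp add: power2_eq_square algebra_simps)
  then have b: "(?p * (1 - ?p)) * ip ?v ?v \<le> ip ?v ?v / 4"
    using mult_right_mono[OF _ ip_nonneg[OF vV]] by fastforce
  obtain s :: int where s: "ip (e + (t k - s) *\<^sub>R ?v) (e + (t k - s) *\<^sub>R ?v) \<le> ip e e + ip ?v ?v / 4"
  proof -
    let ?A = "ip (e + ?p *\<^sub>R ?v) (e + ?p *\<^sub>R ?v)"
    let ?B = "ip (e + (?p - 1) *\<^sub>R ?v) (e + (?p - 1) *\<^sub>R ?v)"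
    let ?M = "ip e e + ip ?v ?v / 4"
    have "?A \<le> ?M \<or> ?B \<le> ?M"
    proof (rule ccontr)
      assume "\<not> ?thesis"
      then have AB: "?A > ?M" "?B > ?M" by auto
      have "?M = (1 - ?p) * ?M + ?p * ?M"
        unfolding distrib_right[symmetric] by simp
      also have "\<dots> < (1 - ?p) * ?A + ?p * ?B"
        by (rule add_less_le_mono) (use AB p in \<open>auto intro!: mult_strict_left_mono mult_left_mono\<close>)
      also have "\<dots> = ip e e + (?p * (1 - ?p)) * ip ?v ?v" by (rule avg)
      also have "\<dots> \<le> ?M" using b by simp
      finally show False by simp
    qed
    moreover have "?p = t k - of_int \<lfloor>t k\<rfloor>" "?p - 1 = t k - of_int (\<lfloor>t k\<rfloor> + 1)" by (auto simp: frac_def)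
    ultimately show thesis using that by metis
  qed
  let ?e = "e + (t k - s) *\<^sub>R ?v"
  obtain c :: "nat \<Rightarrow> int" where c: "ip (?e + (\<Sum>i<k. (t i - c i) *\<^sub>R v i)) (?e + (\<Sum>i<k. (t i - c i) *\<^sub>R v i))
    \<le> ip ?e ?e + (\<Sum>i<k. ip (v i) (v i)) / 4"
    using Suc.IH[of ?e] Suc.prems vV by auto
  have "e + (\<Sum>i<Suc k. (t i - (c(k := s)) i) *\<^sub>R v i) = ?e + (\<Sum>i<k. (t i - c i) *\<^sub>R v i)"
    by (simp add: add_ac)
  then show ?case
    using c s by (intro exI[of _ "c(k := s)"]) (simp only: sum.lessThan_Suc[of "\<lambda>i. ip (v i) (v i)"], simp add: add_divide_distrib)
qed auto

lemma covering:
  assumes f: "basis_seq n f V" and x: "x \<in> V"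
  obtains y where "y \<in> zlat n f" "ip (x - y) (x - y) \<le> (\<Sum>i<n. ip (f i) (f i)) / 4"
proof -
  obtain t where t: "x = (\<Sum>i<n. t i *\<^sub>R f i)" using basis_seq_expand[OF f x] .
  obtain c :: "nat \<Rightarrow> int" where c: "ip (0 + (\<Sum>i<n. (t i - c i) *\<^sub>R f i)) (0 + (\<Sum>i<n. (t i - c i) *\<^sub>R f i))
    \<le> ip 0 0 + (\<Sum>i<n. ip (f i) (f i)) / 4"
    using rounding_aux[of n f 0 t] basis_seq_in[OF f] by auto
  let ?y = "\<Sum>i<n. of_int (c i) *\<^sub>R f i"
  have "x - ?y = (\<Sum>i<n. (t i - c i) *\<^sub>R f i)"
    unfolding t by (simp add: scaleR_diff_left sum_subtractf)
  then show thesis using c by (intro that[of ?y]) (auto simp: zlat_def)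
qed

text \<open>For each \<open>i\<close> choose a vector of \<open>L\<close> in the span of \<open>f\<^sub>0, \<dots>, f\<^sub>i\<close> whose \<open>i\<close>-th coordinate is
  positive and minimal.\<close>

lemma sublattice:
  assumes f: "basis_seq n f V"
    and L: "0 \<in> L" "\<And>x y. x \<in> L \<Longrightarrow> y \<in> L \<Longrightarrow> x - y \<in> L" "L \<subseteq> V"
    and fL: "\<And>i. i < n \<Longrightarrow> f i \<in> L"
    and N: "N > 0" "\<And>x. x \<in> L \<Longrightarrow> real N *\<^sub>R x \<in> zlat n f"
  obtains g where "basis_seq n g V" "L = zlat n g"
proof -
  obtain f' where d: "dual_pair f f'" using dual_pair_exists[OF f] .
  \<comment> \<open>N times the i-th coordinate: it takes integral values on L, so that a least
    positive value exists.\<close>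
  define \<phi> where "\<phi> i x = real N * ip x (f' i)" for i x
  have \<phi>Z: "\<phi> i x \<in> \<int>" if "x \<in> L" "i < n" for i x
    using N(2)[OF that(1)] that(2) zlat_dual_iff[OF d] by (auto simp: \<phi>_def ip_scale)
  \<comment> \<open>The members of L in the span of the first k vectors of \<open>f\<close>.\<close>
  define Lk where "Lk k = {x \<in> L. \<forall>j<n. k \<le> j \<longrightarrow> \<phi> j x = 0}" for k
  define P where "P i a \<longleftrightarrow> a > 0 \<and> (\<exists>x\<in>Lk (Suc i). \<phi> i x = real a)" for i and a :: nat
  have ff: "\<phi> j (f i) = (if i = j then real N else 0)" if "i < n" "j < n" for i j
    using d that by (auto simp: \<phi>_def dual_pair_def)
  have P_N: "P i N" if "i < n" for i
    unfolding P_def Lk_def using that N(1) fL ff by (intro conjI bexI[of _ "f i"]) auto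
  define a where "a i = (LEAST k. P i k)" for i
  have Pa: "P i (a i)" if "i < n" for i
    unfolding a_def using P_N[OF that] by (rule LeastI)
  have "\<forall>i\<in>{..<n}. \<exists>x\<in>Lk (Suc i). \<phi> i x = real (a i)"
    using Pa by (auto simp: P_def)
  then obtain g where g: "\<And>i. i < n \<Longrightarrow> g i \<in> Lk (Suc i)" "\<And>i. i < n \<Longrightarrow> \<phi> i (g i) = real (a i)"
    by (metis lessThan_iff)
  have \<phi>_diff: "\<phi> j (x - c *\<^sub>R y) = \<phi> j x - c * \<phi> j y" for j x y c
    by (simp add: \<phi>_def ip_diff ip_scale algebra_simps)
  have main: "k \<le> n \<Longrightarrow> x \<in> Lk k \<Longrightarrow> x \<in> zlat k g" for k x
  proof (induction k arbitrary: x)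
    case 0
    then have "\<forall>i<n. ip x (f' i) = 0" "x \<in> V" using N(1) L(3) by (auto simp: Lk_def \<phi>_def)
    then have "x = 0" using dual_pair_expand[OF d, of x] by simp
    then show ?case by simp
  next
    case (Suc k)
    then have k: "k < n" and xL: "x \<in> L" by (auto simp: Lk_def)
    obtain z where z: "\<phi> k x = of_int z" using \<phi>Z[OF xL k] by (auto elim: Ints_cases)
    let ?q = "z div int (a k)"
    let ?r = "z mod int (a k)"
    let ?y = "x - of_int ?q *\<^sub>R g k"
    have ap: "a k > 0" using Pa[OF k] by (simp add: P_def)
    have gL: "g k \<in> L" "\<forall>j<n. Suc k \<le> j \<longrightarrow> \<phi> j (g k) = 0" using g(1)[OF k] by (auto simp: Lk_def)
    have yL: "?y \<in> L" using xL gL L by (intro L(2) subgroup_int_scale) auto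
    have yS: "?y \<in> Lk (Suc k)"
      using yL gL(2) Suc.prems by (auto simp: Lk_def \<phi>_diff)
    have yk: "\<phi> k ?y = of_int ?r"
    proof -
      have "z = ?q * int (a k) + ?r" by simp
      then have "real_of_int z = of_int ?q * real (a k) + of_int ?r"
        by (metis of_int_add of_int_mult of_int_of_nat_eq)
      then show ?thesis using g(2)[OF k] z by (simp add: \<phi>_diff)
    qed
    \<comment> \<open>A nonzero remainder would be a positive value of the coordinate below the
      minimum \<open>a k\<close>.\<close>
    have "?r = 0"
    proof (rule ccontr)
      assume "?r \<noteq> 0"
      moreover have "?r \<ge> 0" "?r < int (a k)" using ap by auto
      ultimately have r: "nat ?r > 0" "nat ?r < a k" by linarith+
      have "P k (nat ?r)" unfolding P_def using r(1) yS yk by (auto intro!: bexI[of _ ?y])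
      then have "a k \<le> nat ?r" unfolding a_def by (rule Least_le)
      then show False using r by simp
    qed
    then have "?y \<in> Lk k"
      using yS yk by (auto simp: Lk_def Suc_le_eq le_less)
    then have "?y \<in> zlat k g" using Suc.IH k by auto
    then obtain c :: "nat \<Rightarrow> int" where c: "?y = (\<Sum>i<k. of_int (c i) *\<^sub>R g i)" by (auto simp: zlat_def)
    then have "x = (\<Sum>i<k. of_int (c i) *\<^sub>R g i) + of_int ?q *\<^sub>R g k" by (metis diff_add_cancel)
    also have "\<dots> = (\<Sum>i<Suc k. of_int ((c(k := ?q)) i) *\<^sub>R g i)" by simp
    finally show ?case unfolding zlat_def by blast
  qed
  have Ln: "Lk n = L" by (auto simp: Lk_def)
  have gL: "g i \<in> L" if "i < n" for i using g(1)[OF that] by (auto simp: Lk_def)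
  have eq: "L = zlat n g"
  proof
    show "L \<subseteq> zlat n g" using main[of n] Ln by auto
    show "zlat n g \<subseteq> L" by (rule zlat_subset) (use L gL in auto)
  qed
  have "basis_seq n g V"
  proof (rule basis_seqI_spanning[OF f])
    show "\<And>i. i < n \<Longrightarrow> g i \<in> V" using gL L(3) by auto
    fix i assume "i < n"
    then have "f i \<in> zlat n g" using fL eq by auto
    then show "f i \<in> span (g ` {..<n})" unfolding span_seq zlat_def by auto
  qed
  then show thesis using eq that by blast
qed

end

lemma euclid_prod:
  assumes "euclid V ip n" "euclid W ip' k"
  shows "euclid (V \<times> W) (\<lambda>x y. ip (fst x) (fst y) + ip' (snd x) (snd y)) (n + k)"
proof -
  interpret A: euclid V ip n by fact
  interpret B: euclid W ip' k by fact
  show ?thesis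
  proof
    fix x y z :: "'a \<times> 'b" and c :: real
    show "ip (fst x) (fst y) + ip' (snd x) (snd y) = ip (fst y) (fst x) + ip' (snd y) (snd x)"
      using A.ip_sym B.ip_sym by metis
    show "ip (fst (x + y)) (fst z) + ip' (snd (x + y)) (snd z) =
       ip (fst x) (fst z) + ip' (snd x) (snd z) + (ip (fst y) (fst z) + ip' (snd y) (snd z))"
      by (simp add: A.ip_add B.ip_add)
    show "ip (fst (c *\<^sub>R x)) (fst z) + ip' (snd (c *\<^sub>R x)) (snd z) =
       c * (ip (fst x) (fst z) + ip' (snd x) (snd z))"
      by (simp add: A.ip_scale B.ip_scale algebra_simps)
    assume x: "x \<in> V \<times> W" "x \<noteq> 0"
    then have "fst x \<noteq> 0 \<or> snd x \<noteq> 0" by (auto simp: prod_eq_iff)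
    then show "ip (fst x) (fst x) + ip' (snd x) (snd x) > 0"
      using x A.ip_pos[of "fst x"] B.ip_pos[of "snd x"] A.ip_nonneg[of "fst x"] B.ip_nonneg[of "snd x"]
      by (force simp: mem_Times_iff)
  next
    show "\<exists>f. basis_seq (n + k) f (V \<times> W)"
      using A.basis_ex B.basis_ex basis_seq_prod by blast
  qed
qed

lemma emeasure_lborel_vimage_plus:
  fixes A :: "real set"
  assumes "A \<in> sets borel"
  shows "emeasure lborel ((\<lambda>x. x + c) -` A) = emeasure lborel A"
proof -
  have "emeasure lborel A = emeasure (distr lborel borel ((+) c)) A"
    by (simp add: lborel_distr_plus)
  also have "\<dots> = emeasure lborel ((+) c -` A)"
    using assms by (subst emeasure_distr) auto
  also have "(+) c -` A = (\<lambda>x. x + c) -` A" by (auto simp: add.commute)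
  finally show ?thesis by simp
qed

context euclid
begin

abbreviation nrm :: "'a \<Rightarrow> real" where "nrm \<equiv> eucl_norm ip"

lemma nrm_triangle:
  assumes "x \<in> V" "y \<in> V"
  shows "nrm (x + y) \<le> nrm x + nrm y"
proof -
  have "ip x y \<le> sqrt (ip x x * ip y y)"
    using cauchy_schwarz[OF assms] by (simp add: real_le_rsqrt)
  then have "ip (x + y) (x + y) \<le> (nrm x + nrm y)\<^sup>2"
    using assms ip_sym[of x y]
    by (simp add: eucl_norm_def ip_add ip_add_right power2_sum ip_nonneg real_sqrt_mult)
  then show ?thesis
    using assms by (simp add: eucl_norm_def real_le_lsqrt ip_nonneg)
qed

lemma nrm_minus: "nrm (- x) = nrm x"
  by (simp add: eucl_norm_def ip_minus)

lemma nrm_triangle_diff: "x \<in> V \<Longrightarrow> y \<in> V \<Longrightarrow> nrm (x - y) \<le> nrm x + nrm y"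
  using nrm_triangle[of x "- y"] by (auto simp: nrm_minus)

subsection \<open>Coordinates\<close>

abbreviation mu :: "(nat \<Rightarrow> real) measure" where "mu \<equiv> lborel_n n"

definition of_coords :: "(nat \<Rightarrow> real) \<Rightarrow> 'a" where "of_coords c = (\<Sum>i<n. c i *\<^sub>R obs i)"

definition coords :: "'a set \<Rightarrow> (nat \<Rightarrow> real) set" where "coords S = {c \<in> space mu. of_coords c \<in> S}"

lemma coord_set_eq: "coord_set V ip S = coords S"
  by (simp add: coord_set_def coords_def Let_def of_coords_def obs_def dimV)

lemma of_coords_in_V: "of_coords c \<in> V"
  unfolding of_coords_def using obs_in_V by auto

lemma ip_of_coords_obs: "i < n \<Longrightarrow> ip (of_coords c) (obs i) = c i"
  by (simp add: of_coords_def ip_sum_obs)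

lemma ip_of_coords: "ip (of_coords c) x = (\<Sum>i<n. c i * ip (obs i) x)"
  by (simp add: of_coords_def ip_sum ip_scale)

lemma ip_of_coords_self: "ip (of_coords c) (of_coords c) = (\<Sum>i<n. (c i)\<^sup>2)"
  unfolding ip_of_coords[of c "of_coords c"]
  by (intro sum.cong refl) (simp add: ip_sym[of "obs _"] ip_of_coords_obs power2_eq_square)

lemma measurable_ip_of_coords: "(\<lambda>c. ip (of_coords c) x) \<in> borel_measurable mu"
  unfolding ip_of_coords by measurable

text \<open>Translation by v in coordinates. The restriction keeps the result in the space of the
  product measure, whose points are extensional functions.\<close>

definition tr :: "'a \<Rightarrow> (nat \<Rightarrow> real) \<Rightarrow> nat \<Rightarrow> real"
  where "tr v c = (\<lambda>i\<in>{..<n}. c i + ip v (obs i))"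

lemma of_coords_tr: "v \<in> V \<Longrightarrow> of_coords (tr v c) = of_coords c + v"
  by (subst (2) obs_expand[of v]) (auto simp: of_coords_def tr_def scaleR_add_left sum.distrib)

lemma tr_measurable: "tr v \<in> measurable mu mu"
  unfolding tr_def by measurable

text \<open>A finite product measure is determined by its values on boxes, where the claim is
  translation invariance of Lebesgue measure in each coordinate.\<close>

lemma distr_tr: "distr mu mu (tr v) = mu"
proof -
  interpret product_sigma_finite "\<lambda>_::nat. lborel :: real measure" by standard
  show ?thesis
  proof (rule PiM_eqI)
    fix A :: "nat \<Rightarrow> real set" assume A: "\<And>i. i \<in> {..<n} \<Longrightarrow> A i \<in> sets lborel"
    then have A': "i < n \<Longrightarrow> A i \<in> sets borel" for i by simp
    have "tr v -` PiE {..<n} A \<inter> space mu = PiE {..<n} (\<lambda>i. (\<lambda>x. x + ip v (obs i)) -` A i)"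
      by (auto simp: tr_def space_PiM PiE_iff)
    moreover have "PiE {..<n} A \<in> sets mu"
      using A by (intro sets_PiM_I_finite) auto
    ultimately have "emeasure (distr mu mu (tr v)) (PiE {..<n} A)
        = emeasure mu (PiE {..<n} (\<lambda>i. (\<lambda>x. x + ip v (obs i)) -` A i))"
      by (simp add: emeasure_distr tr_measurable)
    also have "\<dots> = (\<Prod>i<n. emeasure lborel ((\<lambda>x. x + ip v (obs i)) -` A i))"
    proof (rule emeasure_PiM)
      fix i assume "i \<in> {..<n}"
      then have "A i \<in> sets borel" using A' by simp
      then show "(\<lambda>x. x + ip v (obs i)) -` A i \<in> sets lborel"
        using measurable_sets[of "\<lambda>x. x + ip v (obs i)" borel borel "A i"] by simp
    qed simp
    also have "\<dots> = (\<Prod>i<n. emeasure lborel (A i))"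
      using A' by (intro prod.cong) (auto simp: emeasure_lborel_vimage_plus)
    finally show "emeasure (distr mu mu (tr v)) (PiE {..<n} A) = (\<Prod>i<n. emeasure lborel (A i))" .
  qed auto
qed

lemma coords_translate: "v \<in> V \<Longrightarrow> coords {x. x + v \<in> S} = tr v -` coords S \<inter> space mu"
  using measurable_space[OF tr_measurable, of _ v] by (auto simp: coords_def of_coords_tr)

lemma coords_translate_sets: "v \<in> V \<Longrightarrow> coords S \<in> sets mu \<Longrightarrow> coords {x. x + v \<in> S} \<in> sets mu"
  unfolding coords_translate using measurable_sets[OF tr_measurable] by blast

lemma emeasure_coords_translate:
  assumes "v \<in> V" "coords S \<in> sets mu"
  shows "emeasure mu (coords {x. x + v \<in> S}) = emeasure mu (coords S)"
proof -
  have "emeasure mu (coords S) = emeasure (distr mu mu (tr v)) (coords S)" by (simp add: distr_tr)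
  also have "\<dots> = emeasure mu (tr v -` coords S \<inter> space mu)"
    using assms by (simp add: emeasure_distr tr_measurable)
  finally show ?thesis using assms by (simp add: coords_translate)
qed

text \<open>\<open>S\<close> is cut into the pieces in the tiles \<open>D + l\<close>, which are translated back into \<open>D\<close>.\<close>

lemma folding:
  assumes L: "countable L" "L \<subseteq> V" and D: "coords D \<in> sets mu" "D \<subseteq> V"
    and tile: "\<And>x. x \<in> V \<Longrightarrow> \<exists>!y. y \<in> D \<and> x - y \<in> L" and S: "coords S \<in> sets mu"
  shows "emeasure mu (coords S) =
    (\<integral>\<^sup>+c. indicator (coords D) c * emeasure (count_space L) {l \<in> L. of_coords c + l \<in> S} \<partial>mu)"
proof -
  define A where "A l = coords {x. x - l \<in> D \<and> x \<in> S}" for l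
  define B where "B l = coords {x. x \<in> D \<and> x + l \<in> S}" for l
  have B_sets: "B l \<in> sets mu" if "l \<in> L" for l
  proof -
    have "B l = coords D \<inter> coords {x. x + l \<in> S}" by (auto simp: B_def coords_def)
    then show ?thesis using coords_translate_sets[of l S] that L D S by auto
  qed
  have AB: "A l = coords {x. x + (- l) \<in> {x. x \<in> D \<and> x + l \<in> S}}" for l
    by (auto simp: A_def)
  have A_sets: "A l \<in> sets mu" and A_em: "emeasure mu (A l) = emeasure mu (B l)" if "l \<in> L" for l
  proof -
    have l: "- l \<in> V" using L(2) that by auto
    show "A l \<in> sets mu" "emeasure mu (A l) = emeasure mu (B l)"
      using B_sets[OF that] unfolding AB B_def
      by (rule coords_translate_sets[OF l], rule emeasure_coords_translate[OF l])
  qed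
  have "coords S = (\<Union>l\<in>L. A l)"
  proof (intro equalityI subsetI)
    fix c assume c: "c \<in> coords S"
    obtain y where "y \<in> D" "of_coords c - y \<in> L" using tile[OF of_coords_in_V] by blast
    then have "c \<in> A (of_coords c - y)" using c by (auto simp: A_def coords_def)
    then show "c \<in> (\<Union>l\<in>L. A l)" using \<open>of_coords c - y \<in> L\<close> by blast
  qed (auto simp: A_def coords_def)
  moreover have "disjoint_family_on A L"
    unfolding disjoint_family_on_def
  proof (intro ballI impI)
    fix l l' assume l: "l \<in> L" "l' \<in> L" "l \<noteq> l'"
    show "A l \<inter> A l' = {}"
    proof (rule ccontr)
      assume "A l \<inter> A l' \<noteq> {}"
      then obtain c where "of_coords c - l \<in> D" "of_coords c - l' \<in> D" by (auto simp: A_def coords_def)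
      then have "of_coords c - l = of_coords c - l'" using tile[OF of_coords_in_V, of c] l by (metis diff_diff_eq2 add_diff_cancel_left')
      then show False using l by simp
    qed
  qed
  ultimately have "emeasure mu (coords S) = (\<integral>\<^sup>+l. emeasure mu (A l) \<partial>count_space L)"
    using emeasure_UN_countable[of L A mu] A_sets L(1) by simp
  also have "\<dots> = (\<integral>\<^sup>+l. (\<integral>\<^sup>+c. indicator (B l) c \<partial>mu) \<partial>count_space L)"
    by (intro nn_integral_cong) (auto simp: A_em B_sets)
  also have "\<dots> = (\<integral>\<^sup>+c. (\<integral>\<^sup>+l. indicator (B l) c \<partial>count_space L) \<partial>mu)"
    by (rule nn_integral_count_space_nn_integral[symmetric]) (auto intro!: L borel_measurable_indicator B_sets)
  also have "\<dots> = (\<integral>\<^sup>+c. indicator (coords D) c * emeasure (count_space L) {l \<in> L. of_coords c + l \<in> S} \<partial>mu)"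
  proof (rule nn_integral_cong)
    fix c assume c: "c \<in> space mu"
    have "(\<integral>\<^sup>+l. indicator (B l) c \<partial>count_space L)
        = (\<integral>\<^sup>+l. indicator (coords D) c * indicator {l \<in> L. of_coords c + l \<in> S} l \<partial>count_space L)"
      using c by (intro nn_integral_cong) (auto simp: B_def coords_def split: split_indicator)
    also have "\<dots> = indicator (coords D) c * emeasure (count_space L) {l \<in> L. of_coords c + l \<in> S}"
      by (subst nn_integral_cmult) auto
    finally show "(\<integral>\<^sup>+l. indicator (B l) c \<partial>count_space L)
        = indicator (coords D) c * emeasure (count_space L) {l \<in> L. of_coords c + l \<in> S}" .
  qed
  finally show ?thesis .
qed

lemma emeasure_ball:
  assumes "r > 0"
  shows "emeasure mu (coords (eucl_ball V ip r)) = ennreal (unit_ball_vol (real n) * r ^ n)"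
    "coords (eucl_ball V ip r) \<in> sets mu"
proof -
  have *: "coords (eucl_ball V ip r) = {f. sqrt (\<Sum>i\<in>{..<n}. (f i)\<^sup>2) \<le> r} \<inter> space mu"
    by (auto simp: coords_def eucl_ball_def eucl_norm_def ip_of_coords_self of_coords_in_V)
  show "emeasure mu (coords (eucl_ball V ip r)) = ennreal (unit_ball_vol (real n) * r ^ n)"
    unfolding * using emeasure_cball_aux[of "{..<n}" r] assms by simp
  have "{f \<in> space mu. sqrt (\<Sum>i\<in>{..<n}. (f i)\<^sup>2) \<le> r} \<in> sets mu"
    by measurable
  then show "coords (eucl_ball V ip r) \<in> sets mu" unfolding * by (simp add: Int_def conj_commute)
qed

lemma eucl_volume_ball: "r > 0 \<Longrightarrow> eucl_volume V ip (eucl_ball V ip r) = unit_ball_vol (real n) * r ^ n"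
  using emeasure_ball(1)[of r]
  by (simp add: eucl_volume_def coord_set_eq dimV Sigma_Algebra.measure_def)

subsection \<open>Counting lattice points\<close>

definition cnt :: "'a set \<Rightarrow> real \<Rightarrow> nat"
  where "cnt L r = card (L \<inter> eucl_ball V ip r)"

lemma finite_lattice_ball: "basis_seq n f V \<Longrightarrow> finite (zlat n f \<inter> eucl_ball V ip r)"
proof (rule finite_subset)
  assume f: "basis_seq n f V"
  show "zlat n f \<inter> eucl_ball V ip r \<subseteq> {x \<in> zlat n f. ip x x \<le> r\<^sup>2}"
    by (auto simp: eucl_ball_def eucl_norm_def dest: sqrt_le_D)
qed (rule zlat_finite_ball)

lemma countable_zlat: "countable (zlat n f)"
proof -
  have "zlat n f = (\<lambda>c. \<Sum>i<n. of_int (c i) *\<^sub>R f i) ` (PiE {..<n} (\<lambda>_. UNIV))"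
  proof (intro equalityI subsetI)
    fix x assume "x \<in> zlat n f"
    then obtain c :: "nat \<Rightarrow> int" where "x = (\<Sum>i<n. of_int (c i) *\<^sub>R f i)" by (auto simp: zlat_def)
    then have "x = (\<Sum>i<n. of_int ((restrict c {..<n}) i) *\<^sub>R f i)" by simp
    moreover have "restrict c {..<n} \<in> PiE {..<n} (\<lambda>_. UNIV)" by simp
    ultimately show "x \<in> (\<lambda>c. \<Sum>i<n. of_int (c i) *\<^sub>R f i) ` (PiE {..<n} (\<lambda>_. UNIV))"
      by (rule image_eqI)
  qed (auto simp: zlat_def)
  then show ?thesis by (simp add: countable_PiE)
qed

definition covers :: "'a set \<Rightarrow> real \<Rightarrow> bool"
  where "covers L \<tau> \<longleftrightarrow> 0 \<le> \<tau> \<and> (\<forall>x\<in>V. \<exists>y\<in>L. nrm (x - y) \<le> \<tau>)"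

lemma covers_zlat:
  assumes "basis_seq n f V"
  shows "covers (zlat n f) (sqrt ((\<Sum>i<n. ip (f i) (f i)) / 4))"
  unfolding covers_def
proof (intro conjI ballI)
  show "0 \<le> sqrt ((\<Sum>i<n. ip (f i) (f i)) / 4)"
    using basis_seq_in[OF assms] by (auto intro!: sum_nonneg ip_nonneg)
  fix x assume "x \<in> V"
  then show "\<exists>y\<in>zlat n f. nrm (x - y) \<le> sqrt ((\<Sum>i<n. ip (f i) (f i)) / 4)"
    using covering[OF assms] unfolding eucl_norm_def by (metis real_sqrt_le_mono)
qed

lemma region_folding:
  assumes f: "basis_seq n f V" and D: "fundamental_region V ip (zlat n f) D" and S: "coords S \<in> sets mu"
  shows "emeasure mu (coords S) =
    (\<integral>\<^sup>+c. indicator (coords D) c * emeasure (count_space (zlat n f)) {l \<in> zlat n f. of_coords c + l \<in> S} \<partial>mu)"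
  using D S zlat_in_V[OF f]
  by (intro folding) (auto simp: fundamental_region_def countable_zlat coord_set_eq dimV)

lemma region_sets: "fundamental_region V ip L D \<Longrightarrow> coords D \<in> sets mu"
  by (simp add: fundamental_region_def coord_set_eq dimV)

lemma region_upper:
  assumes f: "basis_seq n f V" and D: "fundamental_region V ip (zlat n f) D" and S: "coords S \<in> sets mu"
    and k: "\<And>x. x \<in> V \<Longrightarrow> finite {l \<in> zlat n f. x + l \<in> S} \<and> card {l \<in> zlat n f. x + l \<in> S} \<le> k"
  shows "emeasure mu (coords S) \<le> of_nat k * emeasure mu (coords D)"
proof -
  have "emeasure mu (coords S) \<le> (\<integral>\<^sup>+c. of_nat k * indicator (coords D) c \<partial>mu)"
    unfolding region_folding[OF f D S]
  proof (rule nn_integral_mono)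
    fix c
    have "emeasure (count_space (zlat n f)) {l \<in> zlat n f. of_coords c + l \<in> S} \<le> of_nat k"
      using k[OF of_coords_in_V, of c] by (subst emeasure_count_space_finite) auto
    then show "indicator (coords D) c * emeasure (count_space (zlat n f)) {l \<in> zlat n f. of_coords c + l \<in> S}
        \<le> of_nat k * indicator (coords D) c"
      by (auto split: split_indicator)
  qed
  also have "\<dots> = of_nat k * emeasure mu (coords D)"
    using region_sets[OF D] by (simp add: nn_integral_cmult)
  finally show ?thesis .
qed

text \<open>A finite set of witnesses takes the place of a cardinality, because \<open>card\<close>
  is 0 on infinite sets.\<close>

lemma region_lower:
  assumes f: "basis_seq n f V" and D: "fundamental_region V ip (zlat n f) D" and S: "coords S \<in> sets mu"
    and k: "\<And>x. x \<in> V \<Longrightarrow> \<exists>A. finite A \<and> card A = k \<and> A \<subseteq> {l \<in> zlat n f. x + l \<in> S}"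
  shows "of_nat k * emeasure mu (coords D) \<le> emeasure mu (coords S)"
proof -
  have "of_nat k * emeasure mu (coords D) = (\<integral>\<^sup>+c. of_nat k * indicator (coords D) c \<partial>mu)"
    using region_sets[OF D] by (simp add: nn_integral_cmult)
  also have "\<dots> \<le> emeasure mu (coords S)"
    unfolding region_folding[OF f D S]
  proof (rule nn_integral_mono)
    fix c
    obtain A where A: "finite A" "card A = k" "A \<subseteq> {l \<in> zlat n f. of_coords c + l \<in> S}"
      using k[OF of_coords_in_V] by blast
    have "of_nat k = emeasure (count_space (zlat n f)) A"
      using A by (subst emeasure_count_space_finite) auto
    also have "\<dots> \<le> emeasure (count_space (zlat n f)) {l \<in> zlat n f. of_coords c + l \<in> S}"
      using A by (intro emeasure_mono) auto
    finally show "of_nat k * indicator (coords D) c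
      \<le> indicator (coords D) c * emeasure (count_space (zlat n f)) {l \<in> zlat n f. of_coords c + l \<in> S}"
      by (auto split: split_indicator)
  qed
  finally show ?thesis .
qed

text \<open>Choose a lattice point y within \<tau> of x. If l has length at most r, then x + (l - y)
  has length at most r + \<tau>; so every translate of the lattice has at least \<open>cnt\<close>
  many points in the larger ball.\<close>

lemma count_upper:
  assumes f: "basis_seq n f V" and D: "fundamental_region V ip (zlat n f) D"
    and \<tau>: "covers (zlat n f) \<tau>" and r: "r > 0"
  shows "of_nat (cnt (zlat n f) r) * emeasure mu (coords D) \<le> ennreal (unit_ball_vol (real n) * (r + \<tau>) ^ n)"
proof -
  have rt: "r + \<tau> > 0" using r \<tau> by (auto simp: covers_def)
  show ?thesis
    unfolding emeasure_ball(1)[OF rt, symmetric]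
  proof (rule region_lower[OF f D emeasure_ball(2)[OF rt]])
    fix x assume x: "x \<in> V"
    obtain y where y: "y \<in> zlat n f" "nrm (x - y) \<le> \<tau>" using \<tau> x by (auto simp: covers_def)
    have yV: "y \<in> V" using zlat_in_V[OF f] y by auto
    let ?A = "(\<lambda>l. l - y) ` (zlat n f \<inter> eucl_ball V ip r)"
    have "nrm (x + (l - y)) \<le> r + \<tau>" if l: "l \<in> zlat n f" "l \<in> eucl_ball V ip r" for l
    proof -
      have e: "x + (l - y) = (x - y) + l" by simp
      show ?thesis unfolding e
        using nrm_triangle[of "x - y" l] x yV y(2) l by (auto simp: eucl_ball_def)
    qed
    then have "?A \<subseteq> {l \<in> zlat n f. x + l \<in> eucl_ball V ip (r + \<tau>)}"
    proof (intro image_subsetI CollectI conjI)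
      fix l assume l: "l \<in> zlat n f \<inter> eucl_ball V ip r"
      then show "l - y \<in> zlat n f" using y(1) by (auto intro: zlat_diff)
      then have "l - y \<in> V" by (rule zlat_in_V[OF f])
      then have "x + (l - y) \<in> V" by (rule V_closed(2)[OF x])
      moreover have "nrm (x + (l - y)) \<le> r + \<tau>"
        using \<open>\<And>l. l \<in> zlat n f \<Longrightarrow> l \<in> eucl_ball V ip r \<Longrightarrow> nrm (x + (l - y)) \<le> r + \<tau>\<close> l by (elim IntE)
      ultimately show "x + (l - y) \<in> eucl_ball V ip (r + \<tau>)" unfolding eucl_ball_def by (intro CollectI conjI)
    qed
    moreover have "card ?A = cnt (zlat n f) r"
      unfolding cnt_def by (rule card_image) (auto simp: inj_on_def)
    moreover have "finite ?A" by (intro finite_imageI finite_lattice_ball[OF f])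
    ultimately show "\<exists>A. finite A \<and> card A = cnt (zlat n f) r \<and> A \<subseteq> {l \<in> zlat n f. x + l \<in> eucl_ball V ip (r + \<tau>)}"
      by (intro exI[of _ ?A] conjI)
  qed
qed

text \<open>With a lattice point y within \<tau> of x, adding y maps the points l with x + l in the
  ball of radius r - \<tau> injectively to lattice points in the ball of radius r.\<close>

lemma count_lower:
  assumes f: "basis_seq n f V" and D: "fundamental_region V ip (zlat n f) D"
    and \<tau>: "covers (zlat n f) \<tau>" and r: "r > \<tau>"
  shows "ennreal (unit_ball_vol (real n) * (r - \<tau>) ^ n) \<le> of_nat (cnt (zlat n f) r) * emeasure mu (coords D)"
proof -
  have rt: "r - \<tau> > 0" using r by simp
  show ?thesis
    unfolding emeasure_ball(1)[OF rt, symmetric]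
  proof (rule region_upper[OF f D emeasure_ball(2)[OF rt]])
    fix x assume x: "x \<in> V"
    obtain y where y: "y \<in> zlat n f" "nrm (x - y) \<le> \<tau>" using \<tau> x by (auto simp: covers_def)
    have yV: "y \<in> V" using zlat_in_V[OF f] y by auto
    let ?A = "{l \<in> zlat n f. x + l \<in> eucl_ball V ip (r - \<tau>)}"
    have "nrm (l + y) \<le> r" if l: "l \<in> ?A" for l
    proof -
      have "l + y = (x + l) - (x - y)" by simp
      then show ?thesis
        using nrm_triangle_diff[of "x + l" "x - y"] x yV y(2) l by (auto simp: eucl_ball_def)
    qed
    then have sub: "(\<lambda>l. l + y) ` ?A \<subseteq> zlat n f \<inter> eucl_ball V ip r"
      using y yV zlat_in_V[OF f] by (auto simp: eucl_ball_def intro: zlat_add)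
    have inj: "inj_on (\<lambda>l. l + y) ?A" by (auto simp: inj_on_def)
    show "finite ?A \<and> card ?A \<le> cnt (zlat n f) r"
      using inj_on_finite[OF inj sub finite_lattice_ball[OF f]]
        card_inj_on_le[OF inj sub finite_lattice_ball[OF f]] by (simp add: cnt_def)
  qed
qed

lemma cnt_pos: "basis_seq n f V \<Longrightarrow> r \<ge> 0 \<Longrightarrow> cnt (zlat n f) r \<ge> 1"
proof -
  assume f: "basis_seq n f V" and r: "r \<ge> 0"
  have "0 \<in> zlat n f \<inter> eucl_ball V ip r" using r by (simp add: eucl_ball_def eucl_norm_def)
  then show ?thesis
    unfolding cnt_def using finite_lattice_ball[OF f, of r] by (metis One_nat_def Suc_leI card_gt_0_iff empty_iff)
qed

text \<open>Finite by \<open>count_upper\<close> at radius 1, where the origin is counted; positive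
  by \<open>count_lower\<close> at radius \<tau> + 1, where the left side is the volume of the unit
  ball.\<close>

lemma region_measure:
  assumes f: "basis_seq n f V" and D: "fundamental_region V ip (zlat n f) D"
  shows "emeasure mu (coords D) = ennreal (measure mu (coords D))" "measure mu (coords D) > 0"
proof -
  obtain \<tau> where \<tau>: "covers (zlat n f) \<tau>" using covers_zlat[OF f] by blast
  have "1 * emeasure mu (coords D) \<le> of_nat (cnt (zlat n f) 1) * emeasure mu (coords D)"
    using cnt_pos[OF f, of 1] of_nat_mono[of 1 "cnt (zlat n f) 1", where ?'a = ennreal]
    by (intro mult_right_mono) simp_all
  also have "\<dots> \<le> ennreal (unit_ball_vol (real n) * (1 + \<tau>) ^ n)"
    by (rule count_upper[OF f D \<tau>]) simp
  also have "\<dots> < \<infinity>" by simp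
  finally have fin: "emeasure mu (coords D) < \<infinity>" by simp
  then show eq: "emeasure mu (coords D) = ennreal (measure mu (coords D))"
    by (simp add: emeasure_eq_ennreal_measure)
  have "0 < ennreal (unit_ball_vol (real n) * ((\<tau> + 1) - \<tau>) ^ n)" by simp
  also have "\<dots> \<le> of_nat (cnt (zlat n f) (\<tau> + 1)) * emeasure mu (coords D)"
    by (rule count_lower[OF f D \<tau>]) simp
  finally have "emeasure mu (coords D) \<noteq> 0" by auto
  then show "measure mu (coords D) > 0" using eq by (simp add: ennreal_eq_0_iff zero_less_measure_iff order_less_le)
qed

lemma count_upper_real:
  assumes f: "basis_seq n f V" and D: "fundamental_region V ip (zlat n f) D"
    and \<tau>: "covers (zlat n f) \<tau>" and r: "r > 0"
  shows "real (cnt (zlat n f) r) * measure mu (coords D) \<le> unit_ball_vol (real n) * (r + \<tau>) ^ n"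
proof -
  have "0 \<le> \<tau>" using \<tau> by (simp add: covers_def)
  then show ?thesis
    using count_upper[OF assms] r unfolding region_measure(1)[OF f D] ennreal_of_nat_eq_real_of_nat
    by (simp add: ennreal_mult'[symmetric])
qed

lemma count_lower_real:
  assumes f: "basis_seq n f V" and D: "fundamental_region V ip (zlat n f) D"
    and \<tau>: "covers (zlat n f) \<tau>" and r: "r > \<tau>"
  shows "unit_ball_vol (real n) * (r - \<tau>) ^ n \<le> real (cnt (zlat n f) r) * measure mu (coords D)"
  using count_lower[OF assms] r unfolding region_measure(1)[OF f D] ennreal_of_nat_eq_real_of_nat
  by (simp add: ennreal_mult'[symmetric])

text \<open>Both counts are the volume of a ball divided by the volume of the region, up to changes
  of the radius by constants. These become negligible as the radius tends to infinity.\<close>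

lemma region_mono:
  assumes f: "basis_seq n f V" and D: "fundamental_region V ip (zlat n f) D"
    and f': "basis_seq n f' V" and D': "fundamental_region V ip (zlat n f') D'"
    and le: "\<And>r. r > 0 \<Longrightarrow> cnt (zlat n f') r \<le> cnt (zlat n f) r"
  shows "measure mu (coords D) \<le> measure mu (coords D')"
proof -
  define v where "v = measure mu (coords D)"
  define v' where "v' = measure mu (coords D')"
  have vp: "v > 0" "v' > 0" using region_measure(2) f D f' D' by (auto simp: v_def v'_def)
  obtain \<tau> where \<tau>: "covers (zlat n f) \<tau>" using covers_zlat[OF f] by blast
  obtain \<tau>' where \<tau>': "covers (zlat n f') \<tau>'" using covers_zlat[OF f'] by blast
  let ?b = "unit_ball_vol (real n)"
  have bp: "?b > 0" by simp
  have key: "v * ((r - \<tau>') / (r + \<tau>)) ^ n \<le> v'" if r: "r > \<tau>'" for r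
  proof -
    have r0: "r > 0" "r + \<tau> > 0" using r \<tau> \<tau>' by (auto simp: covers_def)
    have "v * (?b * (r - \<tau>') ^ n) \<le> v * (real (cnt (zlat n f') r) * v')"
      using count_lower_real[OF f' D' \<tau>' r] vp by (simp add: v'_def)
    also have "\<dots> \<le> v * (real (cnt (zlat n f) r) * v')"
      using le[OF r0(1)] vp by (intro mult_left_mono mult_right_mono) auto
    also have "\<dots> = (real (cnt (zlat n f) r) * v) * v'" by simp
    also have "\<dots> \<le> (?b * (r + \<tau>) ^ n) * v'"
      using count_upper_real[OF f D \<tau> r0(1)] vp by (intro mult_right_mono) (auto simp: v_def)
    finally have "v * (r - \<tau>') ^ n \<le> v' * (r + \<tau>) ^ n"
      using bp by (simp add: mult.assoc mult.left_commute[of _ ?b] mult.commute[of v'])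
    then show ?thesis using r0 by (simp add: power_divide pos_divide_le_eq)
  qed
  have "((\<lambda>r. (r - \<tau>') / (r + \<tau>)) \<longlongrightarrow> 1) at_top"
    by real_asymp
  then have "((\<lambda>r. v * ((r - \<tau>') / (r + \<tau>)) ^ n) \<longlongrightarrow> v * 1 ^ n) at_top"
    by (intro tendsto_intros)
  then have "v * 1 ^ n \<le> v'"
    by (rule tendsto_upperbound) (auto intro!: eventually_mono[OF eventually_gt_at_top[of \<tau>']] key)
  then show ?thesis by (simp add: v_def v'_def)
qed

subsection \<open>The volume of a lattice\<close>

text \<open>For orthogonal \<open>g\<close> this is the half-open box with edges \<open>g i\<close>:
  each coordinate \<open>ip x (g i) / ip (g i) (g i)\<close> lies in [0, 1).\<close>

definition gbox :: "(nat \<Rightarrow> 'a) \<Rightarrow> 'a set"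
  where "gbox g = {x \<in> V. \<forall>i<n. 0 \<le> ip x (g i) \<and> ip x (g i) < ip (g i) (g i)}"

text \<open>By triangularity, adding multiples of \<open>f j\<close> with j < i leaves the i-th
  inner product unchanged. Adjusting the inner products from the last to the first therefore moves
  any point into the box.\<close>

lemma box_region:
  assumes f: "basis_seq n f V"
    and g: "\<And>i. i < n \<Longrightarrow> ip (g i) (g i) > 0"
    and fg: "\<And>i j. i < n \<Longrightarrow> j \<le> i \<Longrightarrow> ip (f j) (g i) = (if j = i then ip (g i) (g i) else 0)"
  shows "fundamental_region V ip (zlat n f) (gbox g)"
  unfolding fundamental_region_def
proof (intro conjI ballI)
  show "gbox g \<subseteq> V" by (auto simp: gbox_def)
  have "coords (gbox g) = {c \<in> space mu. \<forall>i<n. 0 \<le> ip (of_coords c) (g i) \<and> ip (of_coords c) (g i) < ip (g i) (g i)}"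
    by (auto simp: coords_def gbox_def of_coords_in_V)
  also have "\<dots> \<in> sets mu"
    using measurable_ip_of_coords by measurable
  finally show "coord_set V ip (gbox g) \<in> sets (lborel_n (dim V))" by (simp add: coord_set_eq dimV)
  fix x assume x: "x \<in> V"
  have ex: "\<exists>l\<in>zlat m f. \<forall>i<m. 0 \<le> ip (y - l) (g i) \<and> ip (y - l) (g i) < ip (g i) (g i)"
    if "m \<le> n" "y \<in> V" for m y
    using that
  proof (induction m arbitrary: y)
    case 0
    then show ?case using zlat_0[of 0 f] by blast
  next
    case (Suc m)
    then have m: "m < n" by simp
    define c where "c = \<lfloor>ip y (g m) / ip (g m) (g m)\<rfloor>"
    define z where "z = y - of_int c *\<^sub>R f m"
    have zV: "z \<in> V" using Suc.prems basis_seq_in[OF f m] by (auto simp: z_def)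
    obtain l where l: "l \<in> zlat m f" "\<forall>i<m. 0 \<le> ip (z - l) (g i) \<and> ip (z - l) (g i) < ip (g i) (g i)"
      using Suc.IH[OF _ zV] m by auto
    then obtain d :: "nat \<Rightarrow> int" where d: "l = (\<Sum>i<m. of_int (d i) *\<^sub>R f i)" by (auto simp: zlat_def)
    have "ip l (g m) = 0"
      unfolding d ip_sum ip_scale using fg[OF m] by (intro sum.neutral) auto
    then have "ip (z - l) (g m) = ip y (g m) - of_int c * ip (g m) (g m)"
      using fg[OF m, of m] by (simp add: z_def ip_diff ip_scale)
    moreover have "of_int c * ip (g m) (g m) \<le> ip y (g m)" "ip y (g m) < (of_int c + 1) * ip (g m) (g m)"
      using g[OF m] unfolding c_def
      by (auto simp: pos_le_divide_eq[symmetric] pos_divide_less_eq[symmetric])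
    ultimately have m': "0 \<le> ip (z - l) (g m)" "ip (z - l) (g m) < ip (g m) (g m)"
      by (auto simp: algebra_simps)
    have "z - l = y - (l + of_int c *\<^sub>R f m)" by (simp add: z_def)
    moreover have "l + of_int c *\<^sub>R f m = (\<Sum>i<Suc m. of_int ((d(m := c)) i) *\<^sub>R f i)" by (simp add: d)
    then have "l + of_int c *\<^sub>R f m \<in> zlat (Suc m) f" unfolding zlat_def by blast
    ultimately show ?case using l(2) m' by (metis less_Suc_eq)
  qed
  obtain l where l: "l \<in> zlat n f" "\<forall>i<n. 0 \<le> ip (x - l) (g i) \<and> ip (x - l) (g i) < ip (g i) (g i)"
    using ex[OF order_refl x] by blast
  \<comment> \<open>For uniqueness: a lattice vector joining two points of the box is 0, because its
    last coefficient is an integer of absolute value below 1, then so is the one before, and so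
    on.\<close>
  have zero: "l = 0" if "m \<le> n" "l \<in> zlat m f" "\<And>i. i < m \<Longrightarrow> \<bar>ip l (g i)\<bar> < ip (g i) (g i)" for m l
    using that
  proof (induction m arbitrary: l)
    case 0
    then show ?case by (auto simp: zlat_def)
  next
    case (Suc m)
    then have m: "m < n" by simp
    obtain d :: "nat \<Rightarrow> int" where d: "l = (\<Sum>i<Suc m. of_int (d i) *\<^sub>R f i)" using Suc.prems by (auto simp: zlat_def)
    have "ip (\<Sum>i<m. of_int (d i) *\<^sub>R f i) (g m) = 0"
      unfolding ip_sum ip_scale using fg[OF m] by (intro sum.neutral) auto
    then have "ip l (g m) = of_int (d m) * ip (g m) (g m)"
      using fg[OF m, of m] by (simp add: d ip_add ip_scale)
    then have "\<bar>of_int (d m)\<bar> * ip (g m) (g m) < 1 * ip (g m) (g m)"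
      using Suc.prems(3)[of m] g[OF m] by (simp add: abs_mult)
    then have "\<bar>real_of_int (d m)\<bar> < 1" using g[OF m] by (simp only: mult_less_cancel_right_pos)
    then have "d m = 0" by linarith
    then have "l \<in> zlat m f" using d by (auto simp: zlat_def)
    then show ?case using Suc.IH[of l] Suc.prems by auto
  qed
  show "\<exists>!y. y \<in> gbox g \<and> x - y \<in> zlat n f"
  proof (rule ex1I[of _ "x - l"])
    show "x - l \<in> gbox g \<and> x - (x - l) \<in> zlat n f"
      using l x zlat_in_V[OF f] by (auto simp: gbox_def)
    fix y assume y: "y \<in> gbox g \<and> x - y \<in> zlat n f"
    have "l - (x - y) = 0"
    proof (rule zero[OF order_refl])
      show "l - (x - y) \<in> zlat n f" using zlat_diff[of l n f "x - y"] l(1) y by blast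
      fix i assume i: "i < n"
      have "ip (l - (x - y)) (g i) = ip y (g i) - ip (x - l) (g i)" by (simp add: ip_diff)
      then show "\<bar>ip (l - (x - y)) (g i)\<bar> < ip (g i) (g i)" using y l(2) i unfolding gbox_def
        by (smt (verit) mem_Collect_eq)
    qed
    then show "y = x - l" by (simp add: algebra_simps)
  qed
qed

lemma region_gs: "basis_seq n f V \<Longrightarrow> fundamental_region V ip (zlat n f) (gbox (gs f))"
  using gs_pos ip_gs_upper by (intro box_region) auto

abbreviation vol :: "'a set \<Rightarrow> real" where "vol \<equiv> lattice_volume V ip"

lemma vol_region_ex:
  assumes "basis_seq n f V"
  obtains D where "fundamental_region V ip (zlat n f) D" "vol (zlat n f) = measure mu (coords D)"
proof -
  have "fundamental_region V ip (zlat n f) (SOME F. fundamental_region V ip (zlat n f) F)"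
    using region_gs[OF assms] by (rule someI)
  then show thesis
    using that by (simp add: lattice_volume_def eucl_volume_def coord_set_eq dimV)
qed

lemma vol_mono:
  assumes "basis_seq n f V" "basis_seq n f' V"
    and "\<And>r. r > 0 \<Longrightarrow> cnt (zlat n f') r \<le> cnt (zlat n f) r"
  shows "vol (zlat n f) \<le> vol (zlat n f')"
  using vol_region_ex[OF assms(1)] vol_region_ex[OF assms(2)] region_mono[OF assms(1) _ assms(2) _ assms(3)]
  by metis

text \<open>\<open>region_mono\<close> in both directions for the same lattice: the choice of a
  region in the definition of the volume does not matter.\<close>

lemma vol_eq_region:
  assumes f: "basis_seq n f V" and D: "fundamental_region V ip (zlat n f) D"
  shows "vol (zlat n f) = measure mu (coords D)"
proof -
  obtain D' where D': "fundamental_region V ip (zlat n f) D'" "vol (zlat n f) = measure mu (coords D')"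
    using vol_region_ex[OF f] .
  show ?thesis
    unfolding D'(2) by (intro antisym region_mono[OF f _ f] D D'(1) order_refl)
qed

lemma vol_pos: "basis_seq n f V \<Longrightarrow> vol (zlat n f) > 0"
  using region_gs vol_eq_region region_measure(2) by metis

lemma vol_subset:
  assumes "basis_seq n f V" "basis_seq n f' V" "zlat n f' \<subseteq> zlat n f"
  shows "vol (zlat n f) \<le> vol (zlat n f')"
  using assms finite_lattice_ball[OF assms(1)]
  by (intro vol_mono) (auto simp: cnt_def intro!: card_mono)

text \<open>The linear map sending \<open>f i\<close> to \<open>h i\<close> preserves lengths, as
  these are determined by the Gram matrix, and maps one lattice injectively into the other.\<close>

lemma gram_count_le:
  assumes f: "basis_seq n f V" and h: "basis_seq n h V"
    and gram: "\<And>i j. i < n \<Longrightarrow> j < n \<Longrightarrow> ip (f i) (f j) = ip (h i) (h j)"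
  shows "cnt (zlat n f) r \<le> cnt (zlat n h) r"
proof -
  obtain f' where d: "dual_pair f f'" using dual_pair_exists[OF f] .
  define \<phi> where "\<phi> x = (\<Sum>i<n. ip x (f' i) *\<^sub>R h i)" for x
  have \<phi>c: "\<phi> (\<Sum>i<n. c i *\<^sub>R f i) = (\<Sum>i<n. c i *\<^sub>R h i)" for c
    unfolding \<phi>_def using dual_pair_coeff[OF d, of _ c] by simp
  have iso: "ip (\<phi> x) (\<phi> x) = ip x x" if x: "x \<in> V" for x
  proof -
    obtain c where c: "x = (\<Sum>i<n. c i *\<^sub>R f i)" using basis_seq_expand[OF f x] .
    show ?thesis unfolding c \<phi>c ip_sum ip_sum_right ip_scale ip_scale_right
      using gram by (intro sum.cong) auto
  qed
  have "inj_on \<phi> V"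
  proof (rule inj_onI)
    fix x y assume x: "x \<in> V" and y: "y \<in> V" and eq: "\<phi> x = \<phi> y"
    obtain c where c: "x = (\<Sum>i<n. c i *\<^sub>R f i)" using basis_seq_expand[OF f x] .
    obtain e where e: "y = (\<Sum>i<n. e i *\<^sub>R f i)" using basis_seq_expand[OF f y] .
    have "c i = e i" if "i < n" for i
      using basis_seq_unique[OF h, of c e i] eq that unfolding c e \<phi>c by simp
    then show "x = y" unfolding c e by (intro sum.cong) auto
  qed
  moreover have "zlat n f \<inter> eucl_ball V ip r \<subseteq> V" using zlat_in_V[OF f] by auto
  ultimately have inj: "inj_on \<phi> (zlat n f \<inter> eucl_ball V ip r)" by (rule inj_on_subset)
  have "\<phi> ` (zlat n f \<inter> eucl_ball V ip r) \<subseteq> zlat n h \<inter> eucl_ball V ip r"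
  proof (intro image_subsetI)
    fix x assume x: "x \<in> zlat n f \<inter> eucl_ball V ip r"
    then obtain c :: "nat \<Rightarrow> int" where c: "x = (\<Sum>i<n. of_int (c i) *\<^sub>R f i)" by (auto simp: zlat_def)
    have "\<phi> x \<in> zlat n h" unfolding c \<phi>c zlat_def by blast
    moreover have "x \<in> V" using x by (auto simp: eucl_ball_def)
    ultimately show "\<phi> x \<in> zlat n h \<inter> eucl_ball V ip r"
      using iso x zlat_in_V[OF h] by (auto simp: eucl_ball_def eucl_norm_def)
  qed
  then show ?thesis unfolding cnt_def
    by (intro card_inj_on_le[OF inj]) (auto intro: finite_lattice_ball[OF h])
qed

lemma vol_gram_eq:
  assumes "basis_seq n f V" "basis_seq n h V"
    and "\<And>i j. i < n \<Longrightarrow> j < n \<Longrightarrow> ip (f i) (f j) = ip (h i) (h j)"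
  shows "vol (zlat n f) = vol (zlat n h)"
  using assms by (intro antisym vol_mono gram_count_le) auto

lemma vol_orthogonal:
  assumes "\<And>i. i < n \<Longrightarrow> a i > 0"
  shows "vol (zlat n (\<lambda>i. a i *\<^sub>R obs i)) = (\<Prod>i<n. a i)"
proof -
  interpret product_sigma_finite "\<lambda>_::nat. lborel :: real measure" by standard
  let ?g = "\<lambda>i. a i *\<^sub>R obs i"
  have g: "basis_seq n ?g V"
  proof (rule basis_seqI_independent[OF basis_seq_obs])
    show "\<And>i. i < n \<Longrightarrow> ?g i \<in> V" using obs_in_V by auto
    fix c i assume "(\<Sum>i<n. c i *\<^sub>R ?g i) = 0" "i < n"
    then show "c i = 0"
      using basis_seq_zero[OF basis_seq_obs, of "\<lambda>i. c i * a i" i] assms[of i] by simp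
  qed
  have gg: "ip (?g j) (?g i) = (if j = i then a i * a i else 0)" if "i < n" "j < n" for i j
    using that by (auto simp: ip_scale ip_scale_right ip_obs)
  have "fundamental_region V ip (zlat n ?g) (gbox ?g)"
    using gg assms by (intro box_region[OF g]) auto
  then have "vol (zlat n ?g) = measure mu (coords (gbox ?g))" by (rule vol_eq_region[OF g])
  also have "coords (gbox ?g) = PiE {..<n} (\<lambda>i. {0..<a i})"
  proof -
    have "0 \<le> ip (of_coords c) (?g i) \<and> ip (of_coords c) (?g i) < ip (?g i) (?g i) \<longleftrightarrow> 0 \<le> c i \<and> c i < a i" if "i < n" for c i
      using gg[OF that that] assms[OF that] ip_of_coords_obs[OF that, of c]
      by (simp add: ip_scale_right zero_le_mult_iff)
    note * = this
    have "c \<in> coords (gbox ?g) \<longleftrightarrow> c \<in> PiE {..<n} (\<lambda>i. {0..<a i})" for c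
    proof -
      have "c \<in> coords (gbox ?g) \<longleftrightarrow> c \<in> space mu \<and>
          (\<forall>i<n. 0 \<le> ip (of_coords c) (?g i) \<and> ip (of_coords c) (?g i) < ip (?g i) (?g i))"
        by (simp add: coords_def gbox_def of_coords_in_V)
      also have "\<dots> \<longleftrightarrow> c \<in> space mu \<and> (\<forall>i<n. 0 \<le> c i \<and> c i < a i)"
        using * by metis
      also have "\<dots> \<longleftrightarrow> c \<in> PiE {..<n} (\<lambda>i. {0..<a i})"
        by (auto simp: space_PiM PiE_iff)
      finally show ?thesis .
    qed
    then show ?thesis by blast
  qed
  also have "emeasure mu (PiE {..<n} (\<lambda>i. {0..<a i})) = ennreal (\<Prod>i<n. a i)"
  proof -
    have "emeasure mu (PiE {..<n} (\<lambda>i. {0..<a i})) = (\<Prod>i<n. ennreal (a i))"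
      using assms by (subst emeasure_PiM) (auto intro!: prod.cong simp: less_imp_le)
    also have "\<dots> = ennreal (\<Prod>i<n. a i)" using assms by (intro prod_ennreal) (auto simp: less_imp_le)
    finally show ?thesis .
  qed
  then have "measure mu (PiE {..<n} (\<lambda>i. {0..<a i})) = (\<Prod>i<n. a i)"
    unfolding Sigma_Algebra.measure_def using assms
    by (simp only:) (intro enn2real_ennreal prod_nonneg, auto simp: less_imp_le)
  finally show ?thesis .
qed

text \<open>The Gram--Schmidt box is a fundamental region of both the given lattice and the orthogonal one,
  and the latter is isometric to a lattice with a box along the chosen coordinate axes.\<close>

lemma vol_gs:
  assumes f: "basis_seq n f V"
  shows "vol (zlat n f) = (\<Prod>i<n. sqrt (ip (gs f i) (gs f i)))"
proof -
  note g = basis_seq_gs[OF f]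
  let ?a = "\<lambda>i. sqrt (ip (gs f i) (gs f i))"
  have a: "?a i > 0" if "i < n" for i using gs_pos[OF f that] by simp
  have "vol (zlat n f) = measure mu (coords (gbox (gs f)))"
    by (rule vol_eq_region[OF f region_gs[OF f]])
  also have "\<dots> = vol (zlat n (gs f))"
    using gs_pos[OF f] gs_orth'[OF f] by (intro vol_eq_region[symmetric] g box_region) auto
  also have "\<dots> = vol (zlat n (\<lambda>i. ?a i *\<^sub>R obs i))"
  proof (rule vol_gram_eq[OF g])
    show "basis_seq n (\<lambda>i. ?a i *\<^sub>R obs i) V"
    proof (rule basis_seqI_independent[OF basis_seq_obs])
      show "\<And>i. i < n \<Longrightarrow> ?a i *\<^sub>R obs i \<in> V" using obs_in_V by auto
      fix c i assume "(\<Sum>i<n. c i *\<^sub>R ?a i *\<^sub>R obs i) = 0" "i < n"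
      then show "c i = 0"
        using basis_seq_zero[OF basis_seq_obs, of "\<lambda>i. c i * ?a i" i] a[of i] by simp
    qed
    fix i j assume ij: "i < n" "j < n"
    then show "ip (gs f i) (gs f j) = ip (?a i *\<^sub>R obs i) (?a j *\<^sub>R obs j)"
      using gs_orth'[OF f ij] gs_pos[OF f, of i] by (auto simp: ip_scale ip_scale_right ip_obs less_imp_le)
  qed
  also have "\<dots> = (\<Prod>i<n. ?a i)" by (rule vol_orthogonal[OF a])
  finally show ?thesis .
qed

text \<open>Hadamard's inequality: a Gram--Schmidt vector is at most as long as the vector it comes
  from.\<close>

lemma vol_hadamard:
  assumes f: "basis_seq n f V"
  shows "vol (zlat n f) \<le> (\<Prod>i<n. sqrt (ip (f i) (f i)))"
  unfolding vol_gs[OF f] using gs_norm_le[OF f] gs_pos[OF f]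
  by (intro prod_mono) (auto simp: less_imp_le)

definition gram :: "(nat \<Rightarrow> 'a) \<Rightarrow> real mat"
  where "gram f = Matrix.mat n n (\<lambda>(i, j). ip (f i) (f j))"

text \<open>The Gram matrix factors as L D L^T, where L is the unitriangular matrix
  \<open>gsc f\<close> and D the diagonal matrix of squared Gram--Schmidt lengths, whose product is
  the squared volume.\<close>

lemma vol_gram:
  assumes f: "basis_seq n f V"
  shows "(vol (zlat n f))\<^sup>2 = Determinant.det (gram f)"
proof -
  let ?a = "\<lambda>k. ip (gs f k) (gs f k)"
  define A where "A = Matrix.mat n n (\<lambda>(i, k). gsc f i k * ?a k)"
  define B where "B = Matrix.mat n n (\<lambda>(i, k). gsc f i k)"
  have car: "A \<in> carrier_mat n n" "B \<in> carrier_mat n n" by (auto simp: A_def B_def)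
  have "gram f = A * transpose_mat B"
  proof (rule eq_matI)
    fix i j assume "i < dim_row (A * transpose_mat B)" "j < dim_col (A * transpose_mat B)"
    then have ij: "i < n" "j < n" by (auto simp: A_def B_def)
    have "ip (f i) (f j) = (\<Sum>k<n. \<Sum>l<n. gsc f i k * (gsc f j l * ip (gs f k) (gs f l)))"
      unfolding arg_cong2[OF gs_expand[OF ij(1), of f] gs_expand[OF ij(2), of f], of ip]
      by (simp only: ip_sum ip_scale) (simp only: ip_sum_right ip_scale_right sum_distrib_left)
    also have "\<dots> = (\<Sum>k<n. \<Sum>l<n. if l = k then gsc f i k * ?a k * gsc f j k else 0)"
      using gs_orth'[OF f] by (intro sum.cong refl) auto
    also have "\<dots> = (\<Sum>k<n. gsc f i k * ?a k * gsc f j k)" by simp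
    finally show "gram f $$ (i, j) = (A * transpose_mat B) $$ (i, j)"
      using ij by (simp add: gram_def A_def B_def scalar_prod_def atLeast0LessThan)
  qed (auto simp: gram_def A_def B_def)
  then have "Determinant.det (gram f) = Determinant.det A * Determinant.det (transpose_mat B)"
    using car det_mult[of A n "transpose_mat B"] by simp
  also have "Determinant.det A = (\<Prod>i<n. ?a i)"
    using det_lower_triangular[of n A] car
    by (subst det_lower_triangular[of n]) (auto simp: A_def gsc_def prod_list_diag_prod atLeast0LessThan)
  also have "Determinant.det (transpose_mat B) = Determinant.det B"
    using det_transpose[OF car(2)] .
  also have "Determinant.det B = 1"
    using car by (subst det_lower_triangular[of n]) (auto simp: B_def gsc_def prod_list_diag_prod)
  also have "(\<Prod>i<n. ?a i) = (vol (zlat n f))\<^sup>2"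
    unfolding vol_gs[OF f] prod_power_distrib
    using gs_pos[OF f] by (intro prod.cong) (auto simp: less_imp_le)
  finally show ?thesis by simp
qed

text \<open>The Gram matrices of dual bases are inverse to each other, since the numbers
  \<open>ip (f i) (f k)\<close> are the coefficients of \<open>f i\<close> in terms of
  \<open>f'\<close>.\<close>

lemma vol_dual:
  assumes d: "dual_pair f f'"
  shows "vol (zlat n f) * vol (zlat n f') = 1"
proof -
  have f: "basis_seq n f V" and f': "basis_seq n f' V" using d by (auto simp: dual_pair_def)
  have "gram f * gram f' = 1\<^sub>m n"
  proof (rule eq_matI)
    fix i j assume "i < dim_row (1\<^sub>m n :: real mat)" "j < dim_col (1\<^sub>m n :: real mat)"
    then have ij: "i < n" "j < n" by auto
    have "(\<Sum>k<n. ip (f i) (f k) * ip (f' k) (f' j)) = ip (\<Sum>k<n. ip (f i) (f k) *\<^sub>R f' k) (f' j)"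
      by (simp add: ip_sum ip_scale)
    also have "(\<Sum>k<n. ip (f i) (f k) *\<^sub>R f' k) = f i"
      using dual_pair_expand[OF dual_pair_sym[OF d] basis_seq_in[OF f ij(1)]] by simp
    also have "ip (f i) (f' j) = (if i = j then 1 else 0)" using d ij by (simp add: dual_pair_def)
    finally show "(gram f * gram f') $$ (i, j) = 1\<^sub>m n $$ (i, j)"
      using ij by (simp add: gram_def scalar_prod_def atLeast0LessThan)
  qed (auto simp: gram_def)
  then have "Determinant.det (gram f) * Determinant.det (gram f') = 1"
    using det_mult[of "gram f" n "gram f'"] by (simp add: gram_def)
  then have "(vol (zlat n f) * vol (zlat n f'))\<^sup>2 = 1\<^sup>2"
    unfolding power_mult_distrib vol_gram[OF f] vol_gram[OF f'] by simp
  then show ?thesis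
    using mult_pos_pos[OF vol_pos[OF f] vol_pos[OF f']] power2_eq_imp_eq[of "vol (zlat n f) * vol (zlat n f')" 1]
    by linarith
qed

text \<open>The translates of a fundamental region by the representatives in Y are disjoint and
  together form a fundamental region of the sublattice.\<close>

lemma vol_index:
  assumes f: "basis_seq n f V" and f': "basis_seq n f' V" and sub: "zlat n f' \<subseteq> zlat n f"
    and Y: "finite Y" "Y \<subseteq> zlat n f"
    and reps: "\<And>x. x \<in> zlat n f \<Longrightarrow> \<exists>!y. y \<in> Y \<and> x - y \<in> zlat n f'"
  shows "vol (zlat n f') = real (card Y) * vol (zlat n f)"
proof -
  define D where "D = gbox (gs f)"
  have D: "fundamental_region V ip (zlat n f) D" unfolding D_def by (rule region_gs[OF f])
  have DV: "D \<subseteq> V" and tile: "\<And>x. x \<in> V \<Longrightarrow> \<exists>!y. y \<in> D \<and> x - y \<in> zlat n f"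
    using D by (auto simp: fundamental_region_def)
  have YV: "Y \<subseteq> V" using Y zlat_in_V[OF f] by auto
  define T where "T y = {x. x + (- y) \<in> D}" for y
  have Tsets: "coords (T y) \<in> sets mu" and Tem: "emeasure mu (coords (T y)) = emeasure mu (coords D)" if "y \<in> Y" for y
    unfolding T_def using YV that
    by (auto intro!: coords_translate_sets emeasure_coords_translate region_sets[OF D] simp del: add_uminus_conv_diff)
  define D' where "D' = {x \<in> V. \<exists>y\<in>Y. x \<in> T y}"
  have csD': "coords D' = (\<Union>y\<in>Y. coords (T y))"
    by (auto simp: D'_def coords_def of_coords_in_V)
  have "fundamental_region V ip (zlat n f') D'"
    unfolding fundamental_region_def
  proof (intro conjI ballI)
    show "D' \<subseteq> V" by (auto simp: D'_def)
    show "coord_set V ip D' \<in> sets (lborel_n (dim V))"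
      unfolding coord_set_eq dimV csD' using Tsets Y by auto
    fix x assume x: "x \<in> V"
    obtain d where d: "d \<in> D" "x - d \<in> zlat n f" using tile[OF x] by blast
    obtain y where y: "y \<in> Y" "x - d - y \<in> zlat n f'" using reps[OF d(2)] by blast
    show "\<exists>!z. z \<in> D' \<and> x - z \<in> zlat n f'"
    proof (rule ex1I[of _ "d + y"])
      show "d + y \<in> D' \<and> x - (d + y) \<in> zlat n f'"
      proof
        have "d + y \<in> T y" "d + y \<in> V" using d y YV DV by (auto simp: T_def)
        then show "d + y \<in> D'" using y by (auto simp: D'_def)
        show "x - (d + y) \<in> zlat n f'" using y by (simp add: diff_diff_eq)
      qed
      fix z assume z: "z \<in> D' \<and> x - z \<in> zlat n f'"
      then obtain y' where y': "y' \<in> Y" "z - y' \<in> D" by (auto simp: D'_def T_def)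
      have "x - (z - y') = (x - z) + y'" by simp
      also have "\<dots> \<in> zlat n f" using z sub y' Y by (intro zlat_add) auto
      finally have "z - y' = d" using tile[OF x] d y' by blast
      then have "x - d - y' = x - z" by auto
      then have "y' = y" using reps[OF d(2)] y y' z by metis
      then show "z = d + y" using \<open>z - y' = d\<close> by auto
    qed
  qed
  then have "vol (zlat n f') = measure mu (coords D')" by (rule vol_eq_region[OF f'])
  moreover have "emeasure mu (coords D') = (\<Sum>y\<in>Y. emeasure mu (coords (T y)))"
    unfolding csD'
  proof (rule sum_emeasure[symmetric])
    show "(\<lambda>y. coords (T y)) ` Y \<subseteq> sets mu" using Tsets by auto
    show "disjoint_family_on (\<lambda>y. coords (T y)) Y"
      unfolding disjoint_family_on_def
    proof (intro ballI impI, rule ccontr)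
      fix y z assume yz: "y \<in> Y" "z \<in> Y" "y \<noteq> z" "coords (T y) \<inter> coords (T z) \<noteq> {}"
      then obtain c where "of_coords c - y \<in> D" "of_coords c - z \<in> D" by (auto simp: coords_def T_def)
      then obtain x where x: "x \<in> V" "x - y \<in> D" "x - z \<in> D" using of_coords_in_V by blast
      have "x - (x - y) \<in> zlat n f" "x - (x - z) \<in> zlat n f" using yz Y by auto
      then have "x - y = x - z" using tile[OF x(1)] x by blast
      then show False using yz by simp
    qed
    show "finite Y" by (rule Y(1))
  qed
  then have "emeasure mu (coords D') = of_nat (card Y) * emeasure mu (coords D)" using Tem by simp
  then have "measure mu (coords D') = real (card Y) * measure mu (coords D)"
    by (simp add: Sigma_Algebra.measure_def enn2real_mult)
  ultimately show ?thesis using vol_eq_region[OF f D] by simp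
qed

text \<open>The ball is estimated from below by an inscribed cube, which avoids the Gamma function.\<close>

lemma minkowski:
  assumes f: "basis_seq n f V" and n: "n > 0"
  obtains x where "x \<in> zlat n f" "x \<noteq> 0" "ip x x \<le> 4 * real n * vol (zlat n f) powr (2 / real n)"
proof -
  interpret product_sigma_finite "\<lambda>_::nat. lborel :: real measure" by standard
  obtain D where D: "fundamental_region V ip (zlat n f) D" "vol (zlat n f) = measure mu (coords D)"
    using vol_region_ex[OF f] .
  define v where "v = vol (zlat n f)"
  have vp: "v > 0" unfolding v_def by (rule vol_pos[OF f])
  \<comment> \<open>The cube of side 2h has volume 2^n v > v and lies in the ball of radius \<rho> =
    sqrt(n) h. Without a nonzero lattice vector of length at most 2\<rho>, a translate of the
    lattice would meet this ball at most once, and the ball would have volume at most v.\<close>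
  define h where "h = v powr (1 / real n)"
  have hp: "h > 0" using vp by (simp add: h_def)
  have hn: "h ^ n = v" using vp n by (simp add: h_def powr_realpow[symmetric] powr_powr)
  define \<rho> where "\<rho> = sqrt (real n) * h"
  have \<rho>p: "\<rho> > 0" using hp n by (simp add: \<rho>_def)
  have \<rho>2: "\<rho>\<^sup>2 = real n * h\<^sup>2" by (simp add: \<rho>_def power_mult_distrib)
  have "\<exists>x\<in>zlat n f. x \<noteq> 0 \<and> nrm x \<le> 2 * \<rho>"
  proof (rule ccontr)
    assume no: "\<not> ?thesis"
    have le1: "emeasure mu (coords (eucl_ball V ip \<rho>)) \<le> of_nat 1 * emeasure mu (coords D)"
    proof (rule region_upper[OF f D(1) emeasure_ball(2)[OF \<rho>p]])
      fix x assume x: "x \<in> V"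
      let ?A = "{l \<in> zlat n f. x + l \<in> eucl_ball V ip \<rho>}"
      have "l = l'" if "l \<in> ?A" "l' \<in> ?A" for l l'
      proof (rule ccontr)
        assume ne: "l \<noteq> l'"
        have "l - l' \<in> zlat n f" using that by (auto intro: zlat_diff)
        moreover have "l - l' = (x + l) - (x + l')" by simp
        then have "nrm (l - l') \<le> 2 * \<rho>"
          using nrm_triangle_diff[of "x + l" "x + l'"] that by (auto simp: eucl_ball_def)
        ultimately show False using no ne by auto
      qed
      then have "?A = {} \<or> (\<exists>l. ?A = {l})" by blast
      then show "finite ?A \<and> card ?A \<le> 1"
      proof
        assume "?A = {}"
        then show ?thesis by (simp only: finite.emptyI card.empty zero_le_one simp_thms)
      next
        assume "\<exists>l. ?A = {l}"
        then obtain l where "?A = {l}" by blast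
        then show ?thesis by (simp only:) simp
      qed
    qed
    have "PiE {..<n} (\<lambda>_. {-h..h}) \<subseteq> coords (eucl_ball V ip \<rho>)"
    proof
      fix c assume c: "c \<in> PiE {..<n} (\<lambda>_. {-h..h})"
      have "(\<Sum>i<n. (c i)\<^sup>2) \<le> (\<Sum>i<n. h\<^sup>2)"
      proof (intro sum_mono)
        fix i assume "i \<in> {..<n}"
        then have "- h \<le> c i" "c i \<le> h" using c by (auto simp: PiE_iff)
        then show "(c i)\<^sup>2 \<le> h\<^sup>2" by (intro abs_le_square_iff[THEN iffD1]) simp
      qed
      also have "\<dots> = \<rho>\<^sup>2" by (simp add: \<rho>2)
      finally have "sqrt (\<Sum>i<n. (c i)\<^sup>2) \<le> \<rho>" using \<rho>p by (simp add: real_le_lsqrt sum_nonneg)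
      then show "c \<in> coords (eucl_ball V ip \<rho>)"
        using c by (auto simp: coords_def eucl_ball_def eucl_norm_def ip_of_coords_self of_coords_in_V space_PiM PiE_iff)
    qed
    then have le2: "emeasure mu (PiE {..<n} (\<lambda>_. {-h..h})) \<le> emeasure mu (coords (eucl_ball V ip \<rho>))"
      by (rule emeasure_mono) (rule emeasure_ball(2)[OF \<rho>p])
    have eq3: "emeasure mu (PiE {..<n} (\<lambda>_. {-h..h})) = ennreal ((2 * h) ^ n)"
      using hp by (subst emeasure_PiM) (auto simp: ennreal_power)
    have "ennreal ((2 * h) ^ n) \<le> of_nat 1 * emeasure mu (coords D)"
      by (rule order_trans[OF le2[unfolded eq3] le1])
    then have "ennreal ((2 * h) ^ n) \<le> ennreal v"
      unfolding v_def D(2) using region_measure(1)[OF f D(1)] by simp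
    then have "2 ^ n * v \<le> v" using vp by (simp add: power_mult_distrib hn)
    moreover have "(2::real) ^ n > 1" using n by (intro one_less_power) auto
    ultimately show False using vp by simp
  qed
  then obtain x where x: "x \<in> zlat n f" "x \<noteq> 0" "nrm x \<le> 2 * \<rho>" by blast
  have "ip x x \<le> (2 * \<rho>)\<^sup>2" using x(3) unfolding eucl_norm_def by (rule sqrt_le_D)
  also have "\<dots> = 4 * real n * h\<^sup>2" by (simp add: power_mult_distrib \<rho>2)
  also have "h\<^sup>2 = v powr (2 / real n)"
    using vp by (simp add: h_def powr_powr powr_realpow[symmetric])
  finally show thesis using that x unfolding v_def by blast
qed

end

section \<open>Arithmetic of cyclotomic fields\<close>

definition ev :: "rat poly \<Rightarrow> complex \<Rightarrow> complex"
  where "ev p z = poly (map_poly of_rat p) z"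

lemma ev_add: "ev (p + q) z = ev p z + ev q z"
proof -
  have "map_poly of_rat (p + q) = (map_poly of_rat p + map_poly of_rat q :: complex poly)"
    by (rule poly_eqI) (simp add: coeff_map_poly of_rat_add)
  then show ?thesis by (simp add: ev_def)
qed

lemma ev_const [simp]: "ev [:c:] z = of_rat c"
  by (simp add: ev_def map_poly_pCons)

lemma ev_0 [simp]: "ev 0 z = 0"
  by (simp add: ev_def)

lemma ev_1 [simp]: "ev 1 z = 1"
  by (simp add: ev_def)

lemma ev_mult: "ev (p * q) z = ev p z * ev q z"
proof -
  have "map_poly of_rat (p * q) = (map_poly of_rat p * map_poly of_rat q :: complex poly)"
    by (rule poly_eqI) (simp add: coeff_map_poly coeff_mult of_rat_sum of_rat_mult)
  then show ?thesis by (simp add: ev_def)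
qed

lemma ev_uminus: "ev (- p) z = - ev p z"
  using ev_add[of p "- p" z] by (simp add: add_eq_0_iff)

lemma ev_diff: "ev (p - q) z = ev p z - ev q z"
  using ev_add[of p "- q" z] by (simp add: ev_uminus)

lemma ev_monom [simp]: "ev (Polynomial.monom c k) z = of_rat c * z ^ k"
  by (simp add: ev_def map_poly_monom poly_monom)

lemma ev_pCons: "ev (pCons a p) z = of_rat a + z * ev p z"
  by (simp add: ev_def map_poly_pCons)

lemma ev_pcompose: "ev (pcompose p q) z = ev p (ev q z)"
  by (induction p) (simp_all add: pcompose_pCons ev_add ev_mult ev_pCons)

lemma ev_sum: "ev (sum h A) z = (\<Sum>i\<in>A. ev (h i) z)"
  by (induction A rule: infinite_finite_induct) (simp_all add: ev_add)

lemma ev_altdef: "ev p z = (\<Sum>i\<le>degree p. of_rat (coeff p i) * z ^ i)"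
  by (simp add: ev_def poly_altdef coeff_map_poly degree_map_poly)

lemma finite_ev_roots:
  assumes "g \<noteq> 0"
  shows "finite {z. ev g z = 0}"
proof -
  have "coeff (map_poly of_rat g :: complex poly) (degree g) = of_rat (lead_coeff g)"
    by (simp add: coeff_map_poly)
  also have "\<dots> \<noteq> 0" using assms by simp
  finally have "(map_poly of_rat g :: complex poly) \<noteq> 0" by auto
  then show ?thesis by (auto simp: ev_def intro: poly_roots_finite)
qed

lemma minimal_poly_exists:
  assumes "q \<noteq> 0" "ev q z = 0"
  obtains f where "f \<noteq> 0" "lead_coeff f = 1" "ev f z = 0" "\<And>p. ev p z = 0 \<Longrightarrow> f dvd p"
proof -
  define P where "P d \<longleftrightarrow> (\<exists>f. f \<noteq> 0 \<and> ev f z = 0 \<and> degree f = d)" for d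
  have "P (degree q)" using assms by (auto simp: P_def)
  then have L: "P (LEAST d. P d)" by (rule LeastI)
  then obtain f where f: "f \<noteq> 0" "ev f z = 0" "degree f = (LEAST d. P d)" by (auto simp: P_def)
  have dv: "f dvd p" if "ev p z = 0" for p
  proof (rule ccontr)
    assume "\<not> f dvd p"
    then have r: "p mod f \<noteq> 0" by (simp add: mod_eq_0_iff_dvd)
    have "p = p div f * f + p mod f" by simp
    then have "ev p z = ev (p div f) z * ev f z + ev (p mod f) z" by (metis ev_add ev_mult)
    then have "ev (p mod f) z = 0" using that f by simp
    then have "P (degree (p mod f))" using r by (auto simp: P_def)
    then have "(LEAST d. P d) \<le> degree (p mod f)" by (rule Least_le)
    moreover have "degree (p mod f) < degree f" using r f(1) degree_mod_less[of f p] by auto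
    ultimately show False using f(3) by simp
  qed
  let ?c = "inverse (lead_coeff f)"
  have c: "?c \<noteq> 0" using f(1) by (metis leading_coeff_0_iff nonzero_imp_inverse_nonzero)
  have "Polynomial.smult ?c f \<noteq> 0" "lead_coeff (Polynomial.smult ?c f) = 1" using f(1) by auto
  moreover have "ev (Polynomial.smult ?c f) z = 0"
    using ev_mult[of "[:?c:]" f z] f(2) by simp
  moreover have "Polynomial.smult ?c f dvd p" if "ev p z = 0" for p
    using dv[OF that] c by (simp add: smult_dvd_iff)
  ultimately show thesis using that by blast
qed

text \<open>The closure of the integers under addition and multiplication is not proved here but taken from
  the ring axioms, which are part of \<^const>\<open>primeideal\<close>.\<close>

locale cyclo =
  fixes m :: nat
  assumes m_pos: "m \<ge> 1" and cring_int_ring: "cring (int_ring m)"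
begin

abbreviation "\<zeta> \<equiv> zeta m"
abbreviation "K \<equiv> cyclo_field m"
abbreviation "OK \<equiv> integers_of m"
abbreviation "n \<equiv> totient m"

lemma K_iff: "x \<in> K \<longleftrightarrow> (\<exists>p. x = ev p \<zeta>)"
  by (auto simp: cyclo_field_def ev_def)

lemma ev_in_K: "ev p \<zeta> \<in> K"
  by (auto simp: K_iff)

lemma K_add: "x \<in> K \<Longrightarrow> y \<in> K \<Longrightarrow> x + y \<in> K"
  by (auto simp: K_iff) (metis ev_add)

lemma K_mult: "x \<in> K \<Longrightarrow> y \<in> K \<Longrightarrow> x * y \<in> K"
  by (auto simp: K_iff) (metis ev_mult)

lemma K_uminus: "x \<in> K \<Longrightarrow> - x \<in> K"
  by (auto simp: K_iff) (metis ev_uminus)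

lemma K_diff: "x \<in> K \<Longrightarrow> y \<in> K \<Longrightarrow> x - y \<in> K"
  using K_add[of x "- y"] K_uminus by auto

lemma K_of_rat: "of_rat q \<in> K"
  by (rule of_rat_in_cyclo_field)

lemma K_of_int: "of_int k \<in> K"
  using K_of_rat[of "of_int k"] by simp

lemma K_of_nat: "of_nat k \<in> K"
  using K_of_rat[of "of_nat k"] by simp

lemma K_0: "0 \<in> K" and K_1: "1 \<in> K"
  using K_of_nat[of 0] K_of_nat[of 1] by auto

lemma K_power: "x \<in> K \<Longrightarrow> x ^ k \<in> K"
  by (induction k) (auto intro: K_mult K_1)

lemma K_sum: "(\<And>i. i \<in> A \<Longrightarrow> h i \<in> K) \<Longrightarrow> sum h A \<in> K"
  by (induction A rule: infinite_finite_induct) (auto intro: K_0 K_add)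

lemma K_zeta: "\<zeta> \<in> K"
  by (rule zeta_in_cyclo_field)

lemma zeta_pow_m: "\<zeta> ^ m = 1"
  using m_pos by (simp add: zeta_def Complex.DeMoivre)

lemma zeta_neq_0: "\<zeta> \<noteq> 0"
  by (simp add: zeta_def)

lemma norm_zeta: "cmod \<zeta> = 1"
  by (simp add: zeta_def)

lemma zeta_pow_mod: "\<zeta> ^ (k mod m) = \<zeta> ^ k"
proof -
  have "\<zeta> ^ k = \<zeta> ^ (m * (k div m) + k mod m)" by simp
  also have "\<dots> = \<zeta> ^ (k mod m)" by (simp only: power_add power_mult zeta_pow_m power_one mult_1)
  finally show ?thesis by simp
qed

lemma zeta_pow_cis: "\<zeta> ^ k = cis (2 * pi * real k / real m)"
  by (simp add: zeta_def Complex.DeMoivre mult_ac)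

lemma zeta_pow_eq_iff: "\<zeta> ^ k = \<zeta> ^ l \<longleftrightarrow> [k = l] (mod m)"
proof
  assume "\<zeta> ^ k = \<zeta> ^ l"
  then have "\<zeta> ^ (k mod m) = \<zeta> ^ (l mod m)" by (simp add: zeta_pow_mod)
  then have "k mod m = l mod m"
    using Complex.bij_betw_roots_unity[of m] m_pos
    unfolding bij_betw_def zeta_pow_cis by (auto dest: inj_onD)
  then show "[k = l] (mod m)" by (simp add: cong_def)
next
  assume "[k = l] (mod m)"
  then show "\<zeta> ^ k = \<zeta> ^ l" by (metis cong_def zeta_pow_mod)
qed

lemma root_of_unity:
  assumes "z ^ m = 1"
  obtains k where "k < m" "z = \<zeta> ^ k"
  using Complex.bij_betw_roots_unity[of m] m_pos assms that
  unfolding bij_betw_def zeta_pow_cis by (auto simp: set_eq_iff image_iff)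

subsection \<open>The ring of integers\<close>

lemma OK_iff: "x \<in> OK \<longleftrightarrow> x \<in> K \<and> algebraic_int x"
  by (simp add: int_ring_def)

lemma OK_K: "x \<in> OK \<Longrightarrow> x \<in> K"
  by (simp add: OK_iff)

lemma OK_add: "x \<in> OK \<Longrightarrow> y \<in> OK \<Longrightarrow> x + y \<in> OK"
  using ring.ring_simprules(1)[OF cring.axioms(1)[OF cring_int_ring], of x y] by (simp add: int_ring_def)

lemma OK_mult: "x \<in> OK \<Longrightarrow> y \<in> OK \<Longrightarrow> x * y \<in> OK"
  using ring.ring_simprules(5)[OF cring.axioms(1)[OF cring_int_ring], of x y] by (simp add: int_ring_def)

lemma OK_uminus: "x \<in> OK \<Longrightarrow> - x \<in> OK"
  by (auto simp: OK_iff intro: K_uminus)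

lemma OK_diff: "x \<in> OK \<Longrightarrow> y \<in> OK \<Longrightarrow> x - y \<in> OK"
  using OK_add[of x "- y"] OK_uminus by auto

lemma OK_of_int: "of_int k \<in> OK"
  by (auto simp: OK_iff K_of_int)

lemma OK_of_nat: "of_nat k \<in> OK"
  using OK_of_int[of "int k"] by simp

lemma OK_0: "0 \<in> OK" and OK_1: "1 \<in> OK"
  using OK_of_nat[of 0] OK_of_nat[of 1] by auto

lemma OK_power: "x \<in> OK \<Longrightarrow> x ^ k \<in> OK"
  by (induction k) (auto intro: OK_mult OK_1)

lemma OK_sum: "(\<And>i. i \<in> A \<Longrightarrow> h i \<in> OK) \<Longrightarrow> sum h A \<in> OK"
  by (induction A rule: infinite_finite_induct) (auto intro: OK_0 OK_add)

lemma OK_prod: "(\<And>i. i \<in> A \<Longrightarrow> h i \<in> OK) \<Longrightarrow> prod h A \<in> OK"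
  by (induction A rule: infinite_finite_induct) (auto intro: OK_1 OK_mult)

lemma OK_zeta: "\<zeta> \<in> OK"
proof -
  have "algebraic_int \<zeta>"
    by (rule algebraic_int_root[of 1 "Polynomial.monom 1 m"])
      (use m_pos in \<open>auto simp: poly_monom zeta_pow_m lead_coeff_monom degree_monom_eq\<close>)
  then show ?thesis by (simp add: OK_iff K_zeta)
qed

lemma OK_rational_int: "x \<in> OK \<Longrightarrow> x \<in> \<rat> \<Longrightarrow> x \<in> \<int>"
  by (simp add: OK_iff rational_algebraic_int_is_int)

lemma OK_cnj: "x \<in> OK \<Longrightarrow> cnj x \<in> OK"
  using mink_cnj_emb(1)[OF _ m_pos] by (auto simp: OK_iff)

definition pcong :: "nat \<Rightarrow> complex \<Rightarrow> complex \<Rightarrow> bool"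
  where "pcong p x y \<longleftrightarrow> (\<exists>w\<in>OK. x - y = of_nat p * w)"

lemma pcong_refl: "pcong p x x"
  unfolding pcong_def by (rule bexI[of _ 0]) (auto intro: OK_0)

lemma pcong_add: "pcong p x y \<Longrightarrow> pcong p u v \<Longrightarrow> pcong p (x + u) (y + v)"
proof -
  assume "pcong p x y" "pcong p u v"
  then obtain w w' where "w \<in> OK" "x - y = of_nat p * w" "w' \<in> OK" "u - v = of_nat p * w'"
    by (auto simp: pcong_def)
  then show ?thesis unfolding pcong_def
    by (intro bexI[of _ "w + w'"]) (auto simp: algebra_simps intro: OK_add)
qed

lemma pcong_sym: "pcong p x y \<Longrightarrow> pcong p y x"
proof -
  assume "pcong p x y"
  then obtain w where "w \<in> OK" "x - y = of_nat p * w" by (auto simp: pcong_def)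
  then show ?thesis unfolding pcong_def
    by (intro bexI[of _ "- w"]) (auto simp: algebra_simps intro: OK_uminus)
qed

lemma pcong_trans: "pcong p x y \<Longrightarrow> pcong p y z \<Longrightarrow> pcong p x z"
proof -
  assume "pcong p x y" "pcong p y z"
  then obtain w w' where w: "w \<in> OK" "x - y = of_nat p * w" "w' \<in> OK" "y - z = of_nat p * w'"
    by (auto simp: pcong_def)
  have "x - z = (x - y) + (y - z)" by simp
  also have "\<dots> = of_nat p * (w + w')" unfolding w by (simp add: algebra_simps)
  finally show ?thesis unfolding pcong_def using OK_add w by blast
qed

lemma pcong_mult:
  assumes "pcong p x y" "pcong p u v" "u \<in> OK" "y \<in> OK"
  shows "pcong p (x * u) (y * v)"
proof -
  obtain w w' where w: "w \<in> OK" "x - y = of_nat p * w" "w' \<in> OK" "u - v = of_nat p * w'"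
    using assms by (auto simp: pcong_def)
  have "x * u - y * v = (x - y) * u + y * (u - v)" by (simp add: algebra_simps)
  also have "\<dots> = of_nat p * (w * u + y * w')" unfolding w by (simp add: algebra_simps)
  finally show ?thesis unfolding pcong_def using OK_add OK_mult w assms by blast
qed

lemma pcong_power: "pcong p x y \<Longrightarrow> x \<in> OK \<Longrightarrow> y \<in> OK \<Longrightarrow> pcong p (x ^ k) (y ^ k)"
  by (induction k) (auto intro: pcong_refl pcong_mult OK_power)

lemma pcong_sum: "(\<And>i. i \<in> A \<Longrightarrow> pcong p (g i) (h i)) \<Longrightarrow> pcong p (sum g A) (sum h A)"
  by (induction A rule: infinite_finite_induct) (auto intro: pcong_refl pcong_add)

lemma frobenius_add:
  assumes p: "prime p" and xy: "x \<in> OK" "y \<in> OK"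
  shows "pcong p ((x + y) ^ p) (x ^ p + y ^ p)"
proof -
  have p2: "p \<ge> 2" using p by (rule prime_ge_2_nat)
  have "(x + y) ^ p = (\<Sum>k\<le>p. of_nat (p choose k) * x ^ k * y ^ (p - k))"
    by (rule binomial_ring)
  also have "{..p} = insert 0 (insert p {1..<p})" using p2 by auto
  also have "(\<Sum>k\<in>\<dots>. of_nat (p choose k) * x ^ k * y ^ (p - k)) =
      y ^ p + (x ^ p + (\<Sum>k\<in>{1..<p}. of_nat (p choose k) * x ^ k * y ^ (p - k)))"
    using p2 by simp
  also have "(\<Sum>k\<in>{1..<p}. of_nat (p choose k) * x ^ k * y ^ (p - k)) =
      (\<Sum>k\<in>{1..<p}. of_nat p * (of_nat ((p choose k) div p) * x ^ k * y ^ (p - k)))"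
  proof (rule sum.cong[OF refl])
    fix k assume "k \<in> {1..<p}"
    then have "p dvd (p choose k)" using p by (intro dvd_choose_prime) auto
    then have "of_nat (p choose k) = (of_nat p * of_nat ((p choose k) div p) :: complex)"
      by (metis dvd_mult_div_cancel of_nat_mult)
    then show "of_nat (p choose k) * x ^ k * y ^ (p - k) =
      of_nat p * (of_nat ((p choose k) div p) * x ^ k * y ^ (p - k))" by simp
  qed
  also have "\<dots> = of_nat p * (\<Sum>k\<in>{1..<p}. of_nat ((p choose k) div p) * x ^ k * y ^ (p - k))"
    by (simp add: sum_distrib_left)
  finally have "(x + y) ^ p - (x ^ p + y ^ p) =
      of_nat p * (\<Sum>k\<in>{1..<p}. of_nat ((p choose k) div p) * x ^ k * y ^ (p - k))"
    by simp
  moreover have "(\<Sum>k\<in>{1..<p}. of_nat ((p choose k) div p) * x ^ k * y ^ (p - k)) \<in> OK"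
    using xy by (intro OK_sum OK_mult OK_power OK_of_nat)
  ultimately show ?thesis unfolding pcong_def by blast
qed

lemma frobenius_sum:
  assumes p: "prime p" and "finite A" "\<And>i. i \<in> A \<Longrightarrow> h i \<in> OK"
  shows "pcong p ((\<Sum>i\<in>A. h i) ^ p) (\<Sum>i\<in>A. h i ^ p)"
  using assms(2,3)
proof (induction A rule: finite_induct)
  case empty
  then show ?case using prime_gt_0_nat[OF p] by (simp add: zero_power pcong_refl)
next
  case (insert a A)
  have "pcong p ((h a + sum h A) ^ p) (h a ^ p + sum h A ^ p)"
    using insert by (intro frobenius_add[OF p] OK_sum) auto
  moreover have "pcong p (h a ^ p + sum h A ^ p) (h a ^ p + (\<Sum>i\<in>A. h i ^ p))"
    using insert by (intro pcong_add pcong_refl) auto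
  ultimately have "pcong p ((h a + sum h A) ^ p) (h a ^ p + (\<Sum>i\<in>A. h i ^ p))" by (rule pcong_trans)
  then show ?case using insert(1,2) by simp
qed

text \<open>For natural numbers this is the Frobenius congruence for a sum of ones; a negative k is
  treated through the p-th power of k + |k| = 0.\<close>

lemma fermat_int:
  assumes p: "prime p"
  shows "pcong p (of_int k ^ p) (of_int k)"
proof -
  have nat: "pcong p (of_nat a ^ p) (of_nat a)" for a
    using frobenius_sum[OF p, of "{..<a}" "\<lambda>_. 1"] OK_1 by simp
  show ?thesis
  proof (cases k)
    case (nonneg a) then show ?thesis using nat by simp
  next
    case (neg a)
    have "pcong p ((of_int k + of_nat (Suc a)) ^ p) (of_int k ^ p + of_nat (Suc a) ^ p)"
      by (rule frobenius_add[OF p OK_of_int OK_of_nat])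
    moreover have "of_int k + of_nat (Suc a) = (0::complex)" by (simp add: neg)
    ultimately have "pcong p (0 ^ p) (of_int k ^ p + of_nat (Suc a) ^ p)" by (simp only:)
    then have "pcong p 0 (of_int k ^ p + of_nat (Suc a) ^ p)"
      using prime_gt_0_nat[OF p] by (simp add: zero_power)
    then have 1: "pcong p (of_int k ^ p + of_nat (Suc a) ^ p) 0" by (rule pcong_sym)
    have "pcong p (of_int k ^ p + of_nat (Suc a) ^ p) (of_int k ^ p + of_nat (Suc a))"
      by (rule pcong_add[OF pcong_refl nat])
    then have "pcong p (of_int k ^ p + of_nat (Suc a)) 0"
      using 1 pcong_sym pcong_trans by blast
    then have "pcong p (of_int k ^ p + of_nat (Suc a) + of_int k) (0 + of_int k)"
      by (rule pcong_add[OF _ pcong_refl])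
    moreover have "of_int k ^ p + of_nat (Suc a) + of_int k = (of_int k ^ p :: complex)"
      using \<open>of_int k + of_nat (Suc a) = (0::complex)\<close> by (simp add: add.assoc add.commute)
    ultimately show ?thesis by (simp only: add_0)
  qed
qed

subsection \<open>The cyclotomic polynomial\<close>

text \<open>Takes the place of Gauss's lemma: g splits into distinct linear factors at m-th roots of
  unity, so its coefficients are algebraic integers of K; being rational, they are integers.\<close>

lemma monic_dvd_coeff_int:
  assumes g: "g dvd Polynomial.monom 1 m - 1" "lead_coeff g = 1"
  shows "map_poly of_rat g = (\<Prod>z | ev g z = 0. [:- z, 1:])" "coeff g i \<in> \<int>"
proof -
  obtain h where h: "Polynomial.monom 1 m - 1 = g * h" using g(1) by blast
  have root: "z ^ m = 1" if "ev g z = 0" for z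
    using arg_cong[OF h, of "\<lambda>p. ev p z"] that by (simp add: ev_diff ev_mult)
  let ?G = "map_poly of_rat g :: complex poly"
  let ?H = "map_poly of_rat h :: complex poly"
  have "?G * ?H = Polynomial.monom 1 m - 1"
  proof (rule poly_eqI)
    fix k
    have "coeff (?G * ?H) k = of_rat (coeff (g * h) k)"
      by (simp add: coeff_map_poly coeff_mult of_rat_sum of_rat_mult)
    also have "\<dots> = coeff (Polynomial.monom 1 m - 1) k"
      by (simp add: h[symmetric] of_rat_diff)
    finally show "coeff (?G * ?H) k = coeff (Polynomial.monom 1 m - 1) k" .
  qed
  then have GH: "pderiv (?G * ?H) = Polynomial.monom (of_nat m) (m - 1)"
    by (simp add: pderiv_diff pderiv_monom)
  have "rsquarefree ?G"
    unfolding rsquarefree_roots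
  proof (intro allI notI)
    \<comment> \<open>A double root would be a zero of the derivative m X^(m-1), hence 0, which is
      no root of unity.\<close>
    fix a assume a: "poly ?G a = 0 \<and> poly (pderiv ?G) a = 0"
    then have "a ^ m = 1" using root by (simp add: ev_def)
    then have "a \<noteq> 0" using m_pos by (auto simp: zero_power)
    have "poly (pderiv (?G * ?H)) a = 0" using a by (simp add: pderiv_mult)
    then have "of_nat m * a ^ (m - 1) = 0" unfolding GH by (simp add: poly_monom)
    then show False using \<open>a \<noteq> 0\<close> m_pos by simp
  qed
  moreover have "lead_coeff ?G = 1" using g(2) by (simp add: coeff_map_poly degree_map_poly)
  ultimately show G: "?G = (\<Prod>z | ev g z = 0. [:- z, 1:])"
    using complex_poly_decompose_rsquarefree[of ?G] by (simp add: ev_def)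
  have "coeff (\<Prod>z\<in>A. [:- z, 1:]) i \<in> OK" if "finite A" "A \<subseteq> {z. z ^ m = 1}" for A i
    using that
  proof (induction A arbitrary: i rule: finite_induct)
    case empty
    then show ?case by (auto simp: coeff_1 intro: OK_0 OK_1)
  next
    case (insert a A)
    obtain k where "a = \<zeta> ^ k" using insert.prems root_of_unity[of a] by auto
    then have "a \<in> OK" by (auto intro: OK_power OK_zeta)
    moreover have "coeff (\<Prod>z\<in>A. [:- z, 1:]) j \<in> OK" for j using insert by auto
    ultimately show ?case
      using insert(1,2) by (auto simp: coeff_pCons mult_pCons_left split: nat.splits intro!: OK_diff OK_uminus OK_mult)
  qed
  moreover have "finite {z. ev g z = 0}"
    using g(2) by (intro finite_ev_roots) auto
  ultimately have "coeff ?G i \<in> OK" unfolding G using root by auto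
  then have "of_rat (coeff g i) \<in> (\<int> :: complex set)"
    using OK_rational_int by (auto simp: coeff_map_poly)
  then obtain k where "of_rat (coeff g i) = (of_int k :: complex)" by (auto elim: Ints_cases)
  then have "coeff g i = of_int k" by (metis of_rat_eq_iff of_rat_of_int_eq)
  then show "coeff g i \<in> \<int>" by simp
qed

lemma ev_int_OK:
  assumes "\<And>i. coeff g i \<in> \<int>" "z \<in> OK"
  shows "ev g z \<in> OK"
  unfolding ev_altdef
proof (intro OK_sum OK_mult OK_power assms(2))
  fix i
  obtain k where "coeff g i = of_int k" using assms(1)[of i] by (auto elim: Ints_cases)
  then show "of_rat (coeff g i) \<in> OK" by (simp add: OK_of_int)
qed

lemma ev_frobenius:
  assumes p: "prime p" and g: "\<And>i. coeff g i \<in> \<int>" and z: "z \<in> OK"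
  shows "pcong p (ev g z ^ p) (ev g (z ^ p))"
proof -
  have c: "pcong p (of_rat (coeff g i) ^ p) (of_rat (coeff g i))" "of_rat (coeff g i) \<in> OK" for i
  proof -
    obtain k where "coeff g i = of_int k" using g[of i] by (auto elim: Ints_cases)
    then show "pcong p (of_rat (coeff g i) ^ p) (of_rat (coeff g i))" "of_rat (coeff g i) \<in> OK"
      using fermat_int[OF p, of k] by (auto simp: OK_of_int)
  qed
  have "pcong p (ev g z ^ p) (\<Sum>i\<le>degree g. (of_rat (coeff g i) * z ^ i) ^ p)"
    unfolding ev_altdef using c z by (intro frobenius_sum[OF p]) (auto intro: OK_mult OK_power)
  moreover have "pcong p (\<Sum>i\<le>degree g. (of_rat (coeff g i) * z ^ i) ^ p) (ev g (z ^ p))"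
    unfolding ev_altdef
  proof (rule pcong_sum)
    fix i
    have "(of_rat (coeff g i) * z ^ i) ^ p = of_rat (coeff g i) ^ p * (z ^ p) ^ i"
      by (simp add: power_mult_distrib power_mult[symmetric] mult.commute)
    then show "pcong p ((of_rat (coeff g i) * z ^ i) ^ p) (of_rat (coeff g i) * (z ^ p) ^ i)"
      using c z by (auto intro!: pcong_mult pcong_refl OK_power)
  qed
  ultimately show ?thesis by (rule pcong_trans)
qed

lemma ev_unity_poly [simp]: "ev (Polynomial.monom 1 k - 1) z = z ^ k - 1"
  by (simp add: ev_diff)

text \<open>If \<open>f\<close> does not vanish at \<open>\<omega>\<^sup>p\<close>, then \<open>f(\<omega>\<^sup>p)\<close> divides the value \<open>m \<omega>\<^bsup>p(m-1)\<^esup>\<close> of the derivative of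
  \<open>X\<^sup>m - 1\<close>, whereas \<open>f(\<omega>\<^sup>p) \<equiv> f(\<omega>)\<^sup>p = 0\<close> modulo \<open>p\<close>.\<close>

lemma root_power_prime:
  assumes f: "f dvd Polynomial.monom 1 m - 1" "lead_coeff f = 1" "ev f z = 0" and p: "prime p" "\<not> p dvd m"
  shows "ev f (z ^ p) = 0"
proof (rule ccontr)
  assume nz: "ev f (z ^ p) \<noteq> 0"
  obtain h where h: "Polynomial.monom 1 m - 1 = f * h" using f(1) by blast
  have "z ^ m = 1"
    using arg_cong[OF h, of "\<lambda>p. ev p z"] f(3) by (simp add: ev_mult)
  then obtain k where "z = \<zeta> ^ k" using root_of_unity by blast
  then have zO: "z \<in> OK" by (auto intro: OK_power OK_zeta)
  let ?y = "z ^ p"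
  have ym: "?y ^ m = 1" using \<open>z ^ m = 1\<close> by (metis power_commutes power_mult power_one mult.commute)
  have "ev f ?y * ev h ?y = 0"
    using arg_cong[OF h, of "\<lambda>p. ev p ?y"] ym by (simp add: ev_mult)
  then have hy: "ev h ?y = 0" using nz by simp
  have "degree (Polynomial.monom 1 m + (- 1) :: rat poly) = degree (Polynomial.monom 1 m :: rat poly)"
    by (rule degree_add_eq_left) (use m_pos in \<open>simp add: degree_monom_eq\<close>)
  then have "degree (Polynomial.monom 1 m - 1 :: rat poly) = m" by (simp add: degree_monom_eq)
  then have "lead_coeff (f * h) = 1" unfolding h[symmetric] using m_pos by (simp add: coeff_1)
  then have "lead_coeff h = 1" using f(2) by (simp add: lead_coeff_mult)
  then have hi: "coeff h i \<in> \<int>" for i using h by (intro monic_dvd_coeff_int) auto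
  have fi: "coeff f i \<in> \<int>" for i using f by (intro monic_dvd_coeff_int) auto
  have "coeff (pderiv h) i \<in> \<int>" for i
    using hi[of "Suc i"] by (simp add: coeff_pderiv)
  then have h'O: "ev (pderiv h) ?y \<in> OK" using zO by (intro ev_int_OK OK_power)
  have "pderiv (Polynomial.monom 1 m - 1 :: rat poly) = f * pderiv h + h * pderiv f"
    unfolding h by (rule pderiv_mult)
  then have "ev (pderiv (Polynomial.monom 1 m - 1)) ?y = ev f ?y * ev (pderiv h) ?y"
    by (simp only: ev_add ev_mult hy mult_zero_left add_0_right)
  moreover have "pderiv (Polynomial.monom 1 m - 1 :: rat poly) = Polynomial.monom (of_nat m) (m - 1)"
    by (simp add: pderiv_diff pderiv_monom)
  ultimately have "ev (Polynomial.monom (of_nat m) (m - 1)) ?y = ev f ?y * ev (pderiv h) ?y"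
    by (simp only:)
  then have "of_nat m * ?y ^ (m - 1) = ev f ?y * ev (pderiv h) ?y" by simp
  then have "of_nat m * (?y ^ (m - 1) * ?y) = ev f ?y * ev (pderiv h) ?y * ?y" by simp
  moreover have "?y ^ (m - 1) * ?y = 1" using ym m_pos power_minus_mult[of m ?y] by simp
  ultimately have m_eq: "of_nat m = ev f ?y * ev (pderiv h) ?y * ?y" by (simp only: mult_1_right)
  have "pcong p (ev f z ^ p) (ev f ?y)" by (rule ev_frobenius[OF p(1) fi zO])
  then have "pcong p (ev f ?y) 0"
    using f(3) prime_gt_0_nat[OF p(1)] pcong_sym by (simp add: zero_power)
  then obtain w where w: "w \<in> OK" "ev f ?y = of_nat p * w" by (auto simp: pcong_def)
  let ?v = "w * ev (pderiv h) ?y * ?y"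
  have v: "?v \<in> OK" using w h'O zO by (intro OK_mult OK_power)
  have mv: "of_nat m = of_nat p * ?v" unfolding m_eq w(2) by simp
  have p0: "p > 0" using p(1) by (rule prime_gt_0_nat)
  \<comment> \<open>Now m/p is an algebraic integer; being rational it is an integer, against the
    hypothesis on p.\<close>
  have "?v = of_nat m / of_nat p" using mv p0 by (simp add: field_simps)
  then have "?v \<in> \<rat>" by simp
  then have "?v \<in> \<int>" using OK_rational_int v by blast
  then obtain k where k: "?v = of_int k" by (auto elim: Ints_cases)
  have "(of_int (int m) :: complex) = of_int (int p * k)" using mv k by simp
  then have "int m = int p * k" by (simp only: of_int_eq_iff)
  then have "int p dvd int m" by simp
  then show False using p(2) by simp
qed

lemma zeta_pow_inj: "inj_on (\<lambda>k. \<zeta> ^ k) (totatives m)"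
proof (rule inj_onI)
  fix k l assume kl: "k \<in> totatives m" "l \<in> totatives m" "\<zeta> ^ k = \<zeta> ^ l"
  then have c: "[k = l] (mod m)" by (simp only: zeta_pow_eq_iff)
  show "k = l"
  proof (cases "m = 1")
    case True
    then show ?thesis using kl by (auto simp: in_totatives_iff)
  next
    case False
    then have "k < m" "l < m" using kl m_pos
    proof -
      have "k \<noteq> m" "l \<noteq> m" using kl False by (auto simp: in_totatives_iff)
      then show "k < m" "l < m" using kl by (simp_all add: in_totatives_iff)
    qed
    then show ?thesis using c by (simp add: cong_def)
  qed
qed

text \<open>f is the minimal polynomial of \<zeta>. Applying \<open>root_power_prime\<close> along
  the prime factors of k shows that each \<open>\<zeta> ^ k\<close> with k coprime to m is a root;
  conversely, a root of f cannot be killed by a smaller exponent than \<zeta>.\<close>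

lemma cyclo_poly_exists:
  obtains f where "f \<noteq> 0" "lead_coeff f = 1" "\<And>p. ev p \<zeta> = 0 \<longleftrightarrow> f dvd p"
    "\<And>z. ev f z = 0 \<longleftrightarrow> z \<in> (\<lambda>k. \<zeta> ^ k) ` totatives m" "degree f = n"
proof -
  have X: "Polynomial.monom 1 m - 1 \<noteq> (0 :: rat poly)"
  proof
    assume "Polynomial.monom 1 m - 1 = (0 :: rat poly)"
    then have "coeff (Polynomial.monom 1 m - 1 :: rat poly) m = 0" by simp
    then show False using m_pos by (simp add: coeff_1)
  qed
  have z: "ev (Polynomial.monom 1 m - 1) \<zeta> = 0" by (simp add: zeta_pow_m)
  obtain f where f: "f \<noteq> 0" "lead_coeff f = 1" "ev f \<zeta> = 0" "\<And>p. ev p \<zeta> = 0 \<Longrightarrow> f dvd p"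
    using minimal_poly_exists[OF X z] by blast
  have iff: "ev p \<zeta> = 0 \<longleftrightarrow> f dvd p" for p
    using f(3,4) by (auto simp: ev_mult elim!: dvdE)
  have fX: "f dvd Polynomial.monom 1 m - 1" using iff z by blast
  have pow: "ev f (\<zeta> ^ k) = 0" if "coprime k m" "k > 0" for k
    using that
  proof (induction k rule: prime_divisors_induct)
    case (unit x)
    then show ?case using f(3) by simp
  next
    case (factor p k)
    then have "ev f (\<zeta> ^ k) = 0" by auto
    moreover have "\<not> p dvd m" using factor by (metis coprime_mult_left_iff coprime_absorb_left not_prime_unit)
    ultimately have "ev f ((\<zeta> ^ k) ^ p) = 0" using root_power_prime[OF fX f(2)] factor by blast
    then show ?case by (simp add: power_mult[symmetric] mult.commute)
  qed simp
  have roots: "ev f z = 0 \<longleftrightarrow> z \<in> (\<lambda>k. \<zeta> ^ k) ` totatives m" for z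
  proof
    assume "z \<in> (\<lambda>k. \<zeta> ^ k) ` totatives m"
    then show "ev f z = 0" using pow by (auto simp: in_totatives_iff)
  next
    assume z0: "ev f z = 0"
    then have "z ^ m = 1" using fX by (auto simp: ev_mult elim!: dvdE dest: arg_cong[of _ _ "\<lambda>p. ev p z"])
    then obtain k where k: "k < m" "z = \<zeta> ^ k" using root_of_unity by blast
    obtain g where g: "g \<noteq> 0" "lead_coeff g = 1" "ev g z = 0" "\<And>p. ev p z = 0 \<Longrightarrow> g dvd p"
      using minimal_poly_exists[OF f(1) z0] by blast
    obtain h where h: "f = g * h" using g(4)[OF z0] by blast
    have "degree g > 0"
    proof (rule ccontr)
      assume "\<not> degree g > 0"
      then have "g = [:1:]" using g(2) by (metis degree_eq_zeroE lead_coeff_pCons(2) neq0_conv pCons_0_0 one_neq_zero degree_pCons_0 coeff_pCons_0)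
      then show False using g(3) by simp
    qed
    have "h \<noteq> 0" using h f(1) by auto
    \<comment> \<open>The cofactor h has smaller degree than f and cannot vanish at \<zeta>, so g
      does. Every relation z^j = 1 then carries over to \<zeta>, which forces gcd(k, m) = 1.\<close>
    have "ev h \<zeta> \<noteq> 0"
    proof
      assume "ev h \<zeta> = 0"
      then have "degree f \<le> degree h" using f(4) \<open>h \<noteq> 0\<close> by (metis dvd_imp_degree_le)
      then show False using h \<open>degree g > 0\<close> \<open>h \<noteq> 0\<close> g(1) by (simp add: degree_mult_eq)
    qed
    then have gz: "ev g \<zeta> = 0" using f(3) h by (simp add: ev_mult)
    let ?d = "gcd k m"
    have d: "?d > 0" "?d dvd m" "?d dvd k" using m_pos by auto
    define m' where "m' = m div ?d"
    have "k * m' = m * (k div ?d)" using d unfolding m'_def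
      by (metis dvd_div_mult dvd_mult_div_cancel mult.commute mult.left_commute div_mult_swap)
    then have "z ^ m' = 1" unfolding k(2) by (metis power_mult zeta_pow_m power_one)
    then have "g dvd Polynomial.monom 1 m' - 1" using g(4) by simp
    then obtain u where u: "Polynomial.monom 1 m' - 1 = g * u" by blast
    have "ev (Polynomial.monom 1 m' - 1) \<zeta> = 0" unfolding u ev_mult gz by simp
    then have "\<zeta> ^ m' = \<zeta> ^ 0" by simp
    then have "[m' = 0] (mod m)" by (simp only: zeta_pow_eq_iff)
    then have "m dvd m'" by (simp add: cong_0_iff)
    moreover have "m' > 0" using d m_pos unfolding m'_def by (simp add: div_greater_zero_iff gcd_le2_nat)
    ultimately have "m \<le> m'" by (simp add: dvd_imp_le)
    moreover have "m = m' * ?d" using d unfolding m'_def by simp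
    ultimately have "?d = 1" using \<open>m' > 0\<close> d(1) by (metis One_nat_def Suc_leI le_antisym mult.right_neutral mult_le_cancel1)
    then have cop: "coprime k m" by (simp add: coprime_iff_gcd_eq_1)
    show "z \<in> (\<lambda>k. \<zeta> ^ k) ` totatives m"
    proof (cases "k = 0")
      case True
      then have "m = 1" using cop by simp
      then show ?thesis using k True zeta_pow_m by (auto simp: in_totatives_iff)
    next
      case False
      then show ?thesis using k cop by (auto simp: in_totatives_iff)
    qed
  qed
  have "{z. ev f z = 0} = (\<lambda>k. \<zeta> ^ k) ` totatives m" using roots by auto
  then have "card {z. ev f z = 0} = n" using zeta_pow_inj by (simp add: card_image totient_def)
  moreover have "degree (\<Prod>z\<in>A. [:- z, 1::complex:]) = card A" if "finite A" for A
    using that by (subst degree_prod_eq_sum_degree) auto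
  moreover have "finite {z. ev f z = 0}" by (rule finite_ev_roots[OF f(1)])
  moreover have "degree (map_poly of_rat f :: complex poly) = degree f" by (simp add: degree_map_poly)
  ultimately have "degree f = n" using monic_dvd_coeff_int(1)[OF fX f(2)] by simp
  then show thesis using that f(1,2) iff roots by blast
qed

end

context cyclo
begin

subsection \<open>Embeddings\<close>

text \<open>The primitive \<open>m\<close>-th roots of unity.\<close>

definition "Rt = (\<lambda>k. \<zeta> ^ k) ` totatives m"

lemma Rt_poly:
  obtains f where "f \<noteq> 0" "lead_coeff f = 1" "\<And>p. ev p \<zeta> = 0 \<longleftrightarrow> f dvd p"
    "\<And>z. ev f z = 0 \<longleftrightarrow> z \<in> Rt" "degree f = n" "\<And>i. coeff f i \<in> \<int>"
proof -
  obtain f where f: "f \<noteq> 0" "lead_coeff f = 1" "\<And>p. ev p \<zeta> = 0 \<longleftrightarrow> f dvd p"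
    "\<And>z. ev f z = 0 \<longleftrightarrow> z \<in> (\<lambda>k. \<zeta> ^ k) ` totatives m" "degree f = n"
    using cyclo_poly_exists by metis
  have "f dvd Polynomial.monom 1 m - 1" using f(3) by (simp flip: f(3) add: zeta_pow_m)
  then have "coeff f i \<in> \<int>" for i by (rule monic_dvd_coeff_int(2)) (rule f(2))
  then show thesis using that[of f] f unfolding Rt_def by blast
qed

text \<open>Write z = \<zeta>^k and let x be inverse to k modulo m. If p vanishes at z, then p(X^k)
  vanishes at \<zeta>, hence at its conjugate \<zeta>^x, and there its value is p(\<zeta>).\<close>

lemma Rt_zero_iff:
  assumes "z \<in> Rt" shows "ev p z = 0 \<longleftrightarrow> ev p \<zeta> = 0"
proof -
  have imp: "ev q w = 0" if "w \<in> Rt" "ev q \<zeta> = 0" for q w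
  proof -
    obtain f where f: "\<And>p. ev p \<zeta> = 0 \<longleftrightarrow> f dvd p" "\<And>z. ev f z = 0 \<longleftrightarrow> z \<in> Rt"
      using Rt_poly by metis
    then obtain h where "q = f * h" using \<open>ev q \<zeta> = 0\<close> by blast
    then show ?thesis using f(2) \<open>w \<in> Rt\<close> by (simp add: ev_mult)
  qed
  obtain k where k: "k \<in> totatives m" "z = \<zeta> ^ k" using assms by (auto simp: Rt_def)
  have "coprime k m" using k by (simp add: in_totatives_iff)
  then obtain x where x: "[k * x = Suc 0] (mod m)" using cong_solve_coprime_nat by blast
  have kx: "\<zeta> ^ (k * x) = \<zeta>" using x zeta_pow_eq_iff[of "k * x" 1] by simp
  have "coprime (k * x) m" using cong_imp_coprime[OF cong_sym[OF x]] by simp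
  then have "coprime x m" by simp
  \<comment> \<open>The residue of x modulo m serves as y unless m = 1, where it would be 0 while
    the only totative is 1.\<close>
  then have "\<exists>y\<in>totatives m. \<zeta> ^ y = \<zeta> ^ x"
  proof (cases "m = 1")
    case True
    then have "[1 = x] (mod m)" by simp
    then have "\<zeta> ^ 1 = \<zeta> ^ x" by (rule zeta_pow_eq_iff[THEN iffD2])
    then show ?thesis using True by (intro bexI[of _ 1]) (auto simp: in_totatives_iff)
  next
    case False
    have "coprime (x mod m) m"
      using \<open>coprime x m\<close> m_pos by (subst coprime_mod_left_iff) auto
    moreover from this have "x mod m \<noteq> 0" using False by (metis coprime_0_left_iff is_unit_gcd nat_dvd_1_iff_1)
    moreover have "x mod m \<le> m" using m_pos by (intro less_imp_le mod_less_divisor) simp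
    ultimately show ?thesis by (intro bexI[of _ "x mod m"]) (auto simp: zeta_pow_mod in_totatives_iff)
  qed
  then have xR: "\<zeta> ^ x \<in> Rt" unfolding Rt_def by (metis image_eqI)
  show ?thesis
  proof
    assume "ev p z = 0"
    then have "ev (pcompose p (Polynomial.monom 1 k)) \<zeta> = 0" by (simp add: ev_pcompose k(2))
    then have "ev (pcompose p (Polynomial.monom 1 k)) (\<zeta> ^ x) = 0" using imp xR by blast
    then have "ev p (\<zeta> ^ (x * k)) = 0" by (simp add: ev_pcompose power_mult)
    then show "ev p \<zeta> = 0" using kx by (simp add: mult.commute)
  qed (use imp assms in blast)
qed

lemma finite_Rt: "finite Rt" and card_Rt: "card Rt = n"
proof -
  show "finite Rt" by (simp add: Rt_def)
  show "card Rt = n" by (simp add: Rt_def card_image[OF zeta_pow_inj] totient_def)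
qed

lemma n_pos: "n > 0"
  using m_pos by simp

lemma Rt_pow_m: "z \<in> Rt \<Longrightarrow> z ^ m = 1"
  unfolding Rt_def using zeta_pow_m by (auto simp: power_mult[symmetric] mult.commute) (metis power_mult power_one mult.commute)

lemma Rt_norm: "z \<in> Rt \<Longrightarrow> cmod z = 1"
  by (auto simp: Rt_def norm_power norm_zeta)

lemma Rt_K: "z \<in> Rt \<Longrightarrow> z \<in> K"
  by (auto simp: Rt_def intro: K_power K_zeta)

lemma zeta_in_Rt: "\<zeta> \<in> Rt"
  using Rt_poly dvd_refl by metis

text \<open>The embedding sending \<zeta> to z. By \<open>Rt_zero_iff\<close> the choice of the
  polynomial is immaterial; the restriction is there because members of \<open>embeddings\<close>
  are extensional.\<close>

definition tau :: "complex \<Rightarrow> complex \<Rightarrow> complex"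
  where "tau z = restrict (\<lambda>x. ev (SOME p. x = ev p \<zeta>) z) K"

lemma tau_ev:
  assumes "z \<in> Rt" shows "tau z (ev p \<zeta>) = ev p z"
proof -
  let ?q = "SOME q. ev p \<zeta> = ev q \<zeta>"
  have "ev p \<zeta> = ev ?q \<zeta>" by (rule someI[of _ p]) simp
  then have "ev (?q - p) \<zeta> = 0" by (simp add: ev_diff)
  then have "ev (?q - p) z = 0" using Rt_zero_iff[OF assms] by blast
  then show ?thesis by (simp add: tau_def ev_in_K ev_diff)
qed

lemma tau_zeta: "z \<in> Rt \<Longrightarrow> tau z \<zeta> = z"
  using tau_ev[of z "Polynomial.monom 1 1"] by simp

lemma tau_in_embeddings:
  assumes "z \<in> Rt" shows "tau z \<in> embeddings m"
  unfolding embeddings_def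
proof (intro CollectI conjI ballI)
  show "tau z \<in> extensional K" by (simp add: tau_def)
  show "tau z 1 = 1" using tau_ev[OF assms, of 1] by simp
  fix x y assume "x \<in> K" "y \<in> K"
  then obtain p q where "x = ev p \<zeta>" "y = ev q \<zeta>" by (auto simp: K_iff)
  then show "tau z (x + y) = tau z x + tau z y" "tau z (x * y) = tau z x * tau z y"
    using tau_ev[OF assms, of "p + q"] tau_ev[OF assms, of "p * q"] tau_ev[OF assms, of p] tau_ev[OF assms, of q]
    by (simp_all add: ev_add ev_mult)
qed

lemma emb_add: "s \<in> embeddings m \<Longrightarrow> x \<in> K \<Longrightarrow> y \<in> K \<Longrightarrow> s (x + y) = s x + s y"
  and emb_mult: "s \<in> embeddings m \<Longrightarrow> x \<in> K \<Longrightarrow> y \<in> K \<Longrightarrow> s (x * y) = s x * s y"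
  and emb_1: "s \<in> embeddings m \<Longrightarrow> s 1 = 1"
  by (auto simp: embeddings_def)

lemma emb_0: "s \<in> embeddings m \<Longrightarrow> s 0 = 0"
  using emb_add[of s 0 0] K_0 by simp

lemma embedding_ev: "s \<in> embeddings m \<Longrightarrow> s (ev p \<zeta>) = ev p (s \<zeta>)"
  unfolding ev_def by (rule embedding_poly)

lemma embedding_zeta: "s \<in> embeddings m \<Longrightarrow> s \<zeta> \<in> Rt"
proof -
  assume s: "s \<in> embeddings m"
  obtain f where f: "\<And>p. ev p \<zeta> = 0 \<longleftrightarrow> f dvd p" "\<And>z. ev f z = 0 \<longleftrightarrow> z \<in> Rt"
    using Rt_poly by metis
  have "ev f (s \<zeta>) = s (ev f \<zeta>)" using embedding_ev[OF s] by simp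
  also have "ev f \<zeta> = 0" using f(1) by simp
  finally show ?thesis using f(2) emb_0[OF s] by simp
qed

lemma embeddings_eq: "embeddings m = tau ` Rt"
proof (intro equalityI subsetI)
  fix s assume s: "s \<in> embeddings m"
  have "s = tau (s \<zeta>)"
  proof (rule extensionalityI[of _ K])
    show "s \<in> extensional K" using s by (simp add: embeddings_def)
    show "tau (s \<zeta>) \<in> extensional K" by (simp add: tau_def)
    fix x assume "x \<in> K"
    then obtain p where "x = ev p \<zeta>" by (auto simp: K_iff)
    then show "s x = tau (s \<zeta>) x" using embedding_ev[OF s] tau_ev[OF embedding_zeta[OF s]] by simp
  qed
  then show "s \<in> tau ` Rt" using embedding_zeta[OF s] by blast
qed (auto intro: tau_in_embeddings)

lemma inj_tau: "inj_on tau Rt"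
  by (rule inj_onI) (metis tau_zeta)

lemma finite_embeddings: "finite (embeddings m)" and card_embeddings: "card (embeddings m) = n"
  using finite_Rt inj_tau card_Rt by (auto simp: embeddings_eq card_image)

lemma emb_nonzero:
  assumes s: "s \<in> embeddings m" and x: "x \<in> K" "x \<noteq> 0"
  shows "s x \<noteq> 0"
proof -
  obtain p where p: "x = ev p \<zeta>" using x by (auto simp: K_iff)
  then show ?thesis using embedding_ev[OF s] Rt_zero_iff[OF embedding_zeta[OF s]] x by simp
qed

lemma emb_of_rat: "s \<in> embeddings m \<Longrightarrow> s (of_rat q) = of_rat q"
  using embedding_ev[of s "[:q:]"] by simp

lemma emb_of_int: "s \<in> embeddings m \<Longrightarrow> s (of_int k) = of_int k"
  using emb_of_rat[of s "of_int k"] by simp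

lemma emb_power: "s \<in> embeddings m \<Longrightarrow> x \<in> K \<Longrightarrow> s (x ^ k) = s x ^ k"
  by (induction k) (auto simp: emb_1 emb_mult K_power)

lemma emb_sum: "s \<in> embeddings m \<Longrightarrow> (\<And>i. i \<in> A \<Longrightarrow> h i \<in> K) \<Longrightarrow> s (sum h A) = (\<Sum>i\<in>A. s (h i))"
  by (induction A rule: infinite_finite_induct) (auto simp: emb_0 emb_add K_sum)

lemma emb_in_K: "s \<in> embeddings m \<Longrightarrow> x \<in> K \<Longrightarrow> s x \<in> K"
proof -
  assume s: "s \<in> embeddings m" and "x \<in> K"
  then obtain p where p: "x = ev p \<zeta>" by (auto simp: K_iff)
  obtain q where q: "s \<zeta> = ev q \<zeta>" using Rt_K[OF embedding_zeta[OF s]] by (auto simp: K_iff)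
  show ?thesis using embedding_ev[OF s, of p] unfolding p q ev_pcompose[symmetric] by (simp add: ev_in_K)
qed

lemma emb_in_OK:
  assumes s: "s \<in> embeddings m" and x: "x \<in> OK"
  shows "s x \<in> OK"
proof -
  obtain g where g: "lead_coeff g = 1" "\<forall>i. coeff g i \<in> \<int>" "poly g x = 0"
    using x by (auto simp: OK_iff elim: algebraic_int.cases)
  have "s (\<Sum>i\<le>degree g. coeff g i * x ^ i) = (\<Sum>i\<le>degree g. coeff g i * s x ^ i)"
  proof (subst emb_sum[OF s])
    have c: "coeff g i \<in> K" "s (coeff g i) = coeff g i" for i
      using g(2)[rule_format, of i] by (auto elim!: Ints_cases simp: K_of_int emb_of_int[OF s])
    show "\<And>i. coeff g i * x ^ i \<in> K" using c OK_K[OF x] by (auto intro: K_mult K_power)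
    show "(\<Sum>i\<le>degree g. s (coeff g i * x ^ i)) = (\<Sum>i\<le>degree g. coeff g i * s x ^ i)"
      using c OK_K[OF x] by (auto simp: emb_mult[OF s] emb_power[OF s] K_power)
  qed
  then have "poly g (s x) = 0" using g(3) emb_0[OF s] by (simp add: poly_altdef)
  then have "algebraic_int (s x)" using g by (intro algebraic_int.intros) auto
  then show ?thesis using emb_in_K[OF s] x by (simp add: OK_iff)
qed

lemma emb_cnj: "s \<in> embeddings m \<Longrightarrow> x \<in> K \<Longrightarrow> s (cnj x) = cnj (s x)"
  using fun_cong[OF mink_cnj_emb(2)[OF _ m_pos], of x s] by (simp add: mink_cnj_def emb_def)

lemma norm_emb_zeta: "s \<in> embeddings m \<Longrightarrow> cmod (s \<zeta>) = 1"
  by (rule Rt_norm[OF embedding_zeta])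

subsection \<open>The trace\<close>

lemma field_trace_ev: "field_trace m (ev p \<zeta>) = (\<Sum>z\<in>Rt. ev p z)"
  unfolding field_trace_def embeddings_eq sum.reindex[OF inj_tau] by (simp add: tau_ev)

lemma Rt_power_bij:
  assumes z: "z \<in> Rt" and l: "l \<in> totatives m"
  shows "bij_betw (\<lambda>z. z ^ l) Rt Rt"
proof -
  have cl: "coprime l m" "l > 0" using l by (auto simp: in_totatives_iff)
  have sub: "(\<lambda>z. z ^ l) ` Rt \<subseteq> Rt"
  proof (intro image_subsetI)
    fix w assume w: "w \<in> Rt"
    obtain f where f: "\<And>p. ev p \<zeta> = 0 \<longleftrightarrow> f dvd p" "\<And>z. ev f z = 0 \<longleftrightarrow> z \<in> Rt"
      using Rt_poly by metis
    have "\<zeta> ^ l \<in> Rt" using l by (simp add: Rt_def)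
    then have "ev (pcompose f (Polynomial.monom 1 l)) \<zeta> = 0" using f(2) by (simp add: ev_pcompose)
    then have "ev (pcompose f (Polynomial.monom 1 l)) w = 0" using Rt_zero_iff[OF w] by blast
    then show "w ^ l \<in> Rt" using f(2) by (simp add: ev_pcompose)
  qed
  moreover have "inj_on (\<lambda>z. z ^ l) Rt"
  proof (rule inj_onI)
    fix x y assume xy: "x \<in> Rt" "y \<in> Rt" "x ^ l = y ^ l"
    then obtain i j where ij: "x = \<zeta> ^ i" "y = \<zeta> ^ j" by (auto simp: Rt_def)
    then have "[i * l = j * l] (mod m)" using xy(3) by (simp add: power_mult[symmetric] zeta_pow_eq_iff)
    then have "[i = j] (mod m)" using cl by (simp add: cong_mult_rcancel_nat)
    then show "x = y" using ij zeta_pow_eq_iff by blast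
  qed
  ultimately show ?thesis using finite_Rt by (simp add: bij_betw_def endo_inj_surj)
qed

text \<open>Represent y by a polynomial p of degree below n. By invariance p - y vanishes at all n
  primitive roots, so p is the constant y.\<close>

lemma invariant_rational:
  assumes y: "y \<in> K" and inv: "\<And>z. z \<in> Rt \<Longrightarrow> tau z y = y"
  shows "y \<in> \<rat>"
proof -
  obtain f where f: "f \<noteq> 0" "lead_coeff f = 1" "\<And>p. ev p \<zeta> = 0 \<longleftrightarrow> f dvd p" "degree f = n"
    using Rt_poly by metis
  obtain p0 where p0: "y = ev p0 \<zeta>" using y by (auto simp: K_iff)
  define p where "p = p0 mod f"
  have "ev p0 \<zeta> = ev (p0 div f * f + p0 mod f) \<zeta>" by simp
  also have "\<dots> = ev p \<zeta>" using f(3)[of f] by (simp only: ev_add ev_mult p_def) simp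
  finally have p: "y = ev p \<zeta>" using p0 by simp
  have dp: "degree p < n"
    using degree_mod_less[OF f(1), of p0] f(4) n_pos unfolding p_def by (metis degree_0)
  let ?q = "map_poly of_rat p - [:y:] :: complex poly"
  have "?q = 0"
  proof (rule ccontr)
    assume ne: "?q \<noteq> 0"
    have "Rt \<subseteq> {x. poly ?q x = 0}"
      using inv tau_ev p by (auto simp: ev_def[symmetric])
    then have "n \<le> card {x. poly ?q x = 0}"
      using card_mono[OF poly_roots_finite[OF ne]] card_Rt by metis
    also have "\<dots> \<le> degree ?q" by (rule card_poly_roots_bound[OF ne])
    also have "degree ?q \<le> degree p"
      by (rule degree_diff_le) (auto simp: degree_map_poly)
    finally show False using dp by simp
  qed
  then have "coeff (map_poly of_rat p) 0 = coeff [:y:] 0" by simp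
  then have "y = of_rat (coeff p 0)" by (simp add: coeff_map_poly)
  then show ?thesis by simp
qed

text \<open>The trace is a sum of algebraic integers of K. Substituting \<zeta>^k for \<zeta> only
  permutes the summands, so it is invariant, hence rational, hence an integer.\<close>

lemma trace_int:
  assumes x: "x \<in> OK"
  shows "field_trace m x \<in> \<int>"
proof -
  have O: "field_trace m x \<in> OK"     unfolding field_trace_def by (rule OK_sum) (rule emb_in_OK[OF _ x])
  obtain p where p: "x = ev p \<zeta>" using OK_K[OF x] by (auto simp: K_iff)
  let ?q = "\<Sum>l\<in>totatives m. pcompose p (Polynomial.monom 1 l)"
  have t: "field_trace m x = ev ?q \<zeta>"
    unfolding p field_trace_ev by (simp add: Rt_def sum.reindex[OF zeta_pow_inj] ev_sum ev_pcompose)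
  have "tau z (field_trace m x) = field_trace m x" if z: "z \<in> Rt" for z
  proof -
    obtain k where k: "k \<in> totatives m" "z = \<zeta> ^ k" using z by (auto simp: Rt_def)
    have "tau z (field_trace m x) = ev ?q z" unfolding t by (rule tau_ev[OF z])
    also have "\<dots> = (\<Sum>l\<in>totatives m. ev p (z ^ l))" by (simp add: ev_sum ev_pcompose)
    also have "\<dots> = (\<Sum>l\<in>totatives m. ev p ((\<zeta> ^ l) ^ k))"
      unfolding k(2) by (simp add: power_mult[symmetric] mult.commute)
    also have "\<dots> = (\<Sum>w\<in>Rt. ev p (w ^ k))" unfolding Rt_def by (simp add: sum.reindex[OF zeta_pow_inj])
    also have "\<dots> = (\<Sum>w\<in>Rt. ev p w)" by (rule sum.reindex_bij_betw[OF Rt_power_bij[OF z k(1)]])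
    finally show ?thesis unfolding p field_trace_ev .
  qed
  then have "field_trace m x \<in> \<rat>" using invariant_rational OK_K[OF O] by blast
  then show ?thesis using OK_rational_int O by blast
qed

text \<open>The sum over j of (\<zeta>/z)^j vanishes unless z = \<zeta>; the exponent m - j stands
  for -j. Since traces of integers are integers, m times the ring of integers lies in
  \<open>Zs\<close>.\<close>

lemma fourier_inversion:
  assumes x: "x \<in> K"
  shows "of_nat m * x = (\<Sum>j<m. field_trace m (x * \<zeta> ^ (m - j)) * \<zeta> ^ j)"
proof -
  have geo: "(\<Sum>j<m. z ^ (m - j) * \<zeta> ^ j) = (if z = \<zeta> then of_nat m else 0)" if z: "z \<in> Rt" for z
  proof -
    have z0: "z \<noteq> 0" using Rt_norm[OF z] by auto
    have "(\<Sum>j<m. z ^ (m - j) * \<zeta> ^ j) = (\<Sum>j<m. (\<zeta> / z) ^ j)"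
    proof (rule sum.cong[OF refl])
      fix j assume "j \<in> {..<m}"
      then have "z ^ (m - j) * z ^ j = 1" using Rt_pow_m[OF z] by (simp add: power_add[symmetric])
      then show "z ^ (m - j) * \<zeta> ^ j = (\<zeta> / z) ^ j" using z0 by (simp add: power_divide field_simps)
    qed
    also have "\<dots> = (if z = \<zeta> then of_nat m else 0)"
    proof (cases "z = \<zeta>")
      case False
      then have "\<zeta> / z \<noteq> 1" using z0 by auto
      then have "(\<Sum>j<m. (\<zeta> / z) ^ j) = ((\<zeta> / z) ^ m - 1) / (\<zeta> / z - 1)" by (rule geometric_sum)
      also have "(\<zeta> / z) ^ m = 1" using Rt_pow_m[OF z] zeta_pow_m by (simp add: power_divide)
      finally show ?thesis using False by simp
    qed (use zeta_neq_0 in simp)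
    finally show ?thesis .
  qed
  have s: "s (x * \<zeta> ^ k) = s x * s \<zeta> ^ k" if "s \<in> embeddings m" for s k
    using that x by (simp add: emb_mult emb_power K_power K_zeta)
  have "(\<Sum>j<m. field_trace m (x * \<zeta> ^ (m - j)) * \<zeta> ^ j)
      = (\<Sum>j<m. \<Sum>s\<in>embeddings m. s x * (s \<zeta> ^ (m - j) * \<zeta> ^ j))"
    by (simp add: field_trace_def sum_distrib_right s mult.assoc)
  also have "\<dots> = (\<Sum>s\<in>embeddings m. \<Sum>j<m. s x * (s \<zeta> ^ (m - j) * \<zeta> ^ j))"
    by (rule sum.swap)
  also have "\<dots> = (\<Sum>s\<in>embeddings m. s x * (\<Sum>j<m. s \<zeta> ^ (m - j) * \<zeta> ^ j))"
    by (simp add: sum_distrib_left)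
  also have "\<dots> = (\<Sum>z\<in>Rt. tau z x * (\<Sum>j<m. z ^ (m - j) * \<zeta> ^ j))"
    unfolding embeddings_eq by (simp add: sum.reindex[OF inj_tau] tau_zeta)
  also have "\<dots> = (\<Sum>z\<in>Rt. if z = \<zeta> then tau \<zeta> x * of_nat m else 0)"
    using geo by (intro sum.cong) auto
  also have "\<dots> = tau \<zeta> x * of_nat m" using zeta_in_Rt finite_Rt by simp
  also have "tau \<zeta> x = x" using x tau_ev[OF zeta_in_Rt] by (auto simp: K_iff)
  finally show ?thesis by simp
qed

text \<open>The order \<open>\<int>[\<zeta>]\<close>.\<close>

definition Zs :: "complex set"
  where "Zs = range (\<lambda>c::nat \<Rightarrow> int. \<Sum>i<n. of_int (c i) * \<zeta> ^ i)"

lemma ZsI: "(\<Sum>i<n. of_int (c i) * \<zeta> ^ i) \<in> Zs"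
  unfolding Zs_def by blast

lemma Zs_add: "x \<in> Zs \<Longrightarrow> y \<in> Zs \<Longrightarrow> x + y \<in> Zs"
proof -
  assume "x \<in> Zs" "y \<in> Zs"
  then obtain c d :: "nat \<Rightarrow> int" where "x = (\<Sum>i<n. of_int (c i) * \<zeta> ^ i)" "y = (\<Sum>i<n. of_int (d i) * \<zeta> ^ i)"
    by (auto simp: Zs_def)
  then have "x + y = (\<Sum>i<n. of_int (c i + d i) * \<zeta> ^ i)" by (simp add: sum.distrib algebra_simps)
  then show ?thesis by (simp only: ZsI)
qed

lemma Zs_of_int: "x \<in> Zs \<Longrightarrow> of_int k * x \<in> Zs"
proof -
  assume "x \<in> Zs"
  then obtain c :: "nat \<Rightarrow> int" where "x = (\<Sum>i<n. of_int (c i) * \<zeta> ^ i)" by (auto simp: Zs_def)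
  then have "of_int k * x = (\<Sum>i<n. of_int (k * c i) * \<zeta> ^ i)" by (simp add: sum_distrib_left algebra_simps)
  then show ?thesis by (simp only: ZsI)
qed

lemma Zs_0: "0 \<in> Zs"
  using ZsI[of "\<lambda>_. 0"] by simp

lemma Zs_sum: "(\<And>i. i \<in> A \<Longrightarrow> h i \<in> Zs) \<Longrightarrow> sum h A \<in> Zs"
  by (induction A rule: infinite_finite_induct) (auto intro: Zs_0 Zs_add)

lemma Zs_base: "i < n \<Longrightarrow> \<zeta> ^ i \<in> Zs"
proof -
  assume "i < n"
  then have "\<zeta> ^ i = (\<Sum>j<n. of_int (if j = i then 1 else 0) * \<zeta> ^ j)"
    by (simp add: if_distrib[of "\<lambda>x. of_int x * _"] cong: if_cong)
  then show ?thesis by (simp only: ZsI)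
qed

text \<open>Exponents from n on are lowered by the cyclotomic polynomial, which is monic with
  integer coefficients.\<close>

lemma Zs_zeta_pow: "\<zeta> ^ k \<in> Zs"
proof (induction k rule: less_induct)
  case (less k)
  show ?case
  proof (cases "k < n")
    case False
    obtain f where f: "lead_coeff f = 1" "\<And>p. ev p \<zeta> = 0 \<longleftrightarrow> f dvd p" "degree f = n" "\<And>i. coeff f i \<in> \<int>"
      using Rt_poly by metis
    have "0 = ev f \<zeta>" using f(2) by simp
    also have "\<dots> = (\<Sum>i<n. of_rat (coeff f i) * \<zeta> ^ i) + \<zeta> ^ n"
      using f(1,3) unfolding ev_altdef by (simp add: lessThan_Suc_atMost[symmetric])
    finally have "\<zeta> ^ n = - (\<Sum>i<n. of_rat (coeff f i) * \<zeta> ^ i)" by (simp add: eq_neg_iff_add_eq_0 add.commute)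
    then have "\<zeta> ^ k = (\<Sum>i<n. - of_rat (coeff f i) * \<zeta> ^ (i + (k - n)))"
      using False power_add[of \<zeta> n "k - n"]
      by (simp only: power_add sum_distrib_right sum_negf mult.assoc mult_minus_left not_less le_add_diff_inverse)
    also have "\<dots> \<in> Zs"
    proof (rule Zs_sum)
      fix i assume i: "i \<in> {..<n}"
      then have "\<zeta> ^ (i + (k - n)) \<in> Zs" using False by (intro less) auto
      moreover obtain a where "coeff f i = of_int a" using f(4)[of i] by (auto elim: Ints_cases)
      ultimately show "- of_rat (coeff f i) * \<zeta> ^ (i + (k - n)) \<in> Zs"
        using Zs_of_int[of _ "- a"] by simp
    qed
    finally show ?thesis .
  qed (rule Zs_base)
qed

lemma m_OK_Zs: "x \<in> OK \<Longrightarrow> of_nat m * x \<in> Zs"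
proof -
  assume x: "x \<in> OK"
  show ?thesis
    unfolding fourier_inversion[OF OK_K[OF x]]
  proof (rule Zs_sum)
    fix j
    have "field_trace m (x * \<zeta> ^ (m - j)) \<in> \<int>" by (intro trace_int OK_mult OK_power OK_zeta x)
    then show "field_trace m (x * \<zeta> ^ (m - j)) * \<zeta> ^ j \<in> Zs"
      using Zs_of_int[OF Zs_zeta_pow] by (auto elim!: Ints_cases)
  qed
qed

lemma Zs_OK: "x \<in> Zs \<Longrightarrow> x \<in> OK"
  by (auto simp: Zs_def intro!: OK_sum OK_mult OK_of_int OK_power OK_zeta)

end

subsection \<open>Prime ideals above primes not dividing the conductor\<close>

locale cyclo_prime = cyclo +
  fixes P :: "complex set" and p :: nat
  assumes primeideal_P: "primeideal P (int_ring m)"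
    and p: "prime p" "\<not> p dvd m" and over: "lies_over P p"
begin

lemma P_OK: "x \<in> P \<Longrightarrow> x \<in> OK"
  using additive_subgroup.a_subset[OF ideal.axioms(1)[OF primeideal.axioms(1)[OF primeideal_P]]] by auto

lemma P_add: "x \<in> P \<Longrightarrow> y \<in> P \<Longrightarrow> x + y \<in> P"
  using additive_subgroup.a_closed[OF ideal.axioms(1)[OF primeideal.axioms(1)[OF primeideal_P]]]
  by (simp add: int_ring_def)

lemma P_mult: "x \<in> P \<Longrightarrow> a \<in> OK \<Longrightarrow> a * x \<in> P"
  using ideal.I_l_closed[OF primeideal.axioms(1)[OF primeideal_P]] by (simp add: int_ring_def)

lemma P_mult_right: "x \<in> P \<Longrightarrow> a \<in> OK \<Longrightarrow> x * a \<in> P"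
  using P_mult[of x a] by (simp add: mult.commute)

lemma P_0: "0 \<in> P"
  using additive_subgroup.zero_closed[OF ideal.axioms(1)[OF primeideal.axioms(1)[OF primeideal_P]]]
  by (simp add: int_ring_def)

lemma P_uminus: "x \<in> P \<Longrightarrow> - x \<in> P"
  using P_mult[of x "-1"] OK_of_int[of "-1"] by simp

lemma P_diff: "x \<in> P \<Longrightarrow> y \<in> P \<Longrightarrow> x - y \<in> P"
  using P_add[of x "- y"] P_uminus by auto

lemma P_prime: "a \<in> OK \<Longrightarrow> b \<in> OK \<Longrightarrow> a * b \<in> P \<Longrightarrow> a \<in> P \<or> b \<in> P"
  using primeideal.I_prime[OF primeideal_P, of a b] by (simp add: int_ring_def)

lemma one_notin_P: "1 \<notin> P"
proof
  assume "1 \<in> P"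
  then have "P = OK" using P_OK P_mult[of 1] by auto
  then show False using primeideal.I_notcarr[OF primeideal_P] by simp
qed

lemma p_in_P: "of_nat p \<in> P"
proof -
  have "int p \<in> {k::int. of_int k \<in> P}" using over unfolding lies_over_def by simp
  then show ?thesis by simp
qed

lemma p_pos: "p > 0"
  using p(1) by (rule prime_gt_0_nat)

lemma coprime_p_m: "coprime p m"
  using p by (simp add: prime_imp_coprime)

lemma p_power_cong_1: obtains t where "t > 0" "[p ^ t = 1] (mod m)"
proof -
  have "\<not> inj_on (\<lambda>i. p ^ i mod m) {..m}"
  proof
    assume "inj_on (\<lambda>i. p ^ i mod m) {..m}"
    moreover have "(\<lambda>i. p ^ i mod m) ` {..m} \<subseteq> {..<m}" using m_pos by auto
    ultimately have "card {..m} \<le> card {..<m}" by (rule card_inj_on_le) simp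
    then show False by simp
  qed
  then obtain i j where "i < j" "p ^ i mod m = p ^ j mod m"
    unfolding inj_on_def by (metis linorder_neqE_nat)
  then have "[p ^ i * p ^ (j - i) = p ^ i * 1] (mod m)"
    by (simp add: cong_def power_add[symmetric])
  moreover have "coprime (p ^ i) m" using coprime_p_m by simp
  ultimately have "[p ^ (j - i) = 1] (mod m)" by (simp only: cong_mult_lcancel_nat)
  then show thesis using that[of "j - i"] \<open>i < j\<close> by simp
qed

lemma frobenius_sum_power:
  assumes "finite A" "\<And>i. i \<in> A \<Longrightarrow> h i \<in> OK"
  shows "pcong p ((\<Sum>i\<in>A. h i) ^ (p ^ t)) (\<Sum>i\<in>A. h i ^ (p ^ t))"
proof (induction t)
  case (Suc t)
  have "pcong p (((\<Sum>i\<in>A. h i) ^ (p ^ t)) ^ p) ((\<Sum>i\<in>A. h i ^ (p ^ t)) ^ p)"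
    using assms by (intro pcong_power Suc.IH OK_power OK_sum) auto
  moreover have "pcong p ((\<Sum>i\<in>A. h i ^ (p ^ t)) ^ p) (\<Sum>i\<in>A. (h i ^ (p ^ t)) ^ p)"
    using assms by (intro frobenius_sum p(1) OK_power) auto
  ultimately have "pcong p (((\<Sum>i\<in>A. h i) ^ (p ^ t)) ^ p) (\<Sum>i\<in>A. (h i ^ (p ^ t)) ^ p)" by (rule pcong_trans)
  then show ?case by (simp only: power_mult[symmetric] power_Suc2)
qed (simp add: pcong_refl)

lemma fermat_int_power: "pcong p (of_int k ^ (p ^ t)) (of_int k)"
proof (induction t)
  case (Suc t)
  have "pcong p ((of_int k ^ (p ^ t)) ^ p) (of_int k ^ p)"
    by (intro pcong_power Suc.IH OK_power OK_of_int)
  then have "pcong p ((of_int k ^ (p ^ t)) ^ p) (of_int k)"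
    using fermat_int[OF p(1)] by (rule pcong_trans)
  then show ?case by (simp only: power_mult[symmetric] power_Suc2)
qed (simp add: pcong_refl)

lemma p_cancel:
  assumes "x \<in> OK" "pcong p (of_nat m * x) 0"
  shows "pcong p x 0"
proof -
  obtain w where w: "w \<in> OK" "of_nat m * x = of_nat p * w" using assms(2) by (auto simp: pcong_def)
  have "gcd (int m) (int p) = 1" using coprime_p_m by (simp add: coprime_commute coprime_imp_gcd_eq_1)
  then obtain a b where "a * int m + b * int p = 1" using bezout_int by metis
  then have "of_int (a * int m + b * int p) = (1 :: complex)" by simp
  then have ab: "of_int a * of_nat m + of_int b * of_nat p = (1 :: complex)" by simp
  have "x = of_int a * (of_nat m * x) + of_int b * of_nat p * x"
    using ab by (metis distrib_right mult.assoc mult_1)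
  also have "\<dots> = of_nat p * (of_int a * w + of_int b * x)" unfolding w by (simp add: algebra_simps)
  finally show ?thesis unfolding pcong_def
    by (intro bexI[of _ "of_int a * w + of_int b * x"] OK_add OK_mult OK_of_int w(1) assms(1)) simp
qed

text \<open>Take Q = p^t with p^t = 1 modulo m. The Q-th power map is additive modulo p and fixes
  \<zeta> and the rational integers, hence all of \<open>Zs\<close>; as m is invertible modulo p,
  this extends to the whole ring of integers.\<close>

lemma frobenius_fixed: obtains Q where "Q \<ge> 2" "\<And>x. x \<in> OK \<Longrightarrow> pcong p (x ^ Q) x"
proof -
  obtain t where t: "t > 0" "[p ^ t = 1] (mod m)" by (rule p_power_cong_1)
  let ?Q = "p ^ t"
  have zp: "\<zeta> ^ (i * ?Q) = \<zeta> ^ i" for i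
    unfolding zeta_pow_eq_iff using cong_scalar_left[OF t(2), of i] by simp
  have Zc: "pcong p (x ^ ?Q) x" if "x \<in> Zs" for x
  proof -
    obtain c :: "nat \<Rightarrow> int" where c: "x = (\<Sum>i<n. of_int (c i) * \<zeta> ^ i)"
      using \<open>x \<in> Zs\<close> by (auto simp: Zs_def)
    have "pcong p (x ^ ?Q) (\<Sum>i<n. (of_int (c i) * \<zeta> ^ i) ^ ?Q)"
      unfolding c by (intro frobenius_sum_power OK_mult OK_of_int OK_power OK_zeta) auto
    moreover have "pcong p (\<Sum>i<n. (of_int (c i) * \<zeta> ^ i) ^ ?Q) x"
      unfolding c
    proof (rule pcong_sum)
      fix i
      have "(of_int (c i) * \<zeta> ^ i) ^ ?Q = of_int (c i) ^ ?Q * \<zeta> ^ i"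
        by (simp add: power_mult_distrib zp power_mult[symmetric])
      then show "pcong p ((of_int (c i) * \<zeta> ^ i) ^ ?Q) (of_int (c i) * \<zeta> ^ i)"
        by (auto intro!: pcong_mult pcong_refl fermat_int_power OK_of_int OK_power OK_zeta)
    qed
    ultimately show ?thesis by (rule pcong_trans)
  qed
  show thesis
  proof (rule that[of ?Q])
    show "?Q \<ge> 2" using t(1) prime_ge_2_nat[OF p(1)] self_le_power[of p t] by linarith
    fix x assume x: "x \<in> OK"
    have mm: "pcong p (of_nat m ^ ?Q) (of_nat m)" using fermat_int_power[of "int m" t] by simp
    have "pcong p ((of_nat m * x) ^ ?Q) (of_nat m * x)" by (rule Zc[OF m_OK_Zs[OF x]])
    moreover have "pcong p (of_nat m ^ ?Q * x ^ ?Q) (of_nat m * x ^ ?Q)"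
      by (intro pcong_mult mm pcong_refl OK_power x OK_of_nat)
    ultimately have "pcong p (of_nat m * x ^ ?Q) (of_nat m * x)"
      unfolding power_mult_distrib using pcong_sym pcong_trans by blast
    then have "pcong p (of_nat m * x ^ ?Q + - (of_nat m * x)) (of_nat m * x + - (of_nat m * x))"
      by (intro pcong_add pcong_refl)
    then have "pcong p (of_nat m * (x ^ ?Q - x)) 0" by (simp add: algebra_simps)
    then have "pcong p (x ^ ?Q - x) 0" by (rule p_cancel[OF OK_diff[OF OK_power[OF x] x]])
    then show "pcong p (x ^ ?Q) x" by (simp add: pcong_def)
  qed
qed

lemma pcong_P: "pcong p x y \<Longrightarrow> x - y \<in> P"
  unfolding pcong_def using P_mult_right[OF p_in_P] by auto

text \<open>From a^Q = a modulo p and primality of P follows a^(Q-1) = 1 modulo P, so a^(Q-2) is an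
  inverse.\<close>

lemma residue_inverse:
  assumes a: "a \<in> OK" "a \<notin> P"
  obtains b where "b \<in> OK" "1 - a * b \<in> P"
proof -
  obtain Q where Q: "Q \<ge> 2" "\<And>x. x \<in> OK \<Longrightarrow> pcong p (x ^ Q) x" using frobenius_fixed by metis
  have "a ^ Q = a * (a * a ^ (Q - 2))"
    using Q(1) by (metis add_2_eq_Suc le_add_diff_inverse power_Suc)
  then have "a * (a * a ^ (Q - 2) - 1) \<in> P"
    using pcong_P[OF Q(2)[OF a(1)]] by (simp add: algebra_simps)
  then have "a * a ^ (Q - 2) - 1 \<in> P"
    using P_prime[of a "a * a ^ (Q - 2) - 1"] a OK_power OK_mult OK_diff OK_1 by metis
  then have "1 - a * a ^ (Q - 2) \<in> P" using P_uminus by fastforce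
  then show thesis using that a OK_power by blast
qed

text \<open>If a m = 1 modulo p, then x is congruent to a (m x), which lies in \<open>Zs\<close> and
  whose coefficients can be reduced modulo p.\<close>

lemma finite_residues:
  obtains F where "finite F" "F \<subseteq> OK" "\<And>x. x \<in> OK \<Longrightarrow> \<exists>y\<in>F. pcong p x y"
proof -
  have "gcd (int m) (int p) = 1" using coprime_p_m by (simp add: coprime_commute coprime_imp_gcd_eq_1)
  then obtain a b where "a * int m + b * int p = 1" using bezout_int by metis
  then have "of_int (a * int m + b * int p) = (1 :: complex)" by simp
  then have ab: "of_int a * of_nat m + of_int b * of_nat p = (1 :: complex)" by simp
  let ?F = "(\<lambda>c. \<Sum>i<n. of_int (c i) * \<zeta> ^ i) ` (PiE {..<n} (\<lambda>_. {0..<int p}))"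
  show thesis
  proof (rule that[of ?F])
    show "finite ?F" by (intro finite_imageI finite_PiE) auto
    show "?F \<subseteq> OK" by (auto intro!: OK_sum OK_mult OK_of_int OK_power OK_zeta)
    fix x assume x: "x \<in> OK"
    have "x = of_int a * (of_nat m * x) + of_int b * of_nat p * x"
      using ab by (metis distrib_right mult.assoc mult_1)
    then have "x - of_int a * (of_nat m * x) = of_nat p * (of_int b * x)"
      by (simp add: algebra_simps)
    then have 1: "pcong p x (of_int a * (of_nat m * x))"
      unfolding pcong_def by (intro bexI[of _ "of_int b * x"] OK_mult OK_of_int x)
    have "of_int a * (of_nat m * x) \<in> Zs" by (intro Zs_of_int m_OK_Zs x)
    then obtain c :: "nat \<Rightarrow> int" where c: "of_int a * (of_nat m * x) = (\<Sum>i<n. of_int (c i) * \<zeta> ^ i)"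
      by (auto simp: Zs_def)
    let ?d = "\<lambda>i\<in>{..<n}. c i mod int p"
    have "pcong p (\<Sum>i<n. of_int (c i) * \<zeta> ^ i) (\<Sum>i<n. of_int (?d i) * \<zeta> ^ i)"
    proof (rule pcong_sum)
      fix i assume i: "i \<in> {..<n}"
      have "(of_int (c i) :: complex) = of_int (int p * (c i div int p) + c i mod int p)" by simp
      then have "(of_int (c i) :: complex) - of_int (?d i) = of_nat p * of_int (c i div int p)"
        using i by (simp only: of_int_add of_int_mult) simp
      then have "pcong p (of_int (c i)) (of_int (?d i))" unfolding pcong_def using OK_of_int by blast
      then show "pcong p (of_int (c i) * \<zeta> ^ i) (of_int (?d i) * \<zeta> ^ i)"
        by (intro pcong_mult pcong_refl OK_power OK_zeta OK_of_int)
    qed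
    then have "pcong p x (\<Sum>i<n. of_int (?d i) * \<zeta> ^ i)" using 1 unfolding c by (blast intro: pcong_trans)
    moreover have "?d \<in> PiE {..<n} (\<lambda>_. {0..<int p})" using p_pos by auto
    ultimately show "\<exists>y\<in>?F. pcong p x y" by blast
  qed
qed

text \<open>Modulo \<open>p\<close> the ideal \<open>P\<close> is generated by an idempotent \<open>e\<close>, so \<open>P\<close> has the inverse
  \<open>(1, (1 - e) / p)\<close>.\<close>

lemma inverse_generator:
  obtains e where "e \<in> P" "\<And>y. y \<in> P \<Longrightarrow> pcong p ((1 - e) * y) 0"
proof -
  obtain Q where Q: "Q \<ge> 2" "\<And>x. x \<in> OK \<Longrightarrow> pcong p (x ^ Q) x" using frobenius_fixed by metis
  obtain F where F: "finite F" "F \<subseteq> OK" "\<And>x. x \<in> OK \<Longrightarrow> \<exists>y\<in>F. pcong p x y"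
    using finite_residues by metis
  \<comment> \<open>Since y^Q = y modulo p, the factor 1 - y^(Q-1) annihilates y modulo p, and it is
    1 modulo P when y is in P. The product over representatives of P modulo p thus annihilates all
    of P modulo p and is itself 1 modulo P.\<close>
  have pr: "1 - (\<Prod>y\<in>A. 1 - y ^ (Q - 1)) \<in> P" if "finite A" "A \<subseteq> P" for A
    using that
  proof (induction A rule: finite_induct)
    case empty
    then show ?case by (simp add: P_0)
  next
    case (insert a A)
    let ?R = "\<Prod>y\<in>A. 1 - y ^ (Q - 1)"
    have "1 - ?R \<in> P" "a \<in> P" using insert by auto
    moreover have "?R \<in> OK"
      using insert P_OK by (intro OK_prod OK_diff OK_1 OK_power) auto
    moreover have "a ^ (Q - 1) = a * a ^ (Q - 2)"
      using Q(1) by (metis Suc_diff_Suc Suc_1 Suc_le_lessD power_Suc)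
    then have "a ^ (Q - 1) \<in> P" using \<open>a \<in> P\<close> P_OK by (auto intro!: P_mult_right OK_power)
    ultimately have "(1 - ?R) + a ^ (Q - 1) * ?R \<in> P" by (intro P_add P_mult_right)
    moreover have "(1 - ?R) + a ^ (Q - 1) * ?R = 1 - (1 - a ^ (Q - 1)) * ?R" by (simp add: algebra_simps)
    ultimately have "1 - (1 - a ^ (Q - 1)) * ?R \<in> P" by (simp only:)
    then show ?case by (simp only: prod.insert[OF insert(1,2)])
  qed
  let ?A = "F \<inter> P"
  define e where "e = 1 - (\<Prod>y\<in>?A. 1 - y ^ (Q - 1))"
  have eP: "e \<in> P" unfolding e_def using F(1) by (intro pr) auto
  have kill: "pcong p ((1 - e) * y) 0" if yP: "y \<in> P" for y
  proof -
    obtain z where z: "z \<in> F" "pcong p y z" using F(3) P_OK[OF yP] by blast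
    have "y - z \<in> P" by (rule pcong_P[OF z(2)])
    then have zP: "z \<in> P" using P_diff[OF yP, of "y - z"] by simp
    have ye: "1 - e \<in> OK" using eP P_OK OK_diff OK_1 by blast
    have 1: "pcong p ((1 - e) * y) ((1 - e) * z)"
      by (intro pcong_mult pcong_refl z(2) P_OK yP ye)
    have "(1 - e) * z = (\<Prod>y\<in>?A - {z}. 1 - y ^ (Q - 1)) * ((1 - z ^ (Q - 1)) * z)"
      using z(1) zP F(1) by (simp add: e_def prod.remove[of ?A z])
    also have "z ^ (Q - 1) * z = z ^ Q" using Q(1) by (intro power_minus_mult) simp
    then have "(1 - z ^ (Q - 1)) * z = z - z ^ Q" by (simp add: algebra_simps)
    finally have eq: "(1 - e) * z = (\<Prod>y\<in>?A - {z}. 1 - y ^ (Q - 1)) * (z - z ^ Q)" .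
    obtain w where w: "w \<in> OK" "z ^ Q - z = of_nat p * w"
      using Q(2)[OF P_OK[OF zP]] by (auto simp: pcong_def)
    let ?R = "\<Prod>y\<in>?A - {z}. 1 - y ^ (Q - 1)"
    have R: "?R \<in> OK" using P_OK by (intro OK_prod OK_diff OK_1 OK_power) auto
    have "z - z ^ Q = of_nat p * (- w)" using w(2) by (simp add: algebra_simps)
    then have "(1 - e) * z - 0 = of_nat p * (?R * (- w))"
      unfolding eq by (simp only: diff_0_right mult.left_commute[of ?R])
    then have 2: "pcong p ((1 - e) * z) 0"
      unfolding pcong_def using R w(1) OK_mult OK_uminus by blast
    show ?thesis using 1 2 by (rule pcong_trans)
  qed
  show thesis using that eP kill by blast
qed

text \<open>The relation exhibits 1 as a member of P times its inverse, as e and p lie in P and 1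
  and e' in the inverse. It is what later splits elements of products with P or its inverse.\<close>

lemma ideal_inverse_partition:
  obtains e e' where "e \<in> P" "e' \<in> ideal_inverse m P" "1 = e + e' * of_nat p"
proof -
  obtain e where e: "e \<in> P" "\<And>y. y \<in> P \<Longrightarrow> pcong p ((1 - e) * y) 0" using inverse_generator by metis
  let ?e = "(1 - e) / of_nat p"
  have pc: "of_nat p \<noteq> (0 :: complex)" using p_pos by simp
  have "?e \<in> ideal_inverse m P"
    unfolding ideal_inverse_def
  proof (intro CollectI conjI ballI)
    have "?e = of_rat (1 / of_nat p) * (1 - e)" by (simp add: of_rat_divide)
    also have "\<dots> \<in> K" using P_OK[OF e(1)] OK_K by (intro K_mult K_of_rat K_diff K_1) auto
    finally show "?e \<in> K" .
    fix y assume "y \<in> P"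
    then obtain w where "w \<in> OK" "(1 - e) * y = of_nat p * w" using e(2) by (auto simp: pcong_def)
    then have "?e * y = w" using pc by (simp add: field_simps)
    then show "?e * y \<in> OK" using \<open>w \<in> OK\<close> by simp
  qed
  moreover have "1 = e + ?e * of_nat p" using pc by simp
  ultimately show thesis using that e(1) by blast
qed

lemma residue_representatives:
  obtains Y where "finite Y" "Y \<subseteq> OK" "card Y = residue_card m P"
    "\<And>x. x \<in> OK \<Longrightarrow> \<exists>!y. y \<in> Y \<and> x - y \<in> P"
proof -
  define co where "co x = (\<lambda>h. h + x) ` P" for x :: complex
  have co_eq: "co x = co y \<longleftrightarrow> x - y \<in> P" for x y
  proof
    assume "co x = co y"
    moreover have "x \<in> co x" unfolding co_def by (rule image_eqI[of _ _ 0]) (auto simp: P_0)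
    ultimately show "x - y \<in> P" by (auto simp: co_def)
  next
    assume xy: "x - y \<in> P"
    show "co x = co y"
    proof (intro equalityI subsetI)
      fix u assume "u \<in> co x"
      then obtain h where "h \<in> P" "u = h + x" by (auto simp: co_def)
      then show "u \<in> co y" unfolding co_def using xy by (intro image_eqI[of _ _ "h + (x - y)"]) (auto intro: P_add)
    next
      fix u assume "u \<in> co y"
      then obtain h where "h \<in> P" "u = h + y" by (auto simp: co_def)
      then show "u \<in> co x" unfolding co_def using xy by (intro image_eqI[of _ _ "h - (x - y)"]) (auto intro: P_diff)
    qed
  qed
  have carr: "carrier (int_ring m Quot P) = co ` OK"
    by (auto simp: FactRing_def A_RCOSETS_def' a_r_coset_def' int_ring_def co_def)
  obtain F where F: "finite F" "F \<subseteq> OK" "\<And>x. x \<in> OK \<Longrightarrow> \<exists>y\<in>F. pcong p x y"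
    using finite_residues by metis
  have "co ` OK \<subseteq> co ` F"
  proof (intro image_subsetI)
    fix x assume "x \<in> OK"
    then obtain y where "y \<in> F" "pcong p x y" using F(3) by blast
    then show "co x \<in> co ` F" using co_eq pcong_P by blast
  qed
  then have fin: "finite (co ` OK)" using F(1) finite_subset by blast
  obtain Y where Y: "Y \<subseteq> OK" "inj_on co Y" "co ` OK = co ` Y"
    using subset_image_inj[of "co ` OK" co OK] by auto
  show thesis
  proof (rule that[of Y])
    show "finite Y" using fin Y by (metis finite_imageD)
    show "Y \<subseteq> OK" by (rule Y(1))
    show "card Y = residue_card m P"
      unfolding residue_card_def carr Y(3) using Y(2) by (simp add: card_image)
    fix x assume "x \<in> OK"
    then obtain y where y: "y \<in> Y" "co x = co y" using Y(3) by blast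
    show "\<exists>!y. y \<in> Y \<and> x - y \<in> P"
    proof (rule ex1I[of _ y])
      show "y \<in> Y \<and> x - y \<in> P" using y co_eq by blast
      fix z assume "z \<in> Y \<and> x - z \<in> P"
      then show "z = y" using y co_eq Y(2) by (metis inj_onD)
    qed
  qed
qed

end

section \<open>Minkowski space\<close>

lemma sum_fun_at: "(\<Sum>i\<in>A. h i) s = (\<Sum>i\<in>A. h i s)"
  by (induction A rule: infinite_finite_induct) (simp_all add: zero_fun_def plus_fun_def)

lemma scaleR_fun_at: "(c *\<^sub>R f) s = c *\<^sub>R f s"
  by (simp add: scaleR_fun_def)

lemma of_real_of_rat_complex: "complex_of_real (of_rat q) = of_rat q"
  by (cases q) (simp add: Fract_of_int_quotient of_rat_divide)

lemmas fun_at = sum_fun_at scaleR_fun_at plus_fun_apply times_fun_apply minus_apply uminus_apply zero_fun_apply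

context cyclo
begin

abbreviation "Es \<equiv> embeddings m"
abbreviation "em \<equiv> emb m"
abbreviation "KR \<equiv> K_real m"

lemma em_at: "s \<in> Es \<Longrightarrow> em x s = s x"
  by (simp add: emb_def)

lemma em_at_out: "s \<notin> Es \<Longrightarrow> em x s = 0"
  by (simp add: emb_def)

lemma em_add: "x \<in> K \<Longrightarrow> y \<in> K \<Longrightarrow> em (x + y) = em x + em y"
  by (rule ext) (auto simp: fun_at emb_def emb_add)

lemma em_mult: "x \<in> K \<Longrightarrow> y \<in> K \<Longrightarrow> em (x * y) = em x * em y"
  by (rule ext) (auto simp: fun_at emb_def emb_mult)

lemma em_of_rat_mult: "x \<in> K \<Longrightarrow> em (of_rat q * x) = of_rat q *\<^sub>R em x"
  by (rule ext) (auto simp: fun_at emb_def emb_mult emb_of_rat K_of_rat scaleR_conv_of_real of_real_of_rat_complex)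

lemma em_of_int_mult: "x \<in> K \<Longrightarrow> em (of_int k * x) = of_int k *\<^sub>R em x"
  using em_of_rat_mult[of x "of_int k"] by simp

lemma em_of_nat_mult: "x \<in> K \<Longrightarrow> em (of_nat k * x) = of_nat k *\<^sub>R em x"
  using em_of_rat_mult[of x "of_nat k"] by simp

lemma em_0: "em 0 = 0"
  by (rule ext) (auto simp: fun_at emb_def emb_0)

lemma em_uminus: "x \<in> K \<Longrightarrow> em (- x) = - em x"
  using em_of_int_mult[of x "-1"] by simp

lemma em_diff: "x \<in> K \<Longrightarrow> y \<in> K \<Longrightarrow> em (x - y) = em x - em y"
  using em_add[of x "- y"] em_uminus[of y] K_uminus[of y] by simp

lemma em_sum: "(\<And>i. i \<in> A \<Longrightarrow> h i \<in> K) \<Longrightarrow> em (sum h A) = (\<Sum>i\<in>A. em (h i))"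
  by (induction A rule: infinite_finite_induct) (auto simp: em_0 em_add K_sum)

lemma Es_nonempty: "Es \<noteq> {}"
  using card_embeddings n_pos by auto

lemma em_eq_0: "x \<in> K \<Longrightarrow> em x = 0 \<longleftrightarrow> x = 0"
proof
  assume x: "x \<in> K" "em x = 0"
  obtain s where s: "s \<in> Es" using Es_nonempty by blast
  have "s x = 0" using fun_cong[OF x(2), of s] s by (simp add: em_at fun_at)
  then show "x = 0" using emb_nonzero[OF s x(1)] by blast
qed (simp add: em_0)

lemma em_inj: "x \<in> K \<Longrightarrow> y \<in> K \<Longrightarrow> em x = em y \<longleftrightarrow> x = y"
  using em_eq_0[of "x - y"] em_diff[of x y] K_diff[of x y] by simp

lemma em_in_KR: "x \<in> K \<Longrightarrow> em x \<in> KR"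
  unfolding K_real_def by (rule span_base) simp

lemma KR_induct:
  assumes "subspace {x. Q x}" "\<And>a. a \<in> K \<Longrightarrow> Q (em a)" "x \<in> KR"
  shows "Q x"
proof -
  have "KR \<subseteq> {x. Q x}" unfolding K_real_def using assms(1,2) by (intro span_minimal) auto
  then show ?thesis using assms(3) by auto
qed

lemma KR_subspace: "subspace KR"
  by (simp add: K_real_def)

lemma KR_support: "x \<in> KR \<Longrightarrow> s \<notin> Es \<Longrightarrow> x s = 0"
  by (rule KR_induct[of "\<lambda>x. x s = 0"]) (auto simp: subspace_def fun_at em_at_out)

lemma KR_mult:
  assumes y: "y \<in> KR" and a: "a \<in> K"
  shows "em a * y \<in> KR"
proof (rule KR_induct[of "\<lambda>y. em a * y \<in> KR", OF _ _ y])
  have 1: "em a * (x + y) = em a * x + em a * y" "em a * (c *\<^sub>R x) = c *\<^sub>R (em a * x)" for x y :: mink and c :: real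
    by (rule ext, simp add: fun_at algebra_simps)+
  show "subspace {y. em a * y \<in> KR}"
    using KR_subspace unfolding subspace_def by (auto simp: 1)
  show "\<And>b. b \<in> K \<Longrightarrow> em a * em b \<in> KR"
    using a by (simp add: em_mult[symmetric] em_in_KR K_mult)
qed

lemma mink_cnj_linear: "mink_cnj (x + y) = mink_cnj x + mink_cnj y" "mink_cnj (c *\<^sub>R x) = c *\<^sub>R mink_cnj x"
    "mink_cnj (- x) = - mink_cnj x" "mink_cnj (mink_cnj x) = x" "mink_cnj 0 = 0"
    "mink_cnj (x * y) = mink_cnj x * mink_cnj y"
  by (rule ext, simp add: mink_cnj_def fun_at)+

lemma mink_cnj_em: "x \<in> K \<Longrightarrow> mink_cnj (em x) = em (cnj x)"
  by (rule mink_cnj_emb(2)[OF _ m_pos])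

lemma K_cnj: "x \<in> K \<Longrightarrow> cnj x \<in> K"
  by (rule mink_cnj_emb(1)[OF _ m_pos])

lemma KR_cnj: "x \<in> KR \<Longrightarrow> mink_cnj x \<in> KR"
proof (rule KR_induct[of "\<lambda>y. mink_cnj y \<in> KR"])
  show "subspace {y. mink_cnj y \<in> KR}"
    using KR_subspace unfolding subspace_def by (auto simp: mink_cnj_linear)
  show "\<And>a. a \<in> K \<Longrightarrow> mink_cnj (em a) \<in> KR" by (simp add: mink_cnj_em em_in_KR K_cnj)
qed

definition "Tr x = Re (mink_trace m x)"

lemma Tr_linear: "Tr (x + y) = Tr x + Tr y" "Tr (c *\<^sub>R x) = c * Tr x" "Tr (- x) = - Tr x"
    "Tr (x - y) = Tr x - Tr y" "Tr 0 = 0" "Tr (mink_cnj x) = Tr x"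
  by (simp_all add: Tr_def mink_trace_def fun_at sum.distrib sum_negf sum_subtractf sum_distrib_left mink_cnj_def)

lemma Tr_sum: "Tr (sum h A) = (\<Sum>i\<in>A. Tr (h i))"
  unfolding Tr_def mink_trace_def sum_fun_at Re_sum by (rule sum.swap)

lemma Tr_em: "Tr (em x) = Re (field_trace m x)"
  by (simp add: Tr_def mink_trace_emb)

lemma Tr_em_int: "x \<in> OK \<Longrightarrow> Tr (em x) \<in> \<int>"
  using trace_int[of x] by (auto simp: Tr_em elim!: Ints_cases)

lemma ip_K_Tr: "ip_K m x y = Tr (x * mink_cnj y)"
  by (simp add: ip_K_def Tr_def)

lemma Tr_ip_K: "Tr (x * y) = ip_K m x (mink_cnj y)"
  by (simp add: ip_K_Tr mink_cnj_linear)

lemma ip_K_sum: "ip_K m x y = (\<Sum>s\<in>Es. Re (x s * cnj (y s)))"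
  by (simp add: ip_K_def mink_trace_def mink_cnj_def fun_at)

lemma ip_K_norm: "ip_K m x x = (\<Sum>s\<in>Es. (cmod (x s))\<^sup>2)"
  unfolding ip_K_sum by (intro sum.cong refl) (simp add: complex_mult_cnj cmod_power2)

lemma ip_K_cnj: "ip_K m (mink_cnj x) (mink_cnj y) = ip_K m x y"
  unfolding ip_K_sum by (intro sum.cong refl) (simp add: mink_cnj_def)

abbreviation "zb \<equiv> (\<lambda>i. em (\<zeta> ^ i))"

text \<open>The coefficients form a polynomial of degree below n that vanishes at all n primitive
  roots. This is why independence persists over the reals.\<close>

lemma zb_independent:
  assumes "(\<Sum>i<n. c i *\<^sub>R zb i) = 0" "i < n"
  shows "c i = 0"
proof -
  let ?q = "\<Sum>i<n. Polynomial.monom (complex_of_real (c i)) i"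
  have root: "poly ?q z = 0" if z: "z \<in> Rt" for z
  proof -
    note s = tau_in_embeddings[OF z]
    have "0 = (\<Sum>i<n. c i *\<^sub>R zb i) (tau z)" unfolding assms(1) by (simp add: fun_at)
    also have "\<dots> = (\<Sum>i<n. of_real (c i) * z ^ i)"
      using s z by (simp add: fun_at em_at scaleR_conv_of_real emb_power K_zeta tau_zeta)
    finally show ?thesis by (simp add: poly_sum poly_monom)
  qed
  have "?q = 0"
  proof (rule ccontr)
    assume ne: "?q \<noteq> 0"
    have "Rt \<subseteq> {x. poly ?q x = 0}" using root by auto
    then have "n \<le> card {x. poly ?q x = 0}"
      using card_mono[OF poly_roots_finite[OF ne], of Rt] unfolding card_Rt by blast
    also have "\<dots> \<le> degree ?q" by (rule card_poly_roots_bound[OF ne])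
    also have "degree ?q \<le> n - 1"
    proof (rule degree_sum_le)
      fix i assume "i \<in> {..<n}"
      then show "degree (Polynomial.monom (complex_of_real (c i)) i) \<le> n - 1"
        using degree_monom_le[of "complex_of_real (c i)" i] by simp
    qed (rule finite_lessThan)
    finally show False using n_pos by linarith
  qed
  then have "coeff ?q i = 0" by simp
  moreover have "coeff ?q i = of_real (c i)"
    using assms(2) by (simp add: coeff_sum if_distrib cong: if_cong)
  ultimately show ?thesis by simp
qed

lemma K_Q_basis:
  assumes "x \<in> K"
  obtains c :: "nat \<Rightarrow> rat" where "x = (\<Sum>i<n. of_rat (c i) * \<zeta> ^ i)"
proof -
  obtain f where f: "f \<noteq> 0" "\<And>p. ev p \<zeta> = 0 \<longleftrightarrow> f dvd p" "degree f = n"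
    using Rt_poly by metis
  obtain p0 where p0: "x = ev p0 \<zeta>" using assms by (auto simp: K_iff)
  let ?p = "p0 mod f"
  have "ev p0 \<zeta> = ev (p0 div f * f + p0 mod f) \<zeta>" by simp
  also have "\<dots> = ev ?p \<zeta>" using f(2)[of f] by (simp only: ev_add ev_mult) simp
  finally have p: "x = ev ?p \<zeta>" using p0 by simp
  have dp: "degree ?p < n"
    using degree_mod_less[OF f(1), of p0] f(3) n_pos by (metis degree_0)
  have "ev ?p \<zeta> = (\<Sum>i<n. of_rat (coeff ?p i) * \<zeta> ^ i)"
    unfolding ev_altdef using dp by (intro sum.mono_neutral_left) (auto simp: coeff_eq_0)
  then show thesis using that p by metis
qed

lemma basis_zb: "basis_seq n zb KR"
proof -
  have "span (zb ` {..<n}) = KR"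
  proof
    show "span (zb ` {..<n}) \<subseteq> KR"
      using KR_subspace by (intro span_minimal) (auto intro: em_in_KR K_power K_zeta)
    have "em ` K \<subseteq> span (zb ` {..<n})"
    proof (intro image_subsetI)
      fix x assume "x \<in> K"
      then obtain c :: "nat \<Rightarrow> rat" where c: "x = (\<Sum>i<n. of_rat (c i) * \<zeta> ^ i)" by (rule K_Q_basis)
      have "em x = (\<Sum>i<n. of_rat (c i) *\<^sub>R zb i)"
        unfolding c by (subst em_sum) (auto simp: em_of_rat_mult K_power K_zeta intro: K_mult K_of_rat)
      then show "em x \<in> span (zb ` {..<n})" by (auto intro!: span_sum span_scale intro: span_base)
    qed
    then show "KR \<subseteq> span (zb ` {..<n})"
      unfolding K_real_def by (intro span_minimal) auto
  qed
  moreover have "inj_on zb {..<n}" "independent (zb ` {..<n})"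
    by (rule seq_independentI; fact zb_independent)+
  ultimately show ?thesis by (simp add: basis_seq_def)
qed

sublocale KS: euclid KR "ip_K m" n
proof
  fix x y z :: mink and c :: real
  show "ip_K m x y = ip_K m y x" unfolding ip_K_sum by (intro sum.cong refl) (simp add: algebra_simps)
  show "ip_K m (x + y) z = ip_K m x z + ip_K m y z"
    unfolding ip_K_sum by (simp add: fun_at algebra_simps sum.distrib sum_subtractf)
  show "ip_K m (c *\<^sub>R x) z = c * ip_K m x z"
    unfolding ip_K_sum by (simp add: fun_at sum_distrib_left algebra_simps)
  show "\<exists>f. basis_seq n f KR" using basis_zb by blast
  assume x: "x \<in> KR" "x \<noteq> 0"
  then obtain s where s: "x s \<noteq> 0" by (auto simp: fun_eq_iff fun_at)
  then have "s \<in> Es" using KR_support[OF x(1)] by blast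
  then have "0 < (\<Sum>s\<in>Es. (cmod (x s))\<^sup>2)"
    using s by (intro sum_pos2[OF finite_embeddings]) auto
  then show "0 < ip_K m x x" by (simp add: ip_K_norm)
qed

subsection \<open>The lattice of integers and its dual\<close>

abbreviation "LO \<equiv> em ` OK"
abbreviation "LD \<equiv> int_dual m"

lemma em_Zs: "em ` Zs = zlat n zb"
proof -
  have "em (\<Sum>i<n. of_int (c i) * \<zeta> ^ i) = (\<Sum>i<n. of_int (c i) *\<^sub>R zb i)" for c
    by (subst em_sum) (auto simp: em_of_int_mult K_power K_zeta intro: K_mult K_of_int)
  then show ?thesis unfolding Zs_def zlat_def by (simp add: image_image)
qed

lemma LO_diff: "x \<in> LO \<Longrightarrow> y \<in> LO \<Longrightarrow> x - y \<in> LO"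
proof -
  assume "x \<in> LO" "y \<in> LO"
  then obtain a b where "a \<in> OK" "b \<in> OK" "x = em a" "y = em b" by auto
  then show ?thesis by (intro image_eqI[of _ _ "a - b"]) (auto simp: em_diff OK_K intro: OK_diff)
qed

lemma LO_0: "0 \<in> LO"
  by (rule image_eqI[of _ _ 0]) (auto simp: em_0 OK_0)

text \<open>The ring of integers lies between Z[\<zeta>] and (1/m) Z[\<zeta>], which is what
  \<open>sublattice\<close> asks for.\<close>

lemma LO_basis: obtains w where "basis_seq n w KR" "LO = zlat n w"
proof (rule KS.sublattice[OF basis_zb LO_0 LO_diff])
  show "LO \<subseteq> KR" using OK_K em_in_KR by auto
  show "\<And>i. i < n \<Longrightarrow> zb i \<in> LO" by (auto intro: OK_power OK_zeta)
  show "0 < m" using m_pos by simp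
  fix x assume "x \<in> LO"
  then obtain a where a: "a \<in> OK" "x = em a" by auto
  then have "real m *\<^sub>R x = em (of_nat m * a)" by (simp add: em_of_nat_mult OK_K)
  then show "real m *\<^sub>R x \<in> zlat n zb" using m_OK_Zs[OF a(1)] em_Zs by auto
qed (use that in auto)

text \<open>The ring of integers is closed under conjugation, so its dual for the scalar product is
  also its dual for the bilinear trace form, that is, the inverse different.\<close>

lemma int_dual_iff: "y \<in> LD \<longleftrightarrow> y \<in> KR \<and> (\<forall>a\<in>OK. Tr (em a * y) \<in> \<int>)"
proof -
  have *: "ip_K m y (em a) = Tr (em (cnj a) * y)" if "a \<in> OK" for a
    using that by (simp add: ip_K_Tr mink_cnj_em OK_K mult.commute)
  have "(\<forall>x\<in>LO. ip_K m y x \<in> \<int>) \<longleftrightarrow> (\<forall>a\<in>OK. Tr (em a * y) \<in> \<int>)"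
  proof
    assume L: "\<forall>x\<in>LO. ip_K m y x \<in> \<int>"
    show "\<forall>a\<in>OK. Tr (em a * y) \<in> \<int>"
    proof
      fix a assume "a \<in> OK"
      then show "Tr (em a * y) \<in> \<int>" using L *[of "cnj a"] OK_cnj[of a] by auto
    qed
  qed (auto simp: * OK_cnj)
  then show ?thesis by (auto simp: int_dual_def dual_lattice_def)
qed

lemma LD_KR: "y \<in> LD \<Longrightarrow> y \<in> KR"
  by (simp add: int_dual_iff)

lemma LD_0: "0 \<in> LD"
  using KS.V_closed(1) by (simp add: int_dual_iff Tr_linear)

lemma LD_diff: "x \<in> LD \<Longrightarrow> y \<in> LD \<Longrightarrow> x - y \<in> LD"
  by (auto simp: int_dual_iff right_diff_distrib Tr_linear intro!: KS.V_closed(3))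

lemma LD_add: "x \<in> LD \<Longrightarrow> y \<in> LD \<Longrightarrow> x + y \<in> LD"
  by (auto simp: int_dual_iff distrib_left Tr_linear intro!: KS.V_closed(2))

lemma LD_mult:
  assumes "y \<in> LD" "a \<in> OK"
  shows "em a * y \<in> LD"
  unfolding int_dual_iff
proof (intro conjI ballI)
  show "em a * y \<in> KR" using assms by (intro KR_mult LD_KR OK_K)
  fix b assume b: "b \<in> OK"
  have "em b * (em a * y) = em (b * a) * y" using assms b by (simp add: em_mult OK_K mult.assoc)
  then show "Tr (em b * (em a * y)) \<in> \<int>" using assms b OK_mult by (simp add: int_dual_iff)
qed

lemma LD_cnj: assumes "y \<in> LD" shows "mink_cnj y \<in> LD"
  unfolding int_dual_iff
proof (intro conjI ballI)
  show "mink_cnj y \<in> KR" using assms by (intro KR_cnj LD_KR)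
  fix a assume a: "a \<in> OK"
  have "em a * mink_cnj y = mink_cnj (em (cnj a) * y)"
    using a by (simp add: mink_cnj_linear mink_cnj_em K_cnj OK_K)
  then show "Tr (em a * mink_cnj y) \<in> \<int>" using assms a OK_cnj by (simp add: int_dual_iff Tr_linear)
qed

lemma LO_LD: "LO \<subseteq> LD"
  by (auto simp: int_dual_iff em_in_KR OK_K em_mult[symmetric] intro!: Tr_em_int OK_mult)

lemma LD_eq_dual: "LD = dual_lattice KR (ip_K m) LO"
  by (simp add: int_dual_def)

lemma LD_basis: obtains w' where "basis_seq n w' KR" "LD = zlat n w'"
proof -
  obtain w where w: "basis_seq n w KR" "LO = zlat n w" by (rule LO_basis)
  obtain w' where "KS.dual_pair w w'" using KS.dual_pair_exists[OF w(1)] .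
  then show thesis using that[of w'] KS.dual_lattice_zlat[of w w'] w
    by (auto simp: LD_eq_dual KS.dual_pair_def)
qed

text \<open>The dual of the dual lattice is the lattice itself; \<open>LD_cnj\<close> absorbs the
  conjugation in \<open>ip_K\<close>.\<close>

lemma dual_LD:
  assumes x: "x \<in> KR" and int: "\<And>y. y \<in> LD \<Longrightarrow> Tr (x * y) \<in> \<int>"
  shows "x \<in> LO"
proof -
  obtain w where w: "basis_seq n w KR" "LO = zlat n w" by (rule LO_basis)
  obtain w' where d: "KS.dual_pair w w'" using KS.dual_pair_exists[OF w(1)] .
  have LD: "LD = zlat n w'" using KS.dual_lattice_zlat[OF d] w by (simp add: LD_eq_dual)
  have "x \<in> dual_lattice KR (ip_K m) (zlat n w')"
    unfolding LD[symmetric] dual_lattice_def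
  proof (intro CollectI conjI ballI x)
    fix y assume "y \<in> LD"
    then show "ip_K m x y \<in> \<int>" using int[OF LD_cnj] by (simp add: ip_K_Tr)
  qed
  then show ?thesis using KS.dual_lattice_zlat[OF KS.dual_pair_sym[OF d]] w by simp
qed

text \<open>\<open>fourier_inversion\<close> extends linearly from the powers of \<zeta> to the real
  algebra, and for y in the dual the coefficients are integers. Hence dual vectors come from K, so
  that their norms can be used.\<close>

lemma LD_denominator: assumes y: "y \<in> LD" shows "real m *\<^sub>R y \<in> zlat n zb"
proof -
  obtain c where c: "y = (\<Sum>i<n. c i *\<^sub>R zb i)" using basis_seq_expand[OF basis_zb LD_KR[OF y]] .
  define T where "T j x = Tr (em (\<zeta> ^ (m - j)) * x)" for j and x :: mink
  have Tlin: "T j (sum h A) = (\<Sum>i\<in>A. T j (h i))" "T j (r *\<^sub>R x) = r * T j x" for j h A r x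
  proof -
    show "T j (sum h A) = (\<Sum>i\<in>A. T j (h i))"
      by (simp add: T_def sum_distrib_left Tr_sum)
    have "em (\<zeta> ^ (m - j)) * (r *\<^sub>R x) = r *\<^sub>R (em (\<zeta> ^ (m - j)) * x)" by (rule ext) (simp add: fun_at)
    then show "T j (r *\<^sub>R x) = r * T j x" by (simp add: T_def Tr_linear)
  qed
  have zb: "real m *\<^sub>R zb i = (\<Sum>j<m. T j (zb i) *\<^sub>R zb j)" for i
  proof -
    have zK: "\<zeta> ^ k \<in> K" for k by (intro K_power K_zeta)
    have zO: "\<zeta> ^ k \<in> OK" for k by (intro OK_power OK_zeta)
    have "real m *\<^sub>R zb i = em (of_nat m * \<zeta> ^ i)" by (simp add: em_of_nat_mult zK)
    also have "of_nat m * \<zeta> ^ i = (\<Sum>j<m. field_trace m (\<zeta> ^ i * \<zeta> ^ (m - j)) * \<zeta> ^ j)"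
      by (rule fourier_inversion[OF zK])
    also have "em \<dots> = (\<Sum>j<m. em (field_trace m (\<zeta> ^ i * \<zeta> ^ (m - j)) * \<zeta> ^ j))"
    proof (rule em_sum)
      fix j
      have "field_trace m (\<zeta> ^ i * \<zeta> ^ (m - j)) \<in> \<int>" by (intro trace_int OK_mult zO)
      then show "field_trace m (\<zeta> ^ i * \<zeta> ^ (m - j)) * \<zeta> ^ j \<in> K"
        by (auto elim!: Ints_cases intro!: K_mult K_of_int zK)
    qed
    also have "\<dots> = (\<Sum>j<m. T j (zb i) *\<^sub>R zb j)"
    proof (rule sum.cong[OF refl])
      fix j
      have "field_trace m (\<zeta> ^ i * \<zeta> ^ (m - j)) \<in> \<int>" by (intro trace_int OK_mult zO)
      then obtain k where k: "field_trace m (\<zeta> ^ i * \<zeta> ^ (m - j)) = of_int k" by (auto elim: Ints_cases)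
      have "T j (zb i) = Re (field_trace m (\<zeta> ^ i * \<zeta> ^ (m - j)))"
        unfolding T_def em_mult[OF zK zK, symmetric] Tr_em by (simp add: mult.commute)
      then have "T j (zb i) = of_int k" by (simp add: k)
      then show "em (field_trace m (\<zeta> ^ i * \<zeta> ^ (m - j)) * \<zeta> ^ j) = T j (zb i) *\<^sub>R zb j"
        by (simp add: k em_of_int_mult zK)
    qed
    finally show ?thesis .
  qed
  have "real m *\<^sub>R y = (\<Sum>i<n. c i *\<^sub>R (real m *\<^sub>R zb i))"
    unfolding c by (simp add: scaleR_sum_right mult.commute)
  also have "\<dots> = (\<Sum>i<n. \<Sum>j<m. (c i * T j (zb i)) *\<^sub>R zb j)"
    unfolding zb by (simp add: scaleR_sum_right)
  also have "\<dots> = (\<Sum>j<m. (\<Sum>i<n. c i * T j (zb i)) *\<^sub>R zb j)"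
    by (subst sum.swap) (simp add: scaleR_sum_left)
  also have "\<dots> = (\<Sum>j<m. T j y *\<^sub>R zb j)" unfolding c by (simp add: Tlin)
  also have "\<dots> \<in> zlat n zb"
  proof (rule subgroup_sum[OF zlat_0 zlat_diff])
    fix j
    have "T j y \<in> \<int>" using y unfolding T_def int_dual_iff by (auto intro: OK_power OK_zeta)
    then obtain k where "T j y = of_int k" by (auto elim: Ints_cases)
    moreover have "zb j \<in> zlat n zb" using Zs_zeta_pow[of j] em_Zs by auto
    ultimately show "T j y *\<^sub>R zb j \<in> zlat n zb" by (simp add: zlat_int_scale)
  qed auto
  finally show ?thesis .
qed

lemma em_K_denominator:
  assumes "N > 0" "real N *\<^sub>R y \<in> LO"
  obtains a where "a \<in> K" "y = em a"
proof -
  obtain b where b: "b \<in> OK" "real N *\<^sub>R y = em b" using assms(2) by auto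
  have "y = (1 / real N) *\<^sub>R (real N *\<^sub>R y)" using assms(1) by simp
  also have "\<dots> = em (of_rat (1 / of_nat N) * b)"
    using b em_of_rat_mult[OF OK_K[OF b(1)], of "1 / of_nat N"] by (simp add: of_rat_divide)
  finally show thesis by (rule that[rotated]) (intro K_mult K_of_rat OK_K b(1))
qed

lemma zb_LO: "zlat n zb \<subseteq> LO"
  using em_Zs Zs_OK by auto

lemma LD_em: assumes "y \<in> LD" obtains a where "a \<in> K" "y = em a"
proof -
  have "real m *\<^sub>R y \<in> LO" using LD_denominator[OF assms] zb_LO by blast
  then show thesis by (rule em_K_denominator[rotated]) (use m_pos that in auto)
qed

subsection \<open>Volumes and determinants\<close>

text \<open>Complex conjugation permutes the primitive roots.\<close>

lemma field_trace_real: assumes "x \<in> K" shows "Im (field_trace m x) = 0"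
proof -
  obtain p where p: "x = ev p \<zeta>" using assms by (auto simp: K_iff)
  obtain f where f: "\<And>z. ev f z = 0 \<longleftrightarrow> z \<in> Rt" using Rt_poly by metis
  have cj: "cnj (ev q z) = ev q (cnj z)" for q z
  proof (induction q)
    case (pCons a q)
    have "cnj (of_rat a) = of_rat a"
      by (cases a) (simp add: Fract_of_int_quotient of_rat_divide)
    then show ?case using pCons by (simp add: ev_pCons)
  qed simp
  have "cnj z \<in> Rt" if "z \<in> Rt" for z
    using that f cj[of f z] by (metis complex_cnj_zero)
  then have b: "bij_betw cnj Rt Rt"
    by (intro bij_betw_byWitness[where f' = cnj]) auto
  have "cnj (field_trace m x) = (\<Sum>z\<in>Rt. ev p (cnj z))"
    unfolding p field_trace_ev by (simp add: cj)
  also have "\<dots> = (\<Sum>z\<in>Rt. ev p z)" by (rule sum.reindex_bij_betw[OF b])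
  finally have "cnj (field_trace m x) = field_trace m x" unfolding p field_trace_ev .
  then show ?thesis by (metis complex_cnj_cancel_iff add.inverse_neutral cnj.simps(2) equal_neg_zero)
qed

definition nth_emb :: "nat \<Rightarrow> complex \<Rightarrow> complex"
  where "nth_emb = (SOME h. bij_betw h {..<n} Es)"

lemma nth_emb_bij: "bij_betw nth_emb {..<n} Es"
proof -
  obtain h where "bij_betw h {0..<card Es} Es" using ex_bij_betw_nat_finite[OF finite_embeddings] by blast
  then have "bij_betw h {..<n} Es" by (simp add: card_embeddings atLeast0LessThan)
  then show ?thesis unfolding nth_emb_def by (rule someI[of "\<lambda>h. bij_betw h {..<n} Es"])
qed

lemma nth_emb_in: "j < n \<Longrightarrow> nth_emb j \<in> Es"
  using nth_emb_bij by (auto simp: bij_betw_def)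

lemma sum_nth_emb: "(\<Sum>s\<in>Es. h s) = (\<Sum>j<n. h (nth_emb j))"
  using sum.reindex_bij_betw[OF nth_emb_bij, of h] by simp

lemma prod_nth_emb: "(\<Prod>s\<in>Es. h s) = (\<Prod>j<n. h (nth_emb j))"
  using prod.reindex_bij_betw[OF nth_emb_bij, of h] by simp

definition emb_mat :: "(nat \<Rightarrow> complex) \<Rightarrow> complex mat"
  where "emb_mat w = Matrix.mat n n (\<lambda>(i, j). nth_emb j (w i))"

lemma emb_mat_carrier: "emb_mat w \<in> carrier_mat n n"
  by (simp add: emb_mat_def)

text \<open>The Gram matrix is \<open>emb_mat w\<close> times its conjugate transpose; as traces are
  real, the real part in \<open>ip_K\<close> loses nothing.\<close>

lemma vol_det:
  assumes w: "\<And>i. i < n \<Longrightarrow> w i \<in> K" and b: "basis_seq n (\<lambda>i. em (w i)) KR"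
  shows "KS.vol (zlat n (\<lambda>i. em (w i))) = cmod (Determinant.det (emb_mat w))"
proof -
  interpret cnj: comm_ring_hom cnj by unfold_locales auto
  let ?f = "\<lambda>i. em (w i)"
  let ?H = "map_mat cnj (transpose_mat (emb_mat w))"
  have "map_mat complex_of_real (KS.gram ?f) = emb_mat w * ?H"
  proof (rule eq_matI)
    fix i j assume "i < dim_row (emb_mat w * ?H)" "j < dim_col (emb_mat w * ?H)"
    then have ij: "i < n" "j < n" by (auto simp: emb_mat_def)
    have "field_trace m (w i * cnj (w j)) = (\<Sum>s\<in>Es. s (w i) * cnj (s (w j)))"
      unfolding field_trace_def using w ij by (intro sum.cong refl) (simp add: emb_mult emb_cnj K_cnj)
    moreover have "ip_K m (em (w i)) (em (w j)) = Re (\<Sum>s\<in>Es. s (w i) * cnj (s (w j)))"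
      unfolding ip_K_sum Re_sum by (intro sum.cong refl) (simp add: em_at)
    moreover have "Im (field_trace m (w i * cnj (w j))) = 0"
      using w ij by (intro field_trace_real K_mult K_cnj) auto
    ultimately have "complex_of_real (ip_K m (em (w i)) (em (w j))) = (\<Sum>s\<in>Es. s (w i) * cnj (s (w j)))"
      by (simp add: complex_eq_iff)
    also have "\<dots> = (\<Sum>k<n. nth_emb k (w i) * cnj (nth_emb k (w j)))" by (rule sum_nth_emb)
    finally show "map_mat complex_of_real (KS.gram ?f) $$ (i, j) = (emb_mat w * ?H) $$ (i, j)"
      using ij by (simp add: KS.gram_def emb_mat_def scalar_prod_def atLeast0LessThan)
  qed (auto simp: KS.gram_def emb_mat_def)
  then have "complex_of_real (Determinant.det (KS.gram ?f)) = Determinant.det (emb_mat w * ?H)"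
    by (metis of_real_hom.hom_det)
  also have "\<dots> = Determinant.det (emb_mat w) * Determinant.det ?H"
    using emb_mat_carrier by (intro det_mult) auto
  also have "Determinant.det ?H = cnj (Determinant.det (emb_mat w))"
    using det_transpose[OF emb_mat_carrier[of w]] by simp
  also have "Determinant.det (emb_mat w) * cnj (Determinant.det (emb_mat w)) = of_real ((cmod (Determinant.det (emb_mat w)))\<^sup>2)"
    by (rule complex_norm_square[symmetric])
  finally have "(KS.vol (zlat n ?f))\<^sup>2 = (cmod (Determinant.det (emb_mat w)))\<^sup>2"
    unfolding KS.vol_gram[OF b] of_real_eq_iff .
  then show ?thesis
    by (rule power2_eq_imp_eq[OF _ less_imp_le[OF KS.vol_pos[OF b]] norm_ge_zero])
qed

lemma basis_em_mult:
  assumes w: "\<And>i. i < n \<Longrightarrow> w i \<in> K" and b: "basis_seq n (\<lambda>i. em (w i)) KR" and a: "a \<in> K" "a \<noteq> 0"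
  shows "basis_seq n (\<lambda>i. em (a * w i)) KR"
proof (rule basis_seqI_independent[OF b])
  show "\<And>i. i < n \<Longrightarrow> em (a * w i) \<in> KR" using w a by (intro em_in_KR K_mult) auto
  fix c i assume c: "(\<Sum>i<n. c i *\<^sub>R em (a * w i)) = 0" "i < n"
  have "(\<Sum>i<n. c i *\<^sub>R em (w i)) s = 0" for s
  proof (cases "s \<in> Es")
    case True
    have "s a * (\<Sum>i<n. c i *\<^sub>R em (w i)) s = (\<Sum>i<n. c i *\<^sub>R em (a * w i)) s"
      using w a True by (simp add: fun_at em_at emb_mult sum_distrib_left)
    then show ?thesis using emb_nonzero[OF True a] unfolding c(1) by (simp add: fun_at)
  qed (simp add: fun_at em_at_out)
  then have "(\<Sum>i<n. c i *\<^sub>R em (w i)) = 0" by (intro ext) (simp add: fun_at)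
  then show "c i = 0" using basis_seq_zero[OF b] c(2) by blast
qed

text \<open>Multiplication by a multiplies the columns of \<open>emb_mat\<close> by the conjugates
  of a, so volumes are scaled by the absolute value of the norm.\<close>

lemma vol_em_mult:
  assumes w: "\<And>i. i < n \<Longrightarrow> w i \<in> K" and b: "basis_seq n (\<lambda>i. em (w i)) KR" and a: "a \<in> K" "a \<noteq> 0"
  shows "KS.vol (zlat n (\<lambda>i. em (a * w i))) = (\<Prod>s\<in>Es. cmod (s a)) * KS.vol (zlat n (\<lambda>i. em (w i)))"
proof -
  define D where "D = Matrix.mat n n (\<lambda>(i, j). if i = j then nth_emb j a else 0)"
  have "emb_mat (\<lambda>i. a * w i) = emb_mat w * D"
  proof (rule eq_matI)
    fix i j assume "i < dim_row (emb_mat w * D)" "j < dim_col (emb_mat w * D)"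
    then have ij: "i < n" "j < n" by (auto simp: emb_mat_def D_def)
    have "(emb_mat w * D) $$ (i, j) = (\<Sum>k<n. nth_emb k (w i) * (if k = j then nth_emb j a else 0))"
      using ij by (simp add: emb_mat_def D_def scalar_prod_def atLeast0LessThan)
    also have "\<dots> = nth_emb j (w i) * nth_emb j a" using ij by (simp add: if_distrib cong: if_cong)
    finally show "emb_mat (\<lambda>i. a * w i) $$ (i, j) = (emb_mat w * D) $$ (i, j)"
      using ij w a nth_emb_in by (simp add: emb_mat_def emb_mult)
  qed (auto simp: emb_mat_def D_def)
  then have "Determinant.det (emb_mat (\<lambda>i. a * w i)) = Determinant.det (emb_mat w) * Determinant.det D"
    using det_mult[OF emb_mat_carrier[of w], of D] by (simp add: D_def)
  also have "Determinant.det D = (\<Prod>j<n. nth_emb j a)"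
    by (subst det_lower_triangular[of n]) (auto simp: D_def prod_list_diag_prod atLeast0LessThan)
  finally show ?thesis
    using w a basis_em_mult[OF assms] b
    by (simp add: vol_det K_mult norm_mult prod_norm prod_nth_emb mult.commute)
qed

lemma LO_em_basis: obtains w where "\<And>i. i < n \<Longrightarrow> w i \<in> OK" "basis_seq n (\<lambda>i. em (w i)) KR" "LO = zlat n (\<lambda>i. em (w i))"
proof -
  obtain u where u: "basis_seq n u KR" "LO = zlat n u" by (rule LO_basis)
  have "\<forall>i\<in>{..<n}. \<exists>a\<in>OK. u i = em a" using u(2) zlat_base[of _ n u] by auto
  then obtain w where w: "\<And>i. i < n \<Longrightarrow> w i \<in> OK" "\<And>i. i < n \<Longrightarrow> u i = em (w i)" by (metis lessThan_iff)
  have "basis_seq n (\<lambda>i. em (w i)) KR"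
    by (rule basis_seqI_spanning[OF u(1)])
      (use w in \<open>auto intro!: em_in_KR OK_K intro: span_base\<close>)
  moreover have "zlat n u = zlat n (\<lambda>i. em (w i))" using w(2) by (simp add: zlat_def)
  ultimately show thesis by (intro that[of w]) (use w(1) u(2) in auto)
qed

lemma integral_basis_exists: "\<exists>w. integral_basis m w"
proof -
  obtain w where w: "\<And>i. i < n \<Longrightarrow> w i \<in> OK" "basis_seq n (\<lambda>i. em (w i)) KR" "LO = zlat n (\<lambda>i. em (w i))"
    using LO_em_basis by blast
  have em_lin: "em (\<Sum>i<n. of_int (c i) * w i) = (\<Sum>i<n. of_int (c i) *\<^sub>R em (w i))" for c
    using w(1) by (subst em_sum) (auto simp: em_of_int_mult OK_K intro: K_mult K_of_int)
  have lcK: "(\<Sum>i<n. of_int (c i) * w i) \<in> K" for c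
    using w(1) by (intro K_sum K_mult K_of_int OK_K) auto
  have "integral_basis m w"
    unfolding integral_basis_def
  proof (intro conjI ballI)
    show "w ` {..<n} \<subseteq> OK" using w(1) by auto
    fix x assume x: "x \<in> OK"
    then have "em x \<in> zlat n (\<lambda>i. em (w i))" using w(3) by auto
    then obtain c :: "nat \<Rightarrow> int" where c: "em x = (\<Sum>i<n. of_int (c i) *\<^sub>R em (w i))" by (auto simp: zlat_def)
    show "\<exists>!c. c \<in> {..<n} \<rightarrow>\<^sub>E (UNIV :: int set) \<and> x = (\<Sum>i<n. of_int (c i) * w i)"
    proof (rule ex1I[of _ "restrict c {..<n}"])
      have "em x = em (\<Sum>i<n. of_int (c i) * w i)" by (simp only: c em_lin)
      then have "x = (\<Sum>i<n. of_int (c i) * w i)" using em_inj[OF OK_K[OF x] lcK] by blast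
      then show "restrict c {..<n} \<in> {..<n} \<rightarrow>\<^sub>E UNIV \<and> x = (\<Sum>i<n. of_int (restrict c {..<n} i) * w i)"
        by simp
      fix d assume d: "d \<in> {..<n} \<rightarrow>\<^sub>E (UNIV :: int set) \<and> x = (\<Sum>i<n. of_int (d i) * w i)"
      then have "em x = (\<Sum>i<n. of_int (d i) *\<^sub>R em (w i))" by (simp only: em_lin)
      then have "real_of_int (c i) = real_of_int (d i)" if "i < n" for i
        using basis_seq_unique[OF w(2), of "\<lambda>i. of_int (c i)" "\<lambda>i. of_int (d i)" i] c that by simp
      then show "d = restrict c {..<n}"
        using d by (intro extensionalityI[of _ "{..<n}"]) (auto simp: PiE_def)
    qed
  qed
  then show ?thesis by blast
qed

text \<open>The discriminant is the determinant of M times its transpose, the squared volume that of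
  M times its conjugate transpose; both have the absolute value |det M|^2.\<close>

lemma vol_LO_discriminant: "(KS.vol LO)\<^sup>2 = cmod (discriminant m)"
proof -
  define w where "w = (SOME w. integral_basis m w)"
  have iw: "integral_basis m w" unfolding w_def using integral_basis_exists by (rule someI_ex)
  have wO: "w i \<in> OK" if "i < n" for i using iw that by (auto simp: integral_basis_def)
  have em_lin: "em (\<Sum>i<n. of_int (c i) * w i) = (\<Sum>i<n. of_int (c i) *\<^sub>R em (w i))" for c
    using wO by (subst em_sum) (auto simp: em_of_int_mult OK_K intro: K_mult K_of_int)
  have sub: "LO \<subseteq> zlat n (\<lambda>i. em (w i))"
  proof (intro image_subsetI)
    fix x assume "x \<in> OK"
    then obtain c where "x = (\<Sum>i<n. of_int (c i) * w i)" using iw by (auto simp: integral_basis_def)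
    then show "em x \<in> zlat n (\<lambda>i. em (w i))" unfolding em_lin zlat_def by (auto simp: em_lin)
  qed
  moreover have "zlat n (\<lambda>i. em (w i)) \<subseteq> LO"
    using wO by (intro zlat_subset LO_0 LO_diff) auto
  ultimately have LO: "LO = zlat n (\<lambda>i. em (w i))" by blast
  have b: "basis_seq n (\<lambda>i. em (w i)) KR"
  proof (rule basis_seqI_spanning[OF basis_zb])
    show "\<And>i. i < n \<Longrightarrow> em (w i) \<in> KR" using wO by (intro em_in_KR OK_K)
    fix i
    have "zb i \<in> LO" by (intro imageI OK_power OK_zeta)
    then have "zb i \<in> zlat n (\<lambda>i. em (w i))" using sub by blast
    then show "zb i \<in> span ((\<lambda>i. em (w i)) ` {..<n})" unfolding span_seq zlat_def by auto
  qed
  have "discriminant m = Determinant.det (emb_mat w * transpose_mat (emb_mat w))"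
    unfolding discriminant_def w_def[symmetric] Let_def
  proof (rule arg_cong[of _ _ Determinant.det], rule eq_matI)
    fix i j assume "i < dim_row (emb_mat w * transpose_mat (emb_mat w))" "j < dim_col (emb_mat w * transpose_mat (emb_mat w))"
    then have ij: "i < n" "j < n" by (auto simp: emb_mat_def)
    have "field_trace m (w i * w j) = (\<Sum>s\<in>Es. s (w i) * s (w j))"
      unfolding field_trace_def using wO ij by (intro sum.cong refl) (simp add: emb_mult OK_K)
    also have "\<dots> = (\<Sum>k<n. nth_emb k (w i) * nth_emb k (w j))" by (rule sum_nth_emb)
    finally show "Matrix.mat n n (\<lambda>(i, j). field_trace m (w i * w j)) $$ (i, j) = (emb_mat w * transpose_mat (emb_mat w)) $$ (i, j)"
      using ij by (simp add: emb_mat_def scalar_prod_def atLeast0LessThan)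
  qed (auto simp: emb_mat_def)
  also have "\<dots> = Determinant.det (emb_mat w) * Determinant.det (emb_mat w)"
    using det_mult[OF emb_mat_carrier[of w], of "transpose_mat (emb_mat w)"] det_transpose[OF emb_mat_carrier[of w]] by (simp add: emb_mat_def)
  finally have "cmod (discriminant m) = (cmod (Determinant.det (emb_mat w)))\<^sup>2" by (simp add: norm_mult power2_eq_square)
  then show ?thesis unfolding LO using vol_det[of w] wO b OK_K by simp
qed

lemma vol_LD: "KS.vol LD = 1 / KS.vol LO"
proof -
  obtain w where w: "basis_seq n w KR" "LO = zlat n w" by (rule LO_basis)
  obtain w' where d: "KS.dual_pair w w'" using KS.dual_pair_exists[OF w(1)] .
  have LD: "LD = zlat n w'" using KS.dual_lattice_zlat[OF d] w by (simp add: LD_eq_dual)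
  show ?thesis using KS.vol_dual[OF d] KS.vol_pos[OF w(1)] unfolding LD w(2) by (simp add: field_simps)
qed

section \<open>Bounds for the discriminant and for lengths of vectors\<close>

lemma vol_LO_pos: "KS.vol LO > 0"
  using LO_basis KS.vol_pos by metis

text \<open>The integers are contained in their dual, whose volume is the inverse.\<close>

lemma vol_LO_ge_1: "KS.vol LO \<ge> 1"
proof -
  obtain w where w: "basis_seq n w KR" "LO = zlat n w" by (rule LO_basis)
  obtain w' where w': "basis_seq n w' KR" "LD = zlat n w'" by (rule LD_basis)
  have "KS.vol LD \<le> KS.vol LO"
    using KS.vol_subset[OF w'(1) w(1)] LO_LD w w' by simp
  then have "1 \<le> (KS.vol LO)\<^sup>2" using vol_LO_pos by (simp add: vol_LD field_simps power2_eq_square)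
  then show ?thesis using vol_LO_pos by (metis one_power2 power2_le_imp_le less_imp_le)
qed

lemma ip_zb: "ip_K m (zb i) (zb i) = real n"
  unfolding ip_K_norm using card_embeddings
  by (simp add: em_at emb_power K_zeta norm_power norm_emb_zeta)

text \<open>Hadamard's inequality for the powers of \<zeta>, all of squared length n. It bounds the
  discriminant by n^n.\<close>

lemma vol_LO_le: "(KS.vol LO)\<^sup>2 \<le> real n ^ n"
proof -
  obtain w where w: "basis_seq n w KR" "LO = zlat n w" by (rule LO_basis)
  have "KS.vol LO \<le> KS.vol (zlat n zb)"
    using KS.vol_subset[OF w(1) basis_zb] zb_LO w by simp
  also have "\<dots> \<le> (\<Prod>i<n. sqrt (real n))"
    using KS.vol_hadamard[OF basis_zb] by (simp add: ip_zb)
  finally have "KS.vol LO \<le> sqrt (real n) ^ n" by simp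
  then have "(KS.vol LO)\<^sup>2 \<le> (sqrt (real n) ^ n)\<^sup>2" using vol_LO_pos by (intro power_mono) auto
  also have "\<dots> = real n ^ n" by (simp add: power_mult[symmetric] mult.commute[of n 2]) (simp add: power_mult)
  finally show ?thesis .
qed

text \<open>The inequality of arithmetic and geometric means for the squared absolute values of the
  conjugates of a, whose product is the squared norm.\<close>

lemma em_norm_ge:
  assumes a: "a \<in> K" "a \<noteq> 0" and N: "N > 0" "N \<le> (\<Prod>s\<in>Es. cmod (s a))"
  shows "real n * N powr (2 / real n) \<le> ip_K m (em a) (em a)"
proof -
  let ?A = "\<Prod>s\<in>Es. cmod (s a)"
  have "(\<Prod>s\<in>Es. (cmod (s a))\<^sup>2) = ?A\<^sup>2" by (simp add: prod_power_distrib)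
  moreover have "(\<Prod>s\<in>Es. (cmod (s a))\<^sup>2) powr (1 / card Es) \<le> (\<Sum>s\<in>Es. (cmod (s a))\<^sup>2 / card Es)"
    by (rule arith_geom_mean[OF finite_embeddings Es_nonempty]) simp
  ultimately have "(?A\<^sup>2) powr (1 / real n) \<le> (\<Sum>s\<in>Es. (cmod (s a))\<^sup>2) / real n"
    by (simp add: card_embeddings sum_divide_distrib)
  then have "(?A\<^sup>2) powr (1 / real n) * real n \<le> (\<Sum>s\<in>Es. (cmod (s a))\<^sup>2)"
    using n_pos by (simp add: pos_le_divide_eq)
  also have "\<dots> = ip_K m (em a) (em a)" unfolding ip_K_norm by (intro sum.cong) (auto simp: em_at)
  finally have 1: "(?A\<^sup>2) powr (1 / real n) * real n \<le> ip_K m (em a) (em a)" .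
  have A: "?A > 0" using N by linarith
  have "N powr (2 / real n) \<le> ?A powr (2 / real n)" using N by (intro powr_mono2) auto
  also have "\<dots> = (?A\<^sup>2) powr (1 / real n)"
    using A by (simp add: powr_powr powr_realpow[symmetric] del: powr_numeral)
  finally have "N powr (2 / real n) * real n \<le> (?A\<^sup>2) powr (1 / real n) * real n" by (intro mult_right_mono) auto
  then show ?thesis using 1 by (simp add: mult.commute)
qed

text \<open>Write y as the image of a in K. Then a times the integers is a sublattice of
  \<open>LD\<close>, so the norm of a is at least the quotient of the volumes of \<open>LD\<close>
  and \<open>LO\<close>.\<close>

lemma LD_norm_ge:
  assumes y: "y \<in> LD" "y \<noteq> 0"
  shows "real n * (1 / (KS.vol LO)\<^sup>2) powr (2 / real n) \<le> ip_K m y y"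
proof -
  obtain a where a: "a \<in> K" "y = em a" using LD_em[OF y(1)] .
  then have a0: "a \<noteq> 0" using y(2) em_0 by auto
  obtain w where w: "\<And>i. i < n \<Longrightarrow> w i \<in> OK" "basis_seq n (\<lambda>i. em (w i)) KR" "LO = zlat n (\<lambda>i. em (w i))"
    using LO_em_basis by blast
  have wK: "i < n \<Longrightarrow> w i \<in> K" for i using w(1) OK_K by blast
  obtain w' where w': "basis_seq n w' KR" "LD = zlat n w'" by (rule LD_basis)
  have "zlat n (\<lambda>i. em (a * w i)) \<subseteq> LD"
  proof (rule zlat_subset[OF LD_0 LD_diff])
    fix i assume "i < n"
    then have "em (a * w i) = em (w i) * y" using a wK by (simp add: em_mult mult.commute)
    then show "em (a * w i) \<in> LD" using LD_mult[OF y(1) w(1)[OF \<open>i < n\<close>]] by simp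
  qed auto
  then have "KS.vol LD \<le> KS.vol (zlat n (\<lambda>i. em (a * w i)))"
    using KS.vol_subset[OF w'(1) basis_em_mult[OF wK w(2) a(1) a0]] w'(2) by simp
  also have "\<dots> = (\<Prod>s\<in>Es. cmod (s a)) * KS.vol LO"
    using vol_em_mult[OF wK w(2) a(1) a0] w(3) by simp
  finally have "1 / (KS.vol LO)\<^sup>2 \<le> (\<Prod>s\<in>Es. cmod (s a))"
    using vol_LO_pos by (simp add: vol_LD field_simps power2_eq_square)
  then show ?thesis using em_norm_ge[OF a(1) a0] vol_LO_pos unfolding a(2) by simp
qed

end

lemma zspan_add: "x \<in> zspan S \<Longrightarrow> y \<in> zspan S \<Longrightarrow> x + y \<in> zspan S"
  using zspan_diff[of x S "0 - y"] zspan_diff[OF zspan_0, of y S] by simp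

context cyclo
begin

section \<open>The ambient space E of dimension 2n\<close>

sublocale ES: euclid "E_space m" "ip_E m" "n + n"
  using euclid_prod[OF KS.euclid_axioms KS.euclid_axioms]
  by (simp add: E_space_def ip_E_def[abs_def])

lemma em_1_mult: "y \<in> KR \<Longrightarrow> em 1 * y = y"
  by (rule ext) (metis KR_support em_at emb_1 mult_1 mult_zero_right times_fun_apply)

lemma em_nat_mult: "y \<in> KR \<Longrightarrow> em (of_nat k) * y = real k *\<^sub>R y"
  using em_of_nat_mult[OF K_1, of k] em_1_mult[of y]
  by (simp add: fun_eq_iff fun_at)

lemma em_mult_scaleR: "em a * (c *\<^sub>R y) = c *\<^sub>R (em a * y)" "(c *\<^sub>R y) * em a = c *\<^sub>R (y * em a)"
  by (rule ext, simp add: fun_at)+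

end

context cyclo_prime
begin

abbreviation "q \<equiv> residue_card m P"
abbreviation "LP \<equiv> em ` P"

lemma P_K: "a \<in> P \<Longrightarrow> a \<in> K"
  by (intro OK_K P_OK)

lemma LP_diff: "x \<in> LP \<Longrightarrow> y \<in> LP \<Longrightarrow> x - y \<in> LP"
proof -
  assume "x \<in> LP" "y \<in> LP"
  then obtain a b where "a \<in> P" "b \<in> P" "x = em a" "y = em b" by auto
  then show ?thesis by (intro image_eqI[of _ _ "a - b"]) (auto simp: em_diff P_K intro: P_diff)
qed

lemma LP_basis: obtains u where "basis_seq n u KR" "LP = zlat n u"
proof -
  obtain w where w: "basis_seq n w KR" "LO = zlat n w" by (rule LO_basis)
  have b: "basis_seq n (\<lambda>i. real p *\<^sub>R w i) KR" using p_pos by (intro basis_seq_scale w(1)) simp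
  show thesis
  proof (rule KS.sublattice[OF b _ LP_diff])
    show "0 \<in> LP" by (rule image_eqI[of _ _ 0]) (auto simp: em_0 P_0)
    show "LP \<subseteq> KR" by (auto intro: em_in_KR P_K)
    show "p > 0" by (rule p_pos)
    fix x assume "x \<in> LP"
    then have "x \<in> zlat n w" using w(2) P_OK by auto
    then show "real p *\<^sub>R x \<in> zlat n (\<lambda>i. real p *\<^sub>R w i)" unfolding zlat_scale by blast
  next
    fix i assume "i < n"
    then have "w i \<in> LO" using w(2) zlat_base by auto
    then obtain a where a: "a \<in> OK" "w i = em a" by auto
    then have "real p *\<^sub>R w i = em (a * of_nat p)"
      using em_of_nat_mult[of a p] OK_K by (simp add: mult.commute)
    then show "real p *\<^sub>R w i \<in> LP" using P_mult[OF p_in_P a(1)] by blast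
  qed (use that in auto)
qed

lemma vol_LP: "KS.vol LP = real q * KS.vol LO"
proof -
  obtain w where w: "basis_seq n w KR" "LO = zlat n w" by (rule LO_basis)
  obtain u where u: "basis_seq n u KR" "LP = zlat n u" by (rule LP_basis)
  obtain Y where Y: "finite Y" "Y \<subseteq> OK" "card Y = q" "\<And>x. x \<in> OK \<Longrightarrow> \<exists>!y. y \<in> Y \<and> x - y \<in> P"
    using residue_representatives by blast
  have inj: "inj_on em OK" using em_inj OK_K by (auto intro: inj_onI)
  have "KS.vol (zlat n u) = real (card (em ` Y)) * KS.vol (zlat n w)"
  proof (rule KS.vol_index[OF w(1) u(1)])
    show "zlat n u \<subseteq> zlat n w" using P_OK by (auto simp flip: u(2) w(2))
    show "finite (em ` Y)" using Y by simp
    show "em ` Y \<subseteq> zlat n w" using Y(2) w(2) by auto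
    fix x assume "x \<in> zlat n w"
    then obtain a where a: "a \<in> OK" "x = em a" using w(2) by auto
    have iff: "em a - em y \<in> zlat n u \<longleftrightarrow> a - y \<in> P" if "y \<in> OK" for y
    proof -
      have "em a - em y \<in> LP \<longleftrightarrow> em (a - y) \<in> LP" using that a by (simp add: em_diff OK_K)
      also have "\<dots> \<longleftrightarrow> a - y \<in> P" using inj_on_image_mem_iff[OF inj, of "a - y" P] that a OK_diff P_OK by blast
      finally show ?thesis using u(2) by simp
    qed
    obtain y where y: "y \<in> Y" "a - y \<in> P" using Y(4)[OF a(1)] by blast
    show "\<exists>!v. v \<in> em ` Y \<and> x - v \<in> zlat n u"
    proof (rule ex1I[of _ "em y"])
      show "em y \<in> em ` Y \<and> x - em y \<in> zlat n u" using y iff Y(2) a by auto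
      fix v assume v: "v \<in> em ` Y \<and> x - v \<in> zlat n u"
      then obtain z where z: "z \<in> Y" "v = em z" by auto
      then have "a - z \<in> P" using v iff[of z] Y(2) a by auto
      then show "v = em y" using Y(4)[OF a(1)] y z by metis
    qed
  qed
  moreover have "card (em ` Y) = q" using inj Y by (metis card_image inj_on_subset)
  ultimately show ?thesis using u w by simp
qed

lemma q_ge_2: "q \<ge> 2"
proof -
  obtain Y where Y: "finite Y" "card Y = q" "\<And>x. x \<in> OK \<Longrightarrow> \<exists>!y. y \<in> Y \<and> x - y \<in> P"
    using residue_representatives by metis
  obtain y where y: "y \<in> Y" "0 - y \<in> P" using Y(3)[OF OK_0] by blast
  obtain z where z: "z \<in> Y" "1 - z \<in> P" using Y(3)[OF OK_1] by blast
  have "y \<noteq> z"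
  proof
    assume "y = z"
    then have "1 = (1 - z) - (0 - y)" by simp
    also have "\<dots> \<in> P" by (rule P_diff[OF z(2) y(2)])
    finally show False using one_notin_P by simp
  qed
  then have "card {y, z} = 2" by simp
  moreover have "card {y, z} \<le> card Y" using y z Y(1) by (intro card_mono) auto
  ultimately show ?thesis using Y(2) by simp
qed

subsection \<open>The inverse different of the prime ideal\<close>

text \<open>\<open>W\<close> is the product of the inverse of \<open>P\<close> with the dual of the integers, see \<open>W_eq_zspan\<close>.\<close>

definition W :: "mink set" where "W = {y \<in> KR. \<forall>a\<in>P. em a * y \<in> LD}"

lemma W_KR: "y \<in> W \<Longrightarrow> y \<in> KR"
  by (simp add: W_def)

lemma W_P: "y \<in> W \<Longrightarrow> a \<in> P \<Longrightarrow> em a * y \<in> LD"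
  by (simp add: W_def)

lemma W_0: "0 \<in> W"
  by (auto simp: W_def LD_0)

lemma W_diff: "x \<in> W \<Longrightarrow> y \<in> W \<Longrightarrow> x - y \<in> W"
  by (auto simp: W_def right_diff_distrib intro: LD_diff KS.V_closed(3))

lemma W_add: "x \<in> W \<Longrightarrow> y \<in> W \<Longrightarrow> x + y \<in> W"
  by (auto simp: W_def distrib_left intro: LD_add KS.V_closed(2))

lemma LD_W: "y \<in> LD \<Longrightarrow> y \<in> W"
  by (auto simp: W_def LD_KR intro: LD_mult P_OK)

lemma W_mult: "y \<in> W \<Longrightarrow> a \<in> OK \<Longrightarrow> em a * y \<in> W"
  unfolding W_def by (auto simp: KR_mult OK_K mult.left_commute[of _ "em a"] intro: LD_mult)

lemma p_W: "y \<in> W \<Longrightarrow> real p *\<^sub>R y \<in> LD"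
  by (metis W_P W_KR em_nat_mult p_in_P)

lemma W_iff: "y \<in> W \<longleftrightarrow> y \<in> KR \<and> (\<forall>a\<in>P. Tr (em a * y) \<in> \<int>)"
proof
  assume y: "y \<in> W"
  show "y \<in> KR \<and> (\<forall>a\<in>P. Tr (em a * y) \<in> \<int>)"
  proof (intro conjI ballI W_KR[OF y])
    fix a assume a: "a \<in> P"
    have "Tr (em 1 * (em a * y)) \<in> \<int>" using W_P[OF y a] OK_1 unfolding int_dual_iff by blast
    then show "Tr (em a * y) \<in> \<int>" using em_1_mult[OF LD_KR[OF W_P[OF y a]]] by simp
  qed
next
  assume y: "y \<in> KR \<and> (\<forall>a\<in>P. Tr (em a * y) \<in> \<int>)"
  show "y \<in> W"
    unfolding W_def int_dual_iff
  proof (intro CollectI conjI ballI)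
    show "y \<in> KR" using y by simp
    fix a assume a: "a \<in> P"
    show "em a * y \<in> KR" using y a by (intro KR_mult P_K) auto
    fix b assume b: "b \<in> OK"
    have "em b * (em a * y) = em (b * a) * y" using a b by (simp add: em_mult OK_K P_K mult.assoc)
    then show "Tr (em b * (em a * y)) \<in> \<int>" using y P_mult[OF a b] by simp
  qed
qed

text \<open>t is invertible modulo P, and multiplication by elements of P maps W into
  \<open>LD\<close>.\<close>

lemma W_cancel:
  assumes t: "t \<in> OK" "t \<notin> P" and y: "y \<in> W" "em t * y \<in> LD"
  shows "y \<in> LD"
proof -
  obtain b where b: "b \<in> OK" "1 - t * b \<in> P" using residue_inverse[OF t] .
  have "em 1 = em b * em t + em (1 - t * b)"
    using t b OK_K P_K em_mult[of b t] em_add[of "b * t" "1 - t * b"] K_mult by (simp add: mult.commute)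
  then have "em 1 * y = em b * (em t * y) + em (1 - t * b) * y" by (simp add: distrib_right mult.assoc)
  then have "y = em b * (em t * y) + em (1 - t * b) * y" using em_1_mult[OF W_KR[OF y(1)]] by simp
  also have "\<dots> \<in> LD" by (rule LD_add[OF LD_mult[OF y(2) b(1)] W_P[OF y(1) b(2)]])
  finally show ?thesis .
qed

text \<open>With 1 = e + e' p, an element y of W is 1 (e y) + e' (p y), where e y and p y lie in
  \<open>LD\<close> and 1 and e' in the inverse of P.\<close>

lemma W_eq_zspan: "zspan {em a * y | a y. a \<in> ideal_inverse m P \<and> y \<in> LD} = W"
proof
  show "zspan {em a * y | a y. a \<in> ideal_inverse m P \<and> y \<in> LD} \<subseteq> W"
  proof (rule zspan_subset[OF W_0 W_diff])
    show "{em a * y | a y. a \<in> ideal_inverse m P \<and> y \<in> LD} \<subseteq> W"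
    proof safe
      fix a y assume a: "a \<in> ideal_inverse m P" and y: "y \<in> LD"
      have aK: "a \<in> K" using a by (simp add: ideal_inverse_def)
      show "em a * y \<in> W"
        unfolding W_def
      proof (intro CollectI conjI ballI)
        show "em a * y \<in> KR" using aK y by (intro KR_mult LD_KR)
        fix b assume b: "b \<in> P"
        then have "a * b \<in> OK" using a by (simp add: ideal_inverse_def)
        moreover have "em b * (em a * y) = em (a * b) * y"
          using aK b by (simp add: em_mult P_K mult.assoc mult.left_commute)
        ultimately show "em b * (em a * y) \<in> LD" using y by (simp add: LD_mult)
      qed
    qed
  qed auto
  show "W \<subseteq> zspan {em a * y | a y. a \<in> ideal_inverse m P \<and> y \<in> LD}" (is "_ \<subseteq> zspan ?S")
  proof
    fix y assume y: "y \<in> W"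
    obtain e e' where e: "e \<in> P" "e' \<in> ideal_inverse m P" "1 = e + e' * of_nat p"
      by (rule ideal_inverse_partition)
    have e'K: "e' \<in> K" using e by (simp add: ideal_inverse_def)
    have 1: "(1::complex) \<in> ideal_inverse m P" by (simp add: ideal_inverse_def K_1 P_OK)
    have "em 1 = em e + em e' * em (of_nat p)"
      using e e'K P_K K_of_nat em_mult[of e' "of_nat p"] em_add[of e "e' * of_nat p"] K_mult by metis
    then have "y = em e * y + em e' * (em (of_nat p) * y)"
      using em_1_mult[OF W_KR[OF y]] by (metis distrib_right mult.assoc)
    also have "\<dots> = em 1 * (em e * y) + em e' * (real p *\<^sub>R y)"
      using em_1_mult[OF LD_KR[OF W_P[OF y e(1)]]] em_nat_mult[OF W_KR[OF y]] by simp
    also have "\<dots> \<in> zspan ?S"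
      using 1 e W_P[OF y e(1)] p_W[OF y] by (intro zspan_add zspan_base) blast+
    finally show "y \<in> zspan ?S" .
  qed
qed

lemma mink_cnj_lincomb: "mink_cnj (\<Sum>i<k. c i *\<^sub>R u i) = (\<Sum>i<k. c i *\<^sub>R mink_cnj (u i))"
  by (rule ext) (simp add: mink_cnj_def fun_at)

lemma basis_mink_cnj:
  assumes "basis_seq n u KR" shows "basis_seq n (\<lambda>i. mink_cnj (u i)) KR"
proof (rule basis_seqI_independent[OF assms])
  show "\<And>i. i < n \<Longrightarrow> mink_cnj (u i) \<in> KR" using basis_seq_in[OF assms] by (intro KR_cnj)
  fix c i assume "(\<Sum>i<n. c i *\<^sub>R mink_cnj (u i)) = 0" "i < n"
  then have "mink_cnj (mink_cnj (\<Sum>i<n. c i *\<^sub>R u i)) = mink_cnj 0"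
    unfolding mink_cnj_lincomb[of _ u] by (simp only:)
  then show "c i = 0" using basis_seq_zero[OF assms, of c i] \<open>i < n\<close> by (simp only: mink_cnj_linear)
qed

lemma zlat_mink_cnj: "zlat n (\<lambda>i. mink_cnj (u i)) = mink_cnj ` zlat n u"
  unfolding zlat_def image_image mink_cnj_lincomb ..

text \<open>Up to conjugation, which preserves lengths, W is the dual lattice of P, and P has index
  q in the integers.\<close>

lemma W_basis_vol: obtains g where "basis_seq n g KR" "W = zlat n g" "KS.vol W = 1 / (real q * KS.vol LO)"
proof -
  obtain u where u: "basis_seq n u KR" "LP = zlat n u" by (rule LP_basis)
  obtain u' where d: "KS.dual_pair u u'" using KS.dual_pair_exists[OF u(1)] .
  have u': "basis_seq n u' KR" using d by (simp add: KS.dual_pair_def)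
  let ?g = "\<lambda>i. mink_cnj (u' i)"
  have iff: "y \<in> W \<longleftrightarrow> mink_cnj y \<in> zlat n u'" for y
  proof -
    have "zlat n u' = dual_lattice KR (ip_K m) LP" using KS.dual_lattice_zlat[OF d] u(2) by simp
    moreover have "ip_K m (mink_cnj y) (em a) = Tr (em a * y)" for a
      unfolding KS.ip_sym[of "mink_cnj y"] Tr_ip_K ..
    moreover have "mink_cnj y \<in> KR \<longleftrightarrow> y \<in> KR" using KR_cnj[of y] KR_cnj[of "mink_cnj y"] by (auto simp: mink_cnj_linear)
    ultimately show ?thesis by (simp add: W_iff dual_lattice_def)
  qed
  have W: "W = zlat n ?g"
    unfolding zlat_mink_cnj
  proof (intro equalityI subsetI)
    fix y assume "y \<in> W"
    then have "mink_cnj y \<in> zlat n u'" using iff by blast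
    then show "y \<in> mink_cnj ` zlat n u'" by (rule rev_image_eqI) (simp only: mink_cnj_linear)
  next
    fix y assume "y \<in> mink_cnj ` zlat n u'"
    then obtain z where "z \<in> zlat n u'" "y = mink_cnj z" by blast
    then have "mink_cnj y \<in> zlat n u'" by (simp only: mink_cnj_linear)
    then show "y \<in> W" using iff by blast
  qed
  have "KS.vol W = KS.vol (zlat n u')"
    unfolding W by (rule KS.vol_gram_eq[OF basis_mink_cnj[OF u'] u']) (rule ip_K_cnj)
  also have "\<dots> = 1 / KS.vol LP"
    using KS.vol_dual[OF d] KS.vol_pos[OF u(1)] unfolding u(2) by (simp add: field_simps)
  finally show thesis using that[OF basis_mink_cnj[OF u'] W] by (simp add: vol_LP)
qed

text \<open>W/\<open>LD\<close> is a line over the residue field, so any v outside \<open>LD\<close>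
  generates it. This is proved by duality: an element of the dual of M is an integer whose conjugate
  maps v into \<open>LD\<close>; by \<open>W_cancel\<close> the conjugate lies in P and therefore
  pairs integrally with y. So y is in the double dual of M, which is M.\<close>

lemma W_generated:
  assumes v: "v \<in> W" "v \<notin> LD" and y: "y \<in> W"
  obtains c where "c \<in> OK" "y - em c * v \<in> LD"
proof -
  define M where "M = {z \<in> KR. \<exists>c\<in>OK. z - em c * v \<in> LD}"
  obtain f where f: "basis_seq n f KR" "LD = zlat n f" by (rule LD_basis)
  have M_W: "z \<in> M \<Longrightarrow> z \<in> W" for z
  proof -
    assume "z \<in> M"
    then obtain c where c: "c \<in> OK" "z - em c * v \<in> LD" by (auto simp: M_def)
    have "(z - em c * v) + em c * v \<in> W" by (rule W_add[OF LD_W[OF c(2)] W_mult[OF v(1) c(1)]])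
    then show "z \<in> W" by simp
  qed
  have LD_M: "z \<in> LD \<Longrightarrow> z \<in> M" for z
    unfolding M_def using LD_KR OK_0 by (auto simp: em_0 intro!: bexI[of _ 0])
  have M_diff: "x - z \<in> M" if xz: "x \<in> M" "z \<in> M" for x z
  proof -
    obtain c d where c: "c \<in> OK" "x - em c * v \<in> LD" and d: "d \<in> OK" "z - em d * v \<in> LD"
      using xz by (auto simp: M_def)
    have "(x - z) - em (c - d) * v = (x - em c * v) - (z - em d * v)"
      using c d by (simp add: em_diff OK_K algebra_simps)
    then have "(x - z) - em (c - d) * v \<in> LD" using LD_diff[OF c(2) d(2)] by (simp only:)
    moreover have "x - z \<in> KR" using xz KS.V_closed(3) by (auto simp: M_def)
    ultimately show ?thesis unfolding M_def using OK_diff[OF c(1) d(1)] by blast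
  qed
  obtain g where g: "basis_seq n g KR" "M = zlat n g"
  proof (rule KS.sublattice[OF f(1) LD_M[OF LD_0] M_diff])
    show "M \<subseteq> KR" by (auto simp: M_def)
    show "\<And>i. i < n \<Longrightarrow> f i \<in> M" using LD_M f(2) zlat_base[of _ n f] by blast
    show "p > 0" by (rule p_pos)
    show "\<And>x. x \<in> M \<Longrightarrow> real p *\<^sub>R x \<in> zlat n f" using p_W[OF M_W] f(2) by simp
  qed auto
  obtain g' where d: "KS.dual_pair g g'" using KS.dual_pair_exists[OF g(1)] .
  have dM: "zlat n g' = dual_lattice KR (ip_K m) M" using KS.dual_lattice_zlat[OF d] g(2) by simp
  have int: "ip_K m y x \<in> \<int>" if x: "x \<in> zlat n g'" for x
  proof -
    have x1: "x \<in> KR" "\<And>z. z \<in> M \<Longrightarrow> ip_K m x z \<in> \<int>" using x unfolding dM dual_lattice_def by auto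
    have "x \<in> LO"
      using x1 LD_M[OF LD_cnj] by (intro dual_LD) (auto simp: Tr_ip_K)
    then obtain c where c: "c \<in> OK" "x = em c" by auto
    have cc: "cnj c \<in> OK" using c by (intro OK_cnj)
    have "em (cnj c) * v \<in> LD"
      unfolding int_dual_iff
    proof (intro conjI ballI)
      show "em (cnj c) * v \<in> KR" using cc v(1) by (intro KR_mult OK_K W_KR)
      fix b assume b: "b \<in> OK"
      have "em b * v \<in> KR" by (rule KR_mult[OF W_KR[OF v(1)] OK_K[OF b]])
      then have "em b * v \<in> M" unfolding M_def using b LD_0 by (auto intro!: bexI[of _ b])
      then have "ip_K m x (em b * v) \<in> \<int>" by (rule x1(2))
      then have "ip_K m (em b * v) x \<in> \<int>" by (simp only: KS.ip_sym[of x])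
      then show "Tr (em b * (em (cnj c) * v)) \<in> \<int>"
        using c by (simp add: ip_K_Tr mink_cnj_em OK_K mult_ac)
    qed
    then have "cnj c \<in> P" using W_cancel[OF cc _ v(1)] v(2) by blast
    then have "Tr (em (cnj c) * y) \<in> \<int>" using y by (simp add: W_iff)
    then show ?thesis using c by (simp add: ip_K_Tr mink_cnj_em OK_K mult.commute)
  qed
  have "y \<in> zlat n g"
    unfolding KS.zlat_dual_iff[OF d] using int zlat_base W_KR[OF y] by auto
  then show thesis using that g(2) by (auto simp: M_def)
qed

subsection \<open>The lattices of the family\<close>

abbreviation "\<alpha> \<equiv> alpha m P"

lemma alpha_eq: "\<alpha> = (real q * (KS.vol LO)\<^sup>2) powr (1 / (2 * real n))"
  by (simp add: alpha_def vol_LO_discriminant)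

lemma alpha_pos: "\<alpha> > 0"
  unfolding alpha_eq using q_ge_2 vol_LO_pos by simp

lemma alpha_sq: "\<alpha>\<^sup>2 = (real q * (KS.vol LO)\<^sup>2) powr (1 / real n)"
proof -
  have "\<alpha>\<^sup>2 = \<alpha> powr real 2" by (rule powr_realpow[symmetric, OF alpha_pos])
  also have "\<dots> = (real q * (KS.vol LO)\<^sup>2) powr (1 / real n)"
    unfolding alpha_eq powr_powr by simp
  finally show ?thesis .
qed

text \<open>In these coordinates \<open>\<Lambda>\<^sub>0\<close> is the product of the integers and \<open>W\<close>, without the factor \<open>\<alpha>\<close>.\<close>

definition pt :: "complex \<Rightarrow> mink \<Rightarrow> mink \<times> mink"
  where "pt a y = (inverse \<alpha> *\<^sub>R em a, \<alpha> *\<^sub>R y)"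

lemma pt_eq_iff: "a \<in> K \<Longrightarrow> b \<in> K \<Longrightarrow> pt a y = pt b z \<longleftrightarrow> a = b \<and> y = z"
  using alpha_pos by (auto simp: pt_def em_inj)

lemma pt_diff: "a \<in> K \<Longrightarrow> b \<in> K \<Longrightarrow> pt a y - pt b z = pt (a - b) (y - z)"
  by (simp add: pt_def em_diff scaleR_diff_right)

lemma pt_add: "a \<in> K \<Longrightarrow> b \<in> K \<Longrightarrow> pt a y + pt b z = pt (a + b) (y + z)"
  by (simp add: pt_def em_add scaleR_add_right)

lemma pt_0: "pt 0 0 = 0"
  by (simp add: pt_def em_0 zero_prod_def)

lemma pt_scale_nat: "a \<in> K \<Longrightarrow> real k *\<^sub>R pt a y = pt (of_nat k * a) (real k *\<^sub>R y)"
  by (simp add: pt_def em_of_nat_mult)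

lemma smult_pt: "a \<in> K \<Longrightarrow> c \<in> K \<Longrightarrow> smult_E m c (pt a y) = pt (c * a) (em c * y)"
  by (simp add: smult_E_def pt_def em_mult em_mult_scaleR)

abbreviation "\<Lambda>0 \<equiv> Lambda0 m P"
abbreviation "P\<Lambda> \<equiv> P_Lambda0 m P"

lemma Lambda0_prod: "\<Lambda>0 = (\<lambda>x. inverse \<alpha> *\<^sub>R x) ` LO \<times> (\<lambda>x. \<alpha> *\<^sub>R x) ` W"
  by (simp add: Lambda0_def W_eq_zspan)

lemma Lambda0_iff: "x \<in> \<Lambda>0 \<longleftrightarrow> (\<exists>a\<in>OK. \<exists>y\<in>W. x = pt a y)"
  by (cases x) (auto simp: Lambda0_prod pt_def)

text \<open>In the first coordinate P times the integers is P; in the second, P cancels against its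
  inverse and leaves \<open>LD\<close>.\<close>

lemma PLambda_iff: "x \<in> P\<Lambda> \<longleftrightarrow> (\<exists>a\<in>P. \<exists>y\<in>LD. x = pt a y)"
proof
  have sub: "P\<Lambda> \<subseteq> {x. \<exists>a\<in>P. \<exists>y\<in>LD. x = pt a y}"
    unfolding P_Lambda0_def
  proof (rule zspan_subset)
    show "0 \<in> {x. \<exists>a\<in>P. \<exists>y\<in>LD. x = pt a y}" using P_0 LD_0 pt_0 by force
    show "\<And>x z. x \<in> {x. \<exists>a\<in>P. \<exists>y\<in>LD. x = pt a y} \<Longrightarrow> z \<in> {x. \<exists>a\<in>P. \<exists>y\<in>LD. x = pt a y}
        \<Longrightarrow> x - z \<in> {x. \<exists>a\<in>P. \<exists>y\<in>LD. x = pt a y}"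
      using pt_diff P_K P_diff LD_diff by blast
    show "{smult_E m a x |a x. a \<in> P \<and> x \<in> \<Lambda>0} \<subseteq> {x. \<exists>a\<in>P. \<exists>y\<in>LD. x = pt a y}"
    proof (intro subsetI)
      fix z assume "z \<in> {smult_E m a x |a x. a \<in> P \<and> x \<in> \<Lambda>0}"
      then obtain a x where a: "a \<in> P" and "x \<in> \<Lambda>0" and z: "z = smult_E m a x" by blast
      then obtain b y where b: "b \<in> OK" "y \<in> W" "x = pt b y" by (auto simp: Lambda0_iff)
      then have "z = pt (a * b) (em a * y)" using a z by (simp add: smult_pt OK_K P_K)
      moreover have "a * b \<in> P" "em a * y \<in> LD" using a b P_mult_right W_P by blast+
      ultimately show "z \<in> {x. \<exists>a\<in>P. \<exists>y\<in>LD. x = pt a y}" by blast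
    qed
  qed
  then show "x \<in> P\<Lambda> \<Longrightarrow> \<exists>a\<in>P. \<exists>y\<in>LD. x = pt a y" by blast
next
  assume "\<exists>a\<in>P. \<exists>y\<in>LD. x = pt a y"
  then obtain a y where a: "a \<in> P" and y: "y \<in> LD" and x: "x = pt a y" by blast
  have mem: "pt (b * c) (em b * z) \<in> P\<Lambda>" if "b \<in> P" "c \<in> OK" "z \<in> W" for b c z
    unfolding P_Lambda0_def
  proof (rule zspan_base)
    have "pt c z \<in> \<Lambda>0" using that by (auto simp: Lambda0_iff)
    moreover have "pt (b * c) (em b * z) = smult_E m b (pt c z)"
      using that by (simp add: smult_pt P_K OK_K)
    ultimately show "pt (b * c) (em b * z) \<in> {smult_E m a x |a x. a \<in> P \<and> x \<in> \<Lambda>0}"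
      using that(1) by blast
  qed
  obtain e e' where e: "e \<in> P" "e' \<in> ideal_inverse m P" "1 = e + e' * of_nat p"
    by (rule ideal_inverse_partition)
  have e'K: "e' \<in> K" using e by (simp add: ideal_inverse_def)
  have e'y: "em e' * y \<in> W"
    using e(2) y W_eq_zspan zspan_base[of "em e' * y" "{em a * y |a y. a \<in> ideal_inverse m P \<and> y \<in> LD}"] by blast
  have "em 1 = em e + em (of_nat p) * em e'"
    using e e'K P_K K_of_nat em_mult[of "of_nat p" e'] em_add[of e "of_nat p * e'"] K_mult by (metis mult.commute)
  then have "y = em e * y + em (of_nat p) * (em e' * y)"
    using em_1_mult[OF LD_KR[OF y]] by (metis distrib_right mult.assoc)
  \<comment> \<open>Each summand is a scalar of P times a vector of \<open>\<Lambda>0\<close>: y is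
    split by 1 = e + p e' into e y and p (e' y), where y and e' y lie in W.\<close>
  then have "x = pt (a * 1) (em a * 0) + (pt (e * 0) (em e * y) + pt (of_nat p * 0) (em (of_nat p) * (em e' * y)))"
    using x a K_0 by (simp add: pt_add P_K)
  also have "\<dots> \<in> P\<Lambda>"
    unfolding P_Lambda0_def
  proof (intro zspan_add)
    show "pt (a * 1) (em a * 0) \<in> zspan {smult_E m a x |a x. a \<in> P \<and> x \<in> \<Lambda>0}"
      using mem[OF a OK_1 W_0] by (simp add: P_Lambda0_def)
    show "pt (e * 0) (em e * y) \<in> zspan {smult_E m a x |a x. a \<in> P \<and> x \<in> \<Lambda>0}"
      using mem[OF e(1) OK_0 LD_W[OF y]] by (simp add: P_Lambda0_def)
    show "pt (of_nat p * 0) (em (of_nat p) * (em e' * y)) \<in> zspan {smult_E m a x |a x. a \<in> P \<and> x \<in> \<Lambda>0}"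
      using mem[OF p_in_P OK_0 e'y] by (simp add: P_Lambda0_def)
  qed
  finally show "x \<in> P\<Lambda>" .
qed

lemma PLambda_0: "0 \<in> P\<Lambda>"
  unfolding PLambda_iff using P_0 LD_0 pt_0 by metis

lemma PLambda_diff: "x \<in> P\<Lambda> \<Longrightarrow> y \<in> P\<Lambda> \<Longrightarrow> x - y \<in> P\<Lambda>"
  unfolding PLambda_iff using P_diff LD_diff P_K pt_diff by metis

lemma PLambda_uminus: "x \<in> P\<Lambda> \<Longrightarrow> - x \<in> P\<Lambda>"
  using PLambda_diff[OF PLambda_0] by simp

lemma residue_proj_eq_iff: "residue_proj m P x = residue_proj m P y \<longleftrightarrow> x - y \<in> P\<Lambda>"
proof
  assume "residue_proj m P x = residue_proj m P y"
  moreover have "x \<in> residue_proj m P x"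
    unfolding residue_proj_def by (rule image_eqI[of _ _ 0]) (auto simp: PLambda_0)
  ultimately show "x - y \<in> P\<Lambda>" by (auto simp: residue_proj_def)
next
  assume xy: "x - y \<in> P\<Lambda>"
  show "residue_proj m P x = residue_proj m P y"
    unfolding residue_proj_def
  proof (intro equalityI subsetI)
    fix u assume "u \<in> (+) x ` P\<Lambda>"
    then obtain h where h: "h \<in> P\<Lambda>" "u = x + h" by auto
    have "(x - y) - (- h) \<in> P\<Lambda>" by (rule PLambda_diff[OF xy PLambda_uminus[OF h(1)]])
    then show "u \<in> (+) y ` P\<Lambda>" using h by (intro image_eqI[of _ _ "(x - y) - (- h)"]) auto
  next
    fix u assume "u \<in> (+) y ` P\<Lambda>"
    then obtain h where h: "h \<in> P\<Lambda>" "u = y + h" by auto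
    have "h - (x - y) \<in> P\<Lambda>" by (rule PLambda_diff[OF h(1) xy])
    then show "u \<in> (+) x ` P\<Lambda>" using h by (intro image_eqI[of _ _ "h - (x - y)"]) auto
  qed
qed

text \<open>The lattice of the line spanned by the class of \<open>pt v1 v2\<close>.\<close>

definition LC :: "complex \<Rightarrow> mink \<Rightarrow> (mink \<times> mink) set"
  where "LC v1 v2 = {pt (c * v1 + a) (em c * v2 + y) | c a y. c \<in> OK \<and> a \<in> P \<and> y \<in> LD}"

definition nonzero_class :: "complex \<Rightarrow> mink \<Rightarrow> bool"
  where "nonzero_class v1 v2 \<longleftrightarrow> v1 \<in> OK \<and> v2 \<in> W \<and> \<not> (v1 \<in> P \<and> v2 \<in> LD)"

lemma LC_I: "c \<in> OK \<Longrightarrow> a \<in> P \<Longrightarrow> y \<in> LD \<Longrightarrow> pt (c * v1 + a) (em c * v2 + y) \<in> LC v1 v2"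
  unfolding LC_def by blast

lemma lattice_family_eq: "lattice_family m P = {LC v1 v2 | v1 v2. nonzero_class v1 v2}"
proof -
  have main: "Lambda_C m P {residue_proj m P (smult_E m a (pt v1 v2)) | a. a \<in> OK} = LC v1 v2"
    if v: "v1 \<in> OK" "v2 \<in> W" for v1 v2
  proof (intro equalityI subsetI)
    fix x assume "x \<in> Lambda_C m P {residue_proj m P (smult_E m a (pt v1 v2)) | a. a \<in> OK}"
    then obtain c where "c \<in> OK" "x - smult_E m c (pt v1 v2) \<in> P\<Lambda>"
      by (auto simp: Lambda_C_def residue_proj_eq_iff)
    then obtain a y where ay: "c \<in> OK" "a \<in> P" "y \<in> LD" "x - pt (c * v1) (em c * v2) = pt a y"
      using v by (auto simp: PLambda_iff smult_pt OK_K)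
    have "x = pt (c * v1) (em c * v2) + pt a y" using ay(4) by (metis add.commute diff_add_cancel)
    also have "\<dots> = pt (c * v1 + a) (em c * v2 + y)"
      by (rule pt_add[OF OK_K[OF OK_mult[OF ay(1) v(1)]] P_K[OF ay(2)]])
    finally show "x \<in> LC v1 v2" using ay LC_I by simp
  next
    fix x assume "x \<in> LC v1 v2"
    then obtain c a y where x: "c \<in> OK" "a \<in> P" "y \<in> LD" "x = pt (c * v1 + a) (em c * v2 + y)"
      by (auto simp: LC_def)
    have "x - smult_E m c (pt v1 v2) = pt ((c * v1 + a) - c * v1) ((em c * v2 + y) - em c * v2)"
      using x v by (simp add: smult_pt OK_K pt_diff K_add K_mult P_K)
    also have "\<dots> = pt a y" by simp
    finally have 1: "x - smult_E m c (pt v1 v2) \<in> P\<Lambda>" using x by (auto simp: PLambda_iff)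
    have "c * v1 + a \<in> OK" by (rule OK_add[OF OK_mult[OF x(1) v(1)] P_OK[OF x(2)]])
    moreover have "em c * v2 + y \<in> W" by (rule W_add[OF W_mult[OF v(2) x(1)] LD_W[OF x(3)]])
    ultimately have "x \<in> \<Lambda>0" unfolding Lambda0_iff x(4) by blast
    then show "x \<in> Lambda_C m P {residue_proj m P (smult_E m a (pt v1 v2)) | a. a \<in> OK}"
      using 1 x(1) by (auto simp: Lambda_C_def residue_proj_eq_iff)
  qed
  have nz: "residue_proj m P (pt v1 v2) \<noteq> residue_proj m P 0 \<longleftrightarrow> \<not> (v1 \<in> P \<and> v2 \<in> LD)"
    if "v1 \<in> OK" for v1 v2
    unfolding residue_proj_eq_iff PLambda_iff using that by (auto simp: pt_eq_iff OK_K P_K)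
  show ?thesis
  proof (intro equalityI subsetI)
    fix L assume "L \<in> lattice_family m P"
    then obtain x where x: "x \<in> \<Lambda>0" "residue_proj m P x \<noteq> residue_proj m P 0"
        "L = Lambda_C m P {residue_proj m P (smult_E m a x) | a. a \<in> OK}"
      by (auto simp: lattice_family_def residue_lines_def)
    then obtain v1 v2 where "v1 \<in> OK" "v2 \<in> W" "x = pt v1 v2" by (auto simp: Lambda0_iff)
    then have v: "v1 \<in> OK" "v2 \<in> W" "x = pt v1 v2" by blast+
    have "L = LC v1 v2" using main[OF v(1,2)] x(3) v(3) by (simp only:)
    moreover have "nonzero_class v1 v2"
      using x(2) nz[OF v(1), of v2] v unfolding nonzero_class_def by (simp only: simp_thms)
    ultimately show "L \<in> {LC v1 v2 | v1 v2. nonzero_class v1 v2}" by blast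
  next
    fix L assume "L \<in> {LC v1 v2 | v1 v2. nonzero_class v1 v2}"
    then obtain v1 v2 where v: "v1 \<in> OK" "v2 \<in> W" "\<not> (v1 \<in> P \<and> v2 \<in> LD)" "L = LC v1 v2"
      by (auto simp: nonzero_class_def)
    have "pt v1 v2 \<in> \<Lambda>0" using v by (auto simp: Lambda0_iff)
    moreover have "residue_proj m P (pt v1 v2) \<noteq> residue_proj m P 0" using nz[OF v(1)] v(3) by blast
    ultimately have "{residue_proj m P (smult_E m a (pt v1 v2)) | a. a \<in> OK} \<in> residue_lines m P"
      unfolding residue_lines_def by (intro CollectI exI[of _ "pt v1 v2"] conjI refl)
    then show "L \<in> lattice_family m P"
      unfolding lattice_family_def v(4) main[OF v(1,2), symmetric] by (rule imageI)
  qed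
qed

lemma pt_in_E: "a \<in> K \<Longrightarrow> y \<in> KR \<Longrightarrow> pt a y \<in> E_space m"
  by (simp add: pt_def E_space_def em_in_KR)

lemma Lambda0_basis: obtains h where "basis_seq (n + n) h (E_space m)" "\<Lambda>0 = zlat (n + n) h"
proof -
  obtain w where w: "basis_seq n w KR" "LO = zlat n w" by (rule LO_basis)
  obtain g where g: "basis_seq n g KR" "W = zlat n g" by (rule W_basis_vol)
  let ?h = "seq_prod n (\<lambda>i. inverse \<alpha> *\<^sub>R w i) (\<lambda>i. \<alpha> *\<^sub>R g i)"
  have "basis_seq (n + n) ?h (E_space m)"
    unfolding E_space_def using alpha_pos by (intro basis_seq_prod basis_seq_scale w(1) g(1)) auto
  moreover have "zlat (n + n) ?h = \<Lambda>0"
    unfolding zlat_prod zlat_scale Lambda0_prod w(2) g(2) ..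
  ultimately show thesis using that by metis
qed

lemma PLambda_basis: obtains h where "basis_seq (n + n) h (E_space m)" "P\<Lambda> = zlat (n + n) h"
proof -
  obtain w where w: "basis_seq n w KR" "LP = zlat n w" by (rule LP_basis)
  obtain g where g: "basis_seq n g KR" "LD = zlat n g" by (rule LD_basis)
  let ?h = "seq_prod n (\<lambda>i. inverse \<alpha> *\<^sub>R w i) (\<lambda>i. \<alpha> *\<^sub>R g i)"
  have "basis_seq (n + n) ?h (E_space m)"
    unfolding E_space_def using alpha_pos by (intro basis_seq_prod basis_seq_scale w(1) g(1)) auto
  moreover have "zlat (n + n) ?h = P\<Lambda>"
    unfolding zlat_prod zlat_scale w(2)[symmetric] g(2)[symmetric]
  proof (intro equalityI subsetI)
    fix x assume "x \<in> (\<lambda>x. inverse \<alpha> *\<^sub>R x) ` LP \<times> (\<lambda>x. \<alpha> *\<^sub>R x) ` LD"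
    then show "x \<in> P\<Lambda>" by (auto simp: PLambda_iff pt_def)
  next
    fix x assume "x \<in> P\<Lambda>"
    then show "x \<in> (\<lambda>x. inverse \<alpha> *\<^sub>R x) ` LP \<times> (\<lambda>x. \<alpha> *\<^sub>R x) ` LD"
      by (auto simp: PLambda_iff pt_def)
  qed
  ultimately show thesis using that by metis
qed

lemma PLambda_LC: "x \<in> P\<Lambda> \<Longrightarrow> x \<in> LC v1 v2"
proof -
  assume "x \<in> P\<Lambda>"
  then obtain a y where "a \<in> P" "y \<in> LD" "x = pt a y" by (auto simp: PLambda_iff)
  then show ?thesis using LC_I[OF OK_0, of a y v1 v2] by (simp add: em_0)
qed

lemma LC_Lambda0: "nonzero_class v1 v2 \<Longrightarrow> x \<in> LC v1 v2 \<Longrightarrow> x \<in> \<Lambda>0"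
proof -
  assume v: "nonzero_class v1 v2" and "x \<in> LC v1 v2"
  then obtain c a y where x: "c \<in> OK" "a \<in> P" "y \<in> LD" "x = pt (c * v1 + a) (em c * v2 + y)"
    by (auto simp: LC_def)
  have vv: "v1 \<in> OK" "v2 \<in> W" using v by (auto simp: nonzero_class_def)
  have "c * v1 + a \<in> OK" by (rule OK_add[OF OK_mult[OF x(1) vv(1)] P_OK[OF x(2)]])
  moreover have "em c * v2 + y \<in> W" by (rule W_add[OF W_mult[OF vv(2) x(1)] LD_W[OF x(3)]])
  ultimately show ?thesis unfolding Lambda0_iff x(4) by blast
qed

lemma LC_diff:
  assumes v: "nonzero_class v1 v2" and x: "x \<in> LC v1 v2" and z: "z \<in> LC v1 v2"
  shows "x - z \<in> LC v1 v2"
proof -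
  have vv: "v1 \<in> OK" "v2 \<in> W" using v by (auto simp: nonzero_class_def)
  obtain c a y where x: "c \<in> OK" "a \<in> P" "y \<in> LD" "x = pt (c * v1 + a) (em c * v2 + y)"
    using x by (auto simp: LC_def)
  obtain d b w where z: "d \<in> OK" "b \<in> P" "w \<in> LD" "z = pt (d * v1 + b) (em d * v2 + w)"
    using z by (auto simp: LC_def)
  have "x - z = pt ((c - d) * v1 + (a - b)) (em (c - d) * v2 + (y - w))"
    unfolding x(4) z(4) using x z vv
    by (subst pt_diff) (auto simp: em_diff OK_K P_K algebra_simps intro!: K_add K_mult)
  then show ?thesis using x z by (simp add: LC_I OK_diff P_diff LD_diff)
qed

lemma LC_basis:
  assumes v: "nonzero_class v1 v2"
  obtains h where "basis_seq (n + n) h (E_space m)" "LC v1 v2 = zlat (n + n) h"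
proof -
  obtain f where f: "basis_seq (n + n) f (E_space m)" "P\<Lambda> = zlat (n + n) f" by (rule PLambda_basis)
  show thesis
  proof (rule ES.sublattice[OF f(1) PLambda_LC[OF PLambda_0] LC_diff[OF v]])
    show "LC v1 v2 \<subseteq> E_space m"
    proof
      fix x assume "x \<in> LC v1 v2"
      then have "x \<in> \<Lambda>0" by (rule LC_Lambda0[OF v])
      then show "x \<in> E_space m" using pt_in_E OK_K W_KR by (auto simp: Lambda0_iff)
    qed
    show "\<And>i. i < n + n \<Longrightarrow> f i \<in> LC v1 v2" using PLambda_LC f(2) zlat_base by blast
    show "p > 0" by (rule p_pos)
    fix x assume "x \<in> LC v1 v2"
    then have "x \<in> \<Lambda>0" by (rule LC_Lambda0[OF v])
    then obtain a y where x: "a \<in> OK" "y \<in> W" "x = pt a y" unfolding Lambda0_iff by blast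
    then have "real p *\<^sub>R x = pt (of_nat p * a) (real p *\<^sub>R y)" by (simp add: pt_scale_nat OK_K)
    moreover have "of_nat p * a \<in> P" by (rule P_mult_right[OF p_in_P x(1)])
    ultimately have "real p *\<^sub>R x \<in> P\<Lambda>" unfolding PLambda_iff using p_W[OF x(2)] by blast
    then show "real p *\<^sub>R x \<in> zlat (n + n) f" using f(2) by simp
  qed (use that in auto)
qed

section \<open>The symplectic structure of the lattices\<close>

definition sympl :: "mink \<times> mink \<Rightarrow> mink \<times> mink"
  where "sympl x = (- mink_cnj (snd x), mink_cnj (fst x))"

lemma sympl_E: "x \<in> E_space m \<Longrightarrow> sympl x \<in> E_space m"
  unfolding sympl_def E_space_def mem_Times_iff fst_conv snd_conv
  using KS.V_closed(4)[OF KR_cnj] KR_cnj by blast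

lemma sympl_sympl: "sympl (sympl x) = - x"
  by (simp add: sympl_def mink_cnj_linear prod_eq_iff)

lemma ip_sympl: "ip_E m (sympl x) (sympl y) = ip_E m x y"
  by (simp add: sympl_def ip_E_def ip_K_cnj KS.ip_minus)

lemma sympl_isometry: "linear_isometry_of (E_space m) (ip_E m) sympl"
  unfolding linear_isometry_of_def
proof (intro conjI ballI allI)
  show "bij_betw sympl (E_space m) (E_space m)"
  proof (rule bij_betw_byWitness[where f' = "\<lambda>x. - sympl x"])
    show "\<forall>x\<in>E_space m. - sympl (sympl x) = x" by (simp add: sympl_sympl)
    show "\<forall>x\<in>E_space m. sympl (- sympl x) = x"
      by (simp add: sympl_def mink_cnj_linear prod_eq_iff)
    show "sympl ` E_space m \<subseteq> E_space m" using sympl_E by blast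
    show "(\<lambda>x. - sympl x) ` E_space m \<subseteq> E_space m" using sympl_E ES.V_closed(4) by blast
  qed
qed (auto simp: sympl_def mink_cnj_linear ip_sympl[unfolded sympl_def])

definition det_form :: "mink \<times> mink \<Rightarrow> mink \<times> mink \<Rightarrow> real"
  where "det_form w x = Tr (fst w * snd x - snd w * fst x)"

lemma ip_sympl_left: "ip_E m (sympl w) x = det_form w x"
proof -
  have "ip_K m (mink_cnj u) z = Tr (u * z)" for u z
    using Tr_linear(6)[of "u * mink_cnj (mink_cnj z)"] by (simp add: ip_K_Tr mink_cnj_linear Tr_linear(6)[of "u * z", symmetric])
  then show ?thesis by (simp add: ip_E_def sympl_def det_form_def KS.ip_minus Tr_linear)
qed

text \<open>The factor \<open>\<alpha>\<close> and its inverse cancel, so the form is the trace of a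
  determinant of unscaled coordinates.\<close>

lemma det_form_pt: "det_form (pt a y) (pt b z) = Tr (em a * z - em b * y)"
proof -
  have "fst (pt a y) * snd (pt b z) - snd (pt a y) * fst (pt b z) = em a * z - em b * y"
    by (rule ext) (use alpha_pos in \<open>simp add: pt_def fun_at field_simps\<close>)
  then show ?thesis by (simp add: det_form_def)
qed

lemma Tr_LD: "y \<in> LD \<Longrightarrow> Tr y \<in> \<int>"
  using em_1_mult[OF LD_KR] OK_1 unfolding int_dual_iff by fastforce

text \<open>The two products of a multiple of v1 with a multiple of v2 cancel. Each remaining term
  has a factor in \<open>LD\<close>, or a factor in P next to v2, and so lies in \<open>LD\<close>,
  where the trace is integral.\<close>

lemma LC_isotropic:
  assumes v: "nonzero_class v1 v2" and x: "x \<in> LC v1 v2" and z: "z \<in> LC v1 v2"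
  shows "det_form x z \<in> \<int>"
proof -
  have vv: "v1 \<in> OK" "v2 \<in> W" using v by (auto simp: nonzero_class_def)
  obtain c a y where x: "c \<in> OK" "a \<in> P" "y \<in> LD" "x = pt (c * v1 + a) (em c * v2 + y)"
    using x by (auto simp: LC_def)
  obtain d b w where z: "d \<in> OK" "b \<in> P" "w \<in> LD" "z = pt (d * v1 + b) (em d * v2 + w)"
    using z by (auto simp: LC_def)
  have em: "em (c * v1 + a) = em c * em v1 + em a" "em (d * v1 + b) = em d * em v1 + em b"
    using x z vv by (simp_all add: em_add em_mult OK_K P_K K_mult)
  have "em (c * v1 + a) * (em d * v2 + w) - em (d * v1 + b) * (em c * v2 + y)
      = em c * (em v1 * w) + em d * (em a * v2) + em a * w - (em d * (em v1 * y) + em c * (em b * v2) + em b * y)"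
    unfolding em by (simp add: algebra_simps)
  also have "\<dots> \<in> LD"
  proof (rule LD_diff[OF LD_add[OF LD_add] LD_add[OF LD_add]])
    show "em c * (em v1 * w) \<in> LD" "em d * (em v1 * y) \<in> LD" using x z vv LD_mult by blast+
    show "em d * (em a * v2) \<in> LD" "em c * (em b * v2) \<in> LD" using x z vv LD_mult W_P by blast+
    show "em a * w \<in> LD" "em b * y \<in> LD" using x z P_OK LD_mult by blast+
  qed
  finally show ?thesis unfolding x(4) z(4) det_form_pt by (rule Tr_LD)
qed

text \<open>Testing w against \<open>P\<Lambda>\<close> places it in \<open>\<Lambda>0\<close>;
  testing it against multiples of (v1, v2) puts their determinant into \<open>LD\<close>. So w is
  proportional to (v1, v2) modulo \<open>P\<Lambda>\<close>, and the factor has to be found.\<close>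

lemma LC_self_dual:
  assumes v: "nonzero_class v1 v2" and w: "w \<in> E_space m" and int: "\<And>x. x \<in> LC v1 v2 \<Longrightarrow> det_form w x \<in> \<int>"
  shows "w \<in> LC v1 v2"
proof -
  have vv: "v1 \<in> OK" "v2 \<in> W" using v by (auto simp: nonzero_class_def)
  have wKR: "fst w \<in> KR" "snd w \<in> KR" using w by (auto simp: E_space_def)
  have "\<alpha> *\<^sub>R fst w \<in> LO"
  proof (rule dual_LD)
    show "\<alpha> *\<^sub>R fst w \<in> KR" using wKR by auto
    fix y assume "y \<in> LD"
    then have "pt 0 y \<in> P\<Lambda>" using P_0 by (auto simp: PLambda_iff)
    then have "det_form w (pt 0 y) \<in> \<int>" using int PLambda_LC by blast
    moreover have "fst w * snd (pt 0 y) - snd w * fst (pt 0 y) = (\<alpha> *\<^sub>R fst w) * y"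
      by (rule ext) (simp add: pt_def em_0 fun_at)
    ultimately show "Tr ((\<alpha> *\<^sub>R fst w) * y) \<in> \<int>" by (simp only: det_form_def)
  qed
  then obtain a where a: "a \<in> OK" "\<alpha> *\<^sub>R fst w = em a" by auto
  define y where "y = inverse \<alpha> *\<^sub>R snd w"
  have yW: "y \<in> W"
    unfolding W_iff
  proof (intro conjI ballI)
    show "y \<in> KR" using wKR by (auto simp: y_def)
    fix b assume "b \<in> P"
    then have "pt b 0 \<in> P\<Lambda>" using LD_0 by (auto simp: PLambda_iff)
    then have "det_form w (pt b 0) \<in> \<int>" using int PLambda_LC by blast
    moreover have "fst w * snd (pt b 0) - snd w * fst (pt b 0) = - (em b * y)"
      by (rule ext) (simp add: pt_def y_def fun_at)
    ultimately have "- Tr (em b * y) \<in> \<int>" by (simp only: det_form_def Tr_linear)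
    then show "Tr (em b * y) \<in> \<int>" by simp
  qed
  have wpt: "w = pt a y"
    using alpha_pos by (simp add: pt_def y_def prod_eq_iff a(2)[symmetric])
  have D: "em a * v2 - em v1 * y \<in> LD"
    unfolding int_dual_iff
  proof (intro conjI ballI)
    show "em a * v2 - em v1 * y \<in> KR" using a vv yW by (intro KS.V_closed(3) KR_mult OK_K W_KR)
    fix c assume c: "c \<in> OK"
    have "pt (c * v1 + 0) (em c * v2 + 0) \<in> LC v1 v2" by (rule LC_I[OF c P_0 LD_0])
    then have "det_form w (pt (c * v1) (em c * v2)) \<in> \<int>" using int by simp
    moreover have "em a * (em c * v2) - em (c * v1) * y = em c * (em a * v2 - em v1 * y)"
      using c vv by (simp add: em_mult OK_K algebra_simps)
    ultimately show "Tr (em c * (em a * v2 - em v1 * y)) \<in> \<int>" by (simp only: wpt det_form_pt)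
  qed
  show ?thesis
  proof (cases "v1 \<in> P")
    \<comment> \<open>v1 has the inverse b modulo P, so the first coordinate dictates the factor a
      b.\<close>
    case False
    obtain b where b: "b \<in> OK" "1 - v1 * b \<in> P" using residue_inverse[OF vv(1) False] .
    define c where "c = a * b"
    define y' where "y' = y - em c * v2"
    have cO: "c \<in> OK" using a b by (simp add: c_def OK_mult)
    have "a * (1 - v1 * b) \<in> P" using a b by (intro P_mult)
    then have a': "a - c * v1 \<in> P" by (simp add: c_def algebra_simps)
    have y'W: "y' \<in> W" using yW vv cO by (auto simp: y'_def intro: W_diff W_mult)
    have "em v1 * y' = em (a - c * v1) * v2 - (em a * v2 - em v1 * y)"
      unfolding y'_def using a cO vv by (simp add: em_diff em_mult OK_K K_mult algebra_simps)
    also have "\<dots> \<in> LD" by (rule LD_diff[OF W_P[OF vv(2) a'] D])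
    finally have "y' \<in> LD" using W_cancel[OF vv(1) False y'W] by simp
    then have "pt (c * v1 + (a - c * v1)) (em c * v2 + y') \<in> LC v1 v2" using cO a' by (intro LC_I)
    then show ?thesis by (simp add: wpt y'_def)
  next
    \<comment> \<open>Here both v1 and, by the determinant condition, a vanish modulo P; the factor
      is found in the second coordinate.\<close>
    case True
    then have v2: "v2 \<notin> LD" using v by (simp add: nonzero_class_def)
    have "(em a * v2 - em v1 * y) + em v1 * y \<in> LD" using D W_P[OF yW True] by (rule LD_add)
    then have "em a * v2 \<in> LD" by simp
    then have aP: "a \<in> P" using W_cancel[OF a(1) _ vv(2)] v2 by blast
    obtain c where c: "c \<in> OK" "y - em c * v2 \<in> LD" using W_generated[OF vv(2) v2 yW] .
    have "a - c * v1 \<in> P" using aP True c by (intro P_diff P_mult)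
    then have "pt (c * v1 + (a - c * v1)) (em c * v2 + (y - em c * v2)) \<in> LC v1 v2" using c by (intro LC_I)
    then show ?thesis by (simp add: wpt)
  qed
qed

lemma LC_dual:
  assumes v: "nonzero_class v1 v2"
  shows "sympl ` LC v1 v2 = dual_lattice (E_space m) (ip_E m) (LC v1 v2)"
proof (intro equalityI subsetI)
  fix z assume "z \<in> sympl ` LC v1 v2"
  then obtain w where w: "w \<in> LC v1 v2" "z = sympl w" by auto
  have "w \<in> E_space m" using LC_Lambda0[OF v w(1)] pt_in_E OK_K W_KR by (auto simp: Lambda0_iff)
  then show "z \<in> dual_lattice (E_space m) (ip_E m) (LC v1 v2)"
    unfolding dual_lattice_def w(2) by (auto simp: sympl_E ip_sympl_left LC_isotropic[OF v w(1)])
next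
  fix z assume "z \<in> dual_lattice (E_space m) (ip_E m) (LC v1 v2)"
  then have z: "z \<in> E_space m" "\<And>x. x \<in> LC v1 v2 \<Longrightarrow> ip_E m z x \<in> \<int>" by (auto simp: dual_lattice_def)
  define w where "w = - sympl z"
  have zw: "z = sympl w" by (simp add: w_def sympl_def mink_cnj_linear prod_eq_iff)
  have "w \<in> E_space m" unfolding w_def using sympl_E[OF z(1)] by auto
  then have "w \<in> LC v1 v2" using z(2) unfolding zw ip_sympl_left by (rule LC_self_dual[OF v])
  then show "z \<in> sympl ` LC v1 v2" using zw by blast
qed

lemma LC_symplectic:
  assumes v: "nonzero_class v1 v2"
  shows "symplectic_lattice (E_space m) (ip_E m) (LC v1 v2)"
proof -
  obtain h where h: "basis_seq (n + n) h (E_space m)" "LC v1 v2 = zlat (n + n) h" using LC_basis[OF v] .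
  show ?thesis
    unfolding symplectic_lattice_def
    using lattice_in_zlat[OF h(1)] sympl_isometry LC_dual[OF v] sympl_sympl h(2) by auto
qed

text \<open>\<open>sympl\<close> carries the lattice to its dual and preserves lengths, so both have
  the same numbers of points in balls and hence equal volumes; the product of these volumes is
  1.\<close>

lemma vol_LC:
  assumes v: "nonzero_class v1 v2"
  shows "ES.vol (LC v1 v2) = 1"
proof -
  obtain h where h: "basis_seq (n + n) h (E_space m)" "LC v1 v2 = zlat (n + n) h" using LC_basis[OF v] .
  obtain h' where d: "ES.dual_pair h h'" using ES.dual_pair_exists[OF h(1)] .
  have h': "basis_seq (n + n) h' (E_space m)" using d by (simp add: ES.dual_pair_def)
  have L': "zlat (n + n) h' = sympl ` zlat (n + n) h"
    using ES.dual_lattice_zlat[OF d] LC_dual[OF v] h(2) by simp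
  have inj: "inj sympl" by (rule injI) (metis sympl_sympl neg_equal_iff_equal)
  have "ES.cnt (zlat (n + n) h') r = ES.cnt (zlat (n + n) h) r" for r
  proof -
    have "zlat (n + n) h' \<inter> eucl_ball (E_space m) (ip_E m) r
        = sympl ` (zlat (n + n) h \<inter> eucl_ball (E_space m) (ip_E m) r)"
      unfolding L' using ES.zlat_in_V[OF h(1)]
      by (auto simp: eucl_ball_def eucl_norm_def ip_sympl sympl_E)
    then show ?thesis unfolding ES.cnt_def using card_image[OF inj_on_subset[OF inj]] by simp
  qed
  then have "ES.vol (zlat (n + n) h') = ES.vol (zlat (n + n) h)"
    by (intro antisym ES.vol_mono h(1) h') auto
  then have "(ES.vol (zlat (n + n) h))\<^sup>2 = 1" using ES.vol_dual[OF d] by (simp add: power2_eq_square)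
  then show ?thesis using ES.vol_pos[OF h(1)] unfolding h(2) power2_eq_1_iff by linarith
qed

end

context cyclo_prime
begin

section \<open>A dense lattice in the family\<close>

definition "\<kappa> = real q powr (1 / real n)"
text \<open>The root discriminant, that is, the n-th root of the absolute value of the
  discriminant.\<close>

definition "\<delta> = KS.vol LO powr (2 / real n)"

lemma kappa_pos: "\<kappa> > 0"
  using q_ge_2 by (simp add: \<kappa>_def)

lemma delta_pos: "\<delta> > 0"
  using vol_LO_pos by (simp add: \<delta>_def)

lemma delta_ge_1: "\<delta> \<ge> 1"
  unfolding \<delta>_def using vol_LO_ge_1 by (intro ge_one_powr_ge_zero) auto

lemma vol_sq_powr: "((KS.vol LO)\<^sup>2) powr (1 / real n) = \<delta>"
proof -
  have "(KS.vol LO)\<^sup>2 = KS.vol LO powr real 2" by (rule powr_realpow[symmetric, OF vol_LO_pos])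
  then show ?thesis by (simp add: \<delta>_def powr_powr)
qed

lemma delta_le: "\<delta> \<le> real n"
proof -
  have "\<delta> \<le> (real n ^ n) powr (1 / real n)"
    unfolding vol_sq_powr[symmetric] using vol_LO_le by (intro powr_mono2) auto
  also have "real n ^ n = real n powr real n" using n_pos by (intro powr_realpow[symmetric]) linarith
  also have "(real n powr real n) powr (1 / real n) = real n"
    using n_pos by (simp only: powr_powr) simp
  finally show ?thesis .
qed

lemma alpha_sq_eq: "\<alpha>\<^sup>2 = \<kappa> * \<delta>"
  unfolding alpha_sq by (simp add: powr_mult \<kappa>_def vol_sq_powr)

lemma powr_two_over: "x > 0 \<Longrightarrow> x powr (2 / real n) = (x powr (1 / real n))\<^sup>2"
  by (simp add: power2_eq_square powr_add[symmetric])

lemma ip_E_pt: "ip_E m (pt a y) (pt a y) = ip_K m (em a) (em a) / \<alpha>\<^sup>2 + \<alpha>\<^sup>2 * ip_K m y y"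
  by (simp add: pt_def ip_E_def KS.ip_scale KS.ip_scale_right power2_eq_square field_simps)

lemma W_em:
  assumes "y \<in> W" obtains c where "c \<in> K" "y = em c"
proof -
  have "real m *\<^sub>R (real p *\<^sub>R y) \<in> LO" using LD_denominator[OF p_W[OF assms]] zb_LO by blast
  then have "real (m * p) *\<^sub>R y \<in> LO" by simp
  then show thesis by (rule em_K_denominator[rotated]) (use m_pos p_pos that in auto)
qed

lemma ip_em_zeta_mult: "ip_K m (em (\<zeta> ^ k) * x) (em (\<zeta> ^ k) * x) = ip_K m x x"
  unfolding ip_K_norm
  by (intro sum.cong refl) (simp add: fun_at em_at emb_power K_zeta norm_mult norm_power norm_emb_zeta)

text \<open>Besides the powers of \<open>\<zeta>\<close> in the first coordinate, use their multiples by a short vector of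
  the second lattice.\<close>

lemma Lambda0_covers: "ES.covers \<Lambda>0 (sqrt (2 * (real n)\<^sup>2 / \<kappa>))"
proof -
  obtain g where g: "basis_seq n g KR" "W = zlat n g" "KS.vol W = 1 / (real q * KS.vol LO)"
    by (rule W_basis_vol)
  obtain x where x: "x \<in> W" "x \<noteq> 0" "ip_K m x x \<le> 4 * real n * KS.vol W powr (2 / real n)"
    using KS.minkowski[OF g(1) n_pos] unfolding g(2) by blast
  have "KS.vol W powr (2 / real n) = 1 / (\<kappa>\<^sup>2 * \<delta>)"
    unfolding g(3) using q_ge_2 vol_LO_pos
    by (simp add: powr_divide powr_mult powr_two_over[of "real q"] \<kappa>_def \<delta>_def)
  then have x3: "ip_K m x x \<le> 4 * real n / (\<kappa>\<^sup>2 * \<delta>)" using x(3) by simp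
  obtain c where c: "c \<in> K" "x = em c" using W_em[OF x(1)] .
  have c0: "c \<noteq> 0" using x(2) c em_0 by auto
  let ?f = "\<lambda>i. em (c * \<zeta> ^ i)"
  have zK: "\<zeta> ^ i \<in> K" for i by (intro K_power K_zeta)
  have f: "basis_seq n ?f KR" by (rule basis_em_mult[OF zK basis_zb c(1) c0])
  have fx: "?f i = em (\<zeta> ^ i) * x" for i
    unfolding c(2) using em_mult[OF zK c(1)] by (simp add: mult.commute)
  have fW: "zlat n ?f \<subseteq> W"
    unfolding fx using x(1) by (intro zlat_subset W_0 W_diff W_mult OK_power OK_zeta)
  have ipf: "ip_K m (?f i) (?f i) = ip_K m x x" for i unfolding fx by (rule ip_em_zeta_mult)
  show ?thesis
    unfolding ES.covers_def
  proof (intro conjI ballI)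
    show "0 \<le> sqrt (2 * (real n)\<^sup>2 / \<kappa>)" using kappa_pos by simp
    fix z assume z: "z \<in> E_space m"
    have zV: "\<alpha> *\<^sub>R fst z \<in> KR" "inverse \<alpha> *\<^sub>R snd z \<in> KR" using z by (auto simp: E_space_def)
    obtain y1 where y1: "y1 \<in> zlat n zb"
        "ip_K m (\<alpha> *\<^sub>R fst z - y1) (\<alpha> *\<^sub>R fst z - y1) \<le> (\<Sum>i<n. ip_K m (zb i) (zb i)) / 4"
      using KS.covering[OF basis_zb zV(1)] .
    obtain y2 where y2: "y2 \<in> zlat n ?f"
        "ip_K m (inverse \<alpha> *\<^sub>R snd z - y2) (inverse \<alpha> *\<^sub>R snd z - y2) \<le> (\<Sum>i<n. ip_K m (?f i) (?f i)) / 4"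
      using KS.covering[OF f zV(2)] .
    obtain a where a: "a \<in> OK" "y1 = em a" using y1(1) zb_LO by auto
    have 1: "pt a y2 \<in> \<Lambda>0" using a fW y2(1) by (auto simp: Lambda0_iff)
    let ?u = "\<alpha> *\<^sub>R fst z - y1"
    let ?v = "inverse \<alpha> *\<^sub>R snd z - y2"
    have eq: "z - pt a y2 = (inverse \<alpha> *\<^sub>R ?u, \<alpha> *\<^sub>R ?v)"
      using alpha_pos by (simp add: pt_def prod_eq_iff a(2)[symmetric] scaleR_diff_right)
    have "ip_E m (z - pt a y2) (z - pt a y2) = ip_K m ?u ?u / \<alpha>\<^sup>2 + \<alpha>\<^sup>2 * ip_K m ?v ?v"
      unfolding eq by (simp only: ip_E_def fst_conv snd_conv KS.ip_scale KS.ip_scale_right power2_eq_square)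
        (simp add: field_simps)
    \<comment> \<open>Rounding along n vectors of squared length n, respectively of the squared
      length of x, and rescaling by \<open>\<alpha>\<close>, whose square is
      \<kappa>\<delta>.\<close>
    also have "\<dots> \<le> (real n * real n / 4) / (\<kappa> * \<delta>) + (\<kappa> * \<delta>) * (real n * (4 * real n / (\<kappa>\<^sup>2 * \<delta>)) / 4)"
    proof (rule add_mono)
      show "ip_K m ?u ?u / \<alpha>\<^sup>2 \<le> (real n * real n / 4) / (\<kappa> * \<delta>)"
        unfolding alpha_sq_eq using y1(2) kappa_pos delta_pos
        by (intro divide_right_mono) (simp_all add: ip_zb)
      have "ip_K m ?v ?v \<le> real n * ip_K m x x / 4" using y2(2) by (simp add: ipf)
      also have "\<dots> \<le> real n * (4 * real n / (\<kappa>\<^sup>2 * \<delta>)) / 4"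
        using x3 by (intro divide_right_mono mult_left_mono) auto
      finally show "\<alpha>\<^sup>2 * ip_K m ?v ?v \<le> (\<kappa> * \<delta>) * (real n * (4 * real n / (\<kappa>\<^sup>2 * \<delta>)) / 4)"
        unfolding alpha_sq_eq using kappa_pos delta_pos by (intro mult_left_mono) auto
    qed
    also have "\<dots> = (real n)\<^sup>2 / 4 / (\<kappa> * \<delta>) + (real n)\<^sup>2 / \<kappa>"
      using kappa_pos delta_pos by (simp add: field_simps power2_eq_square)
    also have "(real n)\<^sup>2 / 4 / (\<kappa> * \<delta>) \<le> (real n)\<^sup>2 / \<kappa>"
    proof -
      have "(real n)\<^sup>2 / 4 \<le> (real n)\<^sup>2" "\<kappa> \<le> \<kappa> * \<delta>" using delta_ge_1 kappa_pos by simp_all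
      then show ?thesis using kappa_pos by (intro frac_le) auto
    qed
    finally have "ip_E m (z - pt a y2) (z - pt a y2) \<le> 2 * (real n)\<^sup>2 / \<kappa>" by simp
    then have "ES.nrm (z - pt a y2) \<le> sqrt (2 * (real n)\<^sup>2 / \<kappa>)"
      unfolding eucl_norm_def by (rule real_sqrt_le_mono)
    then show "\<exists>y\<in>\<Lambda>0. ES.nrm (z - y) \<le> sqrt (2 * (real n)\<^sup>2 / \<kappa>)" using 1 by blast
  qed
qed

text \<open>Multiplication by a maps the integers into P, whose volume is q times larger; so the
  norm of a is at least q in absolute value.\<close>

lemma P_norm_ge:
  assumes a: "a \<in> P" "a \<noteq> 0"
  shows "real n * \<kappa>\<^sup>2 \<le> ip_K m (em a) (em a)"
proof -
  have aK: "a \<in> K" using a P_K by blast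
  obtain w where w: "\<And>i. i < n \<Longrightarrow> w i \<in> OK" "basis_seq n (\<lambda>i. em (w i)) KR" "LO = zlat n (\<lambda>i. em (w i))"
    using LO_em_basis by blast
  have wK: "i < n \<Longrightarrow> w i \<in> K" for i using w(1) OK_K by blast
  obtain u where u: "basis_seq n u KR" "LP = zlat n u" by (rule LP_basis)
  have "zlat n (\<lambda>i. em (a * w i)) \<subseteq> LP"
  proof (rule zlat_subset[OF _ LP_diff])
    show "0 \<in> LP" by (rule image_eqI[of _ _ 0]) (auto simp: em_0 P_0)
    show "\<And>i. i < n \<Longrightarrow> em (a * w i) \<in> LP" using P_mult_right[OF a(1) w(1)] by blast
  qed auto
  then have "KS.vol LP \<le> KS.vol (zlat n (\<lambda>i. em (a * w i)))"
    using KS.vol_subset[OF u(1) basis_em_mult[OF wK w(2) aK a(2)]] u(2) by simp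
  also have "\<dots> = (\<Prod>s\<in>Es. cmod (s a)) * KS.vol LO"
    using vol_em_mult[OF wK w(2) aK a(2)] w(3) by simp
  finally have "real q \<le> (\<Prod>s\<in>Es. cmod (s a))" using vol_LO_pos by (simp add: vol_LP)
  then have "real n * real q powr (2 / real n) \<le> ip_K m (em a) (em a)"
    using q_ge_2 by (intro em_norm_ge[OF aK a(2)]) auto
  then show ?thesis using q_ge_2 by (simp add: powr_two_over \<kappa>_def)
qed

lemma LD_norm_ge': "y \<in> LD \<Longrightarrow> y \<noteq> 0 \<Longrightarrow> real n / \<delta>\<^sup>2 \<le> ip_K m y y"
proof -
  assume y: "y \<in> LD" "y \<noteq> 0"
  have "(1 / (KS.vol LO)\<^sup>2) powr (2 / real n) = ((1 / (KS.vol LO)\<^sup>2) powr (1 / real n))\<^sup>2"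
    using vol_LO_pos by (intro powr_two_over) simp
  also have "(1 / (KS.vol LO)\<^sup>2) powr (1 / real n) = 1 / \<delta>" by (simp add: powr_divide vol_sq_powr)
  finally show ?thesis using LD_norm_ge[OF y] by (simp add: power_divide)
qed

text \<open>The choice of \<open>\<alpha>\<close> balances the two coordinates: a nonzero entry in
  either contributes at least n\<kappa>/\<delta>, and \<delta> <= n by Hadamard's bound for the
  discriminant.\<close>

lemma PLambda_norm_ge:
  assumes z: "z \<in> P\<Lambda>" "z \<noteq> 0"
  shows "\<kappa> \<le> ip_E m z z"
proof -
  obtain a y where ay: "a \<in> P" "y \<in> LD" "z = pt a y" using z(1) by (auto simp: PLambda_iff)
  have nn: "ip_K m (em a) (em a) \<ge> 0" "ip_K m y y \<ge> 0"
    using KS.ip_nonneg[OF em_in_KR[OF P_K[OF ay(1)]]] KS.ip_nonneg[OF LD_KR[OF ay(2)]] by auto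
  have key: "\<kappa> \<le> real n * \<kappa> / \<delta>"
    using delta_le delta_pos kappa_pos by (simp add: field_simps)
  have kd: "\<kappa> * \<delta> > 0" using kappa_pos delta_pos by simp
  show ?thesis
  proof (cases "a = 0")
    case False
    have "real n * \<kappa> / \<delta> = real n * \<kappa>\<^sup>2 / \<alpha>\<^sup>2"
      unfolding alpha_sq_eq using kappa_pos delta_pos by (simp add: field_simps power2_eq_square)
    also have "\<dots> \<le> ip_K m (em a) (em a) / \<alpha>\<^sup>2"
      by (intro divide_right_mono P_norm_ge ay(1) False) simp
    also have "\<dots> \<le> ip_E m z z" unfolding ay(3) ip_E_pt using nn by simp
    finally show ?thesis using key by simp
  next
    case True
    then have "y \<noteq> 0" using z(2) ay(3) pt_0 by auto
    have "real n * \<kappa> / \<delta> = \<alpha>\<^sup>2 * (real n / \<delta>\<^sup>2)"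
      unfolding alpha_sq_eq using kappa_pos delta_pos by (simp add: field_simps power2_eq_square)
    also have "\<dots> \<le> \<alpha>\<^sup>2 * ip_K m y y"
      by (intro mult_left_mono LD_norm_ge' ay(2) \<open>y \<noteq> 0\<close>) simp
    also have "\<dots> \<le> ip_E m z z" unfolding ay(3) ip_E_pt using nn by simp
    finally show ?thesis using key by simp
  qed
qed

lemma W_not_LD: obtains v where "v \<in> W" "v \<notin> LD"
proof -
  have "W \<noteq> LD"
  proof
    assume "W = LD"
    moreover obtain g where "KS.vol W = 1 / (real q * KS.vol LO)" using W_basis_vol by metis
    ultimately have "1 / (real q * KS.vol LO) = 1 / KS.vol LO" by (simp only: vol_LD)
    then show False using vol_LO_pos q_ge_2 by (simp add: field_simps)
  qed
  then show thesis using that LD_W by blast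
qed

text \<open>The class (0, v) yields P times W in unscaled coordinates, a member of the family and
  hence of volume 1. Its index in \<open>\<Lambda>0\<close> is q, with representatives
  \<open>pt a 0\<close>.\<close>

lemma vol_Lambda0: "ES.vol \<Lambda>0 = 1 / real q"
proof -
  obtain v where v: "v \<in> W" "v \<notin> LD" by (rule W_not_LD)
  have nz: "nonzero_class 0 v" using v OK_0 by (simp add: nonzero_class_def)
  obtain h where h: "basis_seq (n + n) h (E_space m)" "LC 0 v = zlat (n + n) h" using LC_basis[OF nz] .
  obtain h0 where h0: "basis_seq (n + n) h0 (E_space m)" "\<Lambda>0 = zlat (n + n) h0" by (rule Lambda0_basis)
  obtain Y where Y: "finite Y" "Y \<subseteq> OK" "card Y = q" "\<And>x. x \<in> OK \<Longrightarrow> \<exists>!y. y \<in> Y \<and> x - y \<in> P"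
    using residue_representatives by blast
  let ?Y = "(\<lambda>a. pt a 0) ` Y"
  have inj: "inj_on (\<lambda>a. pt a 0) Y" using Y(2) OK_K by (intro inj_onI) (auto simp: pt_eq_iff subset_iff)
  have "ES.vol (zlat (n + n) h) = real (card ?Y) * ES.vol (zlat (n + n) h0)"
  proof (rule ES.vol_index[OF h0(1) h(1)])
    show "zlat (n + n) h \<subseteq> zlat (n + n) h0" using LC_Lambda0[OF nz] h(2) h0(2) by blast
    show "finite ?Y" using Y by simp
    show "?Y \<subseteq> zlat (n + n) h0"
      unfolding h0(2)[symmetric] using Y(2) W_0 Lambda0_iff by blast
    fix x assume "x \<in> zlat (n + n) h0"
    then obtain a y where x: "a \<in> OK" "y \<in> W" "x = pt a y" unfolding h0(2)[symmetric] Lambda0_iff by blast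
    have iff: "x - pt b 0 \<in> zlat (n + n) h \<longleftrightarrow> a - b \<in> P" if b: "b \<in> OK" for b
    proof -
      have xb: "x - pt b 0 = pt (a - b) y" using x b by (simp add: pt_diff OK_K)
      show ?thesis
        unfolding xb h(2)[symmetric]
      proof
        assume "pt (a - b) y \<in> LC 0 v"
        then obtain c a' y' where "a' \<in> P" "pt (a - b) y = pt (c * 0 + a') (em c * v + y')"
          by (auto simp: LC_def)
        then have "a - b = a'" using pt_eq_iff[of "a - b" a'] x b by (simp add: OK_K P_K K_diff)
        then show "a - b \<in> P" using \<open>a' \<in> P\<close> by simp
      next
        assume ab: "a - b \<in> P"
        obtain c where "c \<in> OK" "y - em c * v \<in> LD" using W_generated[OF v x(2)] .
        then have "pt (c * 0 + (a - b)) (em c * v + (y - em c * v)) \<in> LC 0 v" using ab by (intro LC_I)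
        then show "pt (a - b) y \<in> LC 0 v" by simp
      qed
    qed
    obtain b where b: "b \<in> Y" "a - b \<in> P" using Y(4)[OF x(1)] by blast
    show "\<exists>!y. y \<in> ?Y \<and> x - y \<in> zlat (n + n) h"
    proof (rule ex1I[of _ "pt b 0"])
      show "pt b 0 \<in> ?Y \<and> x - pt b 0 \<in> zlat (n + n) h" using b iff Y(2) by auto
      fix w assume w: "w \<in> ?Y \<and> x - w \<in> zlat (n + n) h"
      then obtain d where d: "d \<in> Y" "w = pt d 0" by auto
      then have "a - d \<in> P" using w iff[of d] Y(2) by auto
      then show "w = pt b 0" using Y(4)[OF x(1)] b d by metis
    qed
  qed
  moreover have "card ?Y = q" using card_image[OF inj] Y(3) by simp
  ultimately have "1 = real q * ES.vol \<Lambda>0" using vol_LC[OF nz] h(2) h0(2) by simp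
  then show ?thesis using q_ge_2 by (simp add: field_simps)
qed

section \<open>Orbits of roots of unity and intersections of lines\<close>

lemma LC_smult:
  assumes v: "nonzero_class v1 v2" and x: "x \<in> LC v1 v2" and d: "d \<in> OK"
  shows "smult_E m d x \<in> LC v1 v2"
proof -
  have vv: "v1 \<in> OK" "v2 \<in> W" using v by (auto simp: nonzero_class_def)
  obtain c a y where x: "c \<in> OK" "a \<in> P" "y \<in> LD" "x = pt (c * v1 + a) (em c * v2 + y)"
    using x by (auto simp: LC_def)
  have "smult_E m d x = pt (d * (c * v1 + a)) (em d * (em c * v2 + y))"
    unfolding x(4)
    by (rule smult_pt[OF OK_K[OF OK_add[OF OK_mult[OF x(1) vv(1)] P_OK[OF x(2)]]] OK_K[OF d]])
  also have "\<dots> = pt ((d * c) * v1 + d * a) (em (d * c) * v2 + em d * y)"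
    using x d by (simp add: em_mult OK_K algebra_simps)
  also have "\<dots> \<in> LC v1 v2" using x d by (intro LC_I OK_mult P_mult LD_mult)
  finally show ?thesis .
qed

lemma ip_smult_zeta: "ip_E m (smult_E m (\<zeta> ^ k) x) (smult_E m (\<zeta> ^ k) x) = ip_E m x x"
  by (simp add: smult_E_def ip_E_def ip_em_zeta_mult)

lemma smult_zeta_inj:
  assumes x: "x \<in> E_space m" "x \<noteq> 0"
  shows "inj_on (\<lambda>k. smult_E m (\<zeta> ^ k) x) {..<m}"
proof (rule inj_onI)
  fix k l assume kl: "k \<in> {..<m}" "l \<in> {..<m}" and eq: "smult_E m (\<zeta> ^ k) x = smult_E m (\<zeta> ^ l) x"
  have zK: "\<zeta> ^ i \<in> K" for i by (intro K_power K_zeta)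
  have main: "k = l" if u: "u \<in> KR" "u \<noteq> 0" "em (\<zeta> ^ k) * u = em (\<zeta> ^ l) * u" for u
  proof -
    obtain s where s: "u s \<noteq> 0" using u(2) by (auto simp: fun_eq_iff fun_at)
    then have sE: "s \<in> Es" using KR_support[OF u(1)] by blast
    have "s (\<zeta> ^ k) * u s = s (\<zeta> ^ l) * u s"
      using fun_cong[OF u(3), of s] sE by (simp add: fun_at em_at)
    then have "s (\<zeta> ^ k) = s (\<zeta> ^ l)" using s by simp
    then have "s (\<zeta> ^ k - \<zeta> ^ l) = 0"
      using emb_add[OF sE K_diff[OF zK zK] zK, of k l l] by simp
    then have "\<zeta> ^ k = \<zeta> ^ l" using emb_nonzero[OF sE K_diff[OF zK zK], of k l] by auto
    then have "[k = l] (mod m)" by (simp only: zeta_pow_eq_iff)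
    then show ?thesis using kl by (simp add: cong_def)
  qed
  have V: "fst x \<in> KR" "snd x \<in> KR" using x by (auto simp: E_space_def)
  show "k = l"
  proof (cases "fst x = 0")
    case False
    then show ?thesis using main[OF V(1)] eq by (simp add: smult_E_def)
  next
    case True
    then have "snd x \<noteq> 0" using x(2) by (auto simp: prod_eq_iff)
    then show ?thesis using main[OF V(2)] eq by (simp add: smult_E_def)
  qed
qed

text \<open>Comparing first coordinates gives c = c' modulo P, and comparing second ones gives c a =
  c' b modulo P. Hence c (a - b) is in P and so is c, since P is prime.\<close>

lemma lines_meet:
  assumes v: "v \<in> W" "v \<notin> LD" and ab: "a \<in> OK" "b \<in> OK" "a - b \<notin> P"
    and z: "z \<in> LC 1 (em a * v)" "z \<in> LC 1 (em b * v)"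
  shows "z \<in> P\<Lambda>"
proof -
  obtain c d y where z1: "c \<in> OK" "d \<in> P" "y \<in> LD" "z = pt (c * 1 + d) (em c * (em a * v) + y)"
    using z(1) by (auto simp: LC_def)
  obtain c' d' y' where z2: "c' \<in> OK" "d' \<in> P" "y' \<in> LD" "z = pt (c' * 1 + d') (em c' * (em b * v) + y')"
    using z(2) by (auto simp: LC_def)
  have "c * 1 + d = c' * 1 + d' \<and> em c * (em a * v) + y = em c' * (em b * v) + y'"
  proof (rule pt_eq_iff[THEN iffD1])
    show "c * 1 + d \<in> K" "c' * 1 + d' \<in> K" using z1 z2 by (simp_all add: K_add OK_K P_K)
    show "pt (c * 1 + d) (em c * (em a * v) + y) = pt (c' * 1 + d') (em c' * (em b * v) + y')"
      using z1(4) z2(4) by (simp only:)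
  qed
  then have e: "c - c' = d' - d" "em c * (em a * v) - em c' * (em b * v) = y' - y"
    by (auto simp: algebra_simps)
  have ccP: "c - c' \<in> P" unfolding e(1) using z1 z2 by (intro P_diff)
  have "em (c * a - c' * b) * v = em c * (em a * v) - em c' * (em b * v)"
    using z1 z2 ab by (simp add: em_diff em_mult OK_K K_mult algebra_simps)
  then have "em (c * a - c' * b) * v \<in> LD" unfolding e(2) using z1 z2 LD_diff by simp
  moreover have "c * a - c' * b \<in> OK" using z1 z2 ab by (intro OK_diff OK_mult)
  ultimately have "c * a - c' * b \<in> P" using W_cancel v by blast
  moreover have "b * (c - c') \<in> P" by (rule P_mult[OF ccP ab(2)])
  ultimately have "(c * a - c' * b) - b * (c - c') \<in> P" by (rule P_diff)
  then have "c * (a - b) \<in> P" by (simp add: algebra_simps)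
  then have cP: "c \<in> P" using P_prime[OF z1(1) OK_diff[OF ab(1,2)]] ab(3) by blast
  have "em c * (em a * v) = em a * (em c * v)" by (simp add: mult.left_commute)
  then have "em c * (em a * v) \<in> LD" using LD_mult[OF W_P[OF v(1) cP] ab(1)] by (simp only:)
  then have "em c * (em a * v) + y \<in> LD" using z1(3) by (rule LD_add)
  moreover have "c * 1 + d \<in> P" using cP z1(2) P_add by simp
  ultimately show ?thesis unfolding PLambda_iff z1(4) by blast
qed

text \<open>Otherwise each of the \<open>q\<close> lines spanned by \<open>(1, a v)\<close> contributes a full orbit of \<open>m\<close> vectors to
  the ball, and these orbits are disjoint.\<close>

lemma exists_sparse_lattice:
  assumes r: "r > 0" "r\<^sup>2 < \<kappa>" and \<tau>: "ES.covers \<Lambda>0 \<tau>"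
    and vol: "unit_ball_vol (real (n + n)) * (r + \<tau>) ^ (n + n) \<le> real m"
  obtains v1 v2 where "nonzero_class v1 v2" "\<And>x. x \<in> LC v1 v2 \<Longrightarrow> x \<noteq> 0 \<Longrightarrow> ES.nrm x > r"
proof -
  obtain v where v: "v \<in> W" "v \<notin> LD" by (rule W_not_LD)
  obtain Y where Y: "finite Y" "Y \<subseteq> OK" "card Y = q" "\<And>x. x \<in> OK \<Longrightarrow> \<exists>!y. y \<in> Y \<and> x - y \<in> P"
    using residue_representatives by blast
  have nz: "nonzero_class 1 (em a * v)" if "a \<in> Y" for a
    using that Y(2) v(1) W_mult OK_1 one_notin_P by (auto simp: nonzero_class_def)
  have "\<exists>a\<in>Y. \<forall>x\<in>LC 1 (em a * v). x \<noteq> 0 \<longrightarrow> ES.nrm x > r"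
  proof (rule ccontr)
    assume "\<not> ?thesis"
    then have "\<forall>a\<in>Y. \<exists>x. x \<in> LC 1 (em a * v) \<and> x \<noteq> 0 \<and> ES.nrm x \<le> r" by (meson not_le)
    then obtain x where x: "\<And>a. a \<in> Y \<Longrightarrow> x a \<in> LC 1 (em a * v)" "\<And>a. a \<in> Y \<Longrightarrow> x a \<noteq> 0"
        "\<And>a. a \<in> Y \<Longrightarrow> ES.nrm (x a) \<le> r"
      by metis
    have \<Lambda>E: "z \<in> E_space m" if "z \<in> \<Lambda>0" for z
      using that pt_in_E OK_K W_KR by (auto simp: Lambda0_iff)
    have xE: "x a \<in> E_space m" if "a \<in> Y" for a
      by (rule \<Lambda>E[OF LC_Lambda0[OF nz[OF that] x(1)[OF that]]])
    define S where "S a = (\<lambda>k. smult_E m (\<zeta> ^ k) (x a)) ` {..<m}" for a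
    have S_LC: "z \<in> LC 1 (em a * v)" if "z \<in> S a" "a \<in> Y" for z a
      using that LC_smult[OF nz x(1)] OK_power OK_zeta by (auto simp: S_def)
    have S_ip: "ip_E m z z = ip_E m (x a) (x a)" if "z \<in> S a" for z a
      using that by (auto simp: S_def ip_smult_zeta)
    have S_nz: "z \<noteq> 0" if "z \<in> S a" "a \<in> Y" for z a
      using S_ip[OF that(1)] ES.ip_pos[OF xE[OF that(2)] x(2)[OF that(2)]] by auto
    \<comment> \<open>Vectors of squared length below \<kappa> avoid \<open>P\<Lambda>\<close>, so
      by \<open>lines_meet\<close> orbits from different lines are disjoint.\<close>
    have S_nP: "z \<notin> P\<Lambda>" if "z \<in> S a" "a \<in> Y" for z a
    proof
      assume "z \<in> P\<Lambda>"
      then have "\<kappa> \<le> ip_E m (x a) (x a)" using PLambda_norm_ge S_nz S_ip that by metis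
      also have "\<dots> \<le> r\<^sup>2" using x(3)[OF that(2)] unfolding eucl_norm_def by (rule sqrt_le_D)
      finally show False using r(2) by simp
    qed
    have S_card: "card (S a) = m" "finite (S a)" if "a \<in> Y" for a
      unfolding S_def using smult_zeta_inj[OF xE x(2)] that by (auto simp: card_image)
    have disj: "S a \<inter> S b = {}" if "a \<in> Y" "b \<in> Y" "a \<noteq> b" for a b
    proof -
      have "a - b \<notin> P"
      proof
        assume "a - b \<in> P"
        moreover have "a - a \<in> P" by (simp add: P_0)
        moreover have "a \<in> OK" using Y(2) that by blast
        ultimately show False using Y(4)[of a] that by blast
      qed
      then show ?thesis using lines_meet[OF v, of a b] S_LC S_nP that Y(2) by blast
    qed
    have "card (\<Union>a\<in>Y. S a) = (\<Sum>a\<in>Y. card (S a))"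
      using Y(1) S_card(2) disj by (intro card_UN_disjoint) auto
    then have cU: "card (\<Union>a\<in>Y. S a) = q * m" using S_card(1) Y(3) by simp
    \<comment> \<open>The origin is the additional point that makes the count exceed the upper bound
      q m, which comes from the volume 1/q of \<open>\<Lambda>0\<close>.\<close>
    have "0 \<notin> (\<Union>a\<in>Y. S a)" using S_nz by blast
    then have "card (insert 0 (\<Union>a\<in>Y. S a)) = q * m + 1"
      using cU S_card(2) Y(1) by (subst card_insert_disjoint) auto
    moreover have "insert 0 (\<Union>a\<in>Y. S a) \<subseteq> \<Lambda>0 \<inter> eucl_ball (E_space m) (ip_E m) r"
    proof (intro subsetI)
      fix z assume "z \<in> insert 0 (\<Union>a\<in>Y. S a)"
      then consider "z = 0" | a where "a \<in> Y" "z \<in> S a" by blast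
      then show "z \<in> \<Lambda>0 \<inter> eucl_ball (E_space m) (ip_E m) r"
      proof cases
        case 1
        have "0 \<in> \<Lambda>0" unfolding Lambda0_iff using OK_0 W_0 pt_0 by metis
        then show ?thesis using 1 r(1) by (simp add: eucl_ball_def eucl_norm_def)
      next
        case 2
        have "z \<in> \<Lambda>0" by (rule LC_Lambda0[OF nz[OF 2(1)] S_LC[OF 2(2,1)]])
        moreover have "ES.nrm z \<le> r" using x(3)[OF 2(1)] S_ip[OF 2(2)] by (simp add: eucl_norm_def)
        ultimately show ?thesis using \<Lambda>E by (simp add: eucl_ball_def)
      qed
    qed
    moreover obtain h where h: "basis_seq (n + n) h (E_space m)" "\<Lambda>0 = zlat (n + n) h" by (rule Lambda0_basis)
    ultimately have "q * m + 1 \<le> ES.cnt \<Lambda>0 r"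
      unfolding ES.cnt_def using ES.finite_lattice_ball[OF h(1)] by (metis card_mono)
    then have 1: "real q * real m + 1 \<le> real (ES.cnt \<Lambda>0 r)"
      by (metis of_nat_1 of_nat_add of_nat_le_iff of_nat_mult)
    obtain D where D: "fundamental_region (E_space m) (ip_E m) (zlat (n + n) h) D"
        "ES.vol (zlat (n + n) h) = measure ES.mu (ES.coords D)"
      using ES.vol_region_ex[OF h(1)] .
    have "real (ES.cnt \<Lambda>0 r) * (1 / real q) \<le> unit_ball_vol (real (n + n)) * (r + \<tau>) ^ (n + n)"
      using ES.count_upper_real[OF h(1) D(1) _ r(1), of \<tau>] \<tau> D(2) vol_Lambda0 h(2) by simp
    also have "\<dots> \<le> real m" by (rule vol)
    finally have "real (ES.cnt \<Lambda>0 r) \<le> real q * real m" using q_ge_2 by (simp add: field_simps)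
    then show False using 1 by simp
  qed
  then show thesis using that nz by blast
qed

text \<open>The lattice has volume 1, so only the ball enters. As an infimum over a nonempty set,
  the minimum is at least r.\<close>

lemma density_ge:
  assumes r: "r > 0" and v: "nonzero_class v1 v2" and min: "\<And>x. x \<in> LC v1 v2 \<Longrightarrow> x \<noteq> 0 \<Longrightarrow> ES.nrm x > r"
  shows "unit_ball_vol (real (n + n)) * r ^ (n + n) / 2 ^ (2 * n) \<le> packing_density (E_space m) (ip_E m) (LC v1 v2)"
proof -
  obtain h where h: "basis_seq (n + n) h (E_space m)" "LC v1 v2 = zlat (n + n) h" using LC_basis[OF v] .
  have "h 0 \<in> LC v1 v2 - {0}" using h zlat_base[of 0 "n + n" h] basis_seq_neq0[OF h(1), of 0] n_pos by simp
  then have "LC v1 v2 - {0} \<noteq> {}" by blast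
  then have "r \<le> min_length (ip_E m) (LC v1 v2)"
    unfolding min_length_def using min by (intro cInf_greatest) (auto simp: less_imp_le)
  then have "r ^ (n + n) \<le> min_length (ip_E m) (LC v1 v2) ^ (n + n)" "min_length (ip_E m) (LC v1 v2) > 0"
    using r by (auto intro: power_mono)
  then show ?thesis
    unfolding packing_density_def ES.dimV vol_LC[OF v] mult_2 mult_1_right
    by (subst ES.eucl_volume_ball) (auto intro!: divide_right_mono mult_left_mono)
qed

end

text \<open>A weak form of Stirling's formula, by induction from (1 + 1/n)^n <= e <= 3.\<close>

lemma power_self_le_fact: "real n ^ n \<le> 3 ^ n * fact n"
proof (induction n)
  case (Suc n)
  show ?case
  proof (cases "n = 0")
    case False
    have "(1 + 1 / real n) ^ n \<le> exp 1"
      using False by (intro exp_ge_one_plus_x_over_n_power_n) auto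
    then have e: "(1 + 1 / real n) ^ n \<le> 3" using exp_le by linarith
    have "1 + real n = real n * (1 + 1 / real n)" using False by (simp add: field_simps)
    then have "(1 + real n) ^ n = real n ^ n * (1 + 1 / real n) ^ n" by (metis power_mult_distrib)
    also have "\<dots> \<le> (3 ^ n * fact n) * 3" using Suc e by (intro mult_mono) auto
    finally have "(1 + real n) * (1 + real n) ^ n \<le> (1 + real n) * ((3 ^ n * fact n) * 3)"
      by (intro mult_left_mono) auto
    then show ?thesis by (simp add: algebra_simps)
  qed simp
qed simp

lemma fact_le_power_self: "fact n \<le> real n ^ n"
  using fact_le_power[of n, where 'a = real] by simp

text \<open>R is the radius of the ball of volume m, and r = R - \<tau>, so that the enlarged ball
  in the counting argument has volume m exactly. It remains to see that \<tau> is small compared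
  with R/n and that R^2 stays below \<kappa>.\<close>

lemma radius_choice:
  fixes n m :: nat and \<kappa> \<epsilon> :: real
  defines "\<beta> \<equiv> unit_ball_vol (real (n + n))" and "\<tau> \<equiv> sqrt (2 * (real n)\<^sup>2 / \<kappa>)"
  assumes n: "n > 0" "n \<le> m" and \<kappa>: "\<kappa> > 0" and \<epsilon>: "0 < \<epsilon>" "\<epsilon> < 1"
    and small: "96 * ((real n)\<^sup>2 * real m) < \<epsilon>\<^sup>2 * \<kappa>"
  obtains r where "r > 0" "r\<^sup>2 < \<kappa>" "\<beta> * (r + \<tau>) ^ (n + n) \<le> real m"
    "(1 - \<epsilon>) * real m < \<beta> * r ^ (n + n)"
proof -
  have m: "m > 0" using n by simp
  have \<beta>: "\<beta> = pi ^ n / fact n"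
    unfolding \<beta>_def unit_ball_vol_even[of n, symmetric] mult_2 ..
  have \<beta>p: "\<beta> > 0" by (simp add: \<beta>)
  define R where "R = (real m / \<beta>) powr (1 / real (n + n))"
  have Rp: "R > 0" unfolding R_def using m \<beta>p by simp
  have R2n: "R ^ (n + n) = real m / \<beta>"
    unfolding R_def using m \<beta>p n by (simp add: powr_realpow[symmetric] powr_powr)
  then have Rn: "(R\<^sup>2) ^ n = real m * fact n / pi ^ n"
    by (simp add: \<beta> power_mult[symmetric] mult_2)
  \<comment> \<open>Here 12 is 3 times 4, with 3 from \<open>power_self_le_fact\<close> and 4 from
    \<pi> < 4.\<close>
  have lower: "real n / 12 \<le> R\<^sup>2"
  proof (rule power_le_imp_le_base)
    have "(real n / 12) ^ n = real n ^ n / 3 ^ n / 4 ^ n"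
      by (simp add: power_divide power_mult_distrib[symmetric] field_simps)
    also have "\<dots> \<le> fact n / 4 ^ n"
      using power_self_le_fact[of n] by (intro divide_right_mono) (simp_all add: field_simps)
    also have "\<dots> \<le> fact n / pi ^ n"
      using pi_less_4 pi_gt_zero by (intro divide_left_mono power_mono) auto
    also have "\<dots> \<le> real m * fact n / pi ^ n"
      using m by (intro divide_right_mono) auto
    finally show "(real n / 12) ^ Suc (n - 1) \<le> (R\<^sup>2) ^ Suc (n - 1)" using n by (simp add: Rn)
  qed simp
  have "R\<^sup>2 \<le> real m * real n"
  proof (rule power_le_imp_le_base)
    have "(R\<^sup>2) ^ n \<le> real m * fact n"
    proof -
      have "1 \<le> pi ^ n" using pi_ge_two by (intro one_le_power) simp
      then have "real m * fact n * 1 \<le> real m * fact n * pi ^ n" by (intro mult_left_mono) auto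
      then show ?thesis unfolding Rn by (simp add: pos_divide_le_eq)
    qed
    also have "\<dots> \<le> real m ^ n * real n ^ n"
      using fact_le_power_self[of n] m n by (intro mult_mono self_le_power) auto
    finally show "(R\<^sup>2) ^ Suc (n - 1) \<le> (real m * real n) ^ Suc (n - 1)"
      using n by (simp add: power_mult_distrib)
  qed simp
  also have "\<dots> \<le> 96 * ((real n)\<^sup>2 * real m)"
    using n m by (simp add: power2_eq_square)
  also have "\<dots> < \<epsilon>\<^sup>2 * \<kappa>" by (rule small)
  also have "\<dots> \<le> 1 * \<kappa>" using \<epsilon> \<kappa> by (intro mult_right_mono power_le_one) auto
  finally have upper: "R\<^sup>2 < \<kappa>" by simp
  define t where "t = \<tau> / R"
  have t0: "t \<ge> 0" using Rp \<kappa> by (simp add: t_def \<tau>_def)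
  have \<tau>2: "\<tau>\<^sup>2 = 2 * (real n)\<^sup>2 / \<kappa>" using \<kappa> by (simp add: \<tau>_def)
  \<comment> \<open>The constant 96 of the hypothesis arises here: 4 from the square, 2 from
    \<tau>^2, and 12 from the lower bound for R^2.\<close>
  have "(2 * real n * t)\<^sup>2 = 4 * (real n)\<^sup>2 * \<tau>\<^sup>2 / R\<^sup>2"
    by (simp add: t_def power_mult_distrib power_divide)
  also have "\<dots> = 8 * real n ^ 4 / \<kappa> / R\<^sup>2"
    unfolding \<tau>2 by (simp add: power2_eq_square power4_eq_xxxx)
  also have "\<dots> \<le> 8 * real n ^ 4 / \<kappa> / (real n / 12)"
    using lower n \<kappa> Rp by (intro divide_left_mono) auto
  also have "\<dots> = 96 * ((real n)\<^sup>2 * real n) / \<kappa>"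
    using n by (simp add: power2_eq_square power4_eq_xxxx)
  also have "\<dots> \<le> 96 * ((real n)\<^sup>2 * real m) / \<kappa>"
    using n \<kappa> by (intro divide_right_mono mult_left_mono) auto
  also have "\<dots> < \<epsilon>\<^sup>2" using small \<kappa> by (simp add: pos_divide_less_eq)
  finally have "(2 * real n * t)\<^sup>2 < \<epsilon>\<^sup>2" .
  then have t: "2 * real n * t < \<epsilon>" by (rule power2_less_imp_less[OF _ less_imp_le[OF \<epsilon>(1)]])
  have "1 * t \<le> 2 * real n * t" using n t0 by (intro mult_right_mono) auto
  then have t1: "t < 1" using t \<epsilon> by simp
  define r where "r = R - \<tau>"
  have rR: "r = R * (1 - t)" using Rp by (simp add: r_def t_def field_simps)
  show thesis
  proof (rule that[of r])
    show rp: "r > 0" using rR Rp t1 by simp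
    have "r \<le> R" using rR Rp t0 by (simp add: mult_le_cancel_left1)
    then have "r\<^sup>2 \<le> R\<^sup>2" using rp by (intro power_mono) auto
    then show "r\<^sup>2 < \<kappa>" using upper by simp
    show "\<beta> * (r + \<tau>) ^ (n + n) \<le> real m" using R2n \<beta>p by (simp add: r_def)
    \<comment> \<open>The ball of radius r = R(1 - t) has volume m (1 - t)^(2n), and Bernoulli's
      inequality bounds the loss by 2nt < \<epsilon>.\<close>
    have "1 + real (n + n) * (- t) \<le> (1 + - t) ^ (n + n)"
      using t1 by (intro Bernoulli_inequality) simp
    then have "1 - 2 * real n * t \<le> (1 - t) ^ (n + n)" by (simp add: algebra_simps)
    then have "1 - \<epsilon> < (1 - t) ^ (n + n)" using t by linarith
    then have "(1 - \<epsilon>) * real m < real m * (1 - t) ^ (n + n)" using m by (simp add: mult.commute)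
    also have "\<dots> = \<beta> * r ^ (n + n)"
      unfolding rR power_mult_distrib R2n using \<beta>p by simp
    finally show "(1 - \<epsilon>) * real m < \<beta> * r ^ (n + n)" .
  qed
qed

theorem theorem3:
  fixes P :: "nat \<Rightarrow> complex set"
  assumes "\<And>m. m \<ge> 1 \<Longrightarrow> primeideal (P m) (int_ring m)"
    and "\<And>m. m \<ge> 1 \<Longrightarrow> \<exists>p::nat. prime p \<and> \<not> p dvd m \<and> lies_over (P m) p"
    and "(\<lambda>m. real (totient m) ^ 2 * real m)
           \<in> o[at_top](\<lambda>m. real (residue_card m (P m)) powr (1 / real (totient m)))"
  shows "\<forall>\<epsilon>::real. 0 < \<epsilon> \<and> \<epsilon> < 1 \<longrightarrow>
    (\<forall>\<^sub>F m in at_top.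
      (\<forall>L\<in>lattice_family m (P m). symplectic_lattice (E_space m) (ip_E m) L) \<and>
      (\<exists>L\<in>lattice_family m (P m).
        packing_density (E_space m) (ip_E m) L > (1 - \<epsilon>) * real m / 2 ^ (2 * totient m)))"
proof (intro allI impI)
  fix \<epsilon> :: real assume \<epsilon>: "0 < \<epsilon> \<and> \<epsilon> < 1"
  \<comment> \<open>Any constant below 1/96 in place of 1/200 would give the strict inequality that
    \<open>radius_choice\<close> demands.\<close>
  have "\<forall>\<^sub>F m in at_top. norm (real (totient m) ^ 2 * real m)
      \<le> (\<epsilon>\<^sup>2 / 200) * norm (real (residue_card m (P m)) powr (1 / real (totient m)))"
    using \<epsilon> by (intro landau_o.smallD[OF assms(3)]) simp
  then show "\<forall>\<^sub>F m in at_top.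
      (\<forall>L\<in>lattice_family m (P m). symplectic_lattice (E_space m) (ip_E m) L) \<and>
      (\<exists>L\<in>lattice_family m (P m).
        packing_density (E_space m) (ip_E m) L > (1 - \<epsilon>) * real m / 2 ^ (2 * totient m))"
    using eventually_ge_at_top[of 1]
  proof eventually_elim
    fix m :: nat
    assume bound: "norm (real (totient m) ^ 2 * real m)
      \<le> (\<epsilon>\<^sup>2 / 200) * norm (real (residue_card m (P m)) powr (1 / real (totient m)))" and m: "m \<ge> 1"
    obtain p where p: "prime p" "\<not> p dvd m" "lies_over (P m) p" using assms(2)[OF m] by blast
    interpret cyclo_prime m "P m" p
      by (intro cyclo_prime.intro cyclo.intro cyclo_prime_axioms.intro m p assms(1)[OF m]
        primeideal.axioms(2)[OF assms(1)[OF m]])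
    have bound': "(real n)\<^sup>2 * real m \<le> (\<epsilon>\<^sup>2 / 200) * \<kappa>"
      using bound kappa_pos by (simp add: \<kappa>_def)
    moreover have "0 < \<epsilon>\<^sup>2 * \<kappa>" using \<epsilon> kappa_pos by simp
    ultimately have small: "96 * ((real n)\<^sup>2 * real m) < \<epsilon>\<^sup>2 * \<kappa>" by simp
    define \<tau> where "\<tau> = sqrt (2 * (real n)\<^sup>2 / \<kappa>)"
    obtain r where r: "r > 0" "r\<^sup>2 < \<kappa>" "unit_ball_vol (real (n + n)) * (r + \<tau>) ^ (n + n) \<le> real m"
        "(1 - \<epsilon>) * real m < unit_ball_vol (real (n + n)) * r ^ (n + n)"
      using radius_choice[of n m \<kappa> \<epsilon>] n_pos totient_le[of m] kappa_pos \<epsilon> small unfolding \<tau>_def by blast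
    obtain v1 v2 where v: "nonzero_class v1 v2" "\<And>x. x \<in> LC v1 v2 \<Longrightarrow> x \<noteq> 0 \<Longrightarrow> ES.nrm x > r"
      using exists_sparse_lattice[OF r(1,2) Lambda0_covers[folded \<tau>_def] r(3)] by blast
    have "(1 - \<epsilon>) * real m / 2 ^ (2 * n) < unit_ball_vol (real (n + n)) * r ^ (n + n) / 2 ^ (2 * n)"
      using r(4) by (intro divide_strict_right_mono) auto
    also have "\<dots> \<le> packing_density (E_space m) (ip_E m) (LC v1 v2)"
      by (rule density_ge[OF r(1) v])
    finally have "packing_density (E_space m) (ip_E m) (LC v1 v2) > (1 - \<epsilon>) * real m / 2 ^ (2 * n)" .
    then show "(\<forall>L\<in>lattice_family m (P m). symplectic_lattice (E_space m) (ip_E m) L) \<and>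
        (\<exists>L\<in>lattice_family m (P m).
          packing_density (E_space m) (ip_E m) L > (1 - \<epsilon>) * real m / 2 ^ (2 * totient m))"
      unfolding lattice_family_eq using LC_symplectic v(1) by blast
  qed
qed

end
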